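(* Let $\lambda\in\mathbb{N}_0^N$ be a partition ($\lambda_1\ge\dots\ge\lambda_N$) and $T\in\mathcal{Y}(\tau)$ with $\lfloor\lambda,T\rfloor$ column-strict; let $T_R,T_S$ be the tableaux defined below from $\mathcal{T}:=\lfloor\lambda,T\rfloor$, and let $\lambda^-$ be the nondecreasing rearrangement of $\lambda$. Then $$\|J_{\lambda,T_S}\|^2=\#\mathcal{T}(\lambda,T_S)\cdot\frac{\mathcal{C}_1(T_R)}{\mathcal{C}_1(T_S)\,\mathcal{E}_1(\lambda^-,T_R)}\,\|\zeta_{\lambda,T_S}\|^2.$$
   Context: Notation. $\mathcal{S}_N$ acts on $x\in\mathbb{C}^N$ by $(xw)_i=x_{w(i)}$ and on $\alpha\in\mathbb{Z}^N$ by $(w\alpha)_i=\alpha_{w^{-1}(i)}$. $\tau$ is a partition of $N$ other than $(N),(1^N)$; $\mathcal{Y}(\tau)$ is the set of reverse standard Young tableaux (fillings of the Ferrers diagram with $1,\dots,N$ decreasing along rows and columns); $c(i,T)=\mathrm{cm}(i,T)-\mathrm{rw}(i,T)$. $V_\tau$ has basis $\mathcal{Y}(\tau)$ with the irreducible orthogonal (Young) representation $\tau$ and invariant inner product $\langle T,T'\rangle_0=\delta_{T,T'}\prod_{i<j,\ c(i,T)\le c(j,T)-2}(1-(c(i,T)-c(j,T))^{-2})$; $\mathcal{P}_\tau$ = $V_\tau$-valued polynomials with $(wp)(x)=\tau(w)p(xw)$. $\mathcal{D}_ip=\partial_ip+\kappa\sum_{j\ne i}\tau(i,j)\frac{p(x)-p(x(i,j))}{x_i-x_j}$,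 $\mathcal{U}_ip=\mathcal{D}_i(x_ip)-\kappa\sum_{j<i}\tau(i,j)p(x(i,j))$, with $-1/h_\tau<\kappa<1/h_\tau$, $h_\tau=\tau_1+\ell(\tau)-1$. $\langle\cdot,\cdot\rangle_{\mathbb{T}}$ is the unique Hermitian form on $\mathcal{P}_\tau$ (conjugate-linear in the first, linear in the second argument) with $\langle1\otimes T,1\otimes T'\rangle_{\mathbb{T}}=\langle T,T'\rangle_0$, $\langle wf,wg\rangle_{\mathbb{T}}=\langle f,g\rangle_{\mathbb{T}}$, $\langle x_i\mathcal{D}_if,g\rangle_{\mathbb{T}}=\langle f,x_i\mathcal{D}_ig\rangle_{\mathbb{T}}$, $\langle x_if,x_ig\rangle_{\mathbb{T}}=\langle f,g\rangle_{\mathbb{T}}$; $\|p\|^2=\langle p,p\rangle_{\mathbb{T}}$. For $\alpha\in\mathbb{N}_0^N$: $\alpha^+$ its nonincreasing rearrangement; $r_\alpha(i)=\#\{j:\alpha_j>\alpha_i\}+\#\{j\le i:\alpha_j=\alpha_i\}$. $\beta\vartriangleleft\alpha$ iff $|\beta|=|\alpha|$ and either $\beta^+\prec\alpha^+$ or ($\beta^+=\alpha^+$ and $\beta\prec\alpha$), where $\beta\prec\alpha$ means $\beta\neq\alpha$ and all partial sums of $\beta$ are $\le$ those of $\alpha$. $\zeta_{\alpha,T}$ is the unique element of $\mathcal{P}_\tau$ of the form $x^\alpha\otimes\tau(r_\alpha^{-1})T+\sum_{\beta\vartriangleleft\alpha}x^\beta\otimes t_{\alpha\beta}$ with $\mathcal{U}_i\zeta_{\alpha,T}=(\alpha_i+1+\kappa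 c(r_\alpha(i),T))\zeta_{\alpha,T}$ for all $i$. $\lfloor\alpha,T\rfloor$: replace each entry $i$ of $T$ by $\alpha^+_i$; column-strict means strictly increasing down columns and weakly increasing along rows. $\mathcal{T}(\alpha,T)=\{(\beta,T'):\lfloor\beta,T'\rfloor=\lfloor\alpha,T\rfloor\}$. With $\mathcal{T}=\lfloor\lambda,T\rfloor$ and cells $(i,j)$ (row, column): $T_R(i,j)=\#\{(k,l):\mathcal{T}(k,l)>\mathcal{T}(i,j)\}+\#\{(k,l):\mathcal{T}(k,l)=\mathcal{T}(i,j),\ l>j\text{ or }(l=j,k\ge i)\}$; $T_S(i,j)=\#\{(k,l):\mathcal{T}(k,l)>\mathcal{T}(i,j)\}+\#\{(k,l):\mathcal{T}(k,l)=\mathcal{T}(i,j),\ k>i\text{ or }(k=i,l\ge j)\}$. $\mathcal{E}_\varepsilon(\alpha,T)=\prod_{i<j,\ \alpha_i<\alpha_j}\bigl(1+\frac{\varepsilon\kappa}{\alpha_j-\alpha_i+\kappa(c(r_\alpha(j),T)-c(r_\alpha(i),T))}\bigr)$, $\mathcal{C}_\varepsilon(T)=\prod_{i<j,\ c(i,T)\le c(j,T)-2}\bigl(1+\frac{\varepsilon}{c(i,T)-c(j,T)}\bigr)$, $\varepsilon=\pm1$. $J_{\lambda,T_S}:=\sum_{(\beta,T')\in\mathcal{T}(\lambda,T_S)}\frac{\mathcal{C}_{-1}(T_S)}{\mathcal{C}_{-1}(T')}\mathcal{E}_{-1}(\beta,T')\zeta_{\beta,T'}$. *)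

theory Defs
  imports Complex_Main "HOL-Combinatorics.Transposition" "HOL-Combinatorics.Permutations"
begin

(* Conventions: variables x_1..x_N are indexed 1..N; a multi-index alpha in N_0^N is a
   function nat => nat vanishing outside {1..N}.  Cells of a Ferrers diagram are (row, column),
   1-indexed.  A tableau is a function from cells to nat, 0 outside the diagram. *)

type_synonym tab = "nat \<times> nat \<Rightarrow> nat"
type_synonym mono = "nat \<Rightarrow> nat"
(* a V_tau-valued polynomial: coefficient of x^alpha (tensor) T *)
type_synonym vpoly = "mono \<Rightarrow> tab \<Rightarrow> complex"

definition is_partition :: "nat \<Rightarrow> nat list \<Rightarrow> bool" where
  "is_partition N tau \<longleftrightarrow> sorted_wrt (\<ge>) tau \<and> (\<forall>x\<in>set tau. 0 < x) \<and> sum_list tau = N"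

definition cells :: "nat list \<Rightarrow> (nat \<times> nat) set" where
  "cells tau = {(i, j). 1 \<le> i \<and> i \<le> length tau \<and> 1 \<le> j \<and> j \<le> tau ! (i - 1)}"

definition RSYT :: "nat \<Rightarrow> nat list \<Rightarrow> tab set" where
  "RSYT N tau = {T. (\<forall>c. c \<notin> cells tau \<longrightarrow> T c = 0) \<and> bij_betw T (cells tau) {1..N}
     \<and> (\<forall>i j. (i, j) \<in> cells tau \<and> (i, j + 1) \<in> cells tau \<longrightarrow> T (i, j + 1) < T (i, j))
     \<and> (\<forall>i j. (i, j) \<in> cells tau \<and> (i + 1, j) \<in> cells tau \<longrightarrow> T (i + 1, j) < T (i, j))}"

definition pos :: "nat list \<Rightarrow> tab \<Rightarrow> nat \<Rightarrow> nat \<times> nat" where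
  "pos tau T k = (THE c. c \<in> cells tau \<and> T c = k)"

definition content :: "nat list \<Rightarrow> tab \<Rightarrow> nat \<Rightarrow> int" where
  "content tau T k = int (snd (pos tau T k)) - int (fst (pos tau T k))"

definition swap_entries :: "nat \<Rightarrow> tab \<Rightarrow> tab" where
  "swap_entries k T = (\<lambda>c. if T c = k then k + 1 else if T c = k + 1 then k else T c)"

(* Young's orthogonal form: matrix of tau(s_k), s_k = (k,k+1): tau(s_k) T = sum_T' adj_mat k T T' * T' *)
definition adj_mat :: "nat list \<Rightarrow> nat \<Rightarrow> tab \<Rightarrow> tab \<Rightarrow> real" where
  "adj_mat tau k T T' =
     (let d = content tau T k - content tau T (k + 1); b = 1 / real_of_int d in
      if fst (pos tau T k) = fst (pos tau T (k + 1)) then (if T' = T then 1 else 0)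
      else if snd (pos tau T k) = snd (pos tau T (k + 1)) then (if T' = T then -1 else 0)
      else if T' = T then b
      else if T' = swap_entries k T then (if d \<ge> 2 then 1 else 1 - b\<^sup>2)
      else 0)"

(* rho w T T' is the coefficient of T' in tau(w) T *)
definition young_rep :: "nat \<Rightarrow> nat list \<Rightarrow> ((nat \<Rightarrow> nat) \<Rightarrow> tab \<Rightarrow> tab \<Rightarrow> real) \<Rightarrow> bool" where
  "young_rep N tau rho \<longleftrightarrow>
     (\<forall>w T T'. \<not> (w permutes {1..N} \<and> T \<in> RSYT N tau \<and> T' \<in> RSYT N tau) \<longrightarrow> rho w T T' = 0)
   \<and> (\<forall>u v. u permutes {1..N} \<longrightarrow> v permutes {1..N} \<longrightarrow>
        (\<forall>T\<in>RSYT N tau. \<forall>T''\<in>RSYT N tau.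
           rho (u \<circ> v) T T'' = (\<Sum>T'\<in>RSYT N tau. rho v T T' * rho u T' T'')))
   \<and> (\<forall>k. 1 \<le> k \<and> k < N \<longrightarrow>
        (\<forall>T\<in>RSYT N tau. \<forall>T'\<in>RSYT N tau. rho (transpose k (k + 1)) T T' = adj_mat tau k T T'))"

definition taurep :: "nat \<Rightarrow> nat list \<Rightarrow> (nat \<Rightarrow> nat) \<Rightarrow> tab \<Rightarrow> tab \<Rightarrow> real" where
  "taurep N tau = (THE rho. young_rep N tau rho)"

definition inner0 :: "nat \<Rightarrow> nat list \<Rightarrow> tab \<Rightarrow> tab \<Rightarrow> real" where
  "inner0 N tau T T' = (if T = T' then
     (\<Prod>(i, j)\<in>{(i, j). 1 \<le> i \<and> i < j \<and> j \<le> N \<and> content tau T i \<le> content tau T j - 2}.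
        1 - 1 / (real_of_int (content tau T i - content tau T j))\<^sup>2) else 0)"

definition psupp :: "vpoly \<Rightarrow> mono set" where
  "psupp p = {a. \<exists>T. p a T \<noteq> 0}"

definition in_P :: "nat \<Rightarrow> nat list \<Rightarrow> vpoly \<Rightarrow> bool" where
  "in_P N tau p \<longleftrightarrow> finite (psupp p) \<and>
     (\<forall>a T. p a T \<noteq> 0 \<longrightarrow> T \<in> RSYT N tau \<and> (\<forall>i. a i \<noteq> 0 \<longrightarrow> i \<in> {1..N}))"

definition padd :: "vpoly \<Rightarrow> vpoly \<Rightarrow> vpoly" where
  "padd f g = (\<lambda>a T. f a T + g a T)"

definition pscale :: "complex \<Rightarrow> vpoly \<Rightarrow> vpoly" where
  "pscale c f = (\<lambda>a T. c * f a T)"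

definition one_tensor :: "tab \<Rightarrow> vpoly" where
  "one_tensor T = (\<lambda>a T'. if a = (\<lambda>_. 0) \<and> T' = T then 1 else 0)"

definition pmat :: "nat \<Rightarrow> nat list \<Rightarrow> (tab \<Rightarrow> tab \<Rightarrow> real) \<Rightarrow> vpoly \<Rightarrow> vpoly" where
  "pmat N tau M p = (\<lambda>b T'. \<Sum>T\<in>RSYT N tau. p b T * complex_of_real (M T T'))"

(* (w p)(x) = tau(w) p(xw), (xw)_i = x_{w(i)};  p(xw) has coefficient p(b o w) at x^b *)
definition pact :: "nat \<Rightarrow> nat list \<Rightarrow> (nat \<Rightarrow> nat) \<Rightarrow> vpoly \<Rightarrow> vpoly" where
  "pact N tau w p = pmat N tau (taurep N tau w) (\<lambda>b. p (b \<circ> w))"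

definition xmul :: "nat \<Rightarrow> vpoly \<Rightarrow> vpoly" where
  "xmul i p = (\<lambda>b T. if 1 \<le> b i then p (b(i := b i - 1)) T else 0)"

definition pdiff :: "nat \<Rightarrow> vpoly \<Rightarrow> vpoly" where
  "pdiff i p = (\<lambda>b T. of_nat (b i + 1) * p (b(i := b i + 1)) T)"

(* coefficient of x^b in (x^a - (x(i,j))^a) / (x_i - x_j) *)
definition ddcoef :: "nat \<Rightarrow> nat \<Rightarrow> mono \<Rightarrow> mono \<Rightarrow> complex" where
  "ddcoef i j a b =
     (if a j < a i then
        (if \<exists>k < a i - a j. b = a(i := a i - 1 - k, j := a j + k) then 1 else 0)
      else if a i < a j then
        (if \<exists>k < a j - a i. b = a(j := a j - 1 - k, i := a i + k) then -1 else 0)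
      else 0)"

definition divdiff :: "nat \<Rightarrow> nat \<Rightarrow> vpoly \<Rightarrow> vpoly" where
  "divdiff i j p = (\<lambda>b T. \<Sum>a\<in>psupp p. ddcoef i j a b * p a T)"

definition dunkl :: "nat \<Rightarrow> nat list \<Rightarrow> real \<Rightarrow> nat \<Rightarrow> vpoly \<Rightarrow> vpoly" where
  "dunkl N tau kappa i p = (\<lambda>b T'. pdiff i p b T' + complex_of_real kappa *
      (\<Sum>j\<in>{1..N} - {i}. pmat N tau (taurep N tau (transpose i j)) (divdiff i j p) b T'))"

definition cherU :: "nat \<Rightarrow> nat list \<Rightarrow> real \<Rightarrow> nat \<Rightarrow> vpoly \<Rightarrow> vpoly" where
  "cherU N tau kappa i p = (\<lambda>b T. dunkl N tau kappa i (xmul i p) b T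
      - complex_of_real kappa * (\<Sum>j\<in>{1..<i}. pact N tau (transpose i j) p b T))"

definition herm_ok :: "nat \<Rightarrow> nat list \<Rightarrow> real \<Rightarrow> (vpoly \<Rightarrow> vpoly \<Rightarrow> complex) \<Rightarrow> bool" where
  "herm_ok N tau kappa B \<longleftrightarrow>
     (\<forall>f g. \<not> (in_P N tau f \<and> in_P N tau g) \<longrightarrow> B f g = 0)
   \<and> (\<forall>f g h. in_P N tau f \<and> in_P N tau g \<and> in_P N tau h \<longrightarrow> B (padd f g) h = B f h + B g h)
   \<and> (\<forall>c f g. in_P N tau f \<and> in_P N tau g \<longrightarrow> B (pscale c f) g = cnj c * B f g)
   \<and> (\<forall>f g. in_P N tau f \<and> in_P N tau g \<longrightarrow> B g f = cnj (B f g))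
   \<and> (\<forall>T\<in>RSYT N tau. \<forall>T'\<in>RSYT N tau.
        B (one_tensor T) (one_tensor T') = complex_of_real (inner0 N tau T T'))
   \<and> (\<forall>w f g. w permutes {1..N} \<and> in_P N tau f \<and> in_P N tau g \<longrightarrow>
        B (pact N tau w f) (pact N tau w g) = B f g)
   \<and> (\<forall>i f g. i \<in> {1..N} \<and> in_P N tau f \<and> in_P N tau g \<longrightarrow>
        B (xmul i (dunkl N tau kappa i f)) g = B f (xmul i (dunkl N tau kappa i g)))
   \<and> (\<forall>i f g. i \<in> {1..N} \<and> in_P N tau f \<and> in_P N tau g \<longrightarrow>
        B (xmul i f) (xmul i g) = B f g)"

definition hermT :: "nat \<Rightarrow> nat list \<Rightarrow> real \<Rightarrow> vpoly \<Rightarrow> vpoly \<Rightarrow> complex" where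
  "hermT N tau kappa = (THE B. herm_ok N tau kappa B)"

definition pnorm2 :: "nat \<Rightarrow> nat list \<Rightarrow> real \<Rightarrow> vpoly \<Rightarrow> complex" where
  "pnorm2 N tau kappa p = hermT N tau kappa p p"

definition plus_part :: "nat \<Rightarrow> mono \<Rightarrow> mono" where
  "plus_part N a = (\<lambda>i. if 1 \<le> i \<and> i \<le> N then rev (sort (map a [1..<N + 1])) ! (i - 1) else 0)"

definition minus_part :: "nat \<Rightarrow> mono \<Rightarrow> mono" where
  "minus_part N a = (\<lambda>i. if 1 \<le> i \<and> i \<le> N then sort (map a [1..<N + 1]) ! (i - 1) else 0)"

definition rank :: "nat \<Rightarrow> mono \<Rightarrow> nat \<Rightarrow> nat" where
  "rank N a i = (if i \<in> {1..N} then card {j\<in>{1..N}. a i < a j} + card {j\<in>{1..i}. a j = a i} else i)"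

definition dprec :: "nat \<Rightarrow> mono \<Rightarrow> mono \<Rightarrow> bool" where
  "dprec N b a \<longleftrightarrow> b \<noteq> a \<and> (\<forall>k\<in>{1..N}. (\<Sum>i=1..k. b i) \<le> (\<Sum>i=1..k. a i))"

definition tri_less :: "nat \<Rightarrow> mono \<Rightarrow> mono \<Rightarrow> bool" where
  "tri_less N b a \<longleftrightarrow> (\<Sum>i=1..N. b i) = (\<Sum>i=1..N. a i) \<and>
     (dprec N (plus_part N b) (plus_part N a) \<or> (plus_part N b = plus_part N a \<and> dprec N b a))"

definition zeta :: "nat \<Rightarrow> nat list \<Rightarrow> real \<Rightarrow> mono \<Rightarrow> tab \<Rightarrow> vpoly" where
  "zeta N tau kappa a T = (THE p. in_P N tau p
     \<and> (\<forall>T'. p a T' = complex_of_real (taurep N tau (inv (rank N a)) T T'))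
     \<and> (\<forall>b T'. b \<noteq> a \<and> p b T' \<noteq> 0 \<longrightarrow> tri_less N b a)
     \<and> (\<forall>i\<in>{1..N}. cherU N tau kappa i p =
          pscale (complex_of_real (real (a i) + 1 + kappa * real_of_int (content tau T (rank N a i)))) p))"

definition fill :: "nat \<Rightarrow> nat list \<Rightarrow> mono \<Rightarrow> tab \<Rightarrow> tab" where
  "fill N tau a T = (\<lambda>c. if c \<in> cells tau then plus_part N a (T c) else 0)"

definition column_strict :: "nat list \<Rightarrow> tab \<Rightarrow> bool" where
  "column_strict tau F \<longleftrightarrow>
     (\<forall>i j. (i, j) \<in> cells tau \<and> (i + 1, j) \<in> cells tau \<longrightarrow> F (i, j) < F (i + 1, j))
   \<and> (\<forall>i j. (i, j) \<in> cells tau \<and> (i, j + 1) \<in> cells tau \<longrightarrow> F (i, j) \<le> F (i, j + 1))"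

definition tabset :: "nat \<Rightarrow> nat list \<Rightarrow> mono \<Rightarrow> tab \<Rightarrow> (mono \<times> tab) set" where
  "tabset N tau a T = {(b, T'). (\<forall>i. b i \<noteq> 0 \<longrightarrow> i \<in> {1..N}) \<and> T' \<in> RSYT N tau
      \<and> fill N tau b T' = fill N tau a T}"

definition TR :: "nat list \<Rightarrow> tab \<Rightarrow> tab" where
  "TR tau F = (\<lambda>(i, j). if (i, j) \<in> cells tau then
      card {(k, l)\<in>cells tau. F (i, j) < F (k, l)}
    + card {(k, l)\<in>cells tau. F (k, l) = F (i, j) \<and> (j < l \<or> (l = j \<and> i \<le> k))} else 0)"

definition TS :: "nat list \<Rightarrow> tab \<Rightarrow> tab" where
  "TS tau F = (\<lambda>(i, j). if (i, j) \<in> cells tau then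
      card {(k, l)\<in>cells tau. F (i, j) < F (k, l)}
    + card {(k, l)\<in>cells tau. F (k, l) = F (i, j) \<and> (i < k \<or> (k = i \<and> j \<le> l))} else 0)"

definition Efac :: "nat \<Rightarrow> nat list \<Rightarrow> real \<Rightarrow> real \<Rightarrow> mono \<Rightarrow> tab \<Rightarrow> real" where
  "Efac N tau kappa eps a T =
     (\<Prod>(i, j)\<in>{(i, j). 1 \<le> i \<and> i < j \<and> j \<le> N \<and> a i < a j}.
        1 + eps * kappa / (real (a j) - real (a i)
          + kappa * real_of_int (content tau T (rank N a j) - content tau T (rank N a i))))"

definition Cfac :: "nat \<Rightarrow> nat list \<Rightarrow> real \<Rightarrow> tab \<Rightarrow> real" where
  "Cfac N tau eps T =
     (\<Prod>(i, j)\<in>{(i, j). 1 \<le> i \<and> i < j \<and> j \<le> N \<and> content tau T i \<le> content tau T j - 2}.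
        1 + eps / real_of_int (content tau T i - content tau T j))"

definition Jpoly :: "nat \<Rightarrow> nat list \<Rightarrow> real \<Rightarrow> mono \<Rightarrow> tab \<Rightarrow> vpoly" where
  "Jpoly N tau kappa lam T0 = (\<lambda>b T''. \<Sum>(c, T')\<in>tabset N tau lam T0.
      complex_of_real (Cfac N tau (-1) T0 / Cfac N tau (-1) T' * Efac N tau kappa (-1) c T')
      * zeta N tau kappa c T' b T'')"

end

theory Submission
  imports Defs "HOL-Library.Function_Algebras" "HOL-Combinatorics.Multiset_Permutations"
begin

text \<open>The polynomials zeta are built from the constants \<open>1 \<otimes> T\<close> by the affine step
  \<open>p \<mapsto> x\<^sub>N (w p)\<close>, with \<open>w\<close> a full cycle, and by the steps \<open>p \<mapsto> s\<^sub>k p - b p\<close>; the exchange relations of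
  the Cherednik operators with these steps make the results joint eigenvectors, so commutativity of
  the operators is never needed. Triangularity and the bound on \<open>\<kappa>\<close> show that a joint eigenvector is
  determined by its leading coefficient. This yields uniqueness and the basis property, and
  an explicit orthogonal form on this basis has all the invariances that characterize
  the form on the torus.

  An element \<open>(\<beta>, T')\<close> of \<open>\<T>(\<lambda>, T\<^sub>S)\<close> amounts to an arrangement of the cells in which each run of equal
  entries of a row is read from right to left. With \<open>Z = entry / \<kappa> + content\<close> the squared norm of \<open>J\<close>
  becomes, up to constants, the sum over these arrangements \<open>\<sigma>\<close> of
  \<open>\<Prod>i<j. 1 + 1 / (Z (\<sigma> i) - Z (\<sigma> j))\<close>. This product vanishes on all other arrangements, and its sum over all
  arrangements is \<open>N!\<close> by partial fractions. The same identity within rows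
  counts \<open>\<T>(\<lambda>, T\<^sub>S)\<close>.\<close>

section \<open>Permutations generated by adjacent transpositions\<close>

text \<open>The operators tau(w), the torus form and the zeta are given by definite descriptions, so
  existence and uniqueness of each must be settled before any norm can be computed. For tau this is
  the Coxeter presentation of the symmetric group, obtained from the normal form of a permutation as
  a cycle times a permutation of fewer letters. The bound on \<open>kappa\<close> acts through one
  fact: contents lie between 1 - l(tau) and tau_1 - 1, so \<open>kappa\<close> times a difference of
  contents, even shifted by one, stays below 1 in absolute value and cannot compensate a difference
  of exponents. The sum over arrangements arises because the squared norm of zeta times E_1 E_(-1)
  equals C_1 C_(-1) times a constant of the filled diagram. Squaring the coefficients of J therefore
  leaves C_1 / C_(-1) and E_(-1) / E_1, a product over pairs of cells. Neighbouring equal entries of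
  a row have contents differing by one, so in the wrong order their factor is 1 + 1/(-1) =
  0.\<close>

abbreviation adj :: "nat \<Rightarrow> nat \<Rightarrow> nat" where
  "adj k \<equiv> transpose k (Suc k)"

text \<open>The word A_a A_(a+1) ... A_(a+m-1), generic in A so that it can be formed from
  transpositions and from operators alike. For \<open>adj\<close> it is the cycle carrying a + m to
  a; the words ending in the letter n represent the cosets of the permutations of n letters in those
  of n + 1 letters.\<close>

fun descent_cycle :: "(nat \<Rightarrow> 'b \<Rightarrow> 'b) \<Rightarrow> nat \<Rightarrow> nat \<Rightarrow> 'b \<Rightarrow> 'b" where
  "descent_cycle A a 0 = id"
| "descent_cycle A a (Suc m) = A a \<circ> descent_cycle A (Suc a) m"

lemma adj_permutes: "1 \<le> k \<Longrightarrow> k < n \<Longrightarrow> adj k permutes {1..n}"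
  by (intro permutes_swap_id) auto

lemma descent_cycle_permutes:
  "1 \<le> a \<Longrightarrow> a + m \<le> n \<Longrightarrow> descent_cycle adj a m permutes {1..n}"
proof (induction m arbitrary: a)
  case 0
  show ?case unfolding descent_cycle.simps by (rule permutes_id)
next
  case (Suc m)
  then show ?case unfolding descent_cycle.simps
    by (intro permutes_compose adj_permutes Suc.IH) auto
qed

lemma descent_cycle_last: "descent_cycle adj a m (a + m) = a"
proof (induction m arbitrary: a)
  case (Suc m)
  from Suc.IH[of "Suc a"] show ?case by simp
qed simp

lemma descent_cycle_commute:
  assumes "\<And>j. a \<le> j \<Longrightarrow> j < a + m \<Longrightarrow> A k \<circ> A j = A j \<circ> A k"
  shows "A k \<circ> descent_cycle A a m = descent_cycle A a m \<circ> A k"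
  using assms
proof (induction m arbitrary: a)
  case (Suc m)
  have IH: "A k \<circ> descent_cycle A (Suc a) m = descent_cycle A (Suc a) m \<circ> A k"
    using Suc.prems by (intro Suc.IH) auto
  have c: "A k \<circ> A a = A a \<circ> A k" by (rule Suc.prems) auto
  have "A k \<circ> descent_cycle A a (Suc m) = (A k \<circ> A a) \<circ> descent_cycle A (Suc a) m"
    by (simp add: o_assoc)
  also have "\<dots> = A a \<circ> (A k \<circ> descent_cycle A (Suc a) m)" by (simp only: c o_assoc)
  also have "\<dots> = descent_cycle A a (Suc m) \<circ> A k" by (simp only: IH o_assoc descent_cycle.simps)
  finally show ?case .
qed simp

locale coxeter_relations =
  fixes A :: "nat \<Rightarrow> 'b \<Rightarrow> 'b" and n :: nat
  assumes invol: "\<And>k. 1 \<le> k \<Longrightarrow> k < n \<Longrightarrow> A k \<circ> A k = id"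
    and far: "\<And>j k. 1 \<le> j \<Longrightarrow> Suc j < k \<Longrightarrow> k < n \<Longrightarrow> A j \<circ> A k = A k \<circ> A j"
    and braid: "\<And>k. 1 \<le> k \<Longrightarrow> Suc k < n \<Longrightarrow>
      A k \<circ> A (Suc k) \<circ> A k = A (Suc k) \<circ> A k \<circ> A (Suc k)"
begin

text \<open>The letter A_k commutes with the word up to A_(k-1) A_k, where the braid relation turns
  A_k A_(k-1) A_k into A_(k-1) A_k A_(k-1); the released A_(k-1) commutes with all later
  letters.\<close>

lemma shift_cycle:
  "1 \<le> a \<Longrightarrow> a < k \<Longrightarrow> k < a + m \<Longrightarrow> a + m \<le> n \<Longrightarrow>
    A k \<circ> descent_cycle A a m = descent_cycle A a m \<circ> A (k - 1)"
proof (induction m arbitrary: a)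
  case (Suc m)
  show ?case
  proof (cases "k = Suc a")
    case True
    with Suc.prems obtain m' where m: "m = Suc m'" by (cases m) auto
    have far': "A a \<circ> descent_cycle A (Suc (Suc a)) m' = descent_cycle A (Suc (Suc a)) m' \<circ> A a"
      using Suc.prems m by (intro descent_cycle_commute far) auto
    have b: "A a \<circ> A (Suc a) \<circ> A a = A (Suc a) \<circ> A a \<circ> A (Suc a)"
      using Suc.prems m by (intro braid) auto
    have "A k \<circ> descent_cycle A a (Suc m)
        = (A (Suc a) \<circ> A a \<circ> A (Suc a)) \<circ> descent_cycle A (Suc (Suc a)) m'"
      by (simp only: True m descent_cycle.simps o_assoc)
    also have "\<dots> = A a \<circ> A (Suc a) \<circ> (A a \<circ> descent_cycle A (Suc (Suc a)) m')"
      by (simp only: b[symmetric] o_assoc)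
    also have "\<dots> = descent_cycle A a (Suc m) \<circ> A a"
      by (simp only: far' m descent_cycle.simps o_assoc)
    finally show ?thesis by (simp only: True diff_Suc_1)
  next
    case False
    have IH: "A k \<circ> descent_cycle A (Suc a) m = descent_cycle A (Suc a) m \<circ> A (k - 1)"
      using Suc.prems False by (intro Suc.IH) auto
    have f: "A a \<circ> A k = A k \<circ> A a" using Suc.prems False by (intro far) auto
    have "A k \<circ> descent_cycle A a (Suc m) = A a \<circ> (A k \<circ> descent_cycle A (Suc a) m)"
      by (simp only: f[symmetric] descent_cycle.simps o_assoc)
    also have "\<dots> = descent_cycle A a (Suc m) \<circ> A (k - 1)"
      by (simp only: IH descent_cycle.simps o_assoc)
    finally show ?thesis .
  qed
qed simp

end

lemma coxeter_relations_adj: "coxeter_relations adj n"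
  by unfold_locales (auto simp: fun_eq_iff transpose_def)

text \<open>The permutation and the cycle agree at n + 1, so their quotient fixes n + 1.\<close>

lemma permutes_descent_cycle:
  assumes "w permutes {1..Suc n}"
  obtains a w' where "1 \<le> a" "a \<le> Suc n" "w (Suc n) = a" "w' permutes {1..n}"
    "w = descent_cycle adj a (Suc n - a) \<circ> w'"
proof -
  define a where "a = w (Suc n)"
  have a: "1 \<le> a" "a \<le> Suc n"
    using permutes_in_image[OF assms, of "Suc n"] by (auto simp: a_def)
  let ?c = "descent_cycle adj a (Suc n - a)"
  have c: "?c permutes {1..Suc n}" using a by (intro descent_cycle_permutes) auto
  define w' where "w' = inv ?c \<circ> w"
  have w': "w' permutes {1..Suc n}"
    unfolding w'_def by (intro permutes_compose assms permutes_inv c)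
  have "?c (Suc n) = a" using descent_cycle_last[of a "Suc n - a"] a by simp
  then have "w' (Suc n) = Suc n"
    using permutes_inverses(2)[OF c] by (metis a_def comp_apply w'_def)
  with w' have "w' permutes {1..n}"
    by (intro permutes_superset[OF w']) (auto simp: le_Suc_eq)
  moreover have "w = ?c \<circ> w'"
    using permutes_inv_o(1)[OF c] by (simp add: w'_def o_assoc)
  ultimately show thesis by (rule that[OF a a_def[symmetric]])
qed

text \<open>Iterating the coset decomposition writes every permutation as a word in adjacent
  transpositions. Left multiplication by one letter is the form in which representations and forms
  are controlled later.\<close>

lemma permutes_adj_induct [consumes 1, case_names id adj]:
  assumes "w permutes {1..n}" and "P id"
    and step: "\<And>k w. 1 \<le> k \<Longrightarrow> k < n \<Longrightarrow> w permutes {1..n} \<Longrightarrow> P w \<Longrightarrow> P (adj k \<circ> w)"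
  shows "P w"
proof -
  have "w permutes {1..m} \<Longrightarrow> m \<le> n \<Longrightarrow> P w" for m w
  proof (induction m arbitrary: w)
    case 0
    then have "w = id" by (auto simp: permutes_def)
    then show ?case by (simp only: assms(2))
  next
    case (Suc m)
    from Suc.prems(1) obtain a w' where a: "1 \<le> a" "a \<le> Suc m"
      and w': "w' permutes {1..m}" and w: "w = descent_cycle adj a (Suc m - a) \<circ> w'"
      by (rule permutes_descent_cycle)
    have Pw': "P w'" using Suc.IH[OF w'] Suc.prems by simp
    have w'n: "w' permutes {1..n}" using w' Suc.prems by (auto intro: permutes_subset)
    have "1 \<le> a \<Longrightarrow> a + j \<le> n \<Longrightarrow> P (descent_cycle adj a j \<circ> w')" for j a
    proof (induction j arbitrary: a)
      case (Suc j)
      have "P (adj a \<circ> (descent_cycle adj (Suc a) j \<circ> w'))"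
      proof (rule step)
        show "P (descent_cycle adj (Suc a) j \<circ> w')" by (rule Suc.IH) (use Suc.prems in auto)
        show "descent_cycle adj (Suc a) j \<circ> w' permutes {1..n}"
          by (intro permutes_compose[OF w'n] descent_cycle_permutes) (use Suc.prems in auto)
      qed (use Suc.prems in auto)
      then show ?case by (simp only: o_assoc descent_cycle.simps)
    qed (use Pw' in \<open>simp only: descent_cycle.simps id_o\<close>)
    from this[of a "Suc m - a"] show ?case using a Suc.prems by (simp only: w)
  qed
  from this[OF assms(1)] show ?thesis by simp
qed

text \<open>Left multiplication by a generator either changes the coset representative (k = a or k +
  1 = a) or passes through it and reappears on the right as a generator of the smaller group. Only
  the Coxeter relations are used, so transpositions and operators obey the same table.\<close>

lemma adj_mult_cycle:
  assumes "1 \<le> a" "a \<le> Suc n" "1 \<le> k" "k \<le> n"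
    and A: "coxeter_relations A (Suc n)"
  shows "A k \<circ> descent_cycle A a (Suc n - a) =
    (if Suc k < a then descent_cycle A a (Suc n - a) \<circ> A k
     else if Suc k = a then descent_cycle A k (Suc n - k)
     else if k = a then descent_cycle A (Suc a) (n - a)
     else descent_cycle A a (Suc n - a) \<circ> A (k - 1))"
proof -
  interpret coxeter_relations A "Suc n" by fact
  consider "Suc k < a" | "Suc k = a" | "k = a" | "a < k" by linarith
  then show ?thesis
  proof cases
    case 1
    then have "A k \<circ> descent_cycle A a (Suc n - a) = descent_cycle A a (Suc n - a) \<circ> A k"
      using assms by (intro descent_cycle_commute far) auto
    then show ?thesis using 1 by auto
  next
    case 2
    then have "Suc n - k = Suc (Suc n - a)" using assms by auto
    then show ?thesis using 2 by auto
  next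
    case 3
    then have "Suc n - a = Suc (n - a)" using assms by auto
    moreover have "A a \<circ> A a = id" using assms 3 by (intro invol) auto
    ultimately show ?thesis using 3 by (simp add: o_assoc)
  next
    case 4
    then have "A k \<circ> descent_cycle A a (Suc n - a) = descent_cycle A a (Suc n - a) \<circ> A (k - 1)"
      using assms by (intro shift_cycle) auto
    then show ?thesis using 4 by auto
  qed
qed

text \<open>Induction on n: R is defined on the normal form (cycle times smaller permutation) and
  compatibility with left multiplication is read off from the table in
  \<open>adj_mult_cycle\<close>, applied once to \<open>adj\<close> and once to A. Full
  multiplicativity then follows by \<open>permutes_adj_induct\<close>.\<close>

lemma coxeter_extend:
  assumes "coxeter_relations A n"
  shows "\<exists>R. R id = id \<and>
    (\<forall>k w. 1 \<le> k \<longrightarrow> k < n \<longrightarrow> w permutes {1..n} \<longrightarrow> R (adj k \<circ> w) = A k \<circ> R w)"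
  using assms
proof (induction n)
  case 0
  show ?case by (intro exI[of _ "\<lambda>_. id"]) auto
next
  case (Suc n)
  have "coxeter_relations A n"
    using Suc.prems unfolding coxeter_relations_def by auto
  from Suc.IH[OF this] obtain R where R: "R id = id"
    and Rk: "\<And>k w. 1 \<le> k \<Longrightarrow> k < n \<Longrightarrow> w permutes {1..n} \<Longrightarrow> R (adj k \<circ> w) = A k \<circ> R w"
    by blast
  define c where "c a = descent_cycle adj a (Suc n - a)" for a
  define C where "C a = descent_cycle A a (Suc n - a)" for a
  \<comment> \<open>The image of \<open>Suc n\<close> names the coset; the remaining factor fixes
    \<open>Suc n\<close> and is handled by the R of the induction hypothesis.\<close>
  define R' where "R' w = C (w (Suc n)) \<circ> R (inv (c (w (Suc n))) \<circ> w)" for w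
  have c: "c a permutes {1..Suc n}" if "1 \<le> a" "a \<le> Suc n" for a
    unfolding c_def using that by (intro descent_cycle_permutes) auto
  have R'_eq: "R' (c a \<circ> w) = C a \<circ> R w" if "1 \<le> a" "a \<le> Suc n" "w permutes {1..n}" for a w
  proof -
    have "w (Suc n) = Suc n" using that by (auto simp: permutes_def)
    moreover have "c a (Suc n) = a"
      using descent_cycle_last[of a "Suc n - a"] that by (simp add: c_def)
    moreover have "inv (c a) \<circ> (c a \<circ> w) = w"
      using permutes_inv_o(2)[OF c[OF that(1,2)]] by (simp add: o_assoc)
    ultimately show ?thesis by (simp add: R'_def)
  qed
  have "R' (adj k \<circ> w) = A k \<circ> R' w" if k: "1 \<le> k" "k < Suc n" and w: "w permutes {1..Suc n}" for k w
  proof -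
    obtain a w' where a: "1 \<le> a" "a \<le> Suc n" and w': "w' permutes {1..n}" and weq: "w = c a \<circ> w'"
      unfolding c_def using permutes_descent_cycle[OF w] by metis
    note s = adj_mult_cycle[OF a k(1) _ coxeter_relations_adj, folded c_def]
      and S = adj_mult_cycle[OF a k(1) _ Suc.prems, folded C_def]
    have kn: "k \<le> n" using k by simp
    have L: "R' (adj k \<circ> w) = R' ((adj k \<circ> c a) \<circ> w')" by (simp add: weq o_assoc)
    have Rt: "A k \<circ> R' w = (A k \<circ> C a) \<circ> R w'" using a w' by (simp add: weq R'_eq o_assoc)
    have cs: "c (Suc a) = descent_cycle adj (Suc a) (n - a)" "C (Suc a) = descent_cycle A (Suc a) (n - a)"
      by (simp_all add: c_def C_def)
    consider "Suc k < a" | "Suc k = a" | "k = a" | "a < k" by linarith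
    then show ?thesis
    proof cases
      case 1
      then have sk: "adj k \<circ> c a = c a \<circ> adj k" and Sk: "A k \<circ> C a = C a \<circ> A k"
        using s S kn by auto
      have "R' ((adj k \<circ> c a) \<circ> w') = R' (c a \<circ> (adj k \<circ> w'))" by (simp only: sk o_assoc)
      also have "\<dots> = C a \<circ> R (adj k \<circ> w')"
        using a 1 k by (intro R'_eq permutes_compose[OF w'] adj_permutes) auto
      also have "R (adj k \<circ> w') = A k \<circ> R w'" using 1 a k w' by (intro Rk) auto
      finally show ?thesis by (simp only: L Rt Sk o_assoc)
    next
      case 2
      then show ?thesis unfolding L Rt s[OF kn] S[OF kn]
        using R'_eq[of k w'] k w' by (simp add: c_def C_def)
    next
      case 3
      then show ?thesis unfolding L Rt s[OF kn] S[OF kn]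
        using R'_eq[of "Suc a" w'] k w' by (simp add: cs)
    next
      case 4
      then have sk: "adj k \<circ> c a = c a \<circ> adj (k - 1)" and Sk: "A k \<circ> C a = C a \<circ> A (k - 1)"
        using s S kn by auto
      have "R' ((adj k \<circ> c a) \<circ> w') = R' (c a \<circ> (adj (k - 1) \<circ> w'))"
        by (simp only: sk o_assoc)
      also have "\<dots> = C a \<circ> R (adj (k - 1) \<circ> w')"
        using a 4 k by (intro R'_eq permutes_compose[OF w'] adj_permutes) auto
      also have "R (adj (k - 1) \<circ> w') = A (k - 1) \<circ> R w'" using 4 a k w' by (intro Rk) auto
      finally show ?thesis by (simp only: L Rt Sk o_assoc)
    qed
  qed
  moreover have "R' id = id"
    using R'_eq[of "Suc n" id] R by (simp add: permutes_id c_def C_def)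
  ultimately show ?case by blast
qed

section \<open>Reverse standard tableaux\<close>

definition cont :: "nat \<times> nat \<Rightarrow> int" where
  "cont c = int (snd c) - int (fst c)"

lemma content_eq: "content tau T k = cont (pos tau T k)"
  by (simp add: content_def cont_def)

lemma swap_entries_apply: "swap_entries k T c = adj k (T c)"
  by (auto simp: swap_entries_def transpose_def)

lemma swap_entries_swap_entries [simp]: "swap_entries k (swap_entries k T) = T"
  by (auto simp: swap_entries_def fun_eq_iff)

locale young_diagram =
  fixes N :: nat and tau :: "nat list"
  assumes partition: "is_partition N tau"
begin

abbreviation "Y \<equiv> RSYT N tau"

text \<open>Standardness is dropped on purpose: swapping consecutive entries may leave the standard
  tableaux, and the braid computation runs through all six fillings of an orbit, whose contents must
  still make sense.\<close>

definition filling :: "tab \<Rightarrow> bool" where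
  "filling T \<longleftrightarrow> (\<forall>c. c \<notin> cells tau \<longrightarrow> T c = 0) \<and> bij_betw T (cells tau) {1..N}"

lemma cells_down:
  assumes "(i, j) \<in> cells tau" "1 \<le> i'" "i' \<le> i" "1 \<le> j'" "j' \<le> j"
  shows "(i', j') \<in> cells tau"
proof -
  have s: "sorted_wrt (\<ge>) tau" using partition by (simp add: is_partition_def)
  have "tau ! (i - 1) \<le> tau ! (i' - 1)"
  proof (cases "i' = i")
    case False
    then show ?thesis using assms sorted_wrt_nth_less[OF s, of "i' - 1" "i - 1"]
      by (auto simp: cells_def)
  qed simp
  then show ?thesis using assms by (auto simp: cells_def)
qed

lemma cells_pos: "c \<in> cells tau \<Longrightarrow> 1 \<le> fst c \<and> 1 \<le> snd c"
  by (auto simp: cells_def)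

lemma finite_cells: "finite (cells tau)"
proof (rule finite_subset)
  have "tau ! (i - 1) \<le> Max (set tau)" if "1 \<le> i" "i \<le> length tau" for i
    using that by (intro Max_ge) auto
  then show "cells tau \<subseteq> {1..length tau} \<times> {1..Max (set tau)}"
    by (force simp: cells_def intro: order_trans)
qed simp

lemma cont_bounds:
  assumes "c \<in> cells tau"
  shows "1 - int (length tau) \<le> cont c" "cont c \<le> int (tau ! 0) - 1"
proof -
  obtain i j where c: "c = (i, j)" by (cases c)
  have "(1, j) \<in> cells tau"
    using assms c cells_pos[OF assms] by (intro cells_down[of i j 1 j]) auto
  then have "j \<le> tau ! 0" by (simp add: cells_def)
  with assms c show "1 - int (length tau) \<le> cont c" "cont c \<le> int (tau ! 0) - 1"
    by (auto simp: cells_def cont_def)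
qed

lemma filling_RSYT: "T \<in> Y \<Longrightarrow> filling T"
  by (simp add: RSYT_def filling_def)

lemma filling_in: "filling T \<Longrightarrow> c \<in> cells tau \<Longrightarrow> T c \<in> {1..N}"
  by (auto simp: filling_def bij_betw_def)

lemma filling_inj: "filling T \<Longrightarrow> c \<in> cells tau \<Longrightarrow> c' \<in> cells tau \<Longrightarrow> T c = T c' \<Longrightarrow> c = c'"
  by (auto simp: filling_def bij_betw_def inj_on_def)

lemma pos_eq:
  assumes "filling T" "c \<in> cells tau"
  shows "pos tau T (T c) = c"
  unfolding pos_def using assms by (intro the_equality) (auto dest: filling_inj)

lemma pos_in:
  assumes "filling T" "k \<in> {1..N}"
  shows "pos tau T k \<in> cells tau" "T (pos tau T k) = k"
proof -
  have "k \<in> T ` cells tau" using assms by (auto simp: filling_def bij_betw_def)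
  then obtain c where "c \<in> cells tau" "T c = k" by auto
  with pos_eq[OF assms(1) this(1)] show "pos tau T k \<in> cells tau" "T (pos tau T k) = k" by auto
qed

lemma card_cells: "filling T \<Longrightarrow> card (cells tau) = N"
  unfolding filling_def using bij_betw_same_card by fastforce

lemma finite_RSYT: "finite Y"
proof (rule finite_subset)
  show "Y \<subseteq> {f. \<forall>x. (x \<in> cells tau \<longrightarrow> f x \<in> {0..N}) \<and> (x \<notin> cells tau \<longrightarrow> f x = 0)}"
    using filling_in filling_RSYT by (fastforce simp: RSYT_def)
qed (intro finite_set_of_finite_funs finite_cells, simp)

lemma filling_swap:
  assumes "filling T" "1 \<le> k" "k < N"
  shows "filling (swap_entries k T)"
proof -
  have "bij_betw (adj k \<circ> T) (cells tau) {1..N}"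
    using assms permutes_imp_bij[OF adj_permutes[of k N]]
    by (intro bij_betw_trans[of T]) (auto simp: filling_def)
  moreover have "swap_entries k T = adj k \<circ> T" by (simp add: fun_eq_iff swap_entries_apply)
  ultimately show ?thesis using assms by (auto simp: filling_def)
qed

lemma pos_swap:
  assumes "filling T" "1 \<le> k" "k < N" "m \<in> {1..N}"
  shows "pos tau (swap_entries k T) m = pos tau T (adj k m)"
proof -
  have "adj k m \<in> {1..N}" using assms by (auto simp: transpose_def)
  note p = pos_in[OF assms(1) this]
  have "swap_entries k T (pos tau T (adj k m)) = m" using p by (simp add: swap_entries_apply)
  then show ?thesis using pos_eq[OF filling_swap[OF assms(1-3)] p(1)] by simp
qed

lemma content_swap:
  "filling T \<Longrightarrow> 1 \<le> k \<Longrightarrow> k < N \<Longrightarrow> m \<in> {1..N} \<Longrightarrow>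
    content tau (swap_entries k T) m = content tau T (adj k m)"
  by (simp add: content_eq pos_swap)

text \<open>Each step up or to the left raises the entry by at least one; the path goes through the
  cell in the row of v and the column of u. The quantitative bound is what later forces entries
  lying between two close values.\<close>

lemma RSYT_northwest:
  assumes T: "T \<in> Y" and u: "u \<in> cells tau" and v: "v \<in> cells tau"
    and le: "fst v \<le> fst u" "snd v \<le> snd u"
  shows "T u + (fst u - fst v) + (snd u - snd v) \<le> T v"
proof -
  have row: "(i, j + m) \<in> cells tau \<Longrightarrow> 1 \<le> j \<Longrightarrow> T (i, j + m) + m \<le> T (i, j)" for i j m
  proof (induction m)
    case (Suc m)
    have "(i, j + m) \<in> cells tau"
      using cells_pos[OF Suc.prems(1)] Suc.prems by (intro cells_down[OF Suc.prems(1)]) auto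
    with Suc T show ?case by (fastforce simp: RSYT_def)
  qed simp
  have col: "(i + m, j) \<in> cells tau \<Longrightarrow> 1 \<le> i \<Longrightarrow> T (i + m, j) + m \<le> T (i, j)" for i j m
  proof (induction m)
    case (Suc m)
    have "(i + m, j) \<in> cells tau"
      using cells_pos[OF Suc.prems(1)] Suc.prems by (intro cells_down[OF Suc.prems(1)]) auto
    with Suc T show ?case by (fastforce simp: RSYT_def)
  qed simp
  obtain i j i' j' where uv: "u = (i, j)" "v = (i', j')" by (cases u, cases v)
  have "(i', j) \<in> cells tau" using cells_pos[OF v] le uv cells_pos[OF u] u by (auto intro: cells_down)
  with row[of i' j' "j - j'"] col[of i' "i - i'" j] show ?thesis
    using le uv cells_pos[OF v] u by auto
qed

lemma RSYT_pos_less: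
  assumes "T \<in> Y" "k \<in> {1..N}" "l \<in> {1..N}" "k < l"
    and "fst (pos tau T k) \<le> fst (pos tau T l)"
  shows "snd (pos tau T l) < snd (pos tau T k)"
proof (rule ccontr)
  assume neg: "\<not> ?thesis"
  note p = pos_in[OF filling_RSYT[OF assms(1)]]
  have "l \<le> k" using RSYT_northwest[OF assms(1) p(1)[OF assms(3)] p(1)[OF assms(2)]] assms
    neg p(2)[OF assms(3)] p(2)[OF assms(2)] by auto
  with assms show False by simp
qed

text \<open>If k + 1 lies weakly northwest of k, then \<open>RSYT_northwest\<close> leaves room for
  only one step between them. Otherwise both coordinates differ in opposite directions, and the
  contents differ by at least 2. Hence the coefficients 1/d of Young's form are defined, and d = 1
  or -1 means neighbours in a row or column.\<close>

lemma content_adj: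
  assumes "T \<in> Y" "1 \<le> k" "k < N"
  defines "d \<equiv> content tau T k - content tau T (Suc k)"
  shows "d \<noteq> 0"
    and "fst (pos tau T k) = fst (pos tau T (Suc k)) \<longleftrightarrow> d = 1"
    and "snd (pos tau T k) = snd (pos tau T (Suc k)) \<longleftrightarrow> d = -1"
proof -
  obtain i j i' j' where p: "pos tau T k = (i, j)" "pos tau T (Suc k) = (i', j')"
    by (cases "pos tau T k", cases "pos tau T (Suc k)")
  note q = pos_in[OF filling_RSYT[OF assms(1)]]
  have k: "k \<in> {1..N}" "Suc k \<in> {1..N}" using assms by auto
  have u: "(i, j) \<in> cells tau" "T (i, j) = k" and v: "(i', j') \<in> cells tau" "T (i', j') = Suc k"
    using q[OF k(1)] q[OF k(2)] p by auto
  have A: "i \<le> i' \<Longrightarrow> j' < j" using RSYT_pos_less[OF assms(1) k] p by auto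
  have B: "i' \<le> i \<Longrightarrow> j' \<le> j \<Longrightarrow> (i - i') + (j - j') \<le> 1"
    using RSYT_northwest[OF assms(1) u(1) v(1)] u v by auto
  have d: "d = (int j - int i) - (int j' - int i')" by (simp add: d_def content_def p)
  show "d \<noteq> 0" "fst (pos tau T k) = fst (pos tau T (Suc k)) \<longleftrightarrow> d = 1"
    "snd (pos tau T k) = snd (pos tau T (Suc k)) \<longleftrightarrow> d = -1"
    using A B unfolding d p by (cases "i \<le> i'"; cases "j' \<le> j"; auto)+
qed

text \<open>Equal contents would put k + 2 northwest of k on one diagonal, with two different cells
  between them both forced to carry k + 1. This excludes the third zero denominator in the braid
  relation.\<close>

lemma content_adj2:
  assumes "T \<in> Y" "1 \<le> k" "Suc k < N"
  shows "content tau T k \<noteq> content tau T (Suc (Suc k))"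
proof
  assume eq: "content tau T k = content tau T (Suc (Suc k))"
  obtain i j i' j' where p: "pos tau T k = (i, j)" "pos tau T (Suc (Suc k)) = (i', j')"
    by (cases "pos tau T k", cases "pos tau T (Suc (Suc k))")
  note fT = filling_RSYT[OF assms(1)]
  have k: "k \<in> {1..N}" "Suc (Suc k) \<in> {1..N}" using assms by auto
  have u: "(i, j) \<in> cells tau" "T (i, j) = k"
    and v: "(i', j') \<in> cells tau" "T (i', j') = Suc (Suc k)"
    using pos_in[OF fT k(1)] pos_in[OF fT k(2)] p by auto
  have A: "i \<le> i' \<Longrightarrow> j' < j" using RSYT_pos_less[OF assms(1) k] p by auto
  have d: "int j - int i = int j' - int i'" using eq by (simp add: content_def p)
  have i: "i' < i" "j' < j" using A d by linarith+
  note uv = cells_pos[OF u(1)] cells_pos[OF v(1)]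
  have w: "(Suc i', j') \<in> cells tau" "(i', Suc j') \<in> cells tau"
    using i uv by (auto intro!: cells_down[OF u(1)])
  have "T (Suc i', j') = Suc k"
    using RSYT_northwest[OF assms(1) u(1) w(1)] RSYT_northwest[OF assms(1) w(1) v(1)] i u v by auto
  moreover have "T (i', Suc j') = Suc k"
    using RSYT_northwest[OF assms(1) u(1) w(2)] RSYT_northwest[OF assms(1) w(2) v(1)] i u v by auto
  ultimately show False using filling_inj[OF fT w] by auto
qed

lemma RSYT_swap:
  assumes T: "T \<in> Y" and k: "1 \<le> k" "k < N"
    and d: "\<bar>content tau T k - content tau T (Suc k)\<bar> \<noteq> 1"
  shows "swap_entries k T \<in> Y"
proof -
  have fT: "filling T" using T by (rule filling_RSYT)
  have row: "fst (pos tau T k) \<noteq> fst (pos tau T (Suc k))"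
    and col: "snd (pos tau T k) \<noteq> snd (pos tau T (Suc k))"
    using content_adj[OF T k] d by auto
  have mono: "T c' < T c \<Longrightarrow> c \<in> cells tau \<Longrightarrow> c' \<in> cells tau \<Longrightarrow> fst c = fst c' \<or> snd c = snd c' \<Longrightarrow>
    swap_entries k T c' < swap_entries k T c" for c c'
  proof -
    assume a: "T c' < T c" "c \<in> cells tau" "c' \<in> cells tau" "fst c = fst c' \<or> snd c = snd c'"
    have "\<not> (T c' = k \<and> T c = Suc k)"
      using row col a pos_eq[OF fT a(2)] pos_eq[OF fT a(3)] by auto
    with a show ?thesis by (auto simp: swap_entries_def)
  qed
  show ?thesis using filling_swap[OF fT k] T unfolding RSYT_def filling_def
    by (auto intro!: mono)
qed

lemma RSYT_swap_iff:
  assumes T: "T \<in> Y" and k: "1 \<le> k" "k < N"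
  shows "swap_entries k T \<in> Y \<longleftrightarrow> \<bar>content tau T k - content tau T (Suc k)\<bar> \<noteq> 1"
proof
  assume S: "swap_entries k T \<in> Y"
  have fT: "filling T" using T by (rule filling_RSYT)
  show "\<bar>content tau T k - content tau T (Suc k)\<bar> \<noteq> 1"
  proof
    assume a: "\<bar>content tau T k - content tau T (Suc k)\<bar> = 1"
    have kN: "k \<in> {1..N}" "Suc k \<in> {1..N}" using k by auto
    have sp: "pos tau (swap_entries k T) k = pos tau T (Suc k)"
       "pos tau (swap_entries k T) (Suc k) = pos tau T k"
      using pos_swap[OF fT k] kN by auto
    show False
      using a content_adj(2,3)[OF T k] RSYT_pos_less[OF T kN] RSYT_pos_less[OF S kN]
      unfolding sp by linarith
  qed
qed (rule RSYT_swap[OF T k])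

text \<open>The largest entry sits in the corner cell; this is the base of the descending induction
  for the Jucys-Murphy elements.\<close>

lemma content_top:
  assumes T: "T \<in> Y" and N: "1 \<le> N"
  shows "content tau T N = 0"
proof -
  have fT: "filling T" using T by (rule filling_RSYT)
  have "N \<in> {1..N}" using N by simp
  note p = pos_in[OF fT this]
  note pp = cells_pos[OF p(1)]
  have o: "(1, 1) \<in> cells tau"
    using p(1) pp by (rule_tac cells_down[of "fst (pos tau T N)" "snd (pos tau T N)"]) auto
  have "N \<le> T (1, 1)" using RSYT_northwest[OF T p(1) o] p(2) pp by auto
  then have "T (1, 1) = N" using filling_in[OF fT o] by auto
  then have "pos tau T N = (1, 1)" using pos_eq[OF fT o] by simp
  then show ?thesis by (simp add: content_def)
qed

end

section \<open>Young's orthogonal form\<close>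

text \<open>The off-diagonal entry of Young's matrix for content difference d. It vanishes for d = 1
  and d = -1, exactly where the swapped tableau fails to be standard, so one formula covers all
  cases of \<open>adj_mat\<close>.\<close>

definition seminormal_coef :: "int \<Rightarrow> real" where
  "seminormal_coef d = (if d \<ge> 2 then 1 else 1 - (1 / real_of_int d)\<^sup>2)"

lemma seminormal_coef_mult:
  "d \<noteq> 0 \<Longrightarrow> seminormal_coef d * seminormal_coef (- d) = 1 - (1 / real_of_int d)\<^sup>2"
proof -
  assume "d \<noteq> 0"
  then consider "d \<ge> 2" | "d \<le> -2" | "d = 1" | "d = -1" by linarith
  then show ?thesis by cases (auto simp: seminormal_coef_def)
qed

lemma seminormal_coef_unit: "\<bar>d\<bar> = 1 \<Longrightarrow> seminormal_coef d = 0"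
  by (cases "d = 1"; cases "d = -1") (auto simp: seminormal_coef_def)

context young_diagram begin

text \<open>The action on coordinate functions, hence the transposed matrix: the coefficient
  arriving at T from its swap is the one belonging to the reversed difference.\<close>

definition nform :: "nat \<Rightarrow> (tab \<Rightarrow> real) \<Rightarrow> tab \<Rightarrow> real" where
  "nform k v T = v T / real_of_int (content tau T k - content tau T (Suc k))
     + seminormal_coef (content tau T (Suc k) - content tau T k) * v (swap_entries k T)"

text \<open>Acting trivially outside the standard tableaux makes the Coxeter relations
  hold for all functions, not only for those supported on standard tableaux.\<close>
definition adj_op :: "nat \<Rightarrow> (tab \<Rightarrow> real) \<Rightarrow> tab \<Rightarrow> real" where
  "adj_op k v T = (if T \<in> Y then nform k v T else v T)"

lemma nform_cong:
  assumes "\<And>T. T \<in> Y \<Longrightarrow> v T = v' T" "T \<in> Y" "1 \<le> k" "k < N"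
  shows "nform k v T = nform k v' T"
proof (cases "\<bar>content tau T k - content tau T (Suc k)\<bar> = 1")
  case True
  then have "seminormal_coef (content tau T (Suc k) - content tau T k) = 0"
    by (intro seminormal_coef_unit) linarith
  then show ?thesis using assms by (simp add: nform_def)
next
  case False
  then show ?thesis using assms RSYT_swap[of T k] by (simp add: nform_def)
qed

lemma adj_op2:
  assumes "T \<in> Y" "1 \<le> j" "j < N" "1 \<le> k" "k < N"
  shows "(adj_op j \<circ> adj_op k) v T = nform j (nform k v) T"
  using nform_cong[of "adj_op k v" "nform k v"] assms by (simp add: adj_op_def)

lemma adj_op3:
  assumes "T \<in> Y" "1 \<le> j" "j < N" "1 \<le> k" "k < N" "1 \<le> l" "l < N"
  shows "(adj_op l \<circ> adj_op j \<circ> adj_op k) v T = nform l (nform j (nform k v)) T"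
proof -
  have "(adj_op l \<circ> adj_op j \<circ> adj_op k) v T = nform l ((adj_op j \<circ> adj_op k) v) T"
    using assms by (simp add: adj_op_def)
  also have "\<dots> = nform l (nform j (nform k v)) T"
    using assms by (intro nform_cong adj_op2)
  finally show ?thesis .
qed

lemma nform_invol:
  assumes T: "T \<in> Y" and k: "1 \<le> k" "k < N"
  shows "nform k (nform k v) T = v T"
proof -
  define d where "d = content tau T k - content tau T (Suc k)"
  have d0: "d \<noteq> 0" using content_adj(1)[OF T k] by (simp add: d_def)
  have s: "content tau (swap_entries k T) k = content tau T (Suc k)"
    "content tau (swap_entries k T) (Suc k) = content tau T k"
    using content_swap[OF filling_RSYT[OF T] k] k by auto
  have e: "content tau T (Suc k) - content tau T k = - d" by (simp add: d_def)
  have m: "seminormal_coef (- d) * seminormal_coef d = 1 - (1 / real_of_int d)\<^sup>2"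
    using seminormal_coef_mult[OF d0] by (simp add: mult.commute)
  have 1: "nform k v T = v T / real_of_int d + seminormal_coef (- d) * v (swap_entries k T)"
    by (simp add: nform_def d_def)
  have 2: "nform k v (swap_entries k T) =
      v (swap_entries k T) / real_of_int (- d) + seminormal_coef d * v T"
    unfolding nform_def s by (simp add: d_def)
  have "nform k (nform k v) T = nform k v T / real_of_int d
      + seminormal_coef (- d) * nform k v (swap_entries k T)"
    by (simp add: nform_def[of k "nform k v"] d_def)
  also have "\<dots> = v T * (1 / real_of_int d)\<^sup>2 + (seminormal_coef (- d) * seminormal_coef d) * v T"
    unfolding 1 2 using d0 by (simp add: field_simps power2_eq_square)
  also have "\<dots> = v T" unfolding m by (simp add: algebra_simps)
  finally show ?thesis .
qed

lemma nform_far: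
  assumes T: "T \<in> Y" and j: "1 \<le> j" "Suc j < k" and k: "k < N"
  shows "nform j (nform k v) T = nform k (nform j v) T"
proof -
  have fT: "filling T" using T by (rule filling_RSYT)
  have c: "content tau (swap_entries j T) k = content tau T k"
    "content tau (swap_entries j T) (Suc k) = content tau T (Suc k)"
    "content tau (swap_entries k T) j = content tau T j"
    "content tau (swap_entries k T) (Suc j) = content tau T (Suc j)"
    using content_swap[OF fT, of j] content_swap[OF fT, of k] j k by (auto simp: transpose_def)
  have s: "swap_entries j (swap_entries k T) = swap_entries k (swap_entries j T)"
    using j by (auto simp: swap_entries_def)
  show ?thesis unfolding nform_def c s by (simp add: algebra_simps add_divide_distrib)
qed

text \<open>Here p, q, r stand for the reciprocals of a - b, b - c, a - c, whose one relation is p q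
  = r (p + q); v1 to v6 are the values on the six fillings of the orbit. Apart from v1, every
  coefficient reduces to that relation; for v1 the products of opposite off-diagonal entries are
  needed as well.\<close>

lemma yang_baxter:
  fixes p q r :: real
  assumes "p * q = r * (p + q)" "gab * gba = 1 - p\<^sup>2" "gbc * gcb = 1 - q\<^sup>2"
  shows "p * (q * (p * v1 + gab * v2) + gbc * (r * v3 + gac * v5))
      + gab * (r * (gba * v1 - p * v2) + gac * (q * v4 + gbc * v6))
    = q * (p * (q * v1 + gbc * v3) + gab * (r * v2 + gac * v4))
      + gbc * (r * (gcb * v1 - q * v3) + gac * (p * v5 + gab * v6))"
proof -
  have 1: "p * q * p + r * (gab * gba) = q * p * q + r * (gbc * gcb)"
  proof -
    have "p * q * p - r * p\<^sup>2 = r * (p * q)" "q * p * q - r * q\<^sup>2 = r * (p * q)"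
      using assms(1) by algebra+
    then show ?thesis unfolding assms by algebra
  qed
  have 2: "p * q - r * p = q * r" using assms(1) by algebra
  have 3: "q * p - r * q = p * r" using assms(1) by algebra
  have "p * (q * (p * v1 + gab * v2) + gbc * (r * v3 + gac * v5))
      + gab * (r * (gba * v1 - p * v2) + gac * (q * v4 + gbc * v6))
     = (p * q * p + r * (gab * gba)) * v1 + (p * q - r * p) * (gab * v2) + p * r * (gbc * v3)
      + p * gbc * gac * v5 + gab * gac * q * v4 + gab * gac * gbc * v6"
    by (simp add: algebra_simps)
  also have "\<dots> = (q * p * q + r * (gbc * gcb)) * v1 + q * r * (gab * v2) + (q * p - r * q) * (gbc * v3)
      + p * gbc * gac * v5 + gab * gac * q * v4 + gab * gac * gbc * v6"
    unfolding 1 2 3 ..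
  also have "\<dots> = q * (p * (q * v1 + gbc * v3) + gab * (r * v2 + gac * v4))
      + gbc * (r * (gcb * v1 - q * v3) + gac * (p * v5 + gab * v6))"
    by (simp add: algebra_simps)
  finally show ?thesis .
qed

text \<open>Both sides are expanded over the orbit of T under the swaps k and k + 1. The
  intermediate fillings may fail to be standard, which is harmless because \<open>nform\<close> is
  defined on every filling.\<close>

lemma nform_braid:
  assumes T: "T \<in> Y" and k: "1 \<le> k" "Suc k < N"
  shows "nform k (nform (Suc k) (nform k v)) T = nform (Suc k) (nform k (nform (Suc k) v)) T"
proof -
  define k' where "k' = Suc k"
  have fT: "filling T" using T by (rule filling_RSYT)
  define a where "a = content tau T k"
  define b where "b = content tau T (Suc k)"
  define c where "c = content tau T (Suc (Suc k))"
  have ab: "a \<noteq> b" "b \<noteq> c" "a \<noteq> c"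
    using content_adj(1)[OF T, of k] content_adj(1)[OF T, of "Suc k"] content_adj2[OF T] k
    by (auto simp: a_def b_def c_def)
  let ?s = "swap_entries k" and ?t = "swap_entries (Suc k)"
  note fs = filling_swap[of _ k] and ft = filling_swap[of _ "Suc k"]
  have F: "filling (?s T)" "filling (?t T)" "filling (?s (?t T))" "filling (?t (?s T))"
    using k by (auto intro!: fs ft fT)
  have m: "content tau (?s S) k = content tau S (Suc k)" "content tau (?s S) (Suc k) = content tau S k"
    "content tau (?s S) (Suc (Suc k)) = content tau S (Suc (Suc k))"
    "content tau (?t S) k = content tau S k" "content tau (?t S) (Suc k) = content tau S (Suc (Suc k))"
    "content tau (?t S) (Suc (Suc k)) = content tau S (Suc k)" if "filling S" for S
    using content_swap[OF that, of k] content_swap[OF that, of "Suc k"] k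
    by (auto simp: transpose_def)
  have sss: "?s (?t (?s T)) = ?t (?s (?t T))"
    by (auto simp: swap_entries_def fun_eq_iff)
  define g where "g x y = seminormal_coef (y - x)" for x y
  have gg: "g x y * g y x = 1 - (1 / real_of_int (x - y))\<^sup>2" if "x \<noteq> y" for x y
    using seminormal_coef_mult[of "x - y"] that by (simp add: g_def mult.commute)
  define p where "p = 1 / real_of_int (a - b)"
  define q where "q = 1 / real_of_int (b - c)"
  define r where "r = 1 / real_of_int (a - c)"
  have nz: "real_of_int (a - b) \<noteq> 0" "real_of_int (b - c) \<noteq> 0" "real_of_int (a - c) \<noteq> 0"
    using ab by auto
  have e: "1 / real_of_int (b - a) = - p" "1 / real_of_int (c - b) = - q"
    using nz by (simp_all add: p_def q_def divide_simps)
  have pq: "p * q = r * (p + q)"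
    using nz by (simp add: p_def q_def r_def divide_simps)
  have N1: "nform k w S = 1 / real_of_int (content tau S k - content tau S (Suc k)) * w S
     + g (content tau S k) (content tau S (Suc k)) * w (?s S)" for w S
    by (simp add: nform_def g_def)
  have N2: "nform (Suc k) w S = 1 / real_of_int (content tau S (Suc k) - content tau S (Suc (Suc k))) * w S
     + g (content tau S (Suc k)) (content tau S (Suc (Suc k))) * w (?t S)" for w S
    by (simp add: nform_def g_def)
  note cs = m[OF fT] m[OF F(1)] m[OF F(2)] m[OF F(3)] m[OF F(4)] a_def[symmetric] b_def[symmetric]
    c_def[symmetric] swap_entries_swap_entries
  have L: "nform k (nform (Suc k) (nform k v)) T =
     p * (q * (p * v T + g a b * v (?s T)) + g b c * (r * v (?t T) + g a c * v (?s (?t T))))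
      + g a b * (r * (g b a * v T - p * v (?s T)) + g a c * (q * v (?t (?s T)) + g b c * v (?s (?t (?s T)))))"
    unfolding N1 N2 cs e p_def[symmetric] q_def[symmetric] r_def[symmetric] by (simp add: algebra_simps)
  have R: "nform (Suc k) (nform k (nform (Suc k) v)) T =
     q * (p * (q * v T + g b c * v (?t T)) + g a b * (r * v (?s T) + g a c * v (?t (?s T))))
      + g b c * (r * (g c b * v T - q * v (?t T)) + g a c * (p * v (?s (?t T)) + g a b * v (?t (?s (?t T)))))"
    unfolding N1 N2 cs e p_def[symmetric] q_def[symmetric] r_def[symmetric] by (simp add: algebra_simps)
  show ?thesis unfolding L R sss
    by (rule yang_baxter) (use pq gg[OF ab(1)] gg[OF ab(2)] in \<open>simp_all add: p_def q_def\<close>)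
qed

lemma coxeter_adj_op: "coxeter_relations adj_op N"
proof
  fix k assume k: "1 \<le> k" "k < N"
  show "adj_op k \<circ> adj_op k = id"
  proof (intro ext)
    fix v T show "(adj_op k \<circ> adj_op k) v T = id v T"
    proof (cases "T \<in> Y")
      case True
      then show ?thesis using adj_op2[of T k k v] nform_invol[of T k v] k by simp
    qed (simp add: adj_op_def)
  qed
next
  fix j k assume k: "1 \<le> j" "Suc j < k" "k < N"
  show "adj_op j \<circ> adj_op k = adj_op k \<circ> adj_op j"
  proof (intro ext)
    fix v T show "(adj_op j \<circ> adj_op k) v T = (adj_op k \<circ> adj_op j) v T"
    proof (cases "T \<in> Y")
      case True
      then show ?thesis using adj_op2[of T j k v] adj_op2[of T k j v] nform_far[of T j k v] k by simp
    qed (simp add: adj_op_def)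
  qed
next
  fix k assume k: "1 \<le> k" "Suc k < N"
  show "adj_op k \<circ> adj_op (Suc k) \<circ> adj_op k = adj_op (Suc k) \<circ> adj_op k \<circ> adj_op (Suc k)"
  proof (intro ext)
    fix v T
    show "(adj_op k \<circ> adj_op (Suc k) \<circ> adj_op k) v T =
      (adj_op (Suc k) \<circ> adj_op k \<circ> adj_op (Suc k)) v T"
    proof (cases "T \<in> Y")
      case True
      then show ?thesis using adj_op3[of T "Suc k" k k v] adj_op3[of T k "Suc k" "Suc k" v]
          nform_braid[of T k v] k by simp
    qed (simp add: adj_op_def)
  qed
qed

lemma adj_mat_eq:
  assumes T: "T \<in> Y" and T': "T' \<in> Y" and k: "1 \<le> k" "k < N"
  shows "adj_mat tau k T T' = nform k (\<lambda>S. if S = T then 1 else 0) T'"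
proof -
  define d where "d = content tau T k - content tau T (Suc k)"
  note ca = content_adj[OF T k, folded d_def]
  have ne: "swap_entries k S \<noteq> S" if "S \<in> Y" for S
  proof
    assume "swap_entries k S = S"
    then have "swap_entries k S (pos tau S k) = S (pos tau S k)" by simp
    then show False using pos_in(2)[OF filling_RSYT[OF that], of k] k by (auto simp: swap_entries_def)
  qed
  consider (eq) "T' = T" | (sw) "T' = swap_entries k T" | (ot) "T' \<noteq> T" "T' \<noteq> swap_entries k T" by blast
  then show ?thesis
  proof cases
    case eq
    have "nform k (\<lambda>S. if S = T then 1 else 0) T' = 1 / real_of_int d"
      using eq ne[OF T] by (simp add: nform_def d_def)
    moreover have "adj_mat tau k T T' = 1 / real_of_int d"
      using ca eq unfolding adj_mat_def Let_def Suc_eq_plus1[symmetric] d_def[symmetric] by auto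
    ultimately show ?thesis by simp
  next
    case sw
    then have s: "content tau T' k = content tau T (Suc k)" "content tau T' (Suc k) = content tau T k"
      using content_swap[OF filling_RSYT[OF T] k] k by auto
    have ns: "\<bar>d\<bar> \<noteq> 1" using RSYT_swap_iff[OF T k] T' sw by (simp add: d_def)
    have "nform k (\<lambda>S. if S = T then 1 else 0) T' = seminormal_coef d"
      using sw ne[OF T] unfolding nform_def s by (simp add: d_def)
    moreover have "adj_mat tau k T T' = seminormal_coef d"
      using ca ns sw ne[OF T] by (auto simp: adj_mat_def Let_def seminormal_coef_def d_def)
    ultimately show ?thesis by simp
  next
    case ot
    moreover have "swap_entries k T' \<noteq> T" using ot by auto
    ultimately show ?thesis by (simp add: adj_mat_def Let_def nform_def)
  qed
qed

lemma adj_op_sum: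
  "adj_op k (\<lambda>S. \<Sum>i\<in>I. c i * v i S) = (\<lambda>S. \<Sum>i\<in>I. c i * adj_op k (v i) S)"
proof
  fix S
  show "adj_op k (\<lambda>S. \<Sum>i\<in>I. c i * v i S) S = (\<Sum>i\<in>I. c i * adj_op k (v i) S)"
    by (simp add: adj_op_def nform_def distrib_left sum.distrib sum_divide_distrib sum_distrib_left
        mult.left_commute)
qed

text \<open>Extending the operators \<open>adj_op\<close> along \<open>coxeter_extend\<close> gives
  linear operators on all functions, whose matrices on the standard tableaux form the
  representation. Two candidates agree on generators and hence, by induction along words,
  everywhere.\<close>

lemma young_rep_ex1:
  assumes N: "2 \<le> N"
  shows "\<exists>!rho. young_rep N tau rho"
proof -
  obtain R where R0: "R id = id"
    and Rk: "\<And>k w. 1 \<le> k \<Longrightarrow> k < N \<Longrightarrow> w permutes {1..N} \<Longrightarrow> R (adj k \<circ> w) = adj_op k \<circ> R w"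
    using coxeter_extend[OF coxeter_adj_op] by blast
  define e where "e T = (\<lambda>S. if S = T then 1 else 0 :: real)" for T :: tab
  define rho where "rho w T T' = (if w permutes {1..N} \<and> T \<in> Y \<and> T' \<in> Y then R w (e T) T' else 0)"
    for w T T'
  have comp: "R (u \<circ> v) = R u \<circ> R v" if "u permutes {1..N}" "v permutes {1..N}" for u v
    using that(1)
  proof (rule permutes_adj_induct)
    show "R (id \<circ> v) = R id \<circ> R v" by (simp only: id_o R0)
  next
    fix k w assume adj: "1 \<le> k" "k < N" "w permutes {1..N}" and IH: "R (w \<circ> v) = R w \<circ> R v"
    have "R (adj k \<circ> w \<circ> v) = R (adj k \<circ> (w \<circ> v))" by (simp only: o_assoc)
    also have "\<dots> = adj_op k \<circ> R (w \<circ> v)"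
      by (rule Rk[OF adj(1,2) permutes_compose[OF that(2) adj(3)]])
    also have "\<dots> = adj_op k \<circ> (R w \<circ> R v)" by (simp only: IH)
    also have "\<dots> = R (adj k \<circ> w) \<circ> R v" by (simp only: Rk[OF adj(1,2,3)] o_assoc)
    finally show "R (adj k \<circ> w \<circ> v) = R (adj k \<circ> w) \<circ> R v" .
  qed
  have Rsum: "R w (\<lambda>S. \<Sum>i\<in>I. c i * v i S) = (\<lambda>S. \<Sum>i\<in>I. c i * R w (v i) S)"
    if "w permutes {1..N}" "finite I" for w and I :: "tab set" and c v
    using that(1)
  proof (rule permutes_adj_induct)
    show "R id (\<lambda>S. \<Sum>i\<in>I. c i * v i S) = (\<lambda>S. \<Sum>i\<in>I. c i * R id (v i) S)"
      by (simp add: R0)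
  next
    fix k w assume adj: "1 \<le> k" "k < N" "w permutes {1..N}"
      and IH: "R w (\<lambda>S. \<Sum>i\<in>I. c i * v i S) = (\<lambda>S. \<Sum>i\<in>I. c i * R w (v i) S)"
    show "R (adj k \<circ> w) (\<lambda>S. \<Sum>i\<in>I. c i * v i S) = (\<lambda>S. \<Sum>i\<in>I. c i * R (adj k \<circ> w) (v i) S)"
      by (simp only: Rk[OF adj] comp_apply IH adj_op_sum)
  qed
  have out: "R w v T = v T" if "w permutes {1..N}" "T \<notin> Y" for w v T
    using that(1)
  proof (rule permutes_adj_induct)
    show "R id v T = v T" by (simp add: R0)
  next
    fix k w assume adj: "1 \<le> k" "k < N" "w permutes {1..N}" and IH: "R w v T = v T"
    show "R (adj k \<circ> w) v T = v T" using that(2) IH by (simp add: Rk[OF adj] adj_op_def)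
  qed
  have exp: "v = (\<lambda>S. \<Sum>T\<in>Y. v T * e T S)" if "\<And>T. T \<notin> Y \<Longrightarrow> v T = 0" for v
  proof
    fix S
    have "(\<Sum>T\<in>Y. v T * e T S) = (\<Sum>T\<in>Y. if T = S then v T else 0)"
      by (intro sum.cong) (auto simp: e_def)
    then show "v S = (\<Sum>T\<in>Y. v T * e T S)" using that finite_RSYT by (cases "S \<in> Y") auto
  qed
  have "young_rep N tau rho"
    unfolding young_rep_def
  proof (intro conjI allI impI ballI)
    fix w T T' assume "\<not> (w permutes {1..N} \<and> T \<in> Y \<and> T' \<in> Y)"
    then show "rho w T T' = 0" by (auto simp: rho_def)
  next
    fix u v T T'' assume u: "u permutes {1..N}" and v: "v permutes {1..N}" and T: "T \<in> Y" "T'' \<in> Y"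
    have z: "R v (e T) S = 0" if "S \<notin> Y" for S
      using out[OF v that] T that by (auto simp: e_def)
    have "R (u \<circ> v) (e T) T'' = R u (R v (e T)) T''" by (simp add: comp[OF u v])
    also have "\<dots> = R u (\<lambda>S. \<Sum>T'\<in>Y. R v (e T) T' * e T' S) T''"
      using exp[of "R v (e T)"] z by simp
    also have "\<dots> = (\<Sum>T'\<in>Y. R v (e T) T' * R u (e T') T'')" by (simp add: Rsum[OF u finite_RSYT])
    finally show "rho (u \<circ> v) T T'' = (\<Sum>T'\<in>Y. rho v T T' * rho u T' T'')"
      using u v T permutes_compose[OF v u] by (simp add: rho_def)
  next
    fix k T T' assume k: "1 \<le> k \<and> k < N" and T: "T \<in> Y" "T' \<in> Y"
    have "R (adj k) = adj_op k" using Rk[of k id] k permutes_id by (simp add: R0)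
    then show "rho (transpose k (k + 1)) T T' = adj_mat tau k T T'"
      using k T adj_mat_eq[OF T] adj_permutes[of k N] by (simp add: rho_def e_def adj_op_def)
  qed
  moreover have "r = r'" if r: "young_rep N tau r" "young_rep N tau r'" for r r'
  proof -
    have mult: "s (u \<circ> v) T T'' = (\<Sum>T'\<in>Y. s v T T' * s u T' T'')"
      if "young_rep N tau s" "u permutes {1..N}" "v permutes {1..N}" "T \<in> Y" "T'' \<in> Y" for s u v T T''
      using that unfolding young_rep_def by blast
    have gen: "s (adj k) T T' = adj_mat tau k T T'"
      if "young_rep N tau s" "1 \<le> k" "k < N" "T \<in> Y" "T' \<in> Y" for s k T T'
      using that unfolding young_rep_def by simp
    have "\<forall>T\<in>Y. \<forall>T'\<in>Y. r w T T' = r' w T T'" if "w permutes {1..N}" for w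
      using that
    proof (rule permutes_adj_induct)
      \<comment> \<open>The conditions of \<open>young_rep\<close> do not mention the identity; its
        matrix is reached as the square of a generator, which is where at least two letters are
        required.\<close>
      have "id = adj 1 \<circ> adj 1" by (simp add: fun_eq_iff)
      then show "\<forall>T\<in>Y. \<forall>T'\<in>Y. r id T T' = r' id T T'"
        using mult[OF r(1), of "adj 1" "adj 1"] mult[OF r(2), of "adj 1" "adj 1"]
          gen[OF r(1), of 1] gen[OF r(2), of 1] N adj_permutes[of 1 N] by simp
    next
      fix k w assume adj: "1 \<le> k" "k < N" "w permutes {1..N}"
        and "\<forall>T\<in>Y. \<forall>T'\<in>Y. r w T T' = r' w T T'"
      then show "\<forall>T\<in>Y. \<forall>T'\<in>Y. r (adj k \<circ> w) T T' = r' (adj k \<circ> w) T T'"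
        using mult[OF r(1) adj_permutes[OF adj(1,2)] adj(3)]
          mult[OF r(2) adj_permutes[OF adj(1,2)] adj(3)] gen[OF r(1) adj(1,2)] gen[OF r(2) adj(1,2)]
        by simp
    qed
    moreover have "s w T T' = 0"
      if "young_rep N tau s" "\<not> (w permutes {1..N} \<and> T \<in> Y \<and> T' \<in> Y)" for s w T T'
      using that unfolding young_rep_def by blast
    note this[OF r(1)] this[OF r(2)]
    ultimately show "r = r'" by (intro ext) metis
  qed
  ultimately show ?thesis by blast
qed

end

section \<open>The action on vectors\<close>

type_synonym vec = "tab \<Rightarrow> complex"

locale young_module = young_diagram +
  assumes N2: "2 \<le> N"
begin

definition vact :: "(nat \<Rightarrow> nat) \<Rightarrow> vec \<Rightarrow> vec" where
  "vact w v = (\<lambda>T'. \<Sum>T\<in>Y. v T * complex_of_real (taurep N tau w T T'))"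

definition V :: "vec set" where
  "V = {v. \<forall>T. T \<notin> Y \<longrightarrow> v T = 0}"

definition unit :: "tab \<Rightarrow> vec" where
  "unit T = (\<lambda>S. if S = T then 1 else 0)"

lemma young_rep_taurep: "young_rep N tau (taurep N tau)"
  unfolding taurep_def by (rule theI'[OF young_rep_ex1[OF N2]])

lemma taurep_outside:
  "\<not> (w permutes {1..N} \<and> T \<in> Y \<and> T' \<in> Y) \<Longrightarrow> taurep N tau w T T' = 0"
  using young_rep_taurep unfolding young_rep_def by blast

lemma taurep_comp:
  assumes "u permutes {1..N}" "v permutes {1..N}" "T \<in> Y" "T'' \<in> Y"
  shows "taurep N tau (u \<circ> v) T T'' = (\<Sum>T'\<in>Y. taurep N tau v T T' * taurep N tau u T' T'')"
  using young_rep_taurep assms unfolding young_rep_def by blast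

lemma taurep_adj:
  assumes "1 \<le> k" "k < N" "T \<in> Y" "T' \<in> Y"
  shows "taurep N tau (adj k) T T' = nform k (\<lambda>S. if S = T then 1 else 0) T'"
  using young_rep_taurep assms adj_mat_eq[OF assms(3,4,1,2)] unfolding young_rep_def by simp

lemma vact_in_V: "vact w v \<in> V"
  by (auto simp: vact_def V_def taurep_outside)

lemma unit_in_V: "T \<in> Y \<Longrightarrow> unit T \<in> V"
  by (auto simp: unit_def V_def)

lemma vact_comp:
  assumes "u permutes {1..N}" "v permutes {1..N}"
  shows "vact (u \<circ> v) x = vact u (vact v x)"
proof
  fix T'' show "vact (u \<circ> v) x T'' = vact u (vact v x) T''"
  proof (cases "T'' \<in> Y")
    case True
    have "vact (u \<circ> v) x T'' =
        (\<Sum>T\<in>Y. \<Sum>T'\<in>Y. x T * (complex_of_real (taurep N tau v T T') * complex_of_real (taurep N tau u T' T'')))"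
      using assms True by (simp add: vact_def taurep_comp sum_distrib_left)
    also have "\<dots> = (\<Sum>T'\<in>Y. \<Sum>T\<in>Y. x T * (complex_of_real (taurep N tau v T T') * complex_of_real (taurep N tau u T' T'')))"
      by (rule sum.swap)
    also have "\<dots> = vact u (vact v x) T''"
      by (simp add: vact_def sum_distrib_right mult.assoc)
    finally show ?thesis .
  next
    case False
    then show ?thesis using vact_in_V by (simp add: V_def)
  qed
qed

lemma vact_adj:
  assumes k: "1 \<le> k" "k < N" and T: "T \<in> Y" and v: "v \<in> V"
  shows "vact (adj k) v T = v T / of_int (content tau T k - content tau T (Suc k))
    + complex_of_real (seminormal_coef (content tau T (Suc k) - content tau T k)) * v (swap_entries k T)"
proof -
  define b where "b = (1::real) / of_int (content tau T k - content tau T (Suc k))"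
  define c where "c = seminormal_coef (content tau T (Suc k) - content tau T k)"
  have "vact (adj k) v T = (\<Sum>S\<in>Y. v S * complex_of_real ((if S = T then b else 0)
      + (if S = swap_entries k T then c else 0)))"
    unfolding vact_def using k T
    by (intro sum.cong refl) (auto simp: taurep_adj nform_def b_def c_def)
  also have "\<dots> = (\<Sum>S\<in>Y. (if S = T then v S * complex_of_real b else 0)
      + (if S = swap_entries k T then v S * complex_of_real c else 0))"
    by (intro sum.cong refl) (auto simp: algebra_simps)
  also have "\<dots> = v T * complex_of_real b + v (swap_entries k T) * complex_of_real c"
    using T v finite_RSYT by (simp add: sum.distrib V_def)
  finally show ?thesis by (simp add: b_def c_def)
qed

text \<open>Multiplicativity alone would make the identity act as some idempotent. Writing it as s_1
  s_1 and using that Young's 2 by 2 block squares to the identity shows that it acts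
  trivially.\<close>

lemma vact_id:
  assumes v: "v \<in> V"
  shows "vact id v = v"
proof
  fix T
  have a: "adj 1 permutes {1..N}" using N2 by (intro adj_permutes) auto
  have "id = adj 1 \<circ> adj 1" by (simp add: fun_eq_iff)
  then have e: "vact id v = vact (adj 1) (vact (adj 1) v)" using vact_comp[OF a a] by metis
  show "vact id v T = v T"
  proof (cases "T \<in> Y")
    case True
    define d where "d = content tau T 1 - content tau T (Suc 1)"
    define c where "c = seminormal_coef (- d)"
    define c' where "c' = seminormal_coef d"
    have d0: "d \<noteq> 0" using content_adj(1)[OF True, of 1] N2 by (simp add: d_def)
    have cc: "c' * c = 1 - (1 / real_of_int d)\<^sup>2"
      using seminormal_coef_mult[OF d0] by (simp add: c_def c'_def)
    have s: "content tau (swap_entries 1 T) 1 = content tau T (Suc 1)"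
      "content tau (swap_entries 1 T) (Suc 1) = content tau T 1"
      using content_swap[OF filling_RSYT[OF True], of 1] N2 by auto
    have vT: "vact (adj 1) v T = v T / of_int d + of_real c * v (swap_entries 1 T)"
      using vact_adj[OF _ _ True v, of 1] N2 by (simp add: d_def c_def)
    have sw: "of_real c * vact (adj 1) v (swap_entries 1 T)
       = of_real c * (v (swap_entries 1 T) / of_int (- d) + of_real c' * v T)"
    proof (cases "swap_entries 1 T \<in> Y")
      case True
      show ?thesis using vact_adj[OF _ _ True v, of 1] N2
        unfolding s by (simp add: d_def c'_def)
    next
      case False
      then have "\<bar>d\<bar> = 1" using RSYT_swap[OF True, of 1] N2 by (auto simp: d_def)
      then have "c = 0" by (simp add: c_def seminormal_coef_unit)
      then show ?thesis by simp
    qed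
    have "vact id v T = vact (adj 1) v T / of_int d + of_real c * vact (adj 1) v (swap_entries 1 T)"
      unfolding e using vact_adj[OF _ _ True vact_in_V, of 1] N2 by (simp add: d_def c_def)
    also have "\<dots> = v T / (of_int d)\<^sup>2 + of_real (c' * c) * v T"
      unfolding vT sw using d0 by (simp add: field_simps power2_eq_square)
    also have "\<dots> = v T" unfolding cc by (simp add: field_simps)
    finally show ?thesis .
  next
    case False
    then show ?thesis using v vact_in_V by (simp add: V_def)
  qed
qed

lemma vact_inv:
  assumes "w permutes {1..N}" "v \<in> V"
  shows "vact w (vact (inv w) v) = v" "vact (inv w) (vact w v) = v"
  using vact_comp[OF assms(1) permutes_inv[OF assms(1)]] vact_comp[OF permutes_inv[OF assms(1)] assms(1)]
    permutes_inv_o[OF assms(1)] vact_id[OF assms(2)] by metis+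

lemma vact_add: "vact w (\<lambda>T. u T + v T) = (\<lambda>T. vact w u T + vact w v T)"
  by (simp add: vact_def algebra_simps sum.distrib)

lemma vact_scale: "vact w (\<lambda>T. c * v T) = (\<lambda>T. c * vact w v T)"
  by (simp add: vact_def sum_distrib_left mult.assoc)

lemma vact_zero: "vact w (\<lambda>T. 0) = (\<lambda>T. 0)"
  by (simp add: vact_def)

lemma vact_sum: "vact w (\<lambda>T. \<Sum>i\<in>I. f i T) = (\<lambda>T. \<Sum>i\<in>I. vact w (f i) T)"
  by (cases "finite I") (auto simp: vact_def sum_distrib_right fun_eq_iff intro: sum.swap)

lemma vact_unit: "T \<in> Y \<Longrightarrow> vact w (unit T) T' = complex_of_real (taurep N tau w T T')"
proof -
  assume "T \<in> Y"
  have "vact w (unit T) T' = (\<Sum>S\<in>Y. if S = T then complex_of_real (taurep N tau w S T') else 0)"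
    unfolding vact_def unit_def by (intro sum.cong) auto
  then show ?thesis using \<open>T \<in> Y\<close> finite_RSYT by simp
qed

lemma vact_adj_invol:
  "1 \<le> k \<Longrightarrow> k < N \<Longrightarrow> v \<in> V \<Longrightarrow> vact (adj k) (vact (adj k) v) = v"
  using vact_inv(1)[OF adj_permutes, of k v] by simp

text \<open>Descending induction from k = N, where the sum is empty and the content is 0. The
  element J_k equals s_k J_(k+1) s_k + s_k, since the transposition (k, j) is the conjugate of (k+1,
  j) by s_k. The sums run upwards because the tableaux are reverse standard.\<close>

lemma jucys_murphy:
  assumes "v \<in> V" "T \<in> Y" "k \<in> {1..N}"
  shows "(\<Sum>j\<in>{k<..N}. vact (transpose k j) v T) = of_int (content tau T k) * v T"
proof -
  have "\<forall>v\<in>V. \<forall>T\<in>Y. (\<Sum>j\<in>{k<..N}. vact (transpose k j) v T) = of_int (content tau T k) * v T"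
    if "k \<le> N" "1 \<le> k" for k
    using that
  proof (induction k rule: inc_induct)
    case base
    then show ?case using content_top by simp
  next
    case (step k)
    show ?case
    proof (intro ballI)
      fix v T assume v: "v \<in> V" and T: "T \<in> Y"
      have k: "1 \<le> k" "k < N" using step by auto
      define u where "u = vact (adj k) v"
      have u: "u \<in> V" unfolding u_def by (rule vact_in_V)
      have uv: "vact (adj k) u = v" unfolding u_def using vact_adj_invol[OF k v] .
      define x where "x = (\<lambda>S. \<Sum>j\<in>{Suc k<..N}. vact (transpose (Suc k) j) u S)"
      have xV: "x \<in> V" using vact_in_V by (auto simp: x_def V_def intro!: sum.neutral)
      have x: "x S = of_int (content tau S (Suc k)) * u S" if "S \<in> Y" for S
        unfolding x_def using step u that by auto
      have "vact (transpose k j) v = vact (adj k) (vact (transpose (Suc k) j) u)" if "j \<in> {Suc k<..N}" for j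
      proof -
        have "transpose k j = adj k \<circ> (transpose (Suc k) j \<circ> adj k)"
          using that by (auto simp: fun_eq_iff transpose_def)
        moreover have p: "transpose (Suc k) j permutes {1..N}" "adj k permutes {1..N}"
          using that k by (auto intro!: permutes_swap_id)
        ultimately show ?thesis unfolding u_def
          by (metis vact_comp[OF p(2) permutes_compose[OF p(2,1)]] vact_comp[OF p])
      qed
      then have "(\<Sum>j\<in>{Suc k<..N}. vact (transpose k j) v T) = vact (adj k) x T"
        unfolding x_def vact_sum by simp
      moreover have "{k<..N} = insert (Suc k) {Suc k<..N}" using k by auto
      ultimately have S: "(\<Sum>j\<in>{k<..N}. vact (transpose k j) v T) = u T + vact (adj k) x T"
        by (simp add: u_def)
      define d where "d = content tau T k - content tau T (Suc k)"
      define c where "c = complex_of_real (seminormal_coef (content tau T (Suc k) - content tau T k))"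
      have d0: "d \<noteq> 0" using content_adj(1)[OF T k] by (simp add: d_def)
      have sw: "c * x (swap_entries k T) = c * (of_int (content tau T k) * u (swap_entries k T))"
      proof (cases "swap_entries k T \<in> Y")
        case True
        then show ?thesis using x[OF True] content_swap[OF filling_RSYT[OF T] k, of "Suc k"] k by simp
      next
        case False
        then show ?thesis using xV u by (simp add: V_def)
      qed
      have vT: "v T = u T / of_int d + c * u (swap_entries k T)"
        using vact_adj[OF k T u] unfolding uv by (simp add: d_def c_def)
      have "vact (adj k) x T = x T / of_int d + c * x (swap_entries k T)"
        using vact_adj[OF k T xV] by (simp add: d_def c_def)
      also have "\<dots> = of_int (content tau T (Suc k)) * (u T / of_int d)
          + of_int (content tau T k) * (c * u (swap_entries k T))"
        unfolding sw x[OF T] by simp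
      also have "content tau T (Suc k) = content tau T k - d" by (simp add: d_def)
      also have "of_int (content tau T k - d) * (u T / of_int d)
          + of_int (content tau T k) * (c * u (swap_entries k T)) = of_int (content tau T k) * v T - u T"
        unfolding vT using d0 by (simp add: field_simps)
      finally show "(\<Sum>j\<in>{k<..N}. vact (transpose k j) v T) = of_int (content tau T k) * v T"
        unfolding S by simp
    qed
  qed
  then show ?thesis using assms by auto
qed

end

section \<open>Operators on vector-valued polynomials\<close>

lemma psupp_finite_sum:
  assumes "finite A" "psupp p \<subseteq> A"
  shows "divdiff i j p b T = (\<Sum>a\<in>A. ddcoef i j a b * p a T)"
  unfolding divdiff_def
  by (rule sum.mono_neutral_left[OF assms]) (auto simp: psupp_def)

text \<open>Replaces the index of the geometric sum by inequalities between exponents, a form that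
  linear arithmetic can decide.\<close>

lemma ddcoef_eq:
  assumes "i \<noteq> j"
  shows "ddcoef i j a b =
    (if (\<forall>k. k \<noteq> i \<and> k \<noteq> j \<longrightarrow> b k = a k) \<and> b i + b j + 1 = a i + a j
     then (if a j \<le> b j \<and> b j < a i then 1 else if a i \<le> b i \<and> b i < a j then - 1 else 0) else 0)"
proof -
  have 1: "(\<exists>k < a i - a j. b = a(i := a i - 1 - k, j := a j + k)) \<longleftrightarrow>
     (\<forall>k. k \<noteq> i \<and> k \<noteq> j \<longrightarrow> b k = a k) \<and> b i + b j + 1 = a i + a j \<and> a j \<le> b j \<and> b j < a i"
    (is "?L \<longleftrightarrow> ?R")
  proof
    assume ?R
    then show ?L using assms by (intro exI[of _ "b j - a j"]) (auto simp: fun_eq_iff)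
  qed (use assms in auto)
  have 2: "(\<exists>k < a j - a i. b = a(j := a j - 1 - k, i := a i + k)) \<longleftrightarrow>
     (\<forall>k. k \<noteq> i \<and> k \<noteq> j \<longrightarrow> b k = a k) \<and> b i + b j + 1 = a i + a j \<and> a i \<le> b i \<and> b i < a j"
    (is "?L \<longleftrightarrow> ?R")
  proof
    assume ?R
    then show ?L using assms by (intro exI[of _ "b i - a i"]) (auto simp: fun_eq_iff)
  qed (use assms in auto)
  show ?thesis unfolding ddcoef_def 1 2 by auto
qed

lemma xmul_add: "xmul i (p + q) = xmul i p + xmul i q"
  and xmul_diff: "xmul i (p - q) = xmul i p - xmul i q"
  and xmul_pscale: "xmul i (pscale c p) = pscale c (xmul i p)"
  and xmul_commute: "xmul i (xmul j p) = xmul j (xmul i p)"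
  by (auto simp: xmul_def pscale_def fun_eq_iff fun_upd_twist)

lemma psupp_add: "psupp (p + q) \<subseteq> psupp p \<union> psupp q"
  and psupp_diff: "psupp (p - q) \<subseteq> psupp p \<union> psupp q"
  and psupp_pscale: "psupp (pscale c p) \<subseteq> psupp p"
  by (auto simp: psupp_def pscale_def)

lemma finite_psupp_xmul:
  assumes "finite (psupp p)" shows "finite (psupp (xmul i p))"
proof (rule finite_subset)
  show "psupp (xmul i p) \<subseteq> (\<lambda>b. b(i := b i + 1)) ` psupp p"
  proof
    fix b assume "b \<in> psupp (xmul i p)"
    then obtain T where "1 \<le> b i" "p (b(i := b i - 1)) T \<noteq> 0"
      by (auto simp: psupp_def xmul_def split: if_splits)
    then show "b \<in> (\<lambda>b. b(i := b i + 1)) ` psupp p"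
      by (intro image_eqI[of _ _ "b(i := b i - 1)"]) (auto simp: psupp_def)
  qed
qed (use assms in simp)

lemma finite_psupp_divdiff:
  assumes "finite (psupp p)" shows "finite (psupp (divdiff i j p))"
proof (rule finite_subset)
  show "psupp (divdiff i j p) \<subseteq> (\<Union>a\<in>psupp p. (\<lambda>k. a(i := a i - 1 - k, j := a j + k)) ` {..a i} \<union>
     (\<lambda>k. a(j := a j - 1 - k, i := a i + k)) ` {..a j})"
  proof
    fix b assume "b \<in> psupp (divdiff i j p)"
    then obtain T where "divdiff i j p b T \<noteq> 0" by (auto simp: psupp_def)
    then obtain a where a: "a \<in> psupp p" "ddcoef i j a b \<noteq> 0"
      unfolding divdiff_def by (metis (mono_tags, lifting) mult_zero_left sum.neutral)
    from a(2) have "b \<in> (\<lambda>k. a(i := a i - 1 - k, j := a j + k)) ` {..a i} \<union>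
     (\<lambda>k. a(j := a j - 1 - k, i := a i + k)) ` {..a j}"
      by (fastforce simp: ddcoef_def split: if_splits)
    with a(1) show "b \<in> (\<Union>a\<in>psupp p. (\<lambda>k. a(i := a i - 1 - k, j := a j + k)) ` {..a i} \<union>
     (\<lambda>k. a(j := a j - 1 - k, i := a i + k)) ` {..a j})" by blast
  qed
qed (use assms in auto)

definition pswap :: "nat \<Rightarrow> nat \<Rightarrow> vpoly \<Rightarrow> vpoly" where
  "pswap i j p = (\<lambda>b. p (b \<circ> transpose i j))"

lemma finite_psupp_comp:
  assumes "bij w" "finite (psupp p)" shows "finite (psupp (\<lambda>b. p (b \<circ> w)))"
proof (rule finite_subset)
  show "psupp (\<lambda>b. p (b \<circ> w)) \<subseteq> (\<lambda>a. a \<circ> inv w) ` psupp p"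
  proof
    fix b assume "b \<in> psupp (\<lambda>b. p (b \<circ> w))"
    then have "b \<circ> w \<in> psupp p" by (auto simp: psupp_def)
    moreover have "b = b \<circ> w \<circ> inv w" using assms(1)
      by (metis bij_is_surj comp_id o_assoc surj_iff)
    ultimately show "b \<in> (\<lambda>a. a \<circ> inv w) ` psupp p" by blast
  qed
qed (use assms in simp)

lemma finite_psupp_pswap: "finite (psupp p) \<Longrightarrow> finite (psupp (pswap i j p))"
  unfolding pswap_def by (rule finite_psupp_comp) auto

text \<open>Coefficientwise form of (x_i - x_j) times the geometric sum: consecutive terms cancel
  and only the two ends survive, namely x^a and the monomial with i and j exchanged.\<close>

lemma ddcoef_telescope:
  assumes "i \<noteq> j"
  shows "(if 1 \<le> b i then ddcoef i j a (b(i := b i - 1)) else 0)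
      - (if 1 \<le> b j then ddcoef i j a (b(j := b j - 1)) else 0)
    = (if a = b then 1 else 0) - (if a = b \<circ> transpose i j then 1 else 0)"
proof (cases "(\<forall>k. k \<noteq> i \<and> k \<noteq> j \<longrightarrow> b k = a k) \<and> b i + b j = a i + a j")
  case True
  have ab: "a = b \<longleftrightarrow> a j = b j"
  proof
    assume j: "a j = b j"
    show "a = b"
    proof
      fix k show "a k = b k" using True j by (cases "k = i"; cases "k = j") auto
    qed
  qed simp
  have ab': "a = b \<circ> transpose i j \<longleftrightarrow> a j = b i"
  proof
    assume j: "a j = b i"
    show "a = b \<circ> transpose i j"
    proof
      fix k show "a k = (b \<circ> transpose i j) k"
        using True j assms by (cases "k = i"; cases "k = j") auto
    qed
  qed (use assms in simp)
  have i: "(if 1 \<le> b i then ddcoef i j a (b(i := b i - 1)) else 0) =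
     (if 1 \<le> b i then if a j \<le> b j \<and> b j < a i then 1
        else if a i \<le> b i - 1 \<and> b i - 1 < a j then - 1 else 0 else 0)"
    unfolding ddcoef_eq[OF assms] using True assms by auto
  have j: "(if 1 \<le> b j then ddcoef i j a (b(j := b j - 1)) else 0) =
     (if 1 \<le> b j then if a j \<le> b j - 1 \<and> b j - 1 < a i then 1
        else if a i \<le> b i \<and> b i < a j then - 1 else 0 else 0)"
    unfolding ddcoef_eq[OF assms] using True assms by auto
  have s: "b i + b j = a i + a j" using True by simp
  show ?thesis unfolding ab ab' i j using s
    by (cases "a j" "b j" rule: linorder_cases; cases "a j" "b i" rule: linorder_cases) auto
next
  case False
  have "a \<noteq> b" using False by auto
  moreover have "a \<noteq> b \<circ> transpose i j"
  proof
    assume "a = b \<circ> transpose i j"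
    then have "\<And>k. a k = b (transpose i j k)" by simp
    then show False using False by (auto simp: add.commute)
  qed
  moreover have "ddcoef i j a (b(i := b i - 1)) = 0" if "1 \<le> b i"
    using False that assms by (auto simp: ddcoef_eq)
  moreover have "ddcoef i j a (b(j := b j - 1)) = 0" if "1 \<le> b j"
    using False that assms by (auto simp: ddcoef_eq)
  ultimately show ?thesis by simp
qed

lemma divdiff_mult:
  assumes "i \<noteq> j" "finite (psupp p)"
  shows "xmul i (divdiff i j p) - xmul j (divdiff i j p) = p - pswap i j p"
proof (intro ext)
  fix b T
  let ?A = "psupp p \<union> {b, b \<circ> transpose i j}"
  have f: "finite ?A" using assms by simp
  note d = psupp_finite_sum[OF f Un_upper1]
  have "(xmul i (divdiff i j p) - xmul j (divdiff i j p)) b T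
    = (\<Sum>a\<in>?A. ((if 1 \<le> b i then ddcoef i j a (b(i := b i - 1)) else 0)
        - (if 1 \<le> b j then ddcoef i j a (b(j := b j - 1)) else 0)) * p a T)"
    by (simp add: xmul_def d left_diff_distrib sum_subtractf)
  also have "\<dots> = (\<Sum>a\<in>?A. (if a = b then p a T else 0) - (if a = b \<circ> transpose i j then p a T else 0))"
    unfolding ddcoef_telescope[OF assms(1)] by (intro sum.cong) auto
  also have "\<dots> = (p - pswap i j p) b T" using f by (simp add: sum_subtractf pswap_def)
  finally show "(xmul i (divdiff i j p) - xmul j (divdiff i j p)) b T = (p - pswap i j p) b T" .
qed

text \<open>Multiplication by x_i - x_j is injective: a monomial with the highest exponent at i,
  multiplied by x_i, cannot be matched by anything multiplied by x_j.\<close>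

lemma xmul_diff_cancel:
  assumes ij: "i \<noteq> j" and fin: "finite (psupp p)" and eq: "xmul i p = xmul j p"
  shows "p = 0"
proof (rule ccontr)
  assume "p \<noteq> 0"
  then have ne: "psupp p \<noteq> {}" by (auto simp: psupp_def fun_eq_iff)
  have f: "finite ((\<lambda>c. c i) ` psupp p)" using fin by simp
  from Max_in[OF f] ne obtain b where b1: "b \<in> psupp p" "b i = Max ((\<lambda>c. c i) ` psupp p)"
    by fastforce
  then have b: "b \<in> psupp p" "\<And>c. c \<in> psupp p \<Longrightarrow> c i \<le> b i"
    using Max_ge[OF f] by auto
  from b(1) obtain T where T: "p b T \<noteq> 0" by (auto simp: psupp_def)
  have "xmul i p (b(i := b i + 1)) T = p b T" by (simp add: xmul_def)
  with T eq have "xmul j p (b(i := b i + 1)) T \<noteq> 0" by simp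
  then have "b(i := b i + 1, j := b j - 1) \<in> psupp p"
    using ij by (auto simp: xmul_def psupp_def split: if_splits)
  from b(2)[OF this] ij show False by simp
qed

text \<open>A divided difference is determined by its product with x_i - x_j. The Leibniz rules
  below then become identities between products, with no further work on coefficients.\<close>

lemma divdiff_unique:
  assumes "i \<noteq> j" "finite (psupp p)" "finite (psupp q)"
    and "xmul i q - xmul j q = p - pswap i j p"
  shows "divdiff i j p = q"
proof -
  have fin: "finite (psupp (divdiff i j p - q))"
    using assms finite_psupp_divdiff[OF assms(2)] by (auto intro: finite_subset[OF psupp_diff])
  have "xmul i (divdiff i j p) - xmul j (divdiff i j p) = xmul i q - xmul j q"
    using divdiff_mult[OF assms(1,2)] assms(4) by simp
  then have "xmul i (divdiff i j p - q) = xmul j (divdiff i j p - q)"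
    by (simp add: xmul_diff algebra_simps)
  from xmul_diff_cancel[OF assms(1) fin this] show ?thesis by simp
qed

lemma pswap_xmul: "pswap i j (xmul k p) = xmul (transpose i j k) (pswap i j p)"
proof (intro ext)
  fix b :: mono and T
  have "(b \<circ> transpose i j)(k := x) = b(transpose i j k := x) \<circ> transpose i j" for x
    by (auto simp: fun_eq_iff transpose_def)
  then show "pswap i j (xmul k p) b T = xmul (transpose i j k) (pswap i j p) b T"
    by (simp add: pswap_def xmul_def)
qed

lemma divdiff_xmul_other:
  assumes "i \<noteq> j" "k \<noteq> i" "k \<noteq> j" "finite (psupp p)"
  shows "divdiff i j (xmul k p) = xmul k (divdiff i j p)"
proof (rule divdiff_unique)
  show "xmul i (xmul k (divdiff i j p)) - xmul j (xmul k (divdiff i j p)) = xmul k p - pswap i j (xmul k p)"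
    using divdiff_mult[OF assms(1,4)] assms
    by (simp add: pswap_xmul xmul_commute[of _ k] xmul_diff[symmetric])
qed (use assms in \<open>auto intro: finite_psupp_xmul finite_psupp_divdiff\<close>)

lemma divdiff_xmul_left:
  assumes "i \<noteq> j" "finite (psupp p)"
  shows "divdiff i j (xmul i p) = xmul i (divdiff i j p) + pswap i j p"
proof (rule divdiff_unique)
  have "xmul i (xmul i (divdiff i j p)) - xmul j (xmul i (divdiff i j p)) = xmul i (p - pswap i j p)"
    unfolding divdiff_mult[OF assms, symmetric] by (simp add: xmul_diff xmul_commute[of i j])
  then show "xmul i (xmul i (divdiff i j p) + pswap i j p) - xmul j (xmul i (divdiff i j p) + pswap i j p)
      = xmul i p - pswap i j (xmul i p)"
    by (simp add: pswap_xmul xmul_diff xmul_add algebra_simps)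
qed (use assms in \<open>auto intro!: finite_psupp_xmul finite_psupp_divdiff finite_psupp_pswap
      finite_subset[OF psupp_add]\<close>)

lemma divdiff_xmul_right:
  assumes "i \<noteq> j" "finite (psupp p)"
  shows "divdiff i j (xmul j p) = xmul j (divdiff i j p) - pswap i j p"
proof (rule divdiff_unique)
  have "xmul i (xmul j (divdiff i j p)) - xmul j (xmul j (divdiff i j p)) = xmul j (p - pswap i j p)"
    unfolding divdiff_mult[OF assms, symmetric] by (simp add: xmul_diff xmul_commute[of i j])
  then show "xmul i (xmul j (divdiff i j p) - pswap i j p) - xmul j (xmul j (divdiff i j p) - pswap i j p)
      = xmul j p - pswap i j (xmul j p)"
    by (simp add: pswap_xmul xmul_diff xmul_add algebra_simps)
qed (use assms in \<open>auto intro!: finite_psupp_xmul finite_psupp_divdiff finite_psupp_pswap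
      finite_subset[OF psupp_diff]\<close>)

lemma divdiff_comp:
  assumes "bij w" and that: "i \<noteq> j"
  shows "divdiff (w i) (w j) (\<lambda>b. p (b \<circ> w)) b T = divdiff i j p (b \<circ> w) T"
proof -
  have wi: "inv w (w x) = x" "w (inv w x) = x" for x
    using assms(1) by (auto simp: bij_is_inj bij_is_surj surj_f_inv_f)
  have c: "a \<circ> inv w \<circ> w = a" "a \<circ> w \<circ> inv w = a" for a :: mono
    by (auto simp: fun_eq_iff wi)
  have dd: "ddcoef (w i) (w j) (a \<circ> inv w) b = ddcoef i j a (b \<circ> w)" for a
  proof -
    have "w i \<noteq> w j" using that wi by metis
    moreover have "(\<forall>k. k \<noteq> w i \<and> k \<noteq> w j \<longrightarrow> b k = (a \<circ> inv w) k) \<longleftrightarrow>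
      (\<forall>k. k \<noteq> i \<and> k \<noteq> j \<longrightarrow> (b \<circ> w) k = a k)" by (metis comp_apply wi)
    ultimately show ?thesis unfolding ddcoef_eq[OF that] ddcoef_eq[OF \<open>w i \<noteq> w j\<close>]
      by (simp only: o_apply wi)
  qed
  have s: "psupp (\<lambda>b. p (b \<circ> w)) = (\<lambda>a. a \<circ> inv w) ` psupp p"
  proof
    show "psupp (\<lambda>b. p (b \<circ> w)) \<subseteq> (\<lambda>a. a \<circ> inv w) ` psupp p"
    proof
      fix b assume "b \<in> psupp (\<lambda>b. p (b \<circ> w))"
      then have "b \<circ> w \<in> psupp p" by (auto simp: psupp_def)
      then show "b \<in> (\<lambda>a. a \<circ> inv w) ` psupp p" using c(2)[of b] by (metis image_eqI)
    qed
  qed (auto simp: psupp_def c)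
  have "inj_on (\<lambda>a. a \<circ> inv w) (psupp p)" by (rule inj_onI) (metis c(1))
  then show ?thesis unfolding divdiff_def s by (simp add: sum.reindex c dd)
qed

declare plus_fun_apply [simp del] zero_fun_apply [simp del] minus_apply [simp del] uminus_apply [simp del]

lemmas fun_pointwise = plus_fun_apply zero_fun_apply minus_apply uminus_apply

lemma comp_transpose_conj:
  assumes "inj w"
  shows "w \<circ> transpose i j = transpose (w i) (w j) \<circ> w"
proof
  fix x show "(w \<circ> transpose i j) x = (transpose (w i) (w j) \<circ> w) x"
    using assms by (cases "x = i"; cases "x = j") (simp_all add: inj_eq)
qed

lemma sum_fun_apply: "(\<Sum>i\<in>I. f i) x = (\<Sum>i\<in>I. f i x)"
  by (induction I rule: infinite_finite_induct) (auto simp: fun_pointwise)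

lemma pscale_add: "pscale c (p + q) = pscale c p + pscale c q"
  and pscale_diff: "pscale c (p - q) = pscale c p - pscale c q"
  and pscale_zero: "pscale c 0 = 0"
  and pscale_pscale: "pscale c (pscale d p) = pscale (c * d) p"
  and pscale_left_add: "pscale (c + d) p = pscale c p + pscale d p"
  and pscale_one: "pscale 1 p = p"
  and pscale_left_zero: "pscale 0 p = 0"
  by (auto simp: pscale_def fun_eq_iff algebra_simps fun_pointwise)

lemma pscale_sum: "pscale c (\<Sum>i\<in>I. f i) = (\<Sum>i\<in>I. pscale c (f i))"
  by (intro ext) (simp add: sum_fun_apply pscale_def sum_distrib_left)

lemma diff_eq_pscale: "p - q = p + pscale (-1) q"
  by (simp add: pscale_def fun_eq_iff fun_pointwise)

lemma xmul_zero: "xmul i 0 = 0"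
  by (simp add: xmul_def fun_eq_iff fun_pointwise)

lemma xmul_sum: "xmul k (\<Sum>i\<in>I. f i) = (\<Sum>i\<in>I. xmul k (f i))"
  by (intro ext) (simp add: sum_fun_apply xmul_def)

lemma padd_eq: "padd p q = p + q"
  by (simp add: padd_def fun_eq_iff fun_pointwise)

lemma divdiff_add:
  assumes "finite (psupp p)" "finite (psupp q)"
  shows "divdiff i j (p + q) = divdiff i j p + divdiff i j q"
proof (intro ext)
  fix b T
  have f: "finite (psupp p \<union> psupp q)" using assms by simp
  show "divdiff i j (p + q) b T = (divdiff i j p + divdiff i j q) b T"
    using psupp_finite_sum[OF f psupp_add] psupp_finite_sum[OF f Un_upper1] psupp_finite_sum[OF f Un_upper2]
    by (simp add: algebra_simps sum.distrib fun_pointwise)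
qed

lemma divdiff_pscale:
  assumes "finite (psupp p)"
  shows "divdiff i j (pscale c p) = pscale c (divdiff i j p)"
proof (intro ext)
  fix b T
  show "divdiff i j (pscale c p) b T = pscale c (divdiff i j p) b T"
    using psupp_finite_sum[OF assms psupp_pscale] psupp_finite_sum[OF assms order_refl]
    by (simp add: pscale_def sum_distrib_left algebra_simps)
qed

lemma pdiff_add: "pdiff i (p + q) = pdiff i p + pdiff i q"
  and pdiff_pscale: "pdiff i (pscale c p) = pscale c (pdiff i p)"
  by (auto simp: pdiff_def pscale_def fun_eq_iff algebra_simps fun_pointwise)

lemma pdiff_xmul_same: "pdiff i (xmul i p) = xmul i (pdiff i p) + p"
proof (intro ext)
  fix b T
  show "pdiff i (xmul i p) b T = (xmul i (pdiff i p) + p) b T"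
    by (cases "b i") (auto simp: pdiff_def xmul_def algebra_simps fun_upd_idem fun_pointwise)
qed

lemma pdiff_xmul_other: "i \<noteq> j \<Longrightarrow> pdiff i (xmul j p) = xmul j (pdiff i p)"
  by (auto simp: pdiff_def xmul_def fun_eq_iff fun_upd_twist)

context young_module begin

definition mon :: "mono \<Rightarrow> bool" where
  "mon a \<longleftrightarrow> (\<forall>i. a i \<noteq> 0 \<longrightarrow> i \<in> {1..N})"

abbreviation P :: "vpoly \<Rightarrow> bool" where "P \<equiv> in_P N tau"

abbreviation act :: "(nat \<Rightarrow> nat) \<Rightarrow> vpoly \<Rightarrow> vpoly" where "act \<equiv> pact N tau"

definition vmap :: "(nat \<Rightarrow> nat) \<Rightarrow> vpoly \<Rightarrow> vpoly" where
  "vmap w p = (\<lambda>b. vact w (p b))"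

lemma pmat_eq: "pmat N tau (taurep N tau w) p = vmap w p"
  by (simp add: pmat_def vmap_def vact_def)

lemma act_eq: "act w p = vmap w (\<lambda>b. p (b \<circ> w))"
  by (simp add: pact_def pmat_eq)

lemma act_apply: "act w p b = vact w (p (b \<circ> w))"
  by (simp add: act_eq vmap_def)

lemma in_P_iff: "P p \<longleftrightarrow> finite (psupp p) \<and> (\<forall>a. p a \<in> V) \<and> (\<forall>a\<in>psupp p. mon a)"
  unfolding in_P_def V_def mon_def psupp_def by blast

lemma P_finite: "P p \<Longrightarrow> finite (psupp p)"
  and P_V: "P p \<Longrightarrow> p a \<in> V"
  and P_mon: "P p \<Longrightarrow> p a T \<noteq> 0 \<Longrightarrow> mon a"
  unfolding in_P_iff by (auto simp: psupp_def)

lemma P_I: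
  assumes "finite (psupp p)" "\<And>a. p a \<in> V" "\<And>a T. p a T \<noteq> 0 \<Longrightarrow> mon a"
  shows "P p"
  unfolding in_P_iff using assms by (auto simp: psupp_def)

lemma V_add: "u \<in> V \<Longrightarrow> v \<in> V \<Longrightarrow> u + v \<in> V"
  and V_diff: "u \<in> V \<Longrightarrow> v \<in> V \<Longrightarrow> u - v \<in> V"
  and V_scale: "u \<in> V \<Longrightarrow> (\<lambda>T. c * u T) \<in> V"
  by (auto simp: V_def fun_pointwise)

lemma P_zero: "P 0"
  by (rule P_I) (auto simp: psupp_def V_def fun_pointwise)

lemma P_add: "P p \<Longrightarrow> P q \<Longrightarrow> P (p + q)"
proof (rule P_I)
  fix a T assume "P p" "P q" "(p + q) a T \<noteq> 0"
  then show "mon a" using P_mon by (cases "p a T = 0") (auto simp: fun_pointwise)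
qed (auto intro: finite_subset[OF psupp_add] P_finite simp: V_add P_V plus_fun_apply[of p q])

lemma P_diff: "P p \<Longrightarrow> P q \<Longrightarrow> P (p - q)"
proof (rule P_I)
  fix a T assume "P p" "P q" "(p - q) a T \<noteq> 0"
  then show "mon a" using P_mon by (cases "p a T = 0") (auto simp: fun_pointwise)
qed (auto intro: finite_subset[OF psupp_diff] P_finite simp: V_diff P_V minus_apply[of p q])

lemma P_pscale: "P p \<Longrightarrow> P (pscale c p)"
proof (rule P_I)
  fix a T assume "P p" "pscale c p a T \<noteq> 0"
  then show "mon a" using P_mon by (auto simp: pscale_def)
next
  fix a assume "P p" then show "pscale c p a \<in> V" using P_V by (auto simp: pscale_def V_scale)
qed (auto intro: finite_subset[OF psupp_pscale] P_finite)

lemma P_sum: "(\<And>i. i \<in> I \<Longrightarrow> P (f i)) \<Longrightarrow> P (\<Sum>i\<in>I. f i)"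
  by (induction I rule: infinite_finite_induct) (auto simp: P_zero P_add)

lemma P_one_tensor: "T \<in> Y \<Longrightarrow> P (one_tensor T)"
proof (rule P_I)
  assume "T \<in> Y"
  have "psupp (one_tensor T) \<subseteq> {\<lambda>_. 0}" by (auto simp: psupp_def one_tensor_def split: if_splits)
  then show "finite (psupp (one_tensor T))" by (rule finite_subset) simp
qed (auto simp: one_tensor_def V_def mon_def split: if_splits)

lemma mon_upd: "mon b \<Longrightarrow> i \<in> {1..N} \<Longrightarrow> mon (b(i := x))"
  by (auto simp: mon_def)

lemma mon_upd_iff: "i \<in> {1..N} \<Longrightarrow> mon (b(i := x)) \<longleftrightarrow> mon b"
  by (auto simp: mon_def split: if_splits)

lemma P_xmul:
  assumes "P p" "i \<in> {1..N}" shows "P (xmul i p)"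
proof (rule P_I)
  fix a T assume "xmul i p a T \<noteq> 0"
  then have "mon (a(i := a i - 1))" using P_mon[OF assms(1)] by (auto simp: xmul_def split: if_splits)
  then show "mon a" using assms(2) by (simp add: mon_upd_iff)
next
  fix a show "xmul i p a \<in> V" using P_V[OF assms(1)] by (auto simp: xmul_def V_def)
qed (use assms P_finite finite_psupp_xmul in auto)

lemma P_pdiff:
  assumes "P p" "i \<in> {1..N}" shows "P (pdiff i p)"
proof (rule P_I)
  fix a T assume "pdiff i p a T \<noteq> 0"
  then have "mon (a(i := a i + 1))" using P_mon[OF assms(1)] by (auto simp: pdiff_def)
  then show "mon a" using assms(2) by (simp add: mon_upd_iff)
next
  fix a show "pdiff i p a \<in> V" using P_V[OF assms(1)] by (auto simp: pdiff_def V_def)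
next
  have "psupp (pdiff i p) \<subseteq> (\<lambda>b. b(i := b i - 1)) ` psupp p"
  proof
    fix b assume "b \<in> psupp (pdiff i p)"
    then have "b(i := b i + 1) \<in> psupp p" by (auto simp: psupp_def pdiff_def)
    then show "b \<in> (\<lambda>b. b(i := b i - 1)) ` psupp p"
      by (intro image_eqI[of _ _ "b(i := b i + 1)"]) auto
  qed
  then show "finite (psupp (pdiff i p))" using P_finite[OF assms(1)] by (auto intro: finite_subset)
qed

lemma P_divdiff:
  assumes "P p" "i \<in> {1..N}" "j \<in> {1..N}" "i \<noteq> j" shows "P (divdiff i j p)"
proof (rule P_I)
  fix b T assume "divdiff i j p b T \<noteq> 0"
  then obtain a where a: "a \<in> psupp p" "ddcoef i j a b \<noteq> 0"
    unfolding divdiff_def by (metis (mono_tags, lifting) mult_zero_left sum.neutral)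
  have "mon a" using a(1) assms(1) by (auto simp: in_P_iff)
  moreover have "\<And>k. k \<noteq> i \<Longrightarrow> k \<noteq> j \<Longrightarrow> b k = a k"
    using a(2) unfolding ddcoef_eq[OF assms(4)] by (auto split: if_splits)
  ultimately show "mon b" using assms unfolding mon_def by metis
next
  fix a show "divdiff i j p a \<in> V" using P_V[OF assms(1)] by (auto simp: divdiff_def V_def intro!: sum.neutral)
qed (use assms P_finite finite_psupp_divdiff in auto)

lemma psupp_vmap: "psupp (vmap w p) \<subseteq> psupp p"
proof
  fix b assume "b \<in> psupp (vmap w p)"
  then obtain T where "vact w (p b) T \<noteq> 0" by (auto simp: psupp_def vmap_def)
  then have "\<exists>T. p b T \<noteq> 0" unfolding vact_def by (metis (mono_tags, lifting) mult_zero_left sum.neutral)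
  then show "b \<in> psupp p" by (simp add: psupp_def)
qed

lemma P_vmap:
  assumes "P p" shows "P (vmap w p)"
proof (rule P_I)
  fix a T assume "vmap w p a T \<noteq> 0"
  then show "mon a" using assms psupp_vmap[of w p] by (auto simp: in_P_iff psupp_def)
next
  fix a show "vmap w p a \<in> V" by (simp add: vmap_def vact_in_V)
next
  show "finite (psupp (vmap w p))" by (rule finite_subset[OF psupp_vmap P_finite[OF assms]])
qed

lemma mon_comp:
  assumes w: "w permutes {1..N}"
  shows "mon (b \<circ> w) \<longleftrightarrow> mon b"
proof
  assume b: "mon (b \<circ> w)"
  show "mon b"
    unfolding mon_def
  proof (intro allI impI)
    fix i assume "b i \<noteq> 0"
    then have "(b \<circ> w) (inv w i) \<noteq> 0" using permutes_inverses(1)[OF w] by simp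
    then have "inv w i \<in> {1..N}" using b unfolding mon_def by blast
    then show "i \<in> {1..N}" using permutes_in_image[OF permutes_inv[OF w]] by blast
  qed
next
  assume b: "mon b"
  show "mon (b \<circ> w)"
    using b permutes_in_image[OF w] unfolding mon_def comp_def by blast
qed

lemma P_act:
  assumes "P p" "w permutes {1..N}" shows "P (act w p)"
  unfolding act_eq
proof (intro P_vmap P_I)
  fix a T assume "p (a \<circ> w) T \<noteq> 0"
  then show "mon a" using P_mon[OF assms(1)] mon_comp[OF assms(2)] by blast
next
  fix a show "p (a \<circ> w) \<in> V" by (rule P_V[OF assms(1)])
next
  show "finite (psupp (\<lambda>b. p (b \<circ> w)))"
    by (rule finite_psupp_comp[OF permutes_bij[OF assms(2)] P_finite[OF assms(1)]])
qed

lemma vmap_add: "vmap w (p + q) = vmap w p + vmap w q"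
  and vmap_diff: "vmap w (p - q) = vmap w p - vmap w q"
  and vmap_pscale: "vmap w (pscale c p) = pscale c (vmap w p)"
  and vmap_zero: "vmap w 0 = 0"
  by (auto simp: vmap_def pscale_def fun_eq_iff vact_def algebra_simps sum.distrib sum_subtractf
      sum_distrib_left fun_pointwise)

lemma vmap_xmul: "vmap w (xmul i p) = xmul i (vmap w p)"
  by (auto simp: vmap_def xmul_def fun_eq_iff vact_def)

lemma vmap_divdiff:
  assumes "finite (psupp p)"
  shows "vmap w (divdiff i j p) = divdiff i j (vmap w p)"
proof (intro ext)
  fix b T
  have "vmap w (divdiff i j p) b T =
     (\<Sum>S\<in>Y. \<Sum>a\<in>psupp p. ddcoef i j a b * (p a S * complex_of_real (taurep N tau w S T)))"
    by (simp add: vmap_def vact_def divdiff_def sum_distrib_right mult.assoc)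
  also have "\<dots> = (\<Sum>a\<in>psupp p. \<Sum>S\<in>Y. ddcoef i j a b * (p a S * complex_of_real (taurep N tau w S T)))"
    by (rule sum.swap)
  also have "\<dots> = divdiff i j (vmap w p) b T"
    unfolding psupp_finite_sum[OF assms psupp_vmap] by (simp add: vmap_def vact_def sum_distrib_left)
  finally show "vmap w (divdiff i j p) b T = divdiff i j (vmap w p) b T" .
qed

lemma act_add: "act w (p + q) = act w p + act w q"
  and act_diff: "act w (p - q) = act w p - act w q"
  and act_pscale: "act w (pscale c p) = pscale c (act w p)"
  and act_zero: "act w 0 = 0"
  by (auto simp: act_apply pscale_def fun_eq_iff vact_def algebra_simps sum.distrib sum_subtractf
      sum_distrib_left fun_pointwise)

lemma act_sum: "act w (\<Sum>i\<in>I. f i) = (\<Sum>i\<in>I. act w (f i))"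
proof
  fix b
  have "(\<Sum>i\<in>I. f i) (b \<circ> w) = (\<lambda>T. \<Sum>i\<in>I. f i (b \<circ> w) T)" by (intro ext) (simp add: sum_fun_apply)
  then show "act w (\<Sum>i\<in>I. f i) b = (\<Sum>i\<in>I. act w (f i)) b"
    by (intro ext) (simp add: act_apply vact_sum sum_fun_apply)
qed

lemma act_comp:
  assumes "u permutes {1..N}" "v permutes {1..N}"
  shows "act (u \<circ> v) p = act u (act v p)"
proof
  fix b
  show "act (u \<circ> v) p b = act u (act v p) b"
    by (simp only: act_apply vact_comp[OF assms] o_assoc)
qed

lemma act_id: assumes "P p" shows "act id p = p"
proof
  fix b show "act id p b = p b" by (simp only: act_apply comp_id vact_id P_V[OF assms])
qed

lemma act_inv:
  assumes "P p" "w permutes {1..N}"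
  shows "act w (act (inv w) p) = p" "act (inv w) (act w p) = p"
  using act_comp[OF assms(2) permutes_inv[OF assms(2)], of p]
    act_comp[OF permutes_inv[OF assms(2)] assms(2), of p]
    permutes_inv_o[OF assms(2)] act_id[OF assms(1)] by simp_all

lemma act_transpose_invol:
  "P p \<Longrightarrow> i \<in> {1..N} \<Longrightarrow> j \<in> {1..N} \<Longrightarrow> act (transpose i j) (act (transpose i j) p) = p"
  using act_inv(1)[of p "transpose i j"] permutes_swap_id[of i "{1..N}" j] by simp

lemma act_transpose_conj:
  assumes "w permutes {1..N}" "i \<in> {1..N}" "j \<in> {1..N}"
  shows "act w (act (transpose i j) p) = act (transpose (w i) (w j)) (act w p)"
proof -
  have t: "transpose i j permutes {1..N}" "transpose (w i) (w j) permutes {1..N}"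
    using assms(2,3) permutes_in_image[OF assms(1)] by (blast intro: permutes_swap_id)+
  have "w \<circ> transpose i j = transpose (w i) (w j) \<circ> w"
    by (rule comp_transpose_conj[OF permutes_inj[OF assms(1)]])
  then have "act (w \<circ> transpose i j) p = act (transpose (w i) (w j) \<circ> w) p" by (simp only:)
  then show ?thesis by (simp only: act_comp[OF assms(1) t(1)] act_comp[OF t(2) assms(1)])
qed

lemma act_xmul:
  assumes "w permutes {1..N}"
  shows "act w (xmul i p) = xmul (w i) (act w p)"
proof
  fix b :: mono
  have e: "(b \<circ> w)(i := (b \<circ> w) i - 1) = b(w i := b (w i) - 1) \<circ> w"
    using permutes_inj[OF assms] by (auto simp: fun_eq_iff inj_def)
  show "act w (xmul i p) b = xmul (w i) (act w p) b"
    unfolding act_apply xmul_def e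
    by (cases "1 \<le> b (w i)") (simp_all add: vact_zero)
qed

lemma act_pdiff:
  assumes "w permutes {1..N}"
  shows "act w (pdiff i p) = pdiff (w i) (act w p)"
proof
  fix b :: mono
  have e: "(b \<circ> w)(i := (b \<circ> w) i + 1) = b(w i := b (w i) + 1) \<circ> w"
    using permutes_inj[OF assms] by (auto simp: fun_eq_iff inj_def)
  show "act w (pdiff i p) b = pdiff (w i) (act w p) b"
    unfolding act_apply pdiff_def e vact_scale by simp
qed

lemma act_divdiff:
  assumes w: "w permutes {1..N}" and ij: "i \<noteq> j" and p: "finite (psupp p)"
  shows "act w (divdiff i j p) = divdiff (w i) (w j) (act w p)"
proof -
  have f: "finite (psupp (\<lambda>b. p (b \<circ> w)))" using finite_psupp_comp[OF permutes_bij[OF w] p] .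
  have "act w (divdiff i j p) = vmap w (\<lambda>b. divdiff i j p (b \<circ> w))" by (rule act_eq)
  also have "(\<lambda>b. divdiff i j p (b \<circ> w)) = divdiff (w i) (w j) (\<lambda>b. p (b \<circ> w))"
    using divdiff_comp[OF permutes_bij[OF w] ij, of p] by (simp add: fun_eq_iff)
  also have "vmap w \<dots> = divdiff (w i) (w j) (act w p)" by (simp add: vmap_divdiff[OF f] act_eq)
  finally show ?thesis .
qed

lemma act_vmap:
  assumes "w permutes {1..N}" "i \<in> {1..N}" "j \<in> {1..N}"
  shows "act w (vmap (transpose i j) p) = vmap (transpose (w i) (w j)) (act w p)"
proof -
  have t: "transpose i j permutes {1..N}" "transpose (w i) (w j) permutes {1..N}"
    using assms(2,3) permutes_in_image[OF assms(1)] by (blast intro: permutes_swap_id)+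
  have "w \<circ> transpose i j = transpose (w i) (w j) \<circ> w"
    by (rule comp_transpose_conj[OF permutes_inj[OF assms(1)]])
  then have "vact (w \<circ> transpose i j) v = vact (transpose (w i) (w j) \<circ> w) v" for v
    by (simp only:)
  then have "vact w (vact (transpose i j) v) = vact (transpose (w i) (w j)) (vact w v)" for v
    by (simp only: vact_comp[OF assms(1) t(1)] vact_comp[OF t(2) assms(1)])
  then show ?thesis by (simp add: act_apply vmap_def fun_eq_iff)
qed

end

locale dunkl_operators = young_module +
  fixes kappa :: real
begin

abbreviation D :: "nat \<Rightarrow> vpoly \<Rightarrow> vpoly" where "D \<equiv> dunkl N tau kappa"
abbreviation U :: "nat \<Rightarrow> vpoly \<Rightarrow> vpoly" where "U \<equiv> cherU N tau kappa"
abbreviation k' :: complex where "k' \<equiv> complex_of_real kappa"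

lemma D_eq: "D i p = pdiff i p + pscale k' (\<Sum>j\<in>{1..N} - {i}. vmap (transpose i j) (divdiff i j p))"
  by (simp add: dunkl_def pmat_eq fun_eq_iff pscale_def sum_fun_apply fun_pointwise)

lemma U_eq: "U i p = D i (xmul i p) - pscale k' (\<Sum>j\<in>{1..<i}. act (transpose i j) p)"
  by (simp add: cherU_def fun_eq_iff pscale_def sum_fun_apply fun_pointwise)

lemma P_D: "P p \<Longrightarrow> i \<in> {1..N} \<Longrightarrow> P (D i p)"
  unfolding D_eq by (intro P_add P_pdiff P_pscale P_sum P_vmap P_divdiff) auto

lemma P_U: "P p \<Longrightarrow> i \<in> {1..N} \<Longrightarrow> P (U i p)"
  unfolding U_eq by (intro P_diff P_D P_pscale P_sum P_act P_xmul permutes_swap_id) auto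

lemma D_add: "P p \<Longrightarrow> P q \<Longrightarrow> D i (p + q) = D i p + D i q"
  by (simp add: D_eq pdiff_add divdiff_add P_finite vmap_add sum.distrib pscale_add)

lemma D_pscale: "P p \<Longrightarrow> D i (pscale c p) = pscale c (D i p)"
  by (simp add: D_eq pdiff_pscale divdiff_pscale P_finite vmap_pscale pscale_sum pscale_add
      pscale_pscale mult.commute)

lemma U_add: "P p \<Longrightarrow> P q \<Longrightarrow> i \<in> {1..N} \<Longrightarrow> U i (p + q) = U i p + U i q"
  by (simp add: U_eq xmul_add D_add P_xmul act_add sum.distrib pscale_add)

lemma U_pscale: "P p \<Longrightarrow> i \<in> {1..N} \<Longrightarrow> U i (pscale c p) = pscale c (U i p)"
  by (simp add: U_eq xmul_pscale D_pscale P_xmul act_pscale pscale_sum pscale_diff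
      pscale_pscale mult.commute)

lemma U_diff: "P p \<Longrightarrow> P q \<Longrightarrow> i \<in> {1..N} \<Longrightarrow> U i (p - q) = U i p - U i q"
  by (simp only: diff_eq_pscale U_add P_pscale U_pscale)

text \<open>The commutation relations of the rational Cherednik algebra, here for distinct indices:
  of all the divided differences only the one for the pair i, j fails to commute with x_j.\<close>

lemma D_xmul_other:
  assumes "P p" "i \<in> {1..N}" "j \<in> {1..N}" "i \<noteq> j"
  shows "D i (xmul j p) = xmul j (D i p) - pscale k' (act (transpose i j) p)"
proof -
  note f = P_finite[OF assms(1)]
  have sp: "vmap (transpose i j) (pswap i j p) = act (transpose i j) p"
    by (simp add: act_eq pswap_def)
  have "(\<Sum>l\<in>{1..N} - {i}. vmap (transpose i l) (divdiff i l (xmul j p))) =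
    (\<Sum>l\<in>{1..N} - {i}. xmul j (vmap (transpose i l) (divdiff i l p)) -
       (if l = j then act (transpose i j) p else 0))"
    using f assms
    by (intro sum.cong refl)
      (auto simp: divdiff_xmul_other divdiff_xmul_right vmap_diff vmap_xmul sp)
  also have "\<dots> = xmul j (\<Sum>l\<in>{1..N} - {i}. vmap (transpose i l) (divdiff i l p)) - act (transpose i j) p"
    using assms by (simp add: sum_subtractf xmul_sum)
  finally show ?thesis using assms
    by (simp add: D_eq pdiff_xmul_other xmul_add xmul_pscale pscale_diff)
qed

text \<open>For equal indices every divided difference contributes its transposition to the
  commutator, and the derivative contributes the summand p.\<close>

lemma D_xmul_same:
  assumes "P p" "i \<in> {1..N}"
  shows "D i (xmul i p) = xmul i (D i p) + p + pscale k' (\<Sum>j\<in>{1..N} - {i}. act (transpose i j) p)"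
proof -
  note f = P_finite[OF assms(1)]
  have "(\<Sum>l\<in>{1..N} - {i}. vmap (transpose i l) (divdiff i l (xmul i p))) =
    (\<Sum>l\<in>{1..N} - {i}. xmul i (vmap (transpose i l) (divdiff i l p)) + act (transpose i l) p)"
    using f assms
    by (intro sum.cong refl)
      (auto simp: divdiff_xmul_left vmap_add vmap_xmul act_eq pswap_def)
  then show ?thesis using assms
    by (simp add: D_eq pdiff_xmul_same xmul_add xmul_pscale xmul_sum sum.distrib pscale_add)
qed

lemma act_D:
  assumes "P p" "w permutes {1..N}" "i \<in> {1..N}"
  shows "act w (D i p) = D (w i) (act w p)"
proof -
  have "act w (\<Sum>j\<in>{1..N} - {i}. vmap (transpose i j) (divdiff i j p)) =
     (\<Sum>j\<in>{1..N} - {i}. vmap (transpose (w i) (w j)) (divdiff (w i) (w j) (act w p)))"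
    unfolding act_sum using assms by (intro sum.cong refl) (auto simp: act_vmap act_divdiff P_finite)
  also have "\<dots> = (\<Sum>j\<in>{1..N} - {w i}. vmap (transpose (w i) j) (divdiff (w i) j (act w p)))"
  proof (rule sum.reindex_bij_betw)
    have "bij_betw w ({1..N} - {i}) ({1..N} - {w i})"
      using permutes_imp_bij[OF assms(2)] assms(3) permutes_in_image[OF assms(2), of i]
      by (intro bij_betw_DiffI) auto
    then show "bij_betw w ({1..N} - {i}) ({1..N} - {w i})" .
  qed
  finally show ?thesis by (simp add: D_eq act_add act_pscale act_pdiff[OF assms(2)])
qed

lemma act_D_xmul:
  assumes "P p" "w permutes {1..N}" "i \<in> {1..N}"
  shows "act w (D i (xmul i p)) = D (w i) (xmul (w i) (act w p))"
  using act_D[OF P_xmul[OF assms(1,3)] assms(2,3)] act_xmul[OF assms(2)] by simp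

text \<open>The degenerate Hecke relation. Conjugation by s_k turns D_(k+1) x_(k+1) into D_k x_k,
  and the correction sum of U_(k+1) has exactly one term more than that of U_k, the transposition
  s_k itself; that term produces \<open>kappa\<close> p.\<close>

lemma U_adj_lower:
  assumes p: "P p" and k: "1 \<le> k" "k < N"
  shows "U k (act (adj k) p) = act (adj k) (U (Suc k) p) + pscale k' p"
proof -
  let ?q = "act (adj k) p"
  have w: "adj k permutes {1..N}" using k by (rule adj_permutes)
  have kk: "k \<in> {1..N}" "Suc k \<in> {1..N}" using k by auto
  have inv: "act (adj k) ?q = p" using act_transpose_invol[OF p kk] .
  have "act (adj k) (\<Sum>j\<in>{1..<Suc k}. act (transpose (Suc k) j) p) =
    (\<Sum>j\<in>{1..<Suc k}. act (transpose k (adj k j)) ?q)"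
    unfolding act_sum using act_transpose_conj[OF w kk(2)] k by (intro sum.cong refl) auto
  also have "\<dots> = (\<Sum>j\<in>insert k {1..<k}. act (transpose k (adj k j)) ?q)"
    using k by (intro sum.cong) auto
  also have "\<dots> = p + (\<Sum>j\<in>{1..<k}. act (transpose k j) ?q)"
    using inv by simp
  finally have S: "act (adj k) (\<Sum>j\<in>{1..<Suc k}. act (transpose (Suc k) j) p) =
      p + (\<Sum>j\<in>{1..<k}. act (transpose k j) ?q)" .
  have "act (adj k) (U (Suc k) p) = D k (xmul k ?q) - pscale k' (p + (\<Sum>j\<in>{1..<k}. act (transpose k j) ?q))"
    unfolding U_eq act_diff act_pscale S using act_D_xmul[OF p w kk(2)] by simp
  then show ?thesis unfolding U_eq by (simp add: pscale_add)
qed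

lemma U_adj_upper:
  assumes p: "P p" and k: "1 \<le> k" "k < N"
  shows "U (Suc k) (act (adj k) p) = act (adj k) (U k p) - pscale k' p"
proof -
  have w: "adj k permutes {1..N}" using k by (rule adj_permutes)
  have kk: "k \<in> {1..N}" "Suc k \<in> {1..N}" using k by auto
  have q: "P (act (adj k) p)" using P_act[OF p w] .
  have inv: "act (adj k) (act (adj k) r) = r" if "P r" for r using act_transpose_invol[OF that kk] .
  have "act (adj k) (U k (act (adj k) (act (adj k) p))) =
     act (adj k) (act (adj k) (U (Suc k) (act (adj k) p))) + act (adj k) (pscale k' (act (adj k) p))"
    unfolding U_adj_lower[OF q k] act_add ..
  then show ?thesis using inv[OF p] inv[OF P_U[OF q kk(2)]] by (simp add: act_pscale)
qed

text \<open>The correction sum of U_m runs over j < m. Since m is neither k nor k + 1, both of these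
  lie on the same side of m and s_k merely permutes the summands.\<close>

lemma U_adj_other:
  assumes p: "P p" and k: "1 \<le> k" "k < N" and m: "m \<in> {1..N}" "m \<noteq> k" "m \<noteq> Suc k"
  shows "U m (act (adj k) p) = act (adj k) (U m p)"
proof -
  have w: "adj k permutes {1..N}" using k by (rule adj_permutes)
  have fx: "adj k m = m" using m by simp
  have "act (adj k) (\<Sum>j\<in>{1..<m}. act (transpose m j) p) =
     (\<Sum>j\<in>{1..<m}. act (transpose m (adj k j)) (act (adj k) p))"
    unfolding act_sum using act_transpose_conj[OF w m(1)] m(1) fx by (intro sum.cong refl) auto
  also have "\<dots> = (\<Sum>j\<in>{1..<m}. act (transpose m j) (act (adj k) p))"
  proof (rule sum.reindex_bij_betw)
    have "(k \<in> {1..<m}) = (Suc k \<in> {1..<m})" using m k by auto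
    then show "bij_betw (adj k) {1..<m} {1..<m}" by (simp add: bij_betw_transpose_iff transpose_image_eq)
  qed
  finally show ?thesis unfolding U_eq act_diff act_pscale using act_D_xmul[OF p w m(1)] fx by simp
qed

section \<open>The affine step and its exchange relations with the Cherednik operators\<close>

definition rot :: "nat \<Rightarrow> nat" where
  "rot i = (if i = 1 then N else if i \<in> {2..N} then i - 1 else i)"

lemma rot_permutes: "rot permutes {1..N}"
proof (rule bij_imp_permutes)
  show "bij_betw rot {1..N} {1..N}"
    by (rule bij_betw_byWitness[where f' = "\<lambda>i. if i = N then 1 else i + 1"])
      (use N2 in \<open>auto simp: rot_def\<close>)
qed (use N2 in \<open>auto simp: rot_def\<close>)

definition Phi :: "vpoly \<Rightarrow> vpoly" where
  "Phi p = xmul N (act rot p)"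

lemma P_Phi: "P p \<Longrightarrow> P (Phi p)"
  unfolding Phi_def using N2 by (auto intro!: P_xmul P_act rot_permutes)

lemma Phi_add: "Phi (p + q) = Phi p + Phi q"
  and Phi_pscale: "Phi (pscale c p) = pscale c (Phi p)"
  and Phi_diff: "Phi (p - q) = Phi p - Phi q"
  by (simp_all add: Phi_def act_add act_diff act_pscale act_zero xmul_add xmul_diff xmul_pscale xmul_zero)

lemma Phi_sum: "Phi (\<Sum>i\<in>I. f i) = (\<Sum>i\<in>I. Phi (f i))"
  by (simp add: Phi_def act_sum xmul_sum)

text \<open>The commutator of D_i with x_N yields the transposition (i, N). Pulled back through the
  cycle it becomes (i+1, 1), the one summand by which the correction sum of U_(i+1) exceeds the
  shifted one of U_i.\<close>

lemma U_Phi: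
  assumes p: "P p" and i: "1 \<le> i" "i < N"
  shows "U i (Phi p) = Phi (U (Suc i) p)"
proof -
  let ?q = "act rot p"
  have q: "P ?q" using P_act[OF p rot_permutes] .
  have I: "i \<in> {1..N}" "Suc i \<in> {1..N}" "N \<in> {1..N}" "i \<noteq> N" using i by auto
  have r: "rot (Suc i) = i" "rot 1 = N" using i by (auto simp: rot_def)
  have t: "transpose i N permutes {1..N}" using I by (intro permutes_swap_id)
  have "D i (xmul i (Phi p)) = xmul N (D i (xmul i ?q)) - pscale k' (act (transpose i N) (xmul i ?q))"
    unfolding Phi_def xmul_commute[of i N] by (rule D_xmul_other[OF P_xmul[OF q I(1)] I(1,3,4)])
  also have "act (transpose i N) (xmul i ?q) = xmul N (act (transpose i N) ?q)"
    unfolding act_xmul[OF t] by simp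
  also have "act (transpose i N) ?q = act rot (act (transpose (Suc i) 1) p)"
    using act_transpose_conj[OF rot_permutes I(2), of 1 p] I r by simp
  also have "D i (xmul i ?q) = act rot (D (Suc i) (xmul (Suc i) p))"
    using act_D_xmul[OF p rot_permutes I(2)] r by simp
  finally have 1: "D i (xmul i (Phi p)) = Phi (D (Suc i) (xmul (Suc i) p))
      - pscale k' (Phi (act (transpose (Suc i) 1) p))"
    by (simp only: Phi_def)
  have "(\<Sum>j\<in>{1..<i}. act (transpose i j) (Phi p)) = (\<Sum>j\<in>{1..<i}. Phi (act (transpose (Suc i) (Suc j)) p))"
  proof (rule sum.cong[OF refl])
    fix j assume j: "j \<in> {1..<i}"
    then have tj: "transpose i j permutes {1..N}" and "Suc j \<in> {1..N}" "rot (Suc j) = j"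
      using i by (auto simp: rot_def intro!: permutes_swap_id)
    then show "act (transpose i j) (Phi p) = Phi (act (transpose (Suc i) (Suc j)) p)"
      using act_transpose_conj[OF rot_permutes I(2), of "Suc j" p] r i j
      by (simp add: Phi_def act_xmul[OF tj])
  qed
  also have "\<dots> = (\<Sum>j\<in>{2..<Suc i}. Phi (act (transpose (Suc i) j) p))"
    using sum.shift_bounds_Suc_ivl[of "\<lambda>j. Phi (act (transpose (Suc i) j) p)" 1 i]
    by (simp add: numeral_2_eq_2)
  finally have 2: "(\<Sum>j\<in>{1..<i}. act (transpose i j) (Phi p)) =
      (\<Sum>j\<in>{2..<Suc i}. Phi (act (transpose (Suc i) j) p))" .
  have e: "{1..<Suc i} = insert 1 {2..<Suc i}" using i by auto
  have "Phi (\<Sum>j\<in>{1..<Suc i}. act (transpose (Suc i) j) p) = Phi (act (transpose (Suc i) 1) p) +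
     (\<Sum>j\<in>{2..<Suc i}. Phi (act (transpose (Suc i) j) p))"
    unfolding Phi_sum e by (subst sum.insert) auto
  then show ?thesis unfolding U_eq[of i] U_eq[of "Suc i"] 1 2 Phi_diff Phi_pscale by (simp add: pscale_add)
qed

text \<open>The commutator of D_N with x_N is 1 plus \<open>kappa\<close> times all transpositions
  (N, j). These cancel the correction sum of U_N, while U_1 has none, so only the shift by 1
  remains.\<close>

lemma U_Phi_last:
  assumes p: "P p"
  shows "U N (Phi p) = Phi (U 1 p) + Phi p"
proof -
  let ?q = "act rot p"
  have q: "P ?q" using P_act[OF p rot_permutes] .
  have I: "1 \<in> {1..N}" "N \<in> {1..N}" using N2 by auto
  have r: "rot 1 = N" by (simp add: rot_def)
  have "D N (xmul N (Phi p)) = xmul N (D N (xmul N ?q)) + Phi p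
      + pscale k' (\<Sum>j\<in>{1..N} - {N}. act (transpose N j) (Phi p))"
    unfolding Phi_def by (rule D_xmul_same[OF P_xmul[OF q I(2)] I(2)])
  also have "D N (xmul N ?q) = act rot (D 1 (xmul 1 p))"
    using act_D_xmul[OF p rot_permutes I(1)] r by simp
  also have "{1..N} - {N} = {1..<N}" by auto
  finally have "D N (xmul N (Phi p)) = Phi (D 1 (xmul 1 p)) + Phi p
      + pscale k' (\<Sum>j\<in>{1..<N}. act (transpose N j) (Phi p))"
    by (simp only: Phi_def)
  then show ?thesis unfolding U_eq by (simp add: pscale_zero)
qed

end

section \<open>Ranks and the triangularity order\<close>

lemma rank_card:
  assumes "i \<in> {1..N}"
  shows "rank N a i = card {j \<in> {1..N}. a i < a j \<or> (a j = a i \<and> j \<le> i)}"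
proof -
  have "{j \<in> {1..N}. a i < a j \<or> (a j = a i \<and> j \<le> i)} = {j \<in> {1..N}. a i < a j} \<union> {j \<in> {1..i}. a j = a i}"
    using assms by auto
  moreover have "card ({j \<in> {1..N}. a i < a j} \<union> {j \<in> {1..i}. a j = a i}) =
      card {j \<in> {1..N}. a i < a j} + card {j \<in> {1..i}. a j = a i}"
    by (rule card_Un_disjoint) auto
  ultimately show ?thesis using assms by (simp add: rank_def)
qed

lemma rank_le_iff:
  assumes i: "i \<in> {1..N}" and j: "j \<in> {1..N}"
  shows "rank N a i \<le> rank N a j \<longleftrightarrow> a j < a i \<or> (a i = a j \<and> i \<le> j)"
proof -
  define B where "B i = {j \<in> {1..N}. a i < a j \<or> (a j = a i \<and> j \<le> i)}" for i
  have r: "rank N a i = card (B i)" "rank N a j = card (B j)"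
    using rank_card[OF i] rank_card[OF j] by (simp_all add: B_def)
  have fin: "finite (B i)" for i by (simp add: B_def)
  show ?thesis
  proof (cases "a j < a i \<or> (a i = a j \<and> i \<le> j)")
    case True
    then have "B i \<subseteq> B j" by (auto simp: B_def)
    then show ?thesis using True r card_mono[OF fin] by auto
  next
    case False
    then have "B j \<subset> B i" using i by (auto simp: B_def)
    then have "card (B j) < card (B i)" by (rule psubset_card_mono[OF fin])
    then show ?thesis using False r by simp
  qed
qed

lemma rank_outside: "i \<notin> {1..N} \<Longrightarrow> rank N a i = i"
  unfolding rank_def by (rule if_not_P)

lemma rank_permutes: "rank N a permutes {1..N}"
proof (rule bij_imp_permutes)
  have inj: "inj_on (rank N a) {1..N}"
  proof (rule inj_onI)
    fix i j assume "i \<in> {1..N}" "j \<in> {1..N}" "rank N a i = rank N a j"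
    then show "i = j" using rank_le_iff[of i N j a] rank_le_iff[of j N i a] by auto
  qed
  have "rank N a ` {1..N} \<subseteq> {1..N}"
  proof
    fix x assume "x \<in> rank N a ` {1..N}"
    then obtain i where i: "i \<in> {1..N}" "x = rank N a i" by auto
    let ?B = "{j \<in> {1..N}. a i < a j \<or> (a j = a i \<and> j \<le> i)}"
    have "card ?B \<le> card {1..N}" by (intro card_mono) auto
    moreover have "card ?B > 0" using i by (auto simp: card_gt_0_iff)
    ultimately show "x \<in> {1..N}" using i rank_card[OF i(1)] by simp
  qed
  then show "bij_betw (rank N a) {1..N} {1..N}"
    using endo_inj_surj[OF _ _ inj] inj by (simp add: bij_betw_def)
qed (rule rank_outside)

text \<open>A permutation of {1..N} is determined by the order of its values, so ranks can be
  identified without counting.\<close>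

lemma rank_eqI:
  assumes s: "s permutes {1..N}"
    and le: "\<And>i j. i \<in> {1..N} \<Longrightarrow> j \<in> {1..N} \<Longrightarrow> s j \<le> s i \<longleftrightarrow> a i < a j \<or> (a j = a i \<and> j \<le> i)"
  shows "rank N a = s"
proof
  fix i show "rank N a i = s i"
  proof (cases "i \<in> {1..N}")
    case True
    have "{j \<in> {1..N}. a i < a j \<or> (a j = a i \<and> j \<le> i)} = {j \<in> {1..N}. s j \<le> s i}"
      using le True by auto
    also have "\<dots> = inv s ` {1..s i}"
    proof
      show "{j \<in> {1..N}. s j \<le> s i} \<subseteq> inv s ` {1..s i}"
      proof
        fix j assume "j \<in> {j \<in> {1..N}. s j \<le> s i}"
        then have j: "j \<in> {1..N}" "s j \<le> s i" by auto
        have "s j \<in> {1..N}" using permutes_in_image[OF s] j(1) by blast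
        with j show "j \<in> inv s ` {1..s i}"
          by (intro image_eqI[of _ _ "s j"]) (auto simp: permutes_inverses(2)[OF s])
      qed
      show "inv s ` {1..s i} \<subseteq> {j \<in> {1..N}. s j \<le> s i}"
      proof
        fix j assume "j \<in> inv s ` {1..s i}"
        then obtain x where x: "x \<in> {1..s i}" "j = inv s x" by auto
        have "s i \<in> {1..N}" using permutes_in_image[OF s] True by blast
        then have "x \<in> {1..N}" using x by auto
        then have "j \<in> {1..N}" using permutes_in_image[OF permutes_inv[OF s]] x by blast
        then show "j \<in> {j \<in> {1..N}. s j \<le> s i}" using x by (simp add: permutes_inverses(1)[OF s])
      qed
    qed
    also have "card (inv s ` {1..s i}) = s i"
      using permutes_inj[OF permutes_inv[OF s]] by (simp add: card_image inj_on_subset)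
    finally show ?thesis using rank_card[OF True] by simp
  next
    case False
    then show ?thesis using permutes_not_in[OF s] rank_outside by simp
  qed
qed

text \<open>\<open>rank\<close> sends each index to its place in the nonincreasing rearrangement,
  with ties in index order; reading b along the inverse therefore lists the same multiset in
  decreasing order.\<close>

lemma plus_part_eq:
  assumes k: "k \<in> {1..N}"
  shows "plus_part N b k = b (inv (rank N b) k)"
proof -
  let ?r = "rank N b"
  note r = rank_permutes[of N b]
  define ys where "ys = map (\<lambda>k. b (inv ?r k)) [1..<N + 1]"
  have "image_mset (inv ?r) (mset_set {1..N}) = mset_set {1..N}"
    using permutes_inj[OF permutes_inv[OF r]] permutes_image[OF permutes_inv[OF r]]
    by (subst image_mset_mset_set) (auto intro: inj_on_subset)
  then have "image_mset (\<lambda>k. b (inv ?r k)) (mset_set {1..N}) = image_mset b (mset_set {1..N})"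
    by (metis (no_types, lifting) comp_def image_mset.compositionality image_mset_cong)
  moreover have "mset [1..<N + 1] = mset_set {1..N}"
    unfolding mset_upt by (rule arg_cong[where f = mset_set]) auto
  ultimately have m: "mset (rev ys) = mset (map b [1..<N + 1])"
    by (simp only: mset_rev mset_map ys_def)
  have len: "length ys = N" by (simp add: ys_def del: upt_Suc)
  have nth: "ys ! i = b (inv ?r (Suc i))" if "i < N" for i
    using that by (simp add: ys_def nth_map_upt del: upt_Suc)
  have "sorted (rev ys)"
    unfolding sorted_rev_iff_nth_mono
  proof (intro allI impI)
    fix i j assume ij: "i \<le> j" "j < length ys"
    let ?i = "inv ?r (Suc i)" and ?j = "inv ?r (Suc j)"
    have "Suc i \<in> {1..N}" "Suc j \<in> {1..N}" using ij len by auto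
    then have "?i \<in> {1..N}" "?j \<in> {1..N}" using permutes_in_image[OF permutes_inv[OF r]] by blast+
    from rank_le_iff[OF this, of b] ij have "b ?j \<le> b ?i"
      by (auto simp: permutes_inverses(1)[OF r])
    then show "ys ! j \<le> ys ! i" using ij by (simp add: nth len)
  qed
  then have "sort (map b [1..<N + 1]) = rev ys" by (intro properties_for_sort m)
  moreover have "ys ! (k - 1) = b (inv ?r k)" using k nth[of "k - 1"] by (cases k) auto
  ultimately show ?thesis using k unfolding plus_part_def by (simp del: upt_Suc)
qed

lemma plus_part_outside: "k \<notin> {1..N} \<Longrightarrow> plus_part N b k = 0"
  by (auto simp: plus_part_def)

lemma plus_part_rank:
  assumes "i \<in> {1..N}" shows "plus_part N b (rank N b i) = b i"
proof -
  have "rank N b i \<in> {1..N}" using permutes_in_image[OF rank_permutes] assms by blast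
  then show ?thesis using plus_part_eq permutes_inverses(2)[OF rank_permutes] by simp
qed

lemma plus_part_antimono:
  assumes "k \<in> {1..N}" "l \<in> {1..N}" "k \<le> l"
  shows "plus_part N b l \<le> plus_part N b k"
proof -
  note r = rank_permutes[of N b]
  have "inv (rank N b) k \<in> {1..N}" "inv (rank N b) l \<in> {1..N}"
    using permutes_in_image[OF permutes_inv[OF r]] assms by blast+
  from rank_le_iff[OF this, of b] assms show ?thesis
    by (auto simp: permutes_inverses(1)[OF r] plus_part_eq)
qed

lemma sum_plus_part: "(\<Sum>i=1..N. f (plus_part N b i)) = (\<Sum>i=1..N. f (b i))"
proof -
  have "(\<Sum>i=1..N. f (b i)) = (\<Sum>i=1..N. f (plus_part N b (rank N b i)))"
    by (intro sum.cong) (auto simp: plus_part_rank)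
  also have "\<dots> = (\<Sum>i=1..N. f (plus_part N b i))"
    by (rule sum.reindex_bij_betw[OF permutes_imp_bij[OF rank_permutes]])
  finally show ?thesis by simp
qed

lemma plus_part_comp:
  assumes "w permutes {1..N}" shows "plus_part N (a \<circ> w) = plus_part N a"
proof -
  have "image_mset w (mset_set {1..N}) = mset_set {1..N}"
    using permutes_inj[OF assms] permutes_image[OF assms]
    by (subst image_mset_mset_set) (auto intro: inj_on_subset)
  then have "image_mset (a \<circ> w) (mset_set {1..N}) = image_mset a (mset_set {1..N})"
    by (metis image_mset.compositionality)
  moreover have "mset [1..<N + 1] = mset_set {1..N}"
    unfolding mset_upt by (rule arg_cong[where f = mset_set]) auto
  ultimately have "mset (map (a \<circ> w) [1..<N + 1]) = mset (map a [1..<N + 1])"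
    by (simp only: mset_map)
  then have "sort (map (a \<circ> w) [1..<N + 1]) = sort (map a [1..<N + 1])"
    by (intro properties_for_sort) auto
  then show ?thesis by (simp only: plus_part_def)
qed

text \<open>Dominance of partial sums follows from the hinge sums, in the form
  \<open>\<Sum>i\<le>k. a\<^sup>+ i = k t + \<Sum>i. (a i - t)\<close> for \<open>t = a\<^sup>+ k\<close>, with truncated subtraction.\<close>
lemma plus_part_dominance:
  assumes hinge: "\<And>t. (\<Sum>i=1..N. b i - t) \<le> (\<Sum>i=1..N. a i - t)" and k: "k \<in> {1..N}"
  shows "(\<Sum>i=1..k. plus_part N b i) \<le> (\<Sum>i=1..k. plus_part N a i)"
proof -
  define t where "t = plus_part N a k"
  have "(\<Sum>i=1..k. plus_part N b i) \<le> (\<Sum>i=1..k. t + (plus_part N b i - t))"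
    by (intro sum_mono) auto
  also have "\<dots> = k * t + (\<Sum>i=1..k. plus_part N b i - t)" by (simp add: sum.distrib)
  also have "(\<Sum>i=1..k. plus_part N b i - t) \<le> (\<Sum>i=1..N. plus_part N b i - t)"
    using k by (intro sum_mono2) auto
  also have "\<dots> \<le> (\<Sum>i=1..N. plus_part N a i - t)"
    using hinge[of t] sum_plus_part[of "\<lambda>x. x - t" N] by simp
  also have "\<dots> = (\<Sum>i=1..k. plus_part N a i - t)"
    using k plus_part_antimono[of k N _ a] by (intro sum.mono_neutral_right) (auto simp: t_def)
  also have "k * t + (\<Sum>i=1..k. plus_part N a i - t) = (\<Sum>i=1..k. t + (plus_part N a i - t))"
    by (simp add: sum.distrib)
  also have "\<dots> = (\<Sum>i=1..k. plus_part N a i)"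
    using k plus_part_antimono[of _ N k a] by (intro sum.cong) (auto simp: t_def)
  finally show ?thesis by simp
qed

text \<open>Moving two exponents towards each other with fixed sum lowers every hinge sum weakly and
  one of them strictly, so the rearrangement descends in dominance.\<close>

lemma tri_less_between:
  assumes ij: "i \<in> {1..N}" "j \<in> {1..N}" "i \<noteq> j"
    and eq: "\<And>k. k \<noteq> i \<Longrightarrow> k \<noteq> j \<Longrightarrow> b k = a k" and s: "b i + b j = a i + a j"
    and lt: "max (b i) (b j) < max (a i) (a j)"
  shows "tri_less N b a"
proof -
  have split: "(\<Sum>k=1..N. f k) = f i + f j + (\<Sum>k\<in>{1..N} - {i} - {j}. f k)" for f :: "nat \<Rightarrow> nat"
    using ij sum.remove[of "{1..N}" i f] sum.remove[of "{1..N} - {i}" j f] by simp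
  have same: "(\<Sum>k\<in>{1..N} - {i} - {j}. f (b k)) = (\<Sum>k\<in>{1..N} - {i} - {j}. f (a k))" for f :: "nat \<Rightarrow> nat"
    using eq by (intro sum.cong) auto
  have "(\<Sum>k=1..N. b k) = (\<Sum>k=1..N. a k)" unfolding split same[of "\<lambda>x. x"] using s by simp
  moreover have "(\<Sum>k=1..N. b k - t) \<le> (\<Sum>k=1..N. a k - t)" for t
    unfolding split same[of "\<lambda>x. x - t"] using s lt by (auto simp: max_def split: if_splits)
  moreover have "plus_part N b \<noteq> plus_part N a"
  proof
    \<comment> \<open>At this level the contribution of i and j to the hinge sum of b vanishes while
      that of a does not.\<close>
    define t where "t = max (b i) (b j)"
    assume "plus_part N b = plus_part N a"
    then have "(\<Sum>k=1..N. b k - t) = (\<Sum>k=1..N. a k - t)"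
      using sum_plus_part[of "\<lambda>x. x - t" N] by metis
    then have "b i - t + (b j - t) = a i - t + (a j - t)" unfolding split same[of "\<lambda>x. x - t"] by simp
    then show False using lt by (auto simp: t_def max_def split: if_splits)
  qed
  ultimately show ?thesis
    unfolding tri_less_def dprec_def using plus_part_dominance by blast
qed

lemma tri_less_swap:
  assumes ij: "i \<in> {1..N}" "j \<in> {1..N}" "i < j" and lt: "b i < b j"
  shows "tri_less N b (b \<circ> transpose i j)"
proof -
  let ?w = "transpose i j"
  have w: "?w permutes {1..N}" using ij by (blast intro: permutes_swap_id)
  have part: "(\<Sum>l=1..k. b l) \<le> (\<Sum>l=1..k. (b \<circ> ?w) l)" if k: "k \<in> {1..N}" for k
  proof (cases "i \<le> k \<and> k < j")
    case True
    then have i: "i \<in> {1..k}" "j \<notin> {1..k}" using ij by auto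
    have "(\<Sum>l\<in>{1..k} - {i}. (b \<circ> ?w) l) = (\<Sum>l\<in>{1..k} - {i}. b l)"
      using i by (intro sum.cong) (auto simp: transpose_def)
    then show ?thesis
      using i lt sum.remove[of "{1..k}" i b] sum.remove[of "{1..k}" i "b \<circ> ?w"] by simp
  next
    case False
    then have "i \<in> {1..k} \<longleftrightarrow> j \<in> {1..k}" using ij by auto
    then have "bij_betw ?w {1..k} {1..k}" by (simp add: bij_betw_transpose_iff transpose_image_eq)
    from sum.reindex_bij_betw[OF this, of b] show ?thesis by simp
  qed
  have "b \<noteq> b \<circ> ?w"
  proof
    assume "b = b \<circ> ?w"
    then have "b i = (b \<circ> ?w) i" by simp
    then show False using lt by simp
  qed
  moreover have "(\<Sum>l=1..N. b l) = (\<Sum>l=1..N. (b \<circ> ?w) l)"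
    using sum.reindex_bij_betw[OF permutes_imp_bij[OF w], of b] by simp
  ultimately show ?thesis unfolding tri_less_def dprec_def using plus_part_comp[OF w] part by simp
qed

text \<open>A strict comparison in \<open>dprec\<close> raises this number strictly. It thus
  linearises the order and yields asymmetry, maximal elements and well-foundedness without further
  combinatorics.\<close>

definition psum_total :: "nat \<Rightarrow> mono \<Rightarrow> nat" where
  "psum_total N f = (\<Sum>k=1..N. \<Sum>i=1..k. f i)"

lemma dprec_total:
  assumes "dprec N f g" "\<And>i. i \<notin> {1..N} \<Longrightarrow> f i = g i"
  shows "psum_total N f < psum_total N g"
proof -
  have le: "\<And>k. k \<in> {1..N} \<Longrightarrow> (\<Sum>i=1..k. f i) \<le> (\<Sum>i=1..k. g i)" and ne: "f \<noteq> g"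
    using assms(1) by (auto simp: dprec_def)
  have "\<exists>k\<in>{1..N}. (\<Sum>i=1..k. f i) < (\<Sum>i=1..k. g i)"
  proof (rule ccontr)
    assume neg: "\<not> ?thesis"
    have eq: "(\<Sum>i=1..k. f i) = (\<Sum>i=1..k. g i)" if "k \<in> {1..N}" for k
      using neg that le[OF that] le_neq_implies_less by blast
    have "f k = g k" for k
    proof (cases "k \<in> {1..N}")
      case True
      then obtain m where m: "k = Suc m" by (cases k) auto
      have "(\<Sum>i=1..m. f i) = (\<Sum>i=1..m. g i)" using eq[of m] True m by (cases m) auto
      then show ?thesis using eq[OF True] m by simp
    qed (rule assms(2))
    with ne show False by auto
  qed
  with le show ?thesis unfolding psum_total_def by (intro sum_strict_mono_ex1) auto
qed

context young_module begin

abbreviation tri :: "mono \<Rightarrow> mono \<Rightarrow> bool" where "tri \<equiv> tri_less N"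

lemma mon_outside: "mon a \<Longrightarrow> i \<notin> {1..N} \<Longrightarrow> a i = 0"
  by (auto simp: mon_def)

lemma tri_total:
  assumes "tri b a" "mon b" "mon a"
  shows "psum_total N (plus_part N b) < psum_total N (plus_part N a) \<or>
    plus_part N b = plus_part N a \<and> psum_total N b < psum_total N a"
  using assms dprec_total[of N "plus_part N b" "plus_part N a"] dprec_total[of N b a]
  by (auto simp: tri_less_def plus_part_outside mon_outside)

lemma dprec_trans:
  assumes "dprec N c b" "dprec N b a" "\<And>i. i \<notin> {1..N} \<Longrightarrow> a i = 0 \<and> b i = 0 \<and> c i = 0"
  shows "dprec N c a"
proof -
  have "psum_total N c < psum_total N b" "psum_total N b < psum_total N a"
    using assms by (auto intro!: dprec_total)
  then have "c \<noteq> a" by auto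
  with assms show ?thesis unfolding dprec_def by (meson le_trans)
qed

lemma tri_trans:
  assumes "tri c b" "tri b a" "mon a" "mon b" "mon c"
  shows "tri c a"
  using assms dprec_trans[of c b a] dprec_trans[of "plus_part N c" "plus_part N b" "plus_part N a"]
  by (auto simp: tri_less_def plus_part_outside mon_outside)

lemma tri_asym:
  assumes "tri b a" "mon b" "mon a" shows "\<not> tri a b" "a \<noteq> b"
  using tri_total[OF assms] tri_total[of a b] assms by auto

lemma tri_maximal:
  assumes "finite X" "X \<noteq> {}" "\<And>b. b \<in> X \<Longrightarrow> mon b"
  obtains b where "b \<in> X" "\<And>g. g \<in> X \<Longrightarrow> \<not> tri b g"
proof -
  define f where "f b = psum_total N (plus_part N b)" for b
  have "Max (f ` X) \<in> f ` X" using assms by (intro Max_in) auto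
  then obtain b where b: "b \<in> X" "f b = Max (f ` X)" by auto
  define X2 where "X2 = {g \<in> X. f g = f b}"
  have X2: "finite X2" "X2 \<noteq> {}" using assms b by (auto simp: X2_def)
  have "Max (psum_total N ` X2) \<in> psum_total N ` X2" using X2 by (intro Max_in) auto
  then obtain c where c: "c \<in> X2" "psum_total N c = Max (psum_total N ` X2)" by auto
  have "\<not> tri c g" if g: "g \<in> X" for g
  proof
    assume t: "tri c g"
    have cX: "c \<in> X" "f c = f b" using c by (auto simp: X2_def)
    have "f g \<le> f b" using b g assms by (auto intro: Max_ge)
    with tri_total[OF t assms(3)[OF cX(1)] assms(3)[OF g]] cX
    have p: "plus_part N c = plus_part N g" "psum_total N c < psum_total N g" by (auto simp: f_def)
    then have "g \<in> X2" using g cX by (auto simp: X2_def f_def)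
    then have "psum_total N g \<le> psum_total N c" using c X2 by (auto intro: Max_ge)
    with p show False by simp
  qed
  with c show thesis using that by (auto simp: X2_def)
qed

end

section \<open>Triangularity of the Cherednik operators\<close>

context dunkl_operators begin

text \<open>Trades the correction over j < i for one over j > i. In this shape U_i differs from x_i
  D_i by elements of the group algebra, which serves both the triangularity argument and the
  comparison of self-adjointness.\<close>

lemma U_xD:
  assumes "P p" "i \<in> {1..N}"
  shows "U i p = xmul i (D i p) + p + pscale k' (\<Sum>j\<in>{i<..N}. act (transpose i j) p)"
proof -
  have e: "{1..N} - {i} = {1..<i} \<union> {i<..N}" using assms(2) by auto
  have "{1..<i} \<inter> {i<..N} = {}" by auto
  then have "(\<Sum>j\<in>{1..N} - {i}. act (transpose i j) p) =
    (\<Sum>j\<in>{1..<i}. act (transpose i j) p) + (\<Sum>j\<in>{i<..N}. act (transpose i j) p)"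
    unfolding e by (rule sum.union_disjoint[OF finite_atLeastLessThan finite_greaterThanAtMost])
  then show ?thesis unfolding U_eq D_xmul_same[OF assms] by (simp add: pscale_add)
qed

text \<open>A monomial a contributing at b agrees with b outside i, j and has the same sum there.
  Since no support monomial dominates b, its two exponents are spread no wider than those of b;
  being an end of the string of a, b must be a or its swap.\<close>

lemma xmul_divdiff_leading:
  assumes p: "P p" and ij: "i \<in> {1..N}" "j \<in> {1..N}" "i \<noteq> j"
    and top: "\<And>g. g \<in> psupp p \<Longrightarrow> \<not> tri b g"
  shows "xmul i (divdiff i j p) b = (if b j < b i then p b - p (b \<circ> transpose i j) else 0)"
proof (intro ext)
  fix T
  let ?b = "b \<circ> transpose i j"
  show "xmul i (divdiff i j p) b T = (if b j < b i then p b - p ?b else 0) T"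
  proof (cases "b i = 0")
    case True
    then show ?thesis by (simp add: xmul_def fun_pointwise)
  next
    case False
    have fin: "finite (psupp p \<union> {b, ?b})" using P_finite[OF p] by simp
    have "ddcoef i j a (b(i := b i - 1)) * p a T =
      (if b j < b i then (if a = b then p a T else 0) - (if a = ?b then p a T else 0) else 0)" for a
    proof (cases "p a T = 0")
      case nz: False
      then have nt: "\<not> tri b a" using top by (auto simp: psupp_def)
      show ?thesis
      proof (cases "(\<forall>k. k \<noteq> i \<and> k \<noteq> j \<longrightarrow> b k = a k) \<and> b i + b j = a i + a j")
        case True
        have ab: "a = b \<longleftrightarrow> a j = b j"
        proof
          assume j: "a j = b j"
          show "a = b"
          proof
            fix k show "a k = b k" using True j by (cases "k = i"; cases "k = j") auto
          qed
        qed simp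
        have ab': "a = ?b \<longleftrightarrow> a j = b i"
        proof
          assume j: "a j = b i"
          show "a = ?b"
          proof
            fix k show "a k = ?b k" using True j ij by (cases "k = i"; cases "k = j") auto
          qed
        qed (use ij in simp)
        have "\<not> max (b i) (b j) < max (a i) (a j)"
          using tri_less_between[OF ij, of b a] True nt by auto
        then have le: "a i \<le> max (b i) (b j)" "a j \<le> max (b i) (b j)" by auto
        have s: "b i + b j = a i + a j" using True by simp
        have dd: "ddcoef i j a (b(i := b i - 1)) =
           (if a j \<le> b j \<and> b j < a i then 1 else if a i \<le> b i - 1 \<and> b i - 1 < a j then - 1 else 0)"
          unfolding ddcoef_eq[OF ij(3)] using True ij False by auto
        show ?thesis unfolding dd ab ab' using s le False by (auto simp: max_def split: if_splits)
      next
        case no: False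
        have "a \<noteq> b" using no by auto
        moreover have "a \<noteq> ?b"
        proof
          assume "a = ?b"
          then have "\<And>k. a k = b (transpose i j k)" by simp
          then show False using no by (auto simp: add.commute)
        qed
        moreover have "ddcoef i j a (b(i := b i - 1)) = 0"
          using no False ij by (auto simp: ddcoef_eq)
        ultimately show ?thesis by simp
      qed
    qed auto
    then have "xmul i (divdiff i j p) b T = (\<Sum>a\<in>psupp p \<union> {b, ?b}.
      (if b j < b i then (if a = b then p a T else 0) - (if a = ?b then p a T else 0) else 0))"
      using False psupp_finite_sum[OF fin Un_upper1] by (simp add: xmul_def)
    also have "\<dots> = (if b j < b i then p b - p ?b else 0) T"
      using fin by (simp add: sum_subtractf fun_pointwise)
    finally show ?thesis .
  qed
qed

text \<open>At a maximal monomial the terms with swapped exponents either vanish, because the swap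
  would dominate b, or cancel between x_i D_i and the correction sum, or coincide with b on ties.
  What is left are exactly the transpositions with indices of later rank.\<close>

lemma U_leading:
  assumes p: "P p" and i: "i \<in> {1..N}"
    and top: "\<And>g. g \<in> psupp p \<Longrightarrow> \<not> tri b g"
  shows "U i p b T = (of_nat (b i) + 1) * p b T
    + k' * (\<Sum>j\<in>{j \<in> {1..N}. rank N b i < rank N b j}. vact (transpose i j) (p b) T)"
proof -
  let ?p = "\<lambda>j. p (b \<circ> transpose i j)"
  have zero: "?p j = 0" if "j \<in> {1..N}" "(i < j \<and> b i < b j) \<or> (j < i \<and> b j < b i)" for j
  proof -
    have "tri b (b \<circ> transpose i j)"
      using that tri_less_swap[of i N j b] tri_less_swap[of j N i b] i by (auto simp: transpose_commute)
    then have "b \<circ> transpose i j \<notin> psupp p" using top by blast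
    then show ?thesis by (auto simp: psupp_def fun_eq_iff fun_pointwise)
  qed
  have comm: "vmap w (xmul i q) b T = vact w (xmul i q b) T" for w q by (simp add: vmap_def)
  have D: "xmul i (D i p) b T = of_nat (b i) * p b T
     + k' * (\<Sum>j\<in>{1..N} - {i}. vact (transpose i j) (if b j < b i then p b - ?p j else 0) T)"
  proof -
    have "xmul i (D i p) = xmul i (pdiff i p)
      + pscale k' (\<Sum>j\<in>{1..N} - {i}. xmul i (vmap (transpose i j) (divdiff i j p)))"
      by (simp add: D_eq xmul_add xmul_pscale xmul_sum)
    then have "xmul i (D i p) b T = xmul i (pdiff i p) b T
      + k' * (\<Sum>j\<in>{1..N} - {i}. xmul i (vmap (transpose i j) (divdiff i j p)) b T)"
      by (simp add: fun_pointwise sum_fun_apply pscale_def)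
    also have "xmul i (pdiff i p) b T = of_nat (b i) * p b T"
      by (cases "b i") (auto simp: xmul_def pdiff_def fun_upd_idem)
    also have "(\<Sum>j\<in>{1..N} - {i}. xmul i (vmap (transpose i j) (divdiff i j p)) b T) =
       (\<Sum>j\<in>{1..N} - {i}. vact (transpose i j) (if b j < b i then p b - ?p j else 0) T)"
    proof (rule sum.cong[OF refl])
      fix j assume "j \<in> {1..N} - {i}"
      then have "xmul i (divdiff i j p) b = (if b j < b i then p b - ?p j else 0)"
        using xmul_divdiff_leading[OF p i _ _ top, of j] by auto
      then show "xmul i (vmap (transpose i j) (divdiff i j p)) b T =
          vact (transpose i j) (if b j < b i then p b - ?p j else 0) T"
        unfolding vmap_xmul[symmetric] comm by simp
    qed
    finally show ?thesis .
  qed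
  have v0: "vact w 0 = 0" for w by (simp add: vact_def fun_eq_iff fun_pointwise)
  have "U i p b T = (of_nat (b i) + 1) * p b T
    + k' * ((\<Sum>j\<in>{1..N} - {i}. vact (transpose i j) (if b j < b i then p b - ?p j else 0) T)
       + (\<Sum>j\<in>{1..N} - {i}. if i < j then vact (transpose i j) (?p j) T else 0))"
  proof -
    have "(\<Sum>j\<in>{i<..N}. act (transpose i j) p) b T =
        (\<Sum>j\<in>{i<..N}. if i < j then vact (transpose i j) (?p j) T else 0)"
      by (simp add: sum_fun_apply act_apply)
    also have "\<dots> = (\<Sum>j\<in>{1..N} - {i}. if i < j then vact (transpose i j) (?p j) T else 0)"
      using i by (intro sum.mono_neutral_left) auto
    finally show ?thesis unfolding U_xD[OF p i]
      by (simp add: fun_pointwise D pscale_def algebra_simps)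
  qed
  also have "(\<Sum>j\<in>{1..N} - {i}. vact (transpose i j) (if b j < b i then p b - ?p j else 0) T)
       + (\<Sum>j\<in>{1..N} - {i}. if i < j then vact (transpose i j) (?p j) T else 0)
     = (\<Sum>j\<in>{1..N} - {i}. if rank N b i < rank N b j then vact (transpose i j) (p b) T else 0)"
    unfolding sum.distrib[symmetric]
  proof (rule sum.cong[OF refl])
    fix j assume j: "j \<in> {1..N} - {i}"
    then have rk: "rank N b i < rank N b j \<longleftrightarrow> b j < b i \<or> (b i = b j \<and> i < j)"
      using rank_le_iff[of j N i b] i by auto
    have d: "vact (transpose i j) (p b - ?p j) T = vact (transpose i j) (p b) T - vact (transpose i j) (?p j) T"
      by (simp add: vact_def fun_pointwise algebra_simps sum_subtractf)
    have sym: "b \<circ> transpose i j = b" if "b i = b j"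
      using that by (auto simp: fun_eq_iff transpose_def)
    consider "b j < b i" | "b i < b j" | "b i = b j" by linarith
    then show "vact (transpose i j) (if b j < b i then p b - ?p j else 0) T
        + (if i < j then vact (transpose i j) (?p j) T else 0)
      = (if rank N b i < rank N b j then vact (transpose i j) (p b) T else 0)"
    proof cases
      case 1
      then show ?thesis using zero[of j] j rk by (cases "i < j") (auto simp: d v0 fun_pointwise)
    next
      case 2
      then show ?thesis using zero[of j] j rk by (auto simp: v0 fun_pointwise)
    next
      case 3
      then show ?thesis using sym[OF 3] rk by (auto simp: v0 fun_pointwise)
    qed
  qed
  also have "\<dots> = (\<Sum>j\<in>{j \<in> {1..N}. rank N b i < rank N b j}. vact (transpose i j) (p b) T)"
    by (intro sum.mono_neutral_cong_right) auto
  finally show ?thesis .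
qed

end

section \<open>Joint eigenvectors and the polynomials zeta\<close>

locale dunkl_small = dunkl_operators +
  assumes kappa_small: "\<bar>kappa\<bar> * real (tau ! 0 + length tau - 1) < 1"
begin

definition spec :: "mono \<Rightarrow> (nat \<Rightarrow> int) \<Rightarrow> nat \<Rightarrow> real" where
  "spec a c i = real (a i) + 1 + kappa * real_of_int (c i)"

definition eig :: "vpoly \<Rightarrow> (nat \<Rightarrow> real) \<Rightarrow> bool" where
  "eig p z \<longleftrightarrow> P p \<and> (\<forall>i\<in>{1..N}. U i p = pscale (complex_of_real (z i)) p)"

lemma eig_cong: "eig p z \<Longrightarrow> (\<And>i. i \<in> {1..N} \<Longrightarrow> z i = z' i) \<Longrightarrow> eig p z'"
  by (simp add: eig_def)

text \<open>Only the range of the numbers is recorded, not that they come from a tableau: exchanging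
  two contents of T may give a vector belonging to no standard tableau, and such eigenvectors must
  be shown to vanish.\<close>

definition content_range :: "(nat \<Rightarrow> int) \<Rightarrow> bool" where
  "content_range c \<longleftrightarrow> (\<forall>i\<in>{1..N}. 1 - int (length tau) \<le> c i \<and> c i \<le> int (tau ! 0) - 1)"

abbreviation rk :: "mono \<Rightarrow> nat \<Rightarrow> nat" where "rk \<equiv> rank N"

abbreviation rcont :: "mono \<Rightarrow> tab \<Rightarrow> nat \<Rightarrow> int" where
  "rcont a T i \<equiv> content tau T (rk a i)"

text \<open>Contents differ by at most h - 1 with h = tau_1 + l(tau) - 1, which leaves room for a
  shift by one in either direction. The shifted versions control the numerators gap +
  \<open>kappa\<close> and gap - \<open>kappa\<close>.\<close>

lemma kappa_diff_small:
  assumes "1 - int (length tau) \<le> x" "x \<le> int (tau ! 0) - 1"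
    and "1 - int (length tau) \<le> y" "y \<le> int (tau ! 0) - 1"
  shows "\<bar>kappa * real_of_int (x - y)\<bar> < 1" "\<bar>kappa * real_of_int (x - y + 1)\<bar> < 1"
    "\<bar>kappa * real_of_int (x - y - 1)\<bar> < 1"
proof -
  let ?h = "real (tau ! 0 + length tau - 1)"
  have *: "\<bar>kappa * real_of_int d\<bar> < 1" if "\<bar>d\<bar> \<le> int (tau ! 0 + length tau - 1)" for d
  proof -
    have "\<bar>kappa * real_of_int d\<bar> = \<bar>kappa\<bar> * \<bar>real_of_int d\<bar>" by (simp add: abs_mult)
    also have "\<dots> \<le> \<bar>kappa\<bar> * ?h" using that by (intro mult_left_mono) linarith+
    finally show ?thesis using kappa_small by simp
  qed
  show "\<bar>kappa * real_of_int (x - y)\<bar> < 1" "\<bar>kappa * real_of_int (x - y + 1)\<bar> < 1"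
    "\<bar>kappa * real_of_int (x - y - 1)\<bar> < 1"
    by (rule *, use assms in linarith)+
qed

lemma content_bounds:
  assumes "T \<in> Y" "k \<in> {1..N}"
  shows "1 - int (length tau) \<le> content tau T k" "content tau T k \<le> int (tau ! 0) - 1"
  using cont_bounds[OF pos_in(1)[OF filling_RSYT[OF assms(1)] assms(2)]] by (auto simp: content_eq)

lemma rk_in: "i \<in> {1..N} \<Longrightarrow> rk a i \<in> {1..N}"
  using permutes_in_image[OF rank_permutes] by blast

lemma content_range_rcont: "T \<in> Y \<Longrightarrow> content_range (rcont a T)"
  using content_bounds rk_in by (auto simp: content_range_def simp del: atLeastAtMost_iff)

lemma spec_eq_imp:
  assumes "real m + kappa * real_of_int x = real n + kappa * real_of_int y"
    and "\<bar>kappa * real_of_int (x - y)\<bar> < 1"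
  shows "m = n"
proof -
  have "real n - real m = kappa * real_of_int (x - y)" using assms(1) by (simp add: algebra_simps)
  then have "\<bar>real n - real m\<bar> < 1" using assms(2) by simp
  then show ?thesis by linarith
qed

text \<open>At a maximal monomial b the operator U_i acts on the leading coefficient as b_i + 1 plus
  \<open>kappa\<close> times a Jucys-Murphy element, after relabelling by rank. Comparing with the
  prescribed eigenvalue at one nonzero coordinate gives an integer equal to a number of absolute
  value below 1, so the exponents coincide.\<close>

lemma eig_leading:
  assumes e: "eig p (spec a c)" and c: "content_range c" and ab: "mon a" "mon b"
    and b: "b \<in> psupp p" and top: "\<And>g. g \<in> psupp p \<Longrightarrow> \<not> tri b g"
  shows "b = a"
proof -
  have p: "P p" using e by (simp add: eig_def)
  let ?r = "rank N b"
  note r = rank_permutes[of N b]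
  \<comment> \<open>Undoing the rank permutation turns the transpositions (i, j) with j of later
    rank into those of a Jucys-Murphy sum.\<close>
  define u where "u = vact ?r (p b)"
  have uV: "u \<in> V" unfolding u_def by (rule vact_in_V)
  have pu: "p b = vact (inv ?r) u"
    unfolding u_def using vact_inv(2)[OF r P_V[OF p]] by simp
  have "\<exists>T. u T \<noteq> 0"
  proof (rule ccontr)
    assume "\<not> ?thesis"
    then have "p b T = 0" for T by (simp add: pu vact_def)
    then show False using b by (auto simp: psupp_def)
  qed
  then obtain T where uT: "u T \<noteq> 0" by blast
  then have TY: "T \<in> Y" using uV by (auto simp: V_def)
  have "a i = b i" if i: "i \<in> {1..N}" for i
  proof -
    let ?J = "{j \<in> {1..N}. ?r i < ?r j}"
    have "(\<lambda>T. complex_of_real (spec a c i) * p b T) = (\<lambda>T. (of_nat (b i) + 1) * p b T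
        + k' * (\<Sum>j\<in>?J. vact (transpose i j) (p b) T))"
    proof
      fix T
      have "U i p b T = complex_of_real (spec a c i) * p b T"
        using e i by (simp add: eig_def pscale_def)
      then show "complex_of_real (spec a c i) * p b T = (of_nat (b i) + 1) * p b T
        + k' * (\<Sum>j\<in>?J. vact (transpose i j) (p b) T)"
        using U_leading[OF p i top, of T] by simp
    qed
    then have "vact ?r (\<lambda>T. complex_of_real (spec a c i) * p b T) T = vact ?r (\<lambda>T. (of_nat (b i) + 1) * p b T
        + k' * (\<Sum>j\<in>?J. vact (transpose i j) (p b) T)) T" by simp
    then have "complex_of_real (spec a c i) * u T = (of_nat (b i) + 1) * u T
        + k' * (\<Sum>j\<in>?J. vact ?r (vact (transpose i j) (p b)) T)"
      by (simp add: vact_add vact_scale vact_sum u_def)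
    also have "(\<Sum>j\<in>?J. vact ?r (vact (transpose i j) (p b)) T) = (\<Sum>j\<in>?J. vact (transpose (?r i) (?r j)) u T)"
    proof (rule sum.cong[OF refl])
      fix j assume "j \<in> ?J"
      then have j: "j \<in> {1..N}" by simp
      have t: "transpose i j permutes {1..N}" "transpose (?r i) (?r j) permutes {1..N}"
        using i j rk_in by (blast intro: permutes_swap_id)+
      have "vact (?r \<circ> transpose i j) (p b) = vact (transpose (?r i) (?r j) \<circ> ?r) (p b)"
        by (simp only: comp_transpose_conj[OF permutes_inj[OF r]])
      then show "vact ?r (vact (transpose i j) (p b)) T = vact (transpose (?r i) (?r j)) u T"
        by (simp only: vact_comp[OF r t(1)] vact_comp[OF t(2) r] u_def)
    qed
    also have "\<dots> = (\<Sum>l\<in>{?r i<..N}. vact (transpose (?r i) l) u T)"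
    proof (rule sum.reindex_bij_betw)
      show "bij_betw ?r ?J {?r i<..N}"
      proof (rule bij_betw_imageI)
        show "inj_on ?r ?J" using permutes_inj[OF r] by (auto intro: inj_on_subset)
        show "?r ` ?J = {?r i<..N}"
        proof
          show "?r ` ?J \<subseteq> {?r i<..N}"
          proof
            fix l assume "l \<in> ?r ` ?J"
            then obtain j where "l = ?r j" "j \<in> {1..N}" "?r i < ?r j" by blast
            then show "l \<in> {?r i<..N}" using rk_in[of j b] by auto
          qed
          show "{?r i<..N} \<subseteq> ?r ` ?J"
          proof
            fix l assume l: "l \<in> {?r i<..N}"
            then have "l \<in> {1..N}" by auto
            then have "inv ?r l \<in> {1..N}" using permutes_in_image[OF permutes_inv[OF r]] by blast
            with l show "l \<in> ?r ` ?J"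
              by (intro image_eqI[of _ _ "inv ?r l"]) (auto simp: permutes_inverses(1)[OF r])
          qed
        qed
      qed
    qed
    also have "\<dots> = of_int (content tau T (?r i)) * u T"
      by (rule jucys_murphy[OF uV TY rk_in[OF i]])
    finally have "complex_of_real (spec a c i) * u T =
       complex_of_real (spec b (rcont b T) i) * u T"
      by (simp add: spec_def algebra_simps)
    then have "spec a c i = spec b (rcont b T) i" using uT by (simp only: mult_cancel_right of_real_eq_iff) simp
    moreover have "\<bar>kappa * real_of_int (c i - rcont b T i)\<bar> < 1"
      using c i content_bounds[OF TY rk_in[OF i]] by (intro kappa_diff_small) (auto simp: content_range_def)
    ultimately show ?thesis by (intro spec_eq_imp[of "a i" "c i" "b i" "rcont b T i"]) (simp_all add: spec_def)
  qed
  then show ?thesis using mon_outside[OF ab(1)] mon_outside[OF ab(2)] by (intro ext) metis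
qed

text \<open>A nonzero eigenvector has a maximal monomial in its support, and
  \<open>eig_leading\<close> identifies it with a.\<close>

lemma eig_zero:
  assumes e: "eig p (spec a c)" and c: "content_range c" and a: "mon a" and 0: "p a = 0"
  shows "p = 0"
proof (rule ccontr)
  assume "p \<noteq> 0"
  then have "psupp p \<noteq> {}" by (auto simp: psupp_def fun_eq_iff fun_pointwise)
  moreover have p: "P p" using e by (simp add: eig_def)
  moreover have "\<And>b. b \<in> psupp p \<Longrightarrow> mon b" using p by (simp add: in_P_iff)
  ultimately obtain b where b: "b \<in> psupp p" "\<And>g. g \<in> psupp p \<Longrightarrow> \<not> tri b g" "mon b"
    using tri_maximal[OF P_finite[OF p]] by metis
  have "b = a" by (rule eig_leading[OF e c a b(3,1,2)])
  then show False using b(1) 0 by (auto simp: psupp_def fun_pointwise)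
qed

text \<open>The affine step does not preserve the order \<open>tri\<close>, so the support of zeta is read off from
  the triangularity of \<open>U\<close> and not by following the steps of the construction.\<close>
lemma eig_support:
  assumes e: "eig p (spec a c)" and c: "content_range c" and a: "mon a" and b: "p b T \<noteq> 0"
  shows "b = a \<or> tri b a"
proof (rule ccontr)
  assume neg: "\<not> ?thesis"
  define X where "X = {b \<in> psupp p. b \<noteq> a \<and> \<not> tri b a}"
  have p: "P p" using e by (simp add: eig_def)
  have mon: "\<And>b. b \<in> psupp p \<Longrightarrow> mon b" using p by (simp add: in_P_iff)
  have "b \<in> X" using neg b by (auto simp: X_def psupp_def)
  moreover have "finite X" using P_finite[OF p] by (simp add: X_def)
  ultimately obtain b where b: "b \<in> X" "\<And>g. g \<in> X \<Longrightarrow> \<not> tri b g"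
    using tri_maximal[of X] mon by (auto simp: X_def)
  have bs: "b \<in> psupp p" using b(1) by (simp add: X_def)
  have "\<not> tri b g" if g: "g \<in> psupp p" for g
  proof
    assume t: "tri b g"
    have "g \<notin> X" using b(2) t by blast
    then have "g = a \<or> tri g a" using g by (auto simp: X_def)
    then have "tri b a" using t tri_trans[OF t _ a mon[OF g] mon[OF bs]] by auto
    then show False using b(1) by (simp add: X_def)
  qed
  from eig_leading[OF e c a mon[OF bs] bs this] show False using b(1) by (simp add: X_def)
qed

lemma eig_diff: "eig p z \<Longrightarrow> eig q z \<Longrightarrow> eig (p - q) z"
  by (simp add: eig_def P_diff U_diff pscale_diff)

lemma eig_pscale: "eig p z \<Longrightarrow> eig (pscale c p) z"
  by (simp add: eig_def P_pscale U_pscale pscale_pscale mult.commute)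

lemma eig_unique:
  assumes "eig p (spec a c)" "eig q (spec a c)" "content_range c" "mon a" "p a = q a"
  shows "p = q"
proof -
  have "p - q = 0" by (rule eig_zero[OF eig_diff[OF assms(1,2)] assms(3,4)]) (simp add: assms(5) minus_apply)
  then show ?thesis by simp
qed

text \<open>Leading coefficient and eigenvalues are the data that both steps of the construction
  transport directly; the triangularity is recovered from \<open>eig_support\<close>.\<close>

definition is_zeta :: "mono \<Rightarrow> tab \<Rightarrow> vpoly \<Rightarrow> bool" where
  "is_zeta a T p \<longleftrightarrow> p a = vact (inv (rk a)) (unit T) \<and> eig p (spec a (rcont a T))"

text \<open>The number b is chosen so that b (z_k - z_(k+1)) cancels the inhomogeneous term of the
  Hecke relation. It is kept as a parameter because it is \<open>step_coef\<close> for different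
  exponents and 1/d for equal ones, where the equation also makes sense at \<open>kappa\<close> =
  0.\<close>

lemma eig_adj:
  assumes e: "eig p z" and k: "1 \<le> k" "k < N" and b: "kappa = b * (z k - z (Suc k))"
  shows "eig (act (adj k) p - pscale (complex_of_real b) p) (z \<circ> adj k)"
  unfolding eig_def
proof (intro conjI ballI)
  have p: "P p" using e by (simp add: eig_def)
  let ?q = "act (adj k) p"
  have q: "P ?q" using P_act[OF p adj_permutes[OF k]] .
  show "P (?q - pscale (complex_of_real b) p)" by (intro P_diff P_pscale p q)
  fix i assume i: "i \<in> {1..N}"
  have Up: "U i p = pscale (complex_of_real (z i)) p" if "i \<in> {1..N}" for i
    using e that by (simp add: eig_def)
  have kk: "k \<in> {1..N}" "Suc k \<in> {1..N}" using k by auto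
  have UD: "U i (?q - pscale (complex_of_real b) p) =
      U i ?q - pscale (complex_of_real (b * z i)) p"
    using p q i by (simp add: U_diff P_pscale U_pscale Up pscale_pscale)
  have b': "k' = complex_of_real b * (complex_of_real (z k) - complex_of_real (z (Suc k)))"
    by (subst b) simp
  consider "i = k" | "i = Suc k" | "i \<noteq> k" "i \<noteq> Suc k" by blast
  then show "U i (?q - pscale (complex_of_real b) p) =
      pscale (complex_of_real ((z \<circ> adj k) i)) (?q - pscale (complex_of_real b) p)"
  proof cases
    case 1
    show ?thesis unfolding UD unfolding 1 U_adj_lower[OF p k] Up[OF kk(2)] act_pscale b'
      by (simp add: pscale_def fun_eq_iff fun_pointwise algebra_simps)
  next
    case 2
    show ?thesis unfolding UD unfolding 2 U_adj_upper[OF p k] Up[OF kk(1)] act_pscale b'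
      by (simp add: pscale_def fun_eq_iff fun_pointwise algebra_simps)
  next
    case 3
    show ?thesis unfolding UD U_adj_other[OF p k i 3] Up[OF i] act_pscale using 3
      by (simp add: pscale_def fun_eq_iff fun_pointwise algebra_simps)
  qed
qed

lemma eig_Phi:
  assumes e: "eig p z"
  shows "eig (Phi p) (\<lambda>i. if i = N then z 1 + 1 else z (Suc i))"
  unfolding eig_def
proof (intro conjI ballI)
  have p: "P p" using e by (simp add: eig_def)
  show "P (Phi p)" using P_Phi[OF p] .
  fix i assume i: "i \<in> {1..N}"
  have Up: "U i p = pscale (complex_of_real (z i)) p" if "i \<in> {1..N}" for i
    using e that by (simp add: eig_def)
  show "U i (Phi p) = pscale (complex_of_real (if i = N then z 1 + 1 else z (Suc i))) (Phi p)"
  proof (cases "i = N")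
    case True
    then show ?thesis using U_Phi_last[OF p] Up[of 1] N2
      by (simp add: Phi_pscale pscale_left_add pscale_one)
  next
    case False
    then show ?thesis using U_Phi[OF p, of i] Up[of "Suc i"] i by (simp add: Phi_pscale)
  qed
qed

text \<open>The exponent of the leading monomial after the affine step: (a_2, ..., a_N, a_1 +
  1).\<close>

definition shift :: "mono \<Rightarrow> mono" where
  "shift a = (a \<circ> inv rot)(N := a 1 + 1)"

lemma inv_rot: "inv rot N = 1" "1 \<le> i \<Longrightarrow> i < N \<Longrightarrow> inv rot i = Suc i"
  using permutes_inv_eq[OF rot_permutes] by (auto simp: rot_def)

lemma mon_shift: "mon a \<Longrightarrow> mon (shift a)"
  unfolding shift_def using N2 mon_comp[OF permutes_inv[OF rot_permutes]] by (intro mon_upd) auto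

lemma shift_apply: "shift a N = a 1 + 1" "1 \<le> i \<Longrightarrow> i < N \<Longrightarrow> shift a i = a (Suc i)"
  by (auto simp: shift_def inv_rot)

text \<open>Standing last, a_1 + 1 beats entries equal to a_1 and loses ties against entries equal
  to a_1 + 1. These are the outcomes of a_1 standing first, so all comparisons are
  preserved.\<close>

lemma rank_shift: "rk (shift a) = rk a \<circ> inv rot"
proof (rule rank_eqI)
  show "rk a \<circ> inv rot permutes {1..N}"
    by (intro permutes_compose permutes_inv rot_permutes rank_permutes)
  fix i j assume i: "i \<in> {1..N}" and j: "j \<in> {1..N}"
  have "inv rot i \<in> {1..N}" "inv rot j \<in> {1..N}"
    using i j permutes_in_image[OF permutes_inv[OF rot_permutes]] by blast+
  note le = rank_le_iff[OF this(2,1), of a]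
  have ij: "i < N \<or> i = N" "j < N \<or> j = N" "1 \<le> i" "1 \<le> j" using i j by auto
  show "(rk a \<circ> inv rot) j \<le> (rk a \<circ> inv rot) i \<longleftrightarrow>
      shift a i < shift a j \<or> (shift a j = shift a i \<and> j \<le> i)"
    using ij le by (auto simp: inv_rot shift_apply)
qed

lemma is_zeta_Phi:
  assumes z: "is_zeta a T p"
  shows "is_zeta (shift a) T (Phi p)"
  unfolding is_zeta_def
proof
  have e: "eig p (spec a (rcont a T))" and pa: "p a = vact (inv (rk a)) (unit T)"
    using z by (auto simp: is_zeta_def)
  have p: "P p" using e by (simp add: eig_def)
  note r = rank_permutes[of N a] and ro = rot_permutes
  have "Phi p (shift a) = act rot p (a \<circ> inv rot)"
    by (simp add: Phi_def xmul_def shift_def fun_upd_idem inv_rot)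
  also have "\<dots> = vact rot (p a)"
    unfolding act_apply by (simp only: o_assoc[symmetric] permutes_inv_o(2)[OF ro] comp_id)
  also have "\<dots> = vact (rot \<circ> inv (rk a)) (unit T)"
    by (simp only: pa vact_comp[OF ro permutes_inv[OF r]])
  also have "rot \<circ> inv (rk a) = inv (rk a \<circ> inv rot)"
    using r ro by (simp add: o_inv_distrib permutes_bij bij_imp_bij_inv inv_inv_eq)
  finally show "Phi p (shift a) = vact (inv (rk (shift a))) (unit T)" by (simp only: rank_shift)
  have "eig (Phi p) (\<lambda>i. if i = N then spec a (rcont a T) 1 + 1 else spec a (rcont a T) (Suc i))"
    by (rule eig_Phi[OF e])
  then show "eig (Phi p) (spec (shift a) (rcont (shift a) T))"
    by (rule eig_cong) (auto simp: spec_def rank_shift inv_rot shift_apply)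
qed

lemma rank_adj_neq:
  assumes k: "1 \<le> k" "k < N" and ne: "a k \<noteq> a (Suc k)"
  shows "rk (a \<circ> adj k) = rk a \<circ> adj k"
proof (rule rank_eqI)
  show "rk a \<circ> adj k permutes {1..N}"
    by (intro permutes_compose adj_permutes k rank_permutes)
  fix i j assume i: "i \<in> {1..N}" and j: "j \<in> {1..N}"
  have "adj k i \<in> {1..N}" "adj k j \<in> {1..N}"
    using i j permutes_in_image[OF adj_permutes[OF k]] by blast+
  note le = rank_le_iff[OF this(2,1), of a]
  show "(rk a \<circ> adj k) j \<le> (rk a \<circ> adj k) i \<longleftrightarrow>
      (a \<circ> adj k) i < (a \<circ> adj k) j \<or> ((a \<circ> adj k) j = (a \<circ> adj k) i \<and> j \<le> i)"
    using le ne by (auto simp: transpose_def split: if_splits)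
qed

lemma rank_adj_eq:
  assumes k: "1 \<le> k" "k < N" and eq: "a k = a (Suc k)"
  shows "rk a (Suc k) = Suc (rk a k)"
proof -
  let ?B = "\<lambda>i. {j \<in> {1..N}. a i < a j \<or> (a j = a i \<and> j \<le> i)}"
  have "?B (Suc k) = insert (Suc k) (?B k)" using k eq by (auto simp: le_Suc_eq)
  moreover have "Suc k \<notin> ?B k" "finite (?B k)" using eq by auto
  ultimately show ?thesis using rank_card[of k N a] rank_card[of "Suc k" N a] k by simp
qed

lemma spec_diff_ne:
  assumes c: "content_range c" and k: "1 \<le> k" "k < N" and ne: "a k \<noteq> a (Suc k)"
  shows "spec a c k \<noteq> spec a c (Suc k)"
proof
  assume "spec a c k = spec a c (Suc k)"
  moreover have "\<bar>kappa * real_of_int (c k - c (Suc k))\<bar> < 1"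
    using c k by (intro kappa_diff_small) (auto simp: content_range_def)
  ultimately have "a k = a (Suc k)" by (intro spec_eq_imp) (auto simp: spec_def)
  with ne show False by simp
qed

definition step_coef :: "mono \<Rightarrow> tab \<Rightarrow> nat \<Rightarrow> real" where
  "step_coef a T k = kappa / (spec a (rcont a T) k - spec a (rcont a T) (Suc k))"

lemma is_zeta_step:
  assumes z: "is_zeta a T p" and T: "T \<in> Y" and a: "mon a" and k: "1 \<le> k" "k < N"
    and lt: "a k < a (Suc k)"
  shows "is_zeta (a \<circ> adj k) T (act (adj k) p - pscale (complex_of_real (step_coef a T k)) p)"
  unfolding is_zeta_def
proof
  have e: "eig p (spec a (rcont a T))" and pa: "p a = vact (inv (rk a)) (unit T)"
    using z by (auto simp: is_zeta_def)
  note r = rank_permutes[of N a]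
  have ad: "adj k permutes {1..N}" by (rule adj_permutes[OF k])
  have ne: "a k \<noteq> a (Suc k)" using lt by simp
  note rk_eq = rank_adj_neq[OF k ne]
  have kk: "k \<in> {1..N}" "Suc k \<in> {1..N}" using k by auto
  have t: "tri a (a \<circ> adj k)" using tri_less_swap[OF kk, of a] lt by simp
  have ma: "mon (a \<circ> adj k)" using a mon_comp[OF ad] by blast
  \<comment> \<open>The swapped exponent lies above a and hence outside the support of p, so the
    subtracted multiple of p leaves the new leading coefficient untouched.\<close>
  have z0: "p (a \<circ> adj k) T' = 0" for T'
    using eig_support[OF e content_range_rcont[OF T] a, of "a \<circ> adj k" T'] tri_asym[OF t a ma] by auto
  have "(act (adj k) p - pscale (complex_of_real (step_coef a T k)) p) (a \<circ> adj k) = vact (adj k) (p a)"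
    by (simp add: act_apply pscale_def z0 fun_eq_iff fun_pointwise o_assoc[symmetric])
  also have "\<dots> = vact (adj k \<circ> inv (rk a)) (unit T)"
    by (simp only: pa vact_comp[OF ad permutes_inv[OF r]])
  also have "adj k \<circ> inv (rk a) = inv (rk a \<circ> adj k)"
    using r ad by (simp add: o_inv_distrib permutes_bij)
  finally show "(act (adj k) p - pscale (complex_of_real (step_coef a T k)) p) (a \<circ> adj k)
     = vact (inv (rk (a \<circ> adj k))) (unit T)" by (simp only: rk_eq)
  have "kappa = step_coef a T k * (spec a (rcont a T) k - spec a (rcont a T) (Suc k))"
    using spec_diff_ne[OF content_range_rcont[OF T] k ne] by (simp add: step_coef_def)
  from eig_adj[OF e k this]
  show "eig (act (adj k) p - pscale (complex_of_real (step_coef a T k)) p)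
     (spec (a \<circ> adj k) (rcont (a \<circ> adj k) T))"
    by (rule eig_cong) (simp add: spec_def rk_eq)
qed

text \<open>Dunkl operators annihilate constants, so U_i acts on them as 1 plus \<open>kappa\<close>
  times a Jucys-Murphy element.\<close>

lemma is_zeta_zero:
  assumes T: "T \<in> Y"
  shows "is_zeta (\<lambda>_. 0) T (one_tensor T)"
proof -
  have rid: "rk (\<lambda>_. 0) = id" by (rule rank_eqI) (auto simp: permutes_id)
  have P1: "P (one_tensor T)" using P_one_tensor[OF T] .
  have o0: "one_tensor T (\<lambda>_. 0) = unit T" by (auto simp: one_tensor_def unit_def)
  have "U i (one_tensor T) = pscale (complex_of_real (spec (\<lambda>_. 0) (rcont (\<lambda>_. 0) T) i)) (one_tensor T)"
    if i: "i \<in> {1..N}" for i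
  proof -
    have dd: "divdiff i j (one_tensor T) = 0" for j
      by (auto simp: divdiff_def fun_eq_iff fun_pointwise ddcoef_def one_tensor_def psupp_def
          intro!: sum.neutral)
    have "D i (one_tensor T) = 0"
      by (simp add: D_eq dd vmap_zero pscale_zero) (auto simp: pdiff_def one_tensor_def fun_eq_iff fun_pointwise)
    then have U: "U i (one_tensor T) = one_tensor T
        + pscale k' (\<Sum>j\<in>{i<..N}. act (transpose i j) (one_tensor T))"
      using U_xD[OF P1 i] by (simp add: xmul_zero)
    show ?thesis
    proof (intro ext)
      fix b T'
      show "U i (one_tensor T) b T' =
        pscale (complex_of_real (spec (\<lambda>_. 0) (rcont (\<lambda>_. 0) T) i)) (one_tensor T) b T'"
      proof (cases "b = (\<lambda>_. 0)")
        case True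
        have s: "(\<Sum>j\<in>{i<..N}. vact (transpose i j) (unit T) T') = of_int (content tau T i) * unit T T'"
        proof (cases "T' \<in> Y")
          case True
          then show ?thesis
            using jucys_murphy[OF unit_in_V[OF T] True i] by (auto simp: unit_def)
        next
          case False
          then show ?thesis using vact_in_V unit_in_V[OF T] by (simp add: V_def)
        qed
        have "act (transpose i j) (one_tensor T) b = vact (transpose i j) (unit T)" for j
          by (simp add: act_apply True comp_def o0)
        then show ?thesis using s
          by (simp add: U fun_pointwise pscale_def sum_fun_apply True o0 spec_def rid algebra_simps)
      next
        case False
        have "b \<circ> transpose i j \<noteq> (\<lambda>_. 0)" for j
        proof
          assume "b \<circ> transpose i j = (\<lambda>_. 0)"
          then have "(b \<circ> transpose i j) (transpose i j x) = 0" for x by simp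
          then show False using False by (simp add: fun_eq_iff)
        qed
        then have "act (transpose i j) (one_tensor T) b T' = 0" for j
          by (simp add: act_apply one_tensor_def vact_zero)
        moreover have "one_tensor T b T' = 0" using False by (simp add: one_tensor_def)
        ultimately show ?thesis by (simp add: U fun_pointwise pscale_def sum_fun_apply)
      qed
    qed
  qed
  then show ?thesis using P1 vact_id[OF unit_in_V[OF T]]
    by (simp add: is_zeta_def eig_def rid o0 inv_id)
qed

text \<open>Induction on the degree. A nonzero last exponent allows one affine step to be undone,
  which lowers the degree; otherwise the last nonzero exponent is first carried to position N by
  swaps across zeros.\<close>

lemma mono_induct [consumes 1, case_names zero shift swap]:
  assumes "mon a" and zero: "Q (\<lambda>_. 0)"
    and shift: "\<And>a. mon a \<Longrightarrow> Q a \<Longrightarrow> Q (shift a)"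
    and swap: "\<And>a k. mon a \<Longrightarrow> Q a \<Longrightarrow> 1 \<le> k \<Longrightarrow> k < N \<Longrightarrow> a k < a (Suc k) \<Longrightarrow> Q (a \<circ> adj k)"
  shows "Q a"
  using assms(1)
proof (induction "\<Sum>i=1..N. a i" arbitrary: a)
  case 0
  then have "a = (\<lambda>_. 0)" using mon_outside by (auto simp: fun_eq_iff)
  then show "Q a" using zero by simp
next
  case (Suc n)
  have step: "Q a"
    if "1 \<le> m" "m \<le> N" "mon a" "(\<Sum>i=1..N. a i) = Suc n" "a m \<noteq> 0" "\<And>j. m < j \<Longrightarrow> a j = 0" for m a
    using that(2,1,3-)
  proof (induction m arbitrary: a rule: inc_induct)
    case base
    \<comment> \<open>The preimage of a under \<open>shift\<close>: lower the last exponent by one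
      and rotate it to the front.\<close>
    define a' where "a' = (a(N := a N - 1)) \<circ> rot"
    have inv: "rot \<circ> inv rot = id" using permutes_inv_o(1)[OF rot_permutes] .
    have sh: "shift a' = a"
    proof -
      have "a' \<circ> inv rot = a(N := a N - 1)" unfolding a'_def by (simp only: o_assoc[symmetric] inv comp_id)
      moreover have "a' 1 = a N - 1" by (simp add: a'_def rot_def)
      ultimately show ?thesis using base(4) by (simp add: shift_def)
    qed
    have ma': "mon a'" unfolding a'_def using mon_comp[OF rot_permutes] mon_upd[OF base(2), of N] N2 by auto
    have "(\<Sum>i=1..N. a' i) = (\<Sum>i=1..N. (a(N := a N - 1)) i)"
      unfolding a'_def using sum.reindex_bij_betw[OF permutes_imp_bij[OF rot_permutes]] by simp
    also have "\<dots> = n"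
    proof -
      have "{1..N} = insert N {1..<N}" using N2 by auto
      then show ?thesis using base(3,4) by simp
    qed
    finally have "Q a'" using Suc.hyps(1)[of a'] ma' by blast
    then show "Q a" using shift[OF ma'] sh by metis
  next
    case (step m)
    define a' where "a' = a \<circ> adj m"
    have m: "1 \<le> m" "m < N" using step by auto
    have ad: "adj m permutes {1..N}" by (rule adj_permutes[OF m])
    have ma': "mon a'" unfolding a'_def using mon_comp[OF ad] step by blast
    have "(\<Sum>i=1..N. a' i) = Suc n"
      unfolding a'_def using sum.reindex_bij_betw[OF permutes_imp_bij[OF ad], of a] step by simp
    moreover have a': "a' (Suc m) \<noteq> 0" "\<And>j. Suc m < j \<Longrightarrow> a' j = 0" "a' m = 0"
      using step by (auto simp: a'_def transpose_def)
    ultimately have "Q a'" using step.IH[of a'] ma' m by auto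
    moreover have "a' \<circ> adj m = a" by (simp add: a'_def o_assoc[symmetric])
    moreover have "a' m < a' (Suc m)" using a' by simp
    ultimately show "Q a" using swap[OF ma' _ m] by metis
  qed
  define m where "m = Max {i \<in> {1..N}. a i \<noteq> 0}"
  have ne: "{i \<in> {1..N}. a i \<noteq> 0} \<noteq> {}" using Suc.hyps(2) by (force intro: ccontr)
  have "m \<in> {i \<in> {1..N}. a i \<noteq> 0}" unfolding m_def using ne by (intro Max_in) auto
  moreover have "a j = 0" if "m < j" for j
  proof (rule ccontr)
    assume "a j \<noteq> 0"
    then have "j \<in> {i \<in> {1..N}. a i \<noteq> 0}" using Suc.prems by (auto simp: mon_def)
    then have "j \<le> m" unfolding m_def by (intro Max_ge) auto
    then show False using that by simp
  qed
  ultimately show "Q a" using step[of m a] Suc.prems(1) Suc.hyps(2) by auto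
qed

lemma zeta_exists:
  assumes "mon a" "T \<in> Y" shows "\<exists>p. is_zeta a T p"
  using assms(1)
proof (rule mono_induct)
  show "\<exists>p. is_zeta (\<lambda>_. 0) T p" using is_zeta_zero[OF assms(2)] by blast
next
  fix a assume "\<exists>p. is_zeta a T p"
  then show "\<exists>p. is_zeta (shift a) T p" using is_zeta_Phi by blast
next
  fix a k assume "mon a" "\<exists>p. is_zeta a T p" "1 \<le> k" "k < N" "a k < a (Suc k)"
  then show "\<exists>p. is_zeta (a \<circ> adj k) T p" using is_zeta_step[OF _ assms(2)] by blast
qed

lemma is_zeta_unique:
  assumes "is_zeta a T p" "is_zeta a T q" "mon a" "T \<in> Y"
  shows "p = q"
  using assms by (auto simp: is_zeta_def intro!: eig_unique[OF _ _ content_range_rcont])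

abbreviation Z :: "mono \<Rightarrow> tab \<Rightarrow> vpoly" where "Z \<equiv> zeta N tau kappa"

lemma is_zeta_Z:
  assumes a: "mon a" and T: "T \<in> Y"
  shows "is_zeta a T (Z a T)"
proof -
  have iff: "(P p \<and> (\<forall>T'. p a T' = complex_of_real (taurep N tau (inv (rk a)) T T'))
     \<and> (\<forall>b T'. b \<noteq> a \<and> p b T' \<noteq> 0 \<longrightarrow> tri b a)
     \<and> (\<forall>i\<in>{1..N}. U i p =
          pscale (complex_of_real (real (a i) + 1 + kappa * real_of_int (content tau T (rk a i)))) p))
     \<longleftrightarrow> is_zeta a T p" for p
  proof -
    have comb: "(A \<longleftrightarrow> A') \<Longrightarrow> (F \<and> C \<longleftrightarrow> E) \<Longrightarrow> (E \<Longrightarrow> B) \<Longrightarrow> F \<and> A \<and> B \<and> C \<longleftrightarrow> A' \<and> E"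
      for A A' B C E F by blast
    have e1: "(\<forall>T'. p a T' = complex_of_real (taurep N tau (inv (rk a)) T T')) \<longleftrightarrow> p a = vact (inv (rk a)) (unit T)"
      by (simp add: vact_unit[OF T] fun_eq_iff)
    have e2: "(P p \<and> (\<forall>i\<in>{1..N}. U i p =
          pscale (complex_of_real (real (a i) + 1 + kappa * real_of_int (content tau T (rk a i)))) p))
       \<longleftrightarrow> eig p (spec a (rcont a T))"
      by (simp add: eig_def spec_def)
    have e3: "eig p (spec a (rcont a T)) \<Longrightarrow> (\<forall>b T'. b \<noteq> a \<and> p b T' \<noteq> 0 \<longrightarrow> tri b a)"
      using eig_support[OF _ content_range_rcont[OF T] a] by blast
    show ?thesis unfolding is_zeta_def by (rule comb[OF e1 e2 e3])
  qed
  obtain p where p: "is_zeta a T p" using zeta_exists[OF a T] by blast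
  have "Z a T = (THE p. is_zeta a T p)" unfolding zeta_def iff ..
  also have "\<dots> = p" by (rule the_equality[where P = "is_zeta a T", OF p is_zeta_unique[OF _ p a T]])
  finally show ?thesis using p by simp
qed

lemma P_Z: "mon a \<Longrightarrow> T \<in> Y \<Longrightarrow> P (Z a T)"
  and Z_leading: "mon a \<Longrightarrow> T \<in> Y \<Longrightarrow> Z a T a = vact (inv (rk a)) (unit T)"
  and U_Z: "mon a \<Longrightarrow> T \<in> Y \<Longrightarrow> i \<in> {1..N} \<Longrightarrow>
    U i (Z a T) = pscale (complex_of_real (spec a (rcont a T) i)) (Z a T)"
  and eig_Z: "mon a \<Longrightarrow> T \<in> Y \<Longrightarrow> eig (Z a T) (spec a (rcont a T))"
  using is_zeta_Z[of a T] by (auto simp: is_zeta_def eig_def)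

lemma Z_support: "mon a \<Longrightarrow> T \<in> Y \<Longrightarrow> Z a T b T' \<noteq> 0 \<Longrightarrow> b = a \<or> tri b a"
  using eig_support[OF eig_Z content_range_rcont] by blast

lemma Z_eqI: "is_zeta a T p \<Longrightarrow> mon a \<Longrightarrow> T \<in> Y \<Longrightarrow> Z a T = p"
  using is_zeta_unique is_zeta_Z by blast

lemma Z_zero: "T \<in> Y \<Longrightarrow> Z (\<lambda>_. 0) T = one_tensor T"
  by (intro Z_eqI is_zeta_zero) (simp_all add: mon_def)

lemma Z_shift: "mon a \<Longrightarrow> T \<in> Y \<Longrightarrow> Z (shift a) T = Phi (Z a T)"
  by (intro Z_eqI is_zeta_Phi is_zeta_Z mon_shift)

lemma Z_step:
  assumes "mon a" "T \<in> Y" "1 \<le> k" "k < N" "a k < a (Suc k)"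
  shows "act (adj k) (Z a T) = Z (a \<circ> adj k) T + pscale (complex_of_real (step_coef a T k)) (Z a T)"
proof -
  have "mon (a \<circ> adj k)" using assms(1) mon_comp[OF adj_permutes[OF assms(3,4)]] by blast
  then show ?thesis using Z_eqI[OF is_zeta_step[OF is_zeta_Z[OF assms(1,2)] assms(2,1,3-5)]] assms by simp
qed

lemma vact_adj_unit:
  assumes T: "T \<in> Y" and j: "1 \<le> j" "j < N"
  defines "d \<equiv> content tau T j - content tau T (Suc j)"
  shows "vact (adj j) (unit T) = (\<lambda>T'. complex_of_real (1 / real_of_int d) * unit T T'
    + complex_of_real (seminormal_coef d) * (if swap_entries j T \<in> Y then unit (swap_entries j T) T' else 0))"
proof
  fix T'
  have tr: "complex_of_real (taurep N tau (adj j) T T') = (if T' \<in> Y then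
      complex_of_real (nform j (\<lambda>S. if S = T then 1 else 0) T') else 0)"
    using taurep_adj[OF j T] taurep_outside[of "adj j" T T'] by simp
  have "vact (adj j) (unit T) T' = (if T' \<in> Y then
      complex_of_real (nform j (\<lambda>S. if S = T then 1 else 0) T') else 0)"
    unfolding vact_unit[OF T] tr ..
  also have "\<dots> = complex_of_real (1 / real_of_int d) * unit T T'
    + complex_of_real (seminormal_coef d) * (if swap_entries j T \<in> Y then unit (swap_entries j T) T' else 0)"
  proof (cases "T' \<in> Y")
    case True
    have sw: "swap_entries j T' = T \<longleftrightarrow> T' = swap_entries j T" by auto
    have c: "content tau (swap_entries j T) j = content tau T (Suc j)"
      "content tau (swap_entries j T) (Suc j) = content tau T j"
      using content_swap[OF filling_RSYT[OF T] j] j by auto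
    show ?thesis using True c T unfolding nform_def sw by (auto simp: unit_def d_def)
  next
    case False
    then show ?thesis using T by (auto simp: unit_def)
  qed
  finally show "vact (adj j) (unit T) T' = complex_of_real (1 / real_of_int d) * unit T T'
    + complex_of_real (seminormal_coef d) * (if swap_entries j T \<in> Y then unit (swap_entries j T) T' else 0)" .
qed

text \<open>On equal exponents s_k acts through T alone: the inverse rank permutation conjugates s_k
  to s_j with j the rank of k. After subtracting the 1/d part the result has the two contents
  exchanged, so it is the predicted multiple of the zeta of the swapped tableau, or zero if that
  tableau is not standard.\<close>

lemma Z_equal:
  assumes a: "mon a" and T: "T \<in> Y" and k: "1 \<le> k" "k < N" and eq: "a k = a (Suc k)"
  defines "j \<equiv> rk a k"
  defines "d \<equiv> content tau T j - content tau T (Suc j)"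
  shows "act (adj k) (Z a T) = pscale (complex_of_real (1 / real_of_int d)) (Z a T)
    + (if swap_entries j T \<in> Y then pscale (complex_of_real (seminormal_coef d)) (Z a (swap_entries j T)) else 0)"
proof -
  let ?S = "swap_entries j T"
  define q where "q = act (adj k) (Z a T) - pscale (complex_of_real (1 / real_of_int d)) (Z a T)"
  have rS: "rk a (Suc k) = Suc j" using rank_adj_eq[OF k eq] by (simp add: j_def)
  have kk: "k \<in> {1..N}" "Suc k \<in> {1..N}" using k by auto
  have j: "1 \<le> j" "j < N" using rk_in[OF kk(1), of a] rk_in[OF kk(2), of a] rS by (auto simp: j_def)
  have d0: "d \<noteq> 0" using content_adj(1)[OF T j] by (simp add: d_def)
  have aadj: "a \<circ> adj k = a" using eq by (auto simp: fun_eq_iff transpose_def)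
  note r = rank_permutes[of N a]
  have ad: "adj k permutes {1..N}" "adj j permutes {1..N}" using k j by (blast intro: adj_permutes)+
  have "kappa = (1 / real_of_int d) * (spec a (rcont a T) k - spec a (rcont a T) (Suc k))"
    using d0 eq rS by (simp add: spec_def d_def j_def field_simps)
  from eig_adj[OF eig_Z[OF a T] k this]
  have "eig q (spec a (rcont a T) \<circ> adj k)" by (simp add: q_def)
  also have "spec a (rcont a T) \<circ> adj k = spec a (rcont a T \<circ> adj k)"
    using eq by (auto simp: fun_eq_iff spec_def transpose_def)
  finally have eq: "eig q (spec a (rcont a T \<circ> adj k))" .
  have cr: "content_range (rcont a T \<circ> adj k)"
    using content_range_rcont[OF T, of a] permutes_in_image[OF ad(1)]
    by (simp add: content_range_def del: atLeastAtMost_iff)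
  have conj: "adj k \<circ> inv (rk a) = inv (rk a) \<circ> adj j"
  proof -
    have "inv (rk a) j = k" "inv (rk a) (Suc j) = Suc k"
      using permutes_inverses(2)[OF r] rS by (metis j_def)+
    then show ?thesis using comp_transpose_conj[OF permutes_inj[OF permutes_inv[OF r]], of j "Suc j"] by simp
  qed
  have "act (adj k) (Z a T) a = vact (adj k \<circ> inv (rk a)) (unit T)"
    by (simp only: act_apply aadj Z_leading[OF a T] vact_comp[OF ad(1) permutes_inv[OF r]])
  also have "\<dots> = vact (inv (rk a)) (vact (adj j) (unit T))"
    by (simp only: conj vact_comp[OF permutes_inv[OF r] ad(2)])
  also have "\<dots> = (\<lambda>T'. complex_of_real (1 / real_of_int d) * vact (inv (rk a)) (unit T) T' +
     vact (inv (rk a)) (\<lambda>T'. complex_of_real (seminormal_coef d) * (if ?S \<in> Y then unit ?S T' else 0)) T')"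
    unfolding vact_adj_unit[OF T j] d_def[symmetric] by (simp only: vact_add vact_scale)
  finally have qa: "q a = vact (inv (rk a)) (\<lambda>T'. complex_of_real (seminormal_coef d) *
      (if ?S \<in> Y then unit ?S T' else 0))"
    unfolding q_def by (simp add: minus_apply pscale_def Z_leading[OF a T] fun_eq_iff)
  show ?thesis
  proof (cases "?S \<in> Y")
    case True
    have c: "rcont a ?S i = (rcont a T \<circ> adj k) i" if i: "i \<in> {1..N}" for i
    proof -
      have "adj j \<circ> rk a = rk a \<circ> adj k"
        using comp_transpose_conj[OF permutes_inj[OF r], of k "Suc k"] rS by (simp add: j_def)
      then have "adj j (rk a i) = rk a (adj k i)" by (metis comp_apply)
      then show ?thesis using content_swap[OF filling_RSYT[OF T] j rk_in[OF i]] by simp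
    qed
    have "eig (pscale (complex_of_real (seminormal_coef d)) (Z a ?S)) (spec a (rcont a ?S))"
      by (intro eig_pscale eig_Z a True)
    then have "eig (pscale (complex_of_real (seminormal_coef d)) (Z a ?S)) (spec a (rcont a T \<circ> adj k))"
      using c unfolding eig_def spec_def by simp
    moreover have "q a = pscale (complex_of_real (seminormal_coef d)) (Z a ?S) a"
      unfolding qa pscale_def Z_leading[OF a True] using True by (simp add: vact_scale)
    ultimately have "q = pscale (complex_of_real (seminormal_coef d)) (Z a ?S)"
      by (intro eig_unique[OF eq _ cr a])
    then show ?thesis using True by (simp add: q_def algebra_simps)
  next
    case False
    then have "q a = 0" unfolding qa by (simp add: vact_zero zero_fun_def)
    from eig_zero[OF eq cr a this] show ?thesis using False by (simp add: q_def)
  qed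
qed

end

section \<open>The norms\<close>

definition pairs :: "nat \<Rightarrow> (nat \<times> nat) set" where
  "pairs N = {(i, j). 1 \<le> i \<and> i < j \<and> j \<le> N}"

lemma finite_pairs: "finite (pairs N)"
  by (rule finite_subset[of _ "{1..N} \<times> {1..N}"]) (auto simp: pairs_def)

lemma prod_pairs_filter:
  "(\<Prod>(i, j)\<in>{(i, j). 1 \<le> i \<and> i < j \<and> j \<le> N \<and> Q i j}. f i j) =
    (\<Prod>(i, j)\<in>pairs N. if Q i j then f i j else (1::'a::comm_monoid_mult))"
proof -
  have "{(i, j). 1 \<le> i \<and> i < j \<and> j \<le> N \<and> Q i j} = {x \<in> pairs N. case x of (i, j) \<Rightarrow> Q i j}"
    by (auto simp: pairs_def)
  then show ?thesis using finite_pairs[of N]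
    by (auto simp: prod.inter_filter split: prod.splits intro!: prod.cong)
qed

text \<open>Exchanging k and k + 1 permutes all increasing pairs except (k, k + 1), so two products
  that differ by this exchange differ in a single factor.\<close>

lemma prod_pairs_split:
  fixes f :: "nat \<Rightarrow> nat \<Rightarrow> 'a::comm_monoid_mult"
  assumes k: "1 \<le> k" "k < N"
  obtains R where "(\<Prod>(i, j)\<in>pairs N. f i j) = f k (Suc k) * R"
    "(\<Prod>(i, j)\<in>pairs N. f (adj k i) (adj k j)) = f (Suc k) k * R"
proof -
  let ?A = "pairs N - {(k, Suc k)}"
  have kin: "(k, Suc k) \<in> pairs N" using k by (auto simp: pairs_def)
  have bij: "bij_betw (\<lambda>(i, j). (adj k i, adj k j)) ?A ?A"
  proof (rule bij_betw_byWitness[where f' = "\<lambda>(i, j). (adj k i, adj k j)"])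
    show "(\<lambda>(i, j). (adj k i, adj k j)) ` ?A \<subseteq> ?A"
      using k by (auto simp: pairs_def transpose_def split: if_splits)
    then show "(\<lambda>(i, j). (adj k i, adj k j)) ` ?A \<subseteq> ?A" .
  qed auto
  have "(\<Prod>(i, j)\<in>?A. f (adj k i) (adj k j)) = (\<Prod>(i, j)\<in>?A. f i j)"
    using prod.reindex_bij_betw[OF bij, of "\<lambda>(i, j). f i j"] by (simp add: case_prod_unfold)
  then show thesis
    using that[of "\<Prod>(i, j)\<in>?A. f i j"] prod.remove[OF finite_pairs kin, of "\<lambda>(i, j). f i j"]
      prod.remove[OF finite_pairs kin, of "\<lambda>(i, j). f (adj k i) (adj k j)"] by simp
qed

context dunkl_small begin

text \<open>The norm formula is forced by the steps: an adjacent swap of \<open>(u, v)\<close>, \<open>u < v\<close>, multiplies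
  the squared norm by \<open>1 - b\<^sup>2\<close>, i.e. adds one factor to the ladder of that pair, while the affine
  step turns \<open>(u, v)\<close> into \<open>(v, u + 1)\<close> and leaves the ladder length unchanged.\<close>
definition ladder :: "nat \<Rightarrow> int \<Rightarrow> real" where
  "ladder m x = (\<Prod>l=1..m. 1 - (kappa / (real l + kappa * real_of_int x))\<^sup>2)"

lemma ladder_Suc: "ladder (Suc m) x = ladder m x * (1 - (kappa / (real (Suc m) + kappa * real_of_int x))\<^sup>2)"
  by (simp add: ladder_def)

definition pair_norm :: "nat \<Rightarrow> int \<Rightarrow> nat \<Rightarrow> int \<Rightarrow> real" where
  "pair_norm u c v d = (if v \<le> u then ladder (u - v) (c - d) else ladder (v - u - 1) (d - c))"

definition nu :: "mono \<Rightarrow> tab \<Rightarrow> real" where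
  "nu a T = inner0 N tau T T *
     (\<Prod>(i, j)\<in>pairs N. pair_norm (a i) (rcont a T i) (a j) (rcont a T j))"

lemma nu_zero: "nu (\<lambda>_. 0) T = inner0 N tau T T"
  by (simp add: nu_def pair_norm_def ladder_def case_prod_unfold)

lemma nu_shift: "nu (shift a) T = nu a T"
proof -
  let ?f = "\<lambda>a (i, j). pair_norm (a i) (rcont a T i) (a j) (rcont a T j)"
  let ?g = "\<lambda>(i, j). if j = N then (1, Suc i) else (Suc i, Suc j)"
  have bij: "bij_betw ?g (pairs N) (pairs N)"
  proof (rule bij_betw_byWitness[where f' = "\<lambda>(i, j). if i = 1 then (j - 1, N) else (i - 1, j - 1)"])
  qed (auto simp: pairs_def split: if_splits)
  \<comment> \<open>Pairs formed with position 1 become pairs with position N: the order is reversed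
    and one exponent is raised, and the offset by one in the ladder lengths absorbs both
    changes.\<close>
  have pn: "pair_norm v d (Suc u) c = pair_norm u c v d" for u c v d
    by (auto simp: pair_norm_def)
  have "(\<Prod>x\<in>pairs N. ?f (shift a) x) = (\<Prod>x\<in>pairs N. ?f a (?g x))"
  proof (rule prod.cong[OF refl])
    fix x assume x: "x \<in> pairs N"
    obtain i j where ij: "x = (i, j)" by (cases x)
    then have b: "1 \<le> i" "i < j" "j \<le> N" "i < N" using x by (auto simp: pairs_def)
    show "?f (shift a) x = ?f a (?g x)"
    proof (cases "j = N")
      case True
      then show ?thesis using b ij by (simp add: shift_apply rank_shift inv_rot pn)
    next
      case False
      then have "j < N" using b by simp
      then show ?thesis using b ij False by (simp add: shift_apply rank_shift inv_rot)
    qed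
  qed
  also have "\<dots> = (\<Prod>x\<in>pairs N. ?f a x)" by (rule prod.reindex_bij_betw[OF bij])
  finally show ?thesis by (simp add: nu_def)
qed

lemma nu_step:
  assumes k: "1 \<le> k" "k < N" and lt: "a k < a (Suc k)"
  shows "nu (a \<circ> adj k) T = (1 - (step_coef a T k)\<^sup>2) * nu a T"
proof -
  let ?f = "\<lambda>i j. pair_norm (a i) (rcont a T i) (a j) (rcont a T j)"
  obtain R where R: "(\<Prod>(i, j)\<in>pairs N. ?f i j) = ?f k (Suc k) * R"
    "(\<Prod>(i, j)\<in>pairs N. ?f (adj k i) (adj k j)) = ?f (Suc k) k * R"
    using prod_pairs_split[OF k, of ?f] by blast
  define m where "m = a (Suc k) - a k"
  obtain m' where m': "m = Suc m'" using lt by (cases m) (auto simp: m_def)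
  have m: "a (Suc k) = a k + m" using lt by (auto simp: m_def)
  define x where "x = rcont a T (Suc k) - rcont a T k"
  have "?f (Suc k) k = ladder m x" using lt by (simp add: pair_norm_def m_def x_def)
  also have "\<dots> = ladder m' x * (1 - (kappa / (real m + kappa * real_of_int x))\<^sup>2)"
    unfolding m' by (rule ladder_Suc)
  also have "ladder m' x = ?f k (Suc k)"
  proof -
    have "m' = a (Suc k) - a k - 1" using m' by (simp add: m_def)
    then show ?thesis using lt by (simp add: pair_norm_def x_def)
  qed
  also have "(kappa / (real m + kappa * real_of_int x))\<^sup>2 = (step_coef a T k)\<^sup>2"
  proof -
    have e: "spec a (rcont a T) k - spec a (rcont a T) (Suc k) = - (real m + kappa * real_of_int x)"
      by (simp add: spec_def m x_def algebra_simps)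
    have "step_coef a T k = - (kappa / (real m + kappa * real_of_int x))"
      unfolding step_coef_def e by (rule minus_divide_right[symmetric])
    then show ?thesis by (simp only: power2_minus)
  qed
  finally have e: "?f (Suc k) k = ?f k (Suc k) * (1 - (step_coef a T k)\<^sup>2)" .
  have ne: "a k \<noteq> a (Suc k)" using lt by simp
  have "nu (a \<circ> adj k) T = inner0 N tau T T * (\<Prod>(i, j)\<in>pairs N. ?f (adj k i) (adj k j))"
    unfolding nu_def rank_adj_neq[OF k ne] by simp
  also have "\<dots> = inner0 N tau T T * (?f k (Suc k) * (1 - (step_coef a T k)\<^sup>2) * R)"
    unfolding R(2) e ..
  also have "\<dots> = (1 - (step_coef a T k)\<^sup>2) * nu a T"
    unfolding nu_def R(1) by (simp only: ac_simps)
  finally show ?thesis .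
qed

lemma inner0_pairs:
  "inner0 N tau T T = (\<Prod>(i, j)\<in>pairs N. if content tau T i \<le> content tau T j - 2
     then 1 - 1 / (real_of_int (content tau T i - content tau T j))\<^sup>2 else 1)"
  unfolding inner0_def if_P[OF refl] by (rule prod_pairs_filter)

text \<open>The balance between the invariant weights and the two off-diagonal entries of Young's
  matrix; it expresses that s_j is symmetric for the inner product.\<close>

lemma inner0_swap:
  assumes T: "T \<in> Y" and j: "1 \<le> j" "j < N"
  defines "d \<equiv> content tau T j - content tau T (Suc j)"
  shows "seminormal_coef d * inner0 N tau (swap_entries j T) (swap_entries j T) =
    seminormal_coef (- d) * inner0 N tau T T"
proof -
  let ?S = "swap_entries j T"
  let ?f = "\<lambda>i l. if content tau T i \<le> content tau T l - 2
     then 1 - 1 / (real_of_int (content tau T i - content tau T l))\<^sup>2 else 1"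
  obtain R where R: "(\<Prod>(i, l)\<in>pairs N. ?f i l) = ?f j (Suc j) * R"
    "(\<Prod>(i, l)\<in>pairs N. ?f (adj j i) (adj j l)) = ?f (Suc j) j * R"
    using prod_pairs_split[OF j, of ?f] by blast
  have "inner0 N tau ?S ?S = (\<Prod>(i, l)\<in>pairs N. ?f (adj j i) (adj j l))"
    unfolding inner0_pairs using content_swap[OF filling_RSYT[OF T] j]
    by (intro prod.cong refl) (auto simp: pairs_def)
  moreover have "inner0 N tau T T = (\<Prod>(i, l)\<in>pairs N. ?f i l)" by (rule inner0_pairs)
  moreover have "seminormal_coef d * ?f (Suc j) j = seminormal_coef (- d) * ?f j (Suc j)"
  proof -
    have d0: "d \<noteq> 0" using content_adj(1)[OF T j] by (simp add: d_def)
    have fs: "?f (Suc j) j = (if 2 \<le> d then 1 - (1 / real_of_int d)\<^sup>2 else 1)"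
      "?f j (Suc j) = (if d \<le> -2 then 1 - (1 / real_of_int d)\<^sup>2 else 1)"
      by (auto simp: d_def power_divide power2_commute)
    consider "d \<ge> 2" | "d \<le> -2" | "\<bar>d\<bar> = 1" using d0 by linarith
    then show ?thesis
    proof cases
      case 3
      then show ?thesis by (simp add: seminormal_coef_unit)
    qed (simp_all only: fs, auto simp: seminormal_coef_def)
  qed
  ultimately show ?thesis unfolding R by (simp only: mult.assoc[symmetric])
qed

lemma nu_swap:
  assumes T: "T \<in> Y" and k: "1 \<le> k" "k < N" and eq: "a k = a (Suc k)"
  defines "j \<equiv> rk a k"
  defines "d \<equiv> content tau T j - content tau T (Suc j)"
  shows "seminormal_coef d * nu a (swap_entries j T) = seminormal_coef (- d) * nu a T"
proof -
  let ?S = "swap_entries j T"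
  let ?f = "\<lambda>i j. pair_norm (a i) (rcont a T i) (a j) (rcont a T j)"
  have rS: "rk a (Suc k) = Suc j" using rank_adj_eq[OF k eq] by (simp add: j_def)
  have kk: "k \<in> {1..N}" "Suc k \<in> {1..N}" using k by auto
  have j: "1 \<le> j" "j < N" using rk_in[OF kk(1), of a] rk_in[OF kk(2), of a] rS by (auto simp: j_def)
  have aadj: "a (adj k i) = a i" for i using eq by (auto simp: transpose_def)
  have c: "rcont a ?S i = rcont a T (adj k i)" if i: "i \<in> {1..N}" for i
  proof -
    have "adj j \<circ> rk a = rk a \<circ> adj k"
      using comp_transpose_conj[OF permutes_inj[OF rank_permutes], of N a k "Suc k"] rS by (simp add: j_def)
    then have "adj j (rk a i) = rk a (adj k i)" by (metis comp_apply)
    then show ?thesis using content_swap[OF filling_RSYT[OF T] j rk_in[OF i]] by simp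
  qed
  obtain R where R: "(\<Prod>(i, j)\<in>pairs N. ?f i j) = ?f k (Suc k) * R"
    "(\<Prod>(i, j)\<in>pairs N. ?f (adj k i) (adj k j)) = ?f (Suc k) k * R"
    using prod_pairs_split[OF k, of ?f] by blast
  have "(\<Prod>(i, j)\<in>pairs N. pair_norm (a i) (rcont a ?S i) (a j) (rcont a ?S j)) =
     (\<Prod>(i, j)\<in>pairs N. ?f (adj k i) (adj k j))"
    using c aadj by (intro prod.cong refl) (auto simp: pairs_def)
  moreover have "?f k (Suc k) = 1" "?f (Suc k) k = 1" using eq by (simp_all add: pair_norm_def ladder_def)
  ultimately show ?thesis
    using inner0_swap[OF T j] unfolding nu_def d_def R by (simp only: mult.assoc[symmetric] mult_1_right)
qed

section \<open>The Hermitian form\<close>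

definition index :: "(mono \<times> tab) set" where
  "index = {(a, T). mon a \<and> T \<in> Y}"

definition zvec :: "mono \<times> tab \<Rightarrow> vpoly" where
  "zvec x = Z (fst x) (snd x)"

text \<open>With \<open>adj_off\<close> and \<open>adj_partner\<close> this describes s_k on the
  zeta basis in blocks of size at most two: partners differ by exchanging unequal exponents or, for
  equal exponents, by swapping entries of the tableau.\<close>

definition adj_diag :: "nat \<Rightarrow> mono \<times> tab \<Rightarrow> real" where
  "adj_diag k x = (case x of (a, T) \<Rightarrow> if a k = a (Suc k)
     then 1 / real_of_int (content tau T (rk a k) - content tau T (Suc (rk a k)))
     else step_coef a T k)"

definition adj_off :: "nat \<Rightarrow> mono \<times> tab \<Rightarrow> real" where
  "adj_off k x = (case x of (a, T) \<Rightarrow> if a k < a (Suc k) then 1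
     else if a (Suc k) < a k then 1 - (step_coef a T k)\<^sup>2
     else seminormal_coef (content tau T (rk a k) - content tau T (Suc (rk a k))))"

text \<open>If the swapped tableau is not standard the index is its own partner. The value is then
  immaterial since \<open>adj_off\<close> is zero there, and the map remains an involution.\<close>

definition adj_partner :: "nat \<Rightarrow> mono \<times> tab \<Rightarrow> mono \<times> tab" where
  "adj_partner k x = (case x of (a, T) \<Rightarrow> if a k \<noteq> a (Suc k) then (a \<circ> adj k, T)
     else if swap_entries (rk a k) T \<in> Y then (a, swap_entries (rk a k) T) else (a, T))"

lemma comp_adj_adj: "a \<circ> adj k \<circ> adj k = a"
  by (simp add: o_assoc[symmetric])

lemma step_coef_adj:
  assumes k: "1 \<le> k" "k < N" and ne: "a k \<noteq> a (Suc k)"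
  shows "step_coef (a \<circ> adj k) T k = - step_coef a T k"
proof -
  have "spec (a \<circ> adj k) (rcont (a \<circ> adj k) T) k = spec a (rcont a T) (Suc k)"
    "spec (a \<circ> adj k) (rcont (a \<circ> adj k) T) (Suc k) = spec a (rcont a T) k"
    by (simp_all add: spec_def rank_adj_neq[OF k ne])
  then show ?thesis unfolding step_coef_def
    by (metis minus_diff_eq minus_divide_right)
qed

lemma rank_adj_range:
  assumes k: "1 \<le> k" "k < N" and eq: "a k = a (Suc k)"
  shows "1 \<le> rk a k" "rk a k < N"
  using rk_in[of k a] rk_in[of "Suc k" a] rank_adj_eq[OF k eq] k by auto

lemma adj_partner_index:
  assumes x: "x \<in> index" and k: "1 \<le> k" "k < N"
  shows "adj_partner k x \<in> index"
  using x mon_comp[OF adj_permutes[OF k]] by (auto simp: adj_partner_def index_def)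

lemma adj_partner_invol:
  assumes x: "x \<in> index" and k: "1 \<le> k" "k < N"
  shows "adj_partner k (adj_partner k x) = x"
  using x by (auto simp: adj_partner_def index_def comp_adj_adj)

lemma adj_off_swap:
  assumes T: "T \<in> Y" and k: "1 \<le> k" "k < N" and eq: "a k = a (Suc k)" and S: "swap_entries (rk a k) T \<notin> Y"
  shows "seminormal_coef (content tau T (rk a k) - content tau T (Suc (rk a k))) = 0"
  using RSYT_swap[OF T rank_adj_range[OF k eq]] S by (intro seminormal_coef_unit) blast

text \<open>The ascending case is the construction step and the equal case is
  \<open>Z_equal\<close>; the descending case follows by applying s_k to the ascending step of the
  partner and solving.\<close>

lemma act_zvec:
  assumes x: "x \<in> index" and k: "1 \<le> k" "k < N"
  shows "act (adj k) (zvec x) = pscale (complex_of_real (adj_diag k x)) (zvec x)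
    + pscale (complex_of_real (adj_off k x)) (zvec (adj_partner k x))"
proof -
  obtain a T where xa: "x = (a, T)" and a: "mon a" and T: "T \<in> Y" using x by (auto simp: index_def)
  consider "a k < a (Suc k)" | "a (Suc k) < a k" | "a k = a (Suc k)" by linarith
  then show ?thesis
  proof cases
    case 1
    then show ?thesis using Z_step[OF a T k 1]
      by (simp add: xa zvec_def adj_diag_def adj_off_def adj_partner_def pscale_one add.commute)
  next
    case 2
    define a' where "a' = a \<circ> adj k"
    have a': "mon a'" unfolding a'_def using a mon_comp[OF adj_permutes[OF k]] by blast
    have lt: "a' k < a' (Suc k)" using 2 by (simp add: a'_def)
    have aa: "a' \<circ> adj k = a" by (simp add: a'_def comp_adj_adj)
    define b where "b = complex_of_real (step_coef a' T k)"
    have sb: "complex_of_real (step_coef a T k) = - b"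
      using step_coef_adj[OF k, of a T] 2 by (simp add: b_def a'_def)
    have s: "act (adj k) (Z a' T) = Z a T + pscale b (Z a' T)"
      using Z_step[OF a' T k lt] by (simp add: aa b_def)
    have "Z a' T = act (adj k) (act (adj k) (Z a' T))"
      using act_transpose_invol[OF P_Z[OF a' T], of k "Suc k"] k by simp
    also have "\<dots> = act (adj k) (Z a T) + pscale b (Z a T + pscale b (Z a' T))"
      by (simp add: s act_add act_pscale)
    finally have "act (adj k) (Z a T) = Z a' T - pscale b (Z a T + pscale b (Z a' T))"
      by (simp add: algebra_simps)
    then have "act (adj k) (Z a T) = pscale (- b) (Z a T) + pscale (1 - b\<^sup>2) (Z a' T)"
      by (simp add: pscale_def fun_eq_iff fun_pointwise algebra_simps power2_eq_square)
    moreover have "complex_of_real (1 - (step_coef a T k)\<^sup>2) = 1 - b\<^sup>2" using sb by simp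
    ultimately show ?thesis using 2 sb
      by (simp add: xa zvec_def adj_diag_def adj_off_def adj_partner_def a'_def)
  next
    case 3
    show ?thesis
    proof (cases "swap_entries (rk a k) T \<in> Y")
      case True
      then show ?thesis using Z_equal[OF a T k 3] 3
        by (simp add: xa zvec_def adj_diag_def adj_off_def adj_partner_def)
    next
      case False
      then show ?thesis using Z_equal[OF a T k 3] 3 adj_off_swap[OF T k 3 False]
        by (simp add: xa zvec_def adj_diag_def adj_off_def adj_partner_def pscale_left_zero)
    qed
  qed
qed

abbreviation nux :: "mono \<times> tab \<Rightarrow> real" where
  "nux x \<equiv> nu (fst x) (snd x)"

text \<open>Detailed balance between partners: precisely the condition under which s_k is
  self-adjoint for a form in which the zeta are orthogonal with squared norms
  \<open>nu\<close>.\<close>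

lemma adj_off_nu:
  assumes x: "x \<in> index" and k: "1 \<le> k" "k < N"
  shows "adj_off k x * nux (adj_partner k x) = adj_off k (adj_partner k x) * nux x"
proof -
  obtain a T where xa: "x = (a, T)" and a: "mon a" and T: "T \<in> Y" using x by (auto simp: index_def)
  consider "a k < a (Suc k)" | "a (Suc k) < a k" | "a k = a (Suc k)" by linarith
  then show ?thesis
  proof cases
    case 1
    then show ?thesis using nu_step[OF k 1, of T] step_coef_adj[OF k, of a T]
      by (simp add: xa adj_off_def adj_partner_def)
  next
    case 2
    then have lt: "(a \<circ> adj k) k < (a \<circ> adj k) (Suc k)" by simp
    have ne: "a k \<noteq> a (Suc k)" using 2 by simp
    have "nu a T = (1 - (step_coef a T k)\<^sup>2) * nu (a \<circ> adj k) T"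
      using nu_step[OF k lt, of T] unfolding comp_adj_adj step_coef_adj[OF k ne] power2_minus .
    then show ?thesis using 2 by (simp add: xa adj_off_def adj_partner_def)
  next
    case 3
    show ?thesis
    proof (cases "swap_entries (rk a k) T \<in> Y")
      case True
      have "content tau (swap_entries (rk a k) T) (rk a k) = content tau T (Suc (rk a k))"
        "content tau (swap_entries (rk a k) T) (Suc (rk a k)) = content tau T (rk a k)"
        using content_swap[OF filling_RSYT[OF T] rank_adj_range[OF k 3]] rank_adj_range[OF k 3] by auto
      then show ?thesis using True nu_swap[OF T k 3] 3
        by (simp add: xa adj_off_def adj_partner_def)
    next
      case False
      then show ?thesis using 3 by (simp add: xa adj_off_def adj_partner_def)
    qed
  qed
qed

end

section \<open>The polynomials zeta form a basis\<close>

interpretation vpoly: vector_space pscale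
  by unfold_locales
    (auto simp: pscale_add pscale_left_add pscale_pscale pscale_one)

context dunkl_small begin

definition zbasis :: "vpoly set" where
  "zbasis = zvec ` index"

lemma P_zvec: "x \<in> index \<Longrightarrow> P (zvec x)"
  by (auto simp: index_def zvec_def P_Z)

definition mono_vec :: "mono \<Rightarrow> vec \<Rightarrow> vpoly" where
  "mono_vec a v = (\<lambda>b T. if b = a then v T else 0)"

lemma mono_vec_expand:
  assumes "P p" shows "p = (\<Sum>a\<in>psupp p. mono_vec a (p a))"
proof (intro ext)
  fix b T
  have "(\<Sum>a\<in>psupp p. mono_vec a (p a)) b T = (\<Sum>a\<in>psupp p. if b = a then p a T else 0)"
    by (simp add: sum_fun_apply mono_vec_def)
  also have "\<dots> = p b T" using P_finite[OF assms] by (auto simp: psupp_def)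
  finally show "p b T = (\<Sum>a\<in>psupp p. mono_vec a (p a)) b T" by simp
qed

lemma wf_tri: "wf {(b, a). mon b \<and> mon a \<and> tri b a}"
proof (rule wf_subset)
  let ?f = "\<lambda>a. (psum_total N (plus_part N a), psum_total N a)"
  show "wf (inv_image (less_than <*lex*> less_than) ?f)"
    by (intro wf_inv_image wf_lex_prod wf_less_than)
  show "{(b, a). mon b \<and> mon a \<and> tri b a} \<subseteq> inv_image (less_than <*lex*> less_than) ?f"
  proof (clarify)
    fix b a assume "mon b" "mon a" "tri b a"
    from tri_total[OF this(3,1,2)] show "(b, a) \<in> inv_image (less_than <*lex*> less_than) ?f" by auto
  qed
qed

lemma vec_expand:
  assumes "v \<in> V" shows "v = (\<lambda>T'. \<Sum>T\<in>Y. v T * unit T T')"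
proof
  fix S
  have "(\<Sum>T\<in>Y. v T * unit T S) = (\<Sum>T\<in>Y. if T = S then v T else 0)"
    by (intro sum.cong) (auto simp: unit_def)
  then show "v S = (\<Sum>T\<in>Y. v T * unit T S)" using assms finite_RSYT by (cases "S \<in> Y") (auto simp: V_def)
qed

text \<open>Well-founded induction along the triangular order: all lower terms of zeta are already
  in the span, and the leading coefficients for a fixed exponent are the images of the tableaux
  basis under one invertible operator.\<close>

lemma mono_vec_span:
  assumes "mon a" "v \<in> V" shows "mono_vec a v \<in> vpoly.span zbasis"
  using assms
proof (induction a arbitrary: v rule: wf_induct_rule[OF wf_tri])
  case (1 a)
  have lead: "mono_vec a (vact (inv (rk a)) (unit T)) \<in> vpoly.span zbasis" if T: "T \<in> Y" for T
  proof -
    note p = P_Z[OF 1(2) T]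
    have "mono_vec b (Z a T b) \<in> vpoly.span zbasis" if b: "b \<in> psupp (Z a T) - {a}" for b
    proof -
      obtain T' where "Z a T b T' \<noteq> 0" using b by (auto simp: psupp_def)
      then have "tri b a" "mon b" using Z_support[OF 1(2) T] b P_mon[OF p] by auto
      then show ?thesis using 1(1)[of b] 1(2) P_V[OF p] by auto
    qed
    then have low: "(\<Sum>b\<in>psupp (Z a T) - {a}. mono_vec b (Z a T b)) \<in> vpoly.span zbasis"
      by (rule vpoly.span_sum)
    have Zs: "Z a T \<in> vpoly.span zbasis"
    proof (rule vpoly.span_base)
      have "(a, T) \<in> index" using 1(2) T by (simp add: index_def)
      then show "Z a T \<in> zbasis" unfolding zbasis_def by (rule rev_image_eqI) (simp add: zvec_def)
    qed
    have "Z a T = (\<Sum>b\<in>psupp (Z a T). mono_vec b (Z a T b))" by (rule mono_vec_expand[OF p])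
    also have "\<dots> = mono_vec a (Z a T a) + (\<Sum>b\<in>psupp (Z a T) - {a}. mono_vec b (Z a T b))"
    proof (cases "a \<in> psupp (Z a T)")
      case True
      then show ?thesis using P_finite[OF p] by (simp add: sum.remove)
    next
      case False
      then have "mono_vec a (Z a T a) = 0"
        by (auto simp: psupp_def mono_vec_def fun_eq_iff fun_pointwise)
      then show ?thesis using False by simp
    qed
    finally have "mono_vec a (Z a T a) = Z a T - (\<Sum>b\<in>psupp (Z a T) - {a}. mono_vec b (Z a T b))"
      by (simp add: algebra_simps)
    then show ?thesis using vpoly.span_diff[OF Zs low] by (simp only: Z_leading[OF 1(2) T])
  qed
  note r = rank_permutes[of N a]
  let ?u = "vact (rk a) v"
  have "v = vact (inv (rk a)) ?u" using vact_inv(2)[OF r 1(3)] by simp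
  also have "\<dots> = vact (inv (rk a)) (\<lambda>T'. \<Sum>T\<in>Y. ?u T * unit T T')"
    using vec_expand[OF vact_in_V[of "rk a" v]] by simp
  also have "\<dots> = (\<lambda>T'. \<Sum>T\<in>Y. ?u T * vact (inv (rk a)) (unit T) T')"
    by (simp add: vact_sum vact_scale)
  finally have v: "v = (\<lambda>T'. \<Sum>T\<in>Y. ?u T * vact (inv (rk a)) (unit T) T')" .
  have "mono_vec a v = (\<Sum>T\<in>Y. pscale (?u T) (mono_vec a (vact (inv (rk a)) (unit T))))"
    by (intro ext, subst v) (simp add: mono_vec_def sum_fun_apply pscale_def)
  also have "\<dots> \<in> vpoly.span zbasis" by (intro vpoly.span_sum vpoly.span_scale lead)
  finally show ?case .
qed

lemma P_span: "P p \<Longrightarrow> p \<in> vpoly.span zbasis"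
proof -
  assume p: "P p"
  have "(\<Sum>a\<in>psupp p. mono_vec a (p a)) \<in> vpoly.span zbasis"
    using p by (intro vpoly.span_sum mono_vec_span) (auto simp: in_P_iff)
  then show ?thesis using mono_vec_expand[OF p] by simp
qed

lemma zvec_coeff_zero:
  assumes a: "mon a" and x: "x \<in> index" and ne: "fst x \<noteq> a" and nt: "\<not> tri a (fst x)"
  shows "zvec x a = 0"
proof (intro ext)
  fix T show "zvec x a T = 0 T"
    using x ne nt Z_support[of "fst x" "snd x" a T]
    by (auto simp: zvec_def index_def fun_pointwise)
qed

text \<open>Among exponents with a nonzero coefficient choose a maximal one. At this monomial only
  the zeta with that exponent contribute, through their independent leading coefficients.\<close>

lemma zvec_combination_zero:
  assumes J: "finite J" "J \<subseteq> index" and s: "(\<Sum>x\<in>J. pscale (c x) (zvec x)) = 0"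
  shows "\<forall>x\<in>J. c x = 0"
proof (rule ccontr)
  assume neg: "\<not> ?thesis"
  define X where "X = fst ` {x \<in> J. c x \<noteq> 0}"
  have "finite X" "X \<noteq> {}" "\<And>b. b \<in> X \<Longrightarrow> mon b" using J neg by (auto simp: X_def index_def)
  then obtain a where a: "a \<in> X" "\<And>g. g \<in> X \<Longrightarrow> \<not> tri a g" using tri_maximal by metis
  have ma: "mon a" using a(1) J by (auto simp: X_def index_def)
  define F where "F = {T. (a, T) \<in> J}"
  have FY: "F \<subseteq> Y" using J by (auto simp: F_def index_def)
  have finF: "finite F" using FY finite_RSYT finite_subset by blast
  note r = rank_permutes[of N a]
  have zc: "c x * zvec x a S = 0" if "x \<in> J" "fst x \<noteq> a" for x S
  proof (cases "c x = 0")
    case False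
    then have "fst x \<in> X" using that by (auto simp: X_def)
    then show ?thesis using zvec_coeff_zero[OF ma _ that(2)] a(2) that J by (auto simp: fun_pointwise)
  qed simp
  have sum0: "(\<Sum>T\<in>F. c (a, T) * vact (inv (rk a)) (unit T) S) = 0" for S
  proof -
    have "(\<Sum>x\<in>J. pscale (c x) (zvec x)) a S = (\<Sum>x\<in>J. c x * zvec x a S)"
      by (simp add: sum_fun_apply pscale_def)
    also have "\<dots> = (\<Sum>x\<in>Pair a ` F. c x * zvec x a S)"
    proof (rule sum.mono_neutral_right)
      show "\<forall>x\<in>J - Pair a ` F. c x * zvec x a S = 0"
      proof
        fix x assume x: "x \<in> J - Pair a ` F"
        then have "fst x \<noteq> a" by (cases x) (auto simp: F_def)
        with x show "c x * zvec x a S = 0" by (intro zc) auto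
      qed
    qed (use J in \<open>auto simp: F_def\<close>)
    also have "\<dots> = (\<Sum>T\<in>F. c (a, T) * zvec (a, T) a S)" by (subst sum.reindex) (auto simp: inj_on_def)
    also have "\<dots> = (\<Sum>T\<in>F. c (a, T) * vact (inv (rk a)) (unit T) S)"
      using Z_leading[OF ma] FY by (intro sum.cong refl) (auto simp: zvec_def)
    finally show ?thesis using s by (simp add: fun_pointwise)
  qed
  define v where "v = (\<lambda>S. \<Sum>T\<in>F. c (a, T) * unit T S)"
  have vV: "v \<in> V" using FY by (auto simp: v_def V_def unit_def intro!: sum.neutral)
  have "vact (inv (rk a)) v = (\<lambda>S. 0)"
    unfolding v_def by (simp add: vact_sum vact_scale sum0)
  then have "v = (\<lambda>S. 0)" using vact_inv(1)[OF r vV] by (simp add: vact_zero)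
  obtain T where T: "(a, T) \<in> J" "c (a, T) \<noteq> 0" using a(1) by (auto simp: X_def)
  have "v T = (\<Sum>S\<in>F. if S = T then c (a, S) else 0)"
    unfolding v_def by (intro sum.cong) (auto simp: unit_def)
  also have "\<dots> = c (a, T)" using T finF by (simp add: F_def)
  finally show False using T \<open>v = (\<lambda>S. 0)\<close> by simp
qed

lemma zvec_inj: "inj_on zvec index"
proof (rule inj_onI, rule ccontr)
  fix x y assume xy: "x \<in> index" "y \<in> index" "zvec x = zvec y" "x \<noteq> y"
  let ?c = "\<lambda>z. if z = x then 1 else - 1"
  have "(\<Sum>z\<in>{x, y}. pscale (?c z) (zvec z)) = 0"
    using xy by (simp add: pscale_def fun_eq_iff fun_pointwise)
  from zvec_combination_zero[OF _ _ this] xy show False by auto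
qed

lemma zbasis_independent: "vpoly.independent zbasis"
proof
  assume "vpoly.dependent zbasis"
  then obtain t u where t: "finite t" "t \<subseteq> zbasis" "(\<Sum>v\<in>t. pscale (u v) v) = 0" "\<exists>v\<in>t. u v \<noteq> 0"
    unfolding vpoly.dependent_explicit by auto
  obtain J where J: "J \<subseteq> index" "finite J" "t = zvec ` J"
    using finite_subset_image[OF t(1) t(2)[unfolded zbasis_def]] by blast
  have "(\<Sum>x\<in>J. pscale (u (zvec x)) (zvec x)) = 0"
    using t(3) J zvec_inj by (simp add: sum.reindex inj_on_subset)
  from zvec_combination_zero[OF J(2,1) this] show False using t(4) J by auto
qed

definition coord :: "vpoly \<Rightarrow> mono \<times> tab \<Rightarrow> complex" where
  "coord p x = (if x \<in> index then vpoly.representation zbasis p (zvec x) else 0)"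

lemma coord_finite: "finite {x. coord p x \<noteq> 0}"
proof (rule finite_imageD)
  have "zvec ` {x. coord p x \<noteq> 0} \<subseteq> {b. vpoly.representation zbasis p b \<noteq> 0}"
    by (auto simp: coord_def split: if_splits)
  then show "finite (zvec ` {x. coord p x \<noteq> 0})" using vpoly.finite_representation finite_subset by blast
  show "inj_on zvec {x. coord p x \<noteq> 0}"
    by (rule inj_on_subset[OF zvec_inj]) (auto simp: coord_def split: if_splits)
qed

lemma coord_add: "P p \<Longrightarrow> P q \<Longrightarrow> coord (p + q) x = coord p x + coord q x"
  using vpoly.representation_add[OF zbasis_independent P_span P_span] by (simp add: coord_def)

lemma coord_pscale: "P p \<Longrightarrow> coord (pscale c p) x = c * coord p x"
  using vpoly.representation_scale[OF zbasis_independent P_span] by (simp add: coord_def)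

lemma coord_zvec: "x \<in> index \<Longrightarrow> coord (zvec x) y = (if y = x then 1 else 0)"
  using vpoly.representation_basis[OF zbasis_independent, of "zvec x"] zvec_inj
  by (auto simp: coord_def zbasis_def inj_on_def)

definition form :: "vpoly \<Rightarrow> vpoly \<Rightarrow> complex" where
  "form f g = (if P f \<and> P g then
     \<Sum>x\<in>{x. coord f x \<noteq> 0}. cnj (coord f x) * coord g x * complex_of_real (nux x) else 0)"

lemma form_eq:
  assumes "P f" "P g" "finite A" "{x. coord f x \<noteq> 0} \<subseteq> A"
  shows "form f g = (\<Sum>x\<in>A. cnj (coord f x) * coord g x * complex_of_real (nux x))"
  unfolding form_def using assms by (auto intro!: sum.mono_neutral_left)

lemma form_zvec:
  assumes "x \<in> index" "y \<in> index"
  shows "form (zvec x) (zvec y) = (if x = y then complex_of_real (nux x) else 0)"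
proof -
  have "form (zvec x) (zvec y) = (\<Sum>z\<in>{x}. cnj (coord (zvec x) z) * coord (zvec y) z * complex_of_real (nux z))"
    using assms by (intro form_eq P_zvec) (auto simp: coord_zvec)
  then show ?thesis using assms by (simp add: coord_zvec)
qed

definition sesq :: "(vpoly \<Rightarrow> vpoly \<Rightarrow> complex) \<Rightarrow> bool" where
  "sesq Q \<longleftrightarrow> (\<forall>f g h. P f \<longrightarrow> P g \<longrightarrow> P h \<longrightarrow> Q (f + g) h = Q f h + Q g h \<and> Q h (f + g) = Q h f + Q h g)
     \<and> (\<forall>c f g. P f \<longrightarrow> P g \<longrightarrow> Q (pscale c f) g = cnj c * Q f g \<and> Q f (pscale c g) = c * Q f g)"

lemma sesq_simps:
  assumes "sesq Q"
  shows "P f \<Longrightarrow> P g \<Longrightarrow> P h \<Longrightarrow> Q (f + g) h = Q f h + Q g h"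
    and "P f \<Longrightarrow> P g \<Longrightarrow> P h \<Longrightarrow> Q h (f + g) = Q h f + Q h g"
    and "P f \<Longrightarrow> P g \<Longrightarrow> Q (pscale c f) g = cnj c * Q f g"
    and "P f \<Longrightarrow> P g \<Longrightarrow> Q f (pscale c g) = c * Q f g"
  using assms unfolding sesq_def by blast+

lemma sesq_zero: "sesq Q \<Longrightarrow> P f \<Longrightarrow> Q 0 f = 0" "sesq Q \<Longrightarrow> P f \<Longrightarrow> Q f 0 = 0"
  using sesq_simps(3)[of Q 0 f 0] sesq_simps(4)[of Q f 0 0] P_zero by (auto simp: pscale_zero)

lemma sesq_form: "sesq form"
  unfolding sesq_def
proof (intro conjI allI impI)
  fix f g h assume P: "P f" "P g" "P h"
  let ?A = "{x. coord f x \<noteq> 0} \<union> {x. coord g x \<noteq> 0} \<union> {x. coord h x \<noteq> 0}"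
  have fin: "finite ?A" using coord_finite by simp
  have fg: "P (f + g)" using P P_add by blast
  have s: "{x. coord (f + g) x \<noteq> 0} \<subseteq> ?A" using P by (auto simp: coord_add)
  show "form (f + g) h = form f h + form g h"
    using P fg s by (subst (1 2 3) form_eq[OF _ _ fin]) (auto simp: coord_add sum.distrib[symmetric] algebra_simps)
  show "form h (f + g) = form h f + form h g"
    using P fg by (subst (1 2 3) form_eq[OF _ _ fin]) (auto simp: coord_add sum.distrib[symmetric] algebra_simps)
next
  fix c f g assume P: "P f" "P g"
  note fin = coord_finite[of f]
  have s: "{x. coord (pscale c f) x \<noteq> 0} \<subseteq> {x. coord f x \<noteq> 0}" using P by (auto simp: coord_pscale)
  show "form (pscale c f) g = cnj c * form f g"
    using P P_pscale s by (subst (1 2) form_eq[OF _ _ fin]) (auto simp: coord_pscale sum_distrib_left algebra_simps)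
  show "form f (pscale c g) = c * form f g"
    using P P_pscale by (subst (1 2) form_eq[OF _ _ fin]) (auto simp: coord_pscale sum_distrib_left algebra_simps)
qed

lemma form_hermitian:
  assumes P: "P f" "P g" shows "form g f = cnj (form f g)"
proof -
  let ?A = "{x. coord f x \<noteq> 0} \<union> {x. coord g x \<noteq> 0}"
  have fin: "finite ?A" using coord_finite by simp
  show ?thesis using P by (subst (1 2) form_eq[OF _ _ fin]) (auto simp: algebra_simps)
qed

lemma P_zspan_induct:
  assumes p: "P p" and zero: "R 0"
    and step: "\<And>c x q. x \<in> index \<Longrightarrow> P q \<Longrightarrow> R q \<Longrightarrow> R (pscale c (zvec x) + q)"
  shows "R p"
proof -
  have "P p \<and> R p"
    using P_span[OF p]
  proof (induction rule: vpoly.span_induct_alt)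
    case base
    then show ?case using P_zero zero by simp
  next
    case (step c x q)
    then obtain y where y: "y \<in> index" "x = zvec y" by (auto simp: zbasis_def)
    then show ?case using step assms(3)[OF y(1), of q c] P_add[OF P_pscale[OF P_zvec[OF y(1)]]] by auto
  qed
  then show ?thesis by simp
qed

lemma sesq_ext:
  assumes Q: "sesq Q" "sesq Q'"
    and eq: "\<And>x y. x \<in> index \<Longrightarrow> y \<in> index \<Longrightarrow> Q (zvec x) (zvec y) = Q' (zvec x) (zvec y)"
    and P: "P f" "P g"
  shows "Q f g = Q' f g"
proof -
  have 1: "Q (zvec x) g = Q' (zvec x) g" if x: "x \<in> index" for x
    using P(2)
  proof (rule P_zspan_induct)
    show "Q (zvec x) 0 = Q' (zvec x) 0" using Q P_zvec[OF x] by (simp add: sesq_zero)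
    fix c y q assume "y \<in> index" "P q" "Q (zvec x) q = Q' (zvec x) q"
    then show "Q (zvec x) (pscale c (zvec y) + q) = Q' (zvec x) (pscale c (zvec y) + q)"
      using Q eq[OF x] P_zvec P_pscale x by (simp add: sesq_simps)
  qed
  show ?thesis
    using P(1)
  proof (rule P_zspan_induct)
    show "Q 0 g = Q' 0 g" using Q P by (simp add: sesq_zero)
    fix c x q assume "x \<in> index" "P q" "Q q g = Q' q g"
    then show "Q (pscale c (zvec x) + q) g = Q' (pscale c (zvec x) + q) g"
      using Q 1 P_zvec P_pscale P by (simp add: sesq_simps)
  qed
qed

lemma sesq_comp:
  assumes Q: "sesq Q"
    and L: "\<And>p. P p \<Longrightarrow> P (L p)" "\<And>p q. P p \<Longrightarrow> P q \<Longrightarrow> L (p + q) = L p + L q"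
      "\<And>p c. P p \<Longrightarrow> L (pscale c p) = pscale c (L p)"
    and M: "\<And>p. P p \<Longrightarrow> P (M p)" "\<And>p q. P p \<Longrightarrow> P q \<Longrightarrow> M (p + q) = M p + M q"
      "\<And>p c. P p \<Longrightarrow> M (pscale c p) = pscale c (M p)"
  shows "sesq (\<lambda>f g. Q (L f) (M g))"
  unfolding sesq_def using Q L M by (simp add: sesq_simps)

end

context dunkl_small begin

text \<open>Checked on the basis, where it reduces to \<open>adj_off_nu\<close>. Since s_k is an
  involution this gives its invariance, and hence that of the whole group.\<close>

lemma form_adj_self:
  assumes k: "1 \<le> k" "k < N" and P: "P f" "P g"
  shows "form (act (adj k) f) g = form f (act (adj k) g)"
proof (rule sesq_ext[where Q = "\<lambda>f g. form (act (adj k) f) g" and Q' = "\<lambda>f g. form f (act (adj k) g)", OF _ _ _ P])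
  note ad = adj_permutes[OF k]
  show "sesq (\<lambda>f g. form (act (adj k) f) g)"
    using sesq_comp[OF sesq_form, of "act (adj k)" "\<lambda>p. p"] P_act[OF _ ad] by (simp add: act_add act_pscale)
  show "sesq (\<lambda>f g. form f (act (adj k) g))"
    using sesq_comp[OF sesq_form, of "\<lambda>p. p" "act (adj k)"] P_act[OF _ ad] by (simp add: act_add act_pscale)
  fix x y assume x: "x \<in> index" and y: "y \<in> index"
  let ?x = "adj_partner k x" and ?y = "adj_partner k y"
  have px: "?x \<in> index" and py: "?y \<in> index" using adj_partner_index[OF _ k] x y by auto
  have L: "form (act (adj k) (zvec x)) (zvec y) =
      complex_of_real (if x = y then adj_diag k x * nux x else 0)
      + complex_of_real (if ?x = y then adj_off k x * nux ?x else 0)"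
    unfolding act_zvec[OF x k]
    by (simp add: sesq_simps[OF sesq_form] P_pscale P_zvec x y px form_zvec)
  have R: "form (zvec x) (act (adj k) (zvec y)) =
      complex_of_real (if x = y then adj_diag k y * nux x else 0)
      + complex_of_real (if x = ?y then adj_off k y * nux x else 0)"
    unfolding act_zvec[OF y k]
    by (simp add: sesq_simps[OF sesq_form] P_pscale P_zvec x y py form_zvec)
  have "?x = y \<longleftrightarrow> x = ?y" using adj_partner_invol[OF x k] adj_partner_invol[OF y k] by metis
  then show "form (act (adj k) (zvec x)) (zvec y) = form (zvec x) (act (adj k) (zvec y))"
    unfolding L R using adj_off_nu[OF x k] by (cases "?x = y") auto
qed

lemma form_act:
  assumes w: "w permutes {1..N}" and P: "P f" "P g"
  shows "form (act w f) (act w g) = form f g"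
proof -
  have "\<forall>f g. P f \<longrightarrow> P g \<longrightarrow> form (act w f) (act w g) = form f g"
    using w
  proof (rule permutes_adj_induct)
    show "\<forall>f g. P f \<longrightarrow> P g \<longrightarrow> form (act id f) (act id g) = form f g" by (simp add: act_id)
  next
    fix k w assume k: "1 \<le> k" "k < N" and w: "w permutes {1..N}"
      and IH: "\<forall>f g. P f \<longrightarrow> P g \<longrightarrow> form (act w f) (act w g) = form f g"
    note ad = adj_permutes[OF k]
    show "\<forall>f g. P f \<longrightarrow> P g \<longrightarrow> form (act (adj k \<circ> w) f) (act (adj k \<circ> w) g) = form f g"
    proof (intro allI impI)
      fix f g assume P: "P f" "P g"
      have Pw: "P (act w f)" "P (act w g)" using P w P_act by auto
      have "form (act (adj k) (act w f)) (act (adj k) (act w g)) =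
         form (act w f) (act (adj k) (act (adj k) (act w g)))"
        by (rule form_adj_self[OF k Pw(1) P_act[OF Pw(2) ad]])
      also have "act (adj k) (act (adj k) (act w g)) = act w g"
        using act_transpose_invol[OF Pw(2), of k "Suc k"] k by simp
      also have "form (act w f) (act w g) = form f g" using IH P by blast
      finally show "form (act (adj k \<circ> w) f) (act (adj k \<circ> w) g) = form f g"
        by (simp only: act_comp[OF ad w])
    qed
  qed
  then show ?thesis using P by blast
qed

lemma U_zvec: "x \<in> index \<Longrightarrow> i \<in> {1..N} \<Longrightarrow>
    U i (zvec x) = pscale (complex_of_real (spec (fst x) (rcont (fst x) (snd x)) i)) (zvec x)"
  by (auto simp: zvec_def index_def U_Z)

text \<open>The zeta are orthogonal eigenvectors with real eigenvalues.\<close>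

lemma form_U:
  assumes i: "i \<in> {1..N}" and P: "P f" "P g"
  shows "form (U i f) g = form f (U i g)"
proof (rule sesq_ext[where Q = "\<lambda>f g. form (U i f) g" and Q' = "\<lambda>f g. form f (U i g)", OF _ _ _ P])
  show "sesq (\<lambda>f g. form (U i f) g)"
    using sesq_comp[OF sesq_form, of "U i" "\<lambda>p. p"] P_U[OF _ i] i by (simp add: U_add U_pscale)
  show "sesq (\<lambda>f g. form f (U i g))"
    using sesq_comp[OF sesq_form, of "\<lambda>p. p" "U i"] P_U[OF _ i] i by (simp add: U_add U_pscale)
  fix x y assume "x \<in> index" "y \<in> index"
  then show "form (U i (zvec x)) (zvec y) = form (zvec x) (U i (zvec y))"
    using i by (simp add: U_zvec sesq_simps[OF sesq_form] P_zvec form_zvec)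
qed

lemma shift_inj:
  assumes "mon a" "mon b" "shift a = shift b" shows "a = b"
proof
  fix i
  show "a i = b i"
  proof (cases "i \<in> {1..N}")
    case True
    show ?thesis
    proof (cases "i = 1")
      case True
      then show ?thesis using shift_apply(1)[of a] shift_apply(1)[of b] assms(3) by simp
    next
      case False
      then show ?thesis using True shift_apply(2)[of "i - 1" a] shift_apply(2)[of "i - 1" b] assms(3) by auto
    qed
  next
    case False
    then show ?thesis using mon_outside[OF assms(1)] mon_outside[OF assms(2)] by metis
  qed
qed

text \<open>The affine step maps the basis injectively into itself and preserves
  \<open>nu\<close>.\<close>

lemma form_Phi:
  assumes P: "P f" "P g"
  shows "form (Phi f) (Phi g) = form f g"
proof (rule sesq_ext[where Q = "\<lambda>f g. form (Phi f) (Phi g)" and Q' = form, OF _ sesq_form _ P])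
  show "sesq (\<lambda>f g. form (Phi f) (Phi g))"
    using sesq_comp[OF sesq_form, of Phi Phi] P_Phi by (simp add: Phi_add Phi_pscale)
  fix x y assume x: "x \<in> index" and y: "y \<in> index"
  have z: "Phi (zvec v) = zvec (shift (fst v), snd v)" "(shift (fst v), snd v) \<in> index" if "v \<in> index" for v
    using that Z_shift mon_shift by (auto simp: index_def zvec_def)
  have "(shift (fst x), snd x) = (shift (fst y), snd y) \<longleftrightarrow> x = y"
    using shift_inj[of "fst x" "fst y"] x y by (auto simp: index_def)
  then show "form (Phi (zvec x)) (Phi (zvec y)) = form (zvec x) (zvec y)"
    unfolding z(1)[OF x] z(1)[OF y] form_zvec[OF z(2)[OF x] z(2)[OF y]] form_zvec[OF x y]
    by (simp add: nu_shift)
qed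

text \<open>Multiplication by x_i is conjugate to that by x_N, which is \<open>Phi\<close> preceded
  by the inverse cycle. Invariance under the group and under \<open>Phi\<close> therefore yields
  invariance under every x_i.\<close>

lemma xmul_via_Phi:
  assumes P: "P p" and i: "i \<in> {1..N}"
  shows "xmul i p = act (transpose i N) (Phi (act (inv rot) (act (transpose i N) p)))"
proof -
  have N: "N \<in> {1..N}" using N2 by simp
  have t: "transpose i N permutes {1..N}" using i N by (rule permutes_swap_id)
  have "Phi (act (inv rot) (act (transpose i N) p)) = xmul N (act (transpose i N) p)"
    using act_inv(1)[OF P_act[OF P t] rot_permutes] by (simp add: Phi_def)
  then show ?thesis using act_transpose_invol[OF P i N] by (simp add: act_xmul[OF t])
qed

lemma form_xmul:
  assumes P: "P f" "P g" and i: "i \<in> {1..N}"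
  shows "form (xmul i f) (xmul i g) = form f g"
proof -
  have N: "N \<in> {1..N}" using N2 by simp
  have t: "transpose i N permutes {1..N}" using i N by (rule permutes_swap_id)
  note r = permutes_inv[OF rot_permutes]
  show ?thesis
    unfolding xmul_via_Phi[OF P(1) i] xmul_via_Phi[OF P(2) i]
  proof -
    note P1 = P_act[OF P(1) t] P_act[OF P(2) t]
    note P2 = P_act[OF P1(1) r] P_act[OF P1(2) r]
    show "form (act (transpose i N) (Phi (act (inv rot) (act (transpose i N) f))))
        (act (transpose i N) (Phi (act (inv rot) (act (transpose i N) g)))) = form f g"
      by (simp only: form_act[OF t P_Phi[OF P2(1)] P_Phi[OF P2(2)]] form_Phi[OF P2]
          form_act[OF r P1] form_act[OF t P])
  qed
qed

lemma xD_U: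
  assumes "P p" "i \<in> {1..N}"
  shows "xmul i (D i p) = U i p + pscale (- 1) p + pscale (- k') (\<Sum>j\<in>{i<..N}. act (transpose i j) p)"
  unfolding U_xD[OF assms] by (simp add: pscale_def fun_eq_iff fun_pointwise)

lemma sesq_sum:
  assumes Q: "sesq Q" and I: "finite I" "\<And>i. i \<in> I \<Longrightarrow> P (h i)" and f: "P f"
  shows "Q (\<Sum>i\<in>I. h i) f = (\<Sum>i\<in>I. Q (h i) f)" "Q f (\<Sum>i\<in>I. h i) = (\<Sum>i\<in>I. Q f (h i))"
  using I
proof (induction I rule: finite_induct)
  case empty
  case 1 show ?case using sesq_zero(1)[OF Q f] by simp
  case 2 show ?case using sesq_zero(2)[OF Q f] by simp
next
  case (insert i I)
  case 1 then show ?case using insert f P_sum[of I h] by (simp add: sesq_simps[OF Q])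
  case 2 then show ?case using insert f P_sum[of I h] by (simp add: sesq_simps[OF Q])
qed

text \<open>The two operators differ by a scalar and a real combination of transpositions, all
  self-adjoint for an invariant form. One direction serves the constructed form, the other an
  arbitrary admissible form.\<close>

lemma xD_selfadjoint_iff_U:
  assumes Q: "sesq Q" and inv: "\<And>w f g. w permutes {1..N} \<Longrightarrow> P f \<Longrightarrow> P g \<Longrightarrow> Q (act w f) (act w g) = Q f g"
    and P: "P f" "P g" and i: "i \<in> {1..N}"
  shows "Q (xmul i (D i f)) g = Q f (xmul i (D i g)) \<longleftrightarrow> Q (U i f) g = Q f (U i g)"
proof -
  have t: "transpose i j permutes {1..N}" if "j \<in> {i<..N}" for j
    using that i by (intro permutes_swap_id) auto
  have "Q (act (transpose i j) f) g = Q f (act (transpose i j) g)" if j: "j \<in> {i<..N}" for j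
    using inv[OF t[OF j] P(1) P_act[OF P(2) t[OF j]]] act_transpose_invol[OF P(2) i, of j] j i by simp
  moreover have Pj: "P (act (transpose i j) p)" if "P p" "j \<in> {i<..N}" for p j
    by (rule P_act[OF that(1) t[OF that(2)]])
  ultimately have s: "Q (\<Sum>j\<in>{i<..N}. act (transpose i j) f) g = Q f (\<Sum>j\<in>{i<..N}. act (transpose i j) g)"
    using sesq_sum(1)[OF Q finite_greaterThanAtMost Pj[OF P(1)] P(2)]
      sesq_sum(2)[OF Q finite_greaterThanAtMost Pj[OF P(2)] P(1)] by simp
  have PS: "P (\<Sum>j\<in>{i<..N}. act (transpose i j) p)" if "P p" for p
    by (rule P_sum[OF Pj[OF that]])
  note m = P_pscale[OF P(1), of "-1"] P_pscale[OF P(2), of "-1"]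
  note u = P_U[OF P(1) i] P_U[OF P(2) i]
  note S = PS[OF P(1)] PS[OF P(2)]
  note S' = P_pscale[OF S(1), of "- k'"] P_pscale[OF S(2), of "- k'"]
  have "Q (xmul i (D i f)) g = Q (U i f) g + cnj (- 1) * Q f g
      + cnj (- k') * Q (\<Sum>j\<in>{i<..N}. act (transpose i j) f) g"
    by (simp only: xD_U[OF P(1) i] sesq_simps(1)[OF Q P_add[OF u(1) m(1)] S'(1) P(2)]
        sesq_simps(1)[OF Q u(1) m(1) P(2)] sesq_simps(3)[OF Q P] sesq_simps(3)[OF Q S(1) P(2)])
  moreover have "Q f (xmul i (D i g)) = Q f (U i g) + (- 1) * Q f g
      + (- k') * Q f (\<Sum>j\<in>{i<..N}. act (transpose i j) g)"
    by (simp only: xD_U[OF P(2) i] sesq_simps(2)[OF Q P_add[OF u(2) m(2)] S'(2) P(1)]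
        sesq_simps(2)[OF Q u(2) m(2) P(1)] sesq_simps(4)[OF Q P] sesq_simps(4)[OF Q P(1) S(2)])
  ultimately show ?thesis using s by simp
qed

section \<open>Existence and uniqueness of the torus form\<close>

lemma herm_okD:
  assumes "herm_ok N tau kappa B"
  shows "\<not> (P f \<and> P g) \<Longrightarrow> B f g = 0"
    and "P f \<Longrightarrow> P g \<Longrightarrow> P h \<Longrightarrow> B (f + g) h = B f h + B g h"
    and "P f \<Longrightarrow> P g \<Longrightarrow> B (pscale c f) g = cnj c * B f g"
    and "P f \<Longrightarrow> P g \<Longrightarrow> B g f = cnj (B f g)"
    and "T \<in> Y \<Longrightarrow> T' \<in> Y \<Longrightarrow> B (one_tensor T) (one_tensor T') = complex_of_real (inner0 N tau T T')"
    and "w permutes {1..N} \<Longrightarrow> P f \<Longrightarrow> P g \<Longrightarrow> B (act w f) (act w g) = B f g"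
    and "i \<in> {1..N} \<Longrightarrow> P f \<Longrightarrow> P g \<Longrightarrow> B (xmul i (D i f)) g = B f (xmul i (D i g))"
    and "i \<in> {1..N} \<Longrightarrow> P f \<Longrightarrow> P g \<Longrightarrow> B (xmul i f) (xmul i g) = B f g"
proof -
  note H = assms[unfolded herm_ok_def padd_eq]
  note H2 = H[THEN conjunct2] note H3 = H2[THEN conjunct2] note H4 = H3[THEN conjunct2]
  note H5 = H4[THEN conjunct2] note H6 = H5[THEN conjunct2] note H7 = H6[THEN conjunct2]
  note H8 = H7[THEN conjunct2]
  show "\<not> (P f \<and> P g) \<Longrightarrow> B f g = 0" by (rule H[THEN conjunct1, rule_format])
  show "P f \<Longrightarrow> P g \<Longrightarrow> P h \<Longrightarrow> B (f + g) h = B f h + B g h"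
    by (rule H2[THEN conjunct1, rule_format]) simp
  show "P f \<Longrightarrow> P g \<Longrightarrow> B (pscale c f) g = cnj c * B f g"
    by (rule H3[THEN conjunct1, rule_format]) simp
  show "P f \<Longrightarrow> P g \<Longrightarrow> B g f = cnj (B f g)" by (rule H4[THEN conjunct1, rule_format]) simp
  show "T \<in> Y \<Longrightarrow> T' \<in> Y \<Longrightarrow> B (one_tensor T) (one_tensor T') = complex_of_real (inner0 N tau T T')"
    by (rule H5[THEN conjunct1, rule_format])
  show "w permutes {1..N} \<Longrightarrow> P f \<Longrightarrow> P g \<Longrightarrow> B (act w f) (act w g) = B f g"
    by (rule H6[THEN conjunct1, rule_format]) simp
  show "i \<in> {1..N} \<Longrightarrow> P f \<Longrightarrow> P g \<Longrightarrow> B (xmul i (D i f)) g = B f (xmul i (D i g))"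
    by (rule H7[THEN conjunct1, rule_format]) simp
  show "i \<in> {1..N} \<Longrightarrow> P f \<Longrightarrow> P g \<Longrightarrow> B (xmul i f) (xmul i g) = B f g"
    by (rule H8[rule_format]) simp
qed

lemma herm_ok_form: "herm_ok N tau kappa form"
  unfolding herm_ok_def
proof (intro conjI allI impI ballI)
  fix f g assume "\<not> (P f \<and> P g)" then show "form f g = 0" by (auto simp: form_def)
next
  fix f g h assume "P f \<and> P g \<and> P h"
  then show "form (padd f g) h = form f h + form g h" by (simp add: padd_eq sesq_simps[OF sesq_form])
next
  fix c f g assume "P f \<and> P g"
  then show "form (pscale c f) g = cnj c * form f g" by (simp add: sesq_simps[OF sesq_form])
next
  fix f g assume "P f \<and> P g" then show "form g f = cnj (form f g)" by (intro form_hermitian) auto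
next
  fix T T' assume T: "T \<in> Y" and T': "T' \<in> Y"
  have m: "mon (\<lambda>_. 0)" by (simp add: mon_def)
  have e: "one_tensor S = zvec (\<lambda>_. 0, S)" "(\<lambda>_. 0, S) \<in> index" if "S \<in> Y" for S
    using Z_zero[OF that] that m by (auto simp: zvec_def index_def)
  show "form (one_tensor T) (one_tensor T') = complex_of_real (inner0 N tau T T')"
    unfolding e(1)[OF T] e(1)[OF T'] form_zvec[OF e(2)[OF T] e(2)[OF T']]
    by (auto simp: nu_zero inner0_def)
next
  fix w f g assume "w permutes {1..N} \<and> P f \<and> P g"
  then show "form (act w f) (act w g) = form f g" by (simp add: form_act)
next
  fix i f g assume "i \<in> {1..N} \<and> P f \<and> P g"
  then have i: "i \<in> {1..N}" and P: "P f" "P g" by auto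
  show "form (xmul i (D i f)) g = form f (xmul i (D i g))"
  proof (rule xD_selfadjoint_iff_U[THEN iffD2, OF sesq_form _ P i])
    show "form (U i f) g = form f (U i g)" by (rule form_U[OF i P])
  qed (rule form_act)
next
  fix i f g assume "i \<in> {1..N} \<and> P f \<and> P g"
  then show "form (xmul i f) (xmul i g) = form f g" using form_xmul by blast
qed

lemma herm_ok_sesq:
  assumes B: "herm_ok N tau kappa B" shows "sesq B"
proof -
  note add = herm_okD(2)[OF B] and sc = herm_okD(3)[OF B] and h = herm_okD(4)[OF B]
  have "B h (f + g) = B h f + B h g" if "P f" "P g" "P h" for f g h
  proof -
    have "B h (f + g) = cnj (B (f + g) h)" by (rule h[OF P_add[OF that(1,2)] that(3)])
    also have "\<dots> = B h f + B h g" using that by (simp add: add h[of _ h])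
    finally show ?thesis .
  qed
  moreover have "B f (pscale c g) = c * B f g" if "P f" "P g" for c f g
  proof -
    have "B f (pscale c g) = cnj (B (pscale c g) f)" by (rule h[OF P_pscale[OF that(2)] that(1)])
    also have "\<dots> = c * B f g" using that by (simp add: sc h[of g f])
    finally show ?thesis .
  qed
  ultimately show ?thesis unfolding sesq_def using add sc by blast
qed

text \<open>Different exponents are separated by the eigenvalue of some U_i, in view of the bound on
  \<open>kappa\<close>. For equal exponents the values are propagated from constants through the two
  steps, each of which is governed by an invariance of B.\<close>

lemma herm_ok_zvec:
  assumes B: "herm_ok N tau kappa B" and x: "x \<in> index" and y: "y \<in> index"
  shows "B (zvec x) (zvec y) = (if x = y then complex_of_real (nux x) else 0)"
proof -
  note sB = herm_ok_sesq[OF B]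
  note act = herm_okD(6)[OF B] and xx = herm_okD(8)[OF B]
  have U: "B (U i f) g = B f (U i g)" if "i \<in> {1..N}" "P f" "P g" for i f g
  proof (rule xD_selfadjoint_iff_U[THEN iffD1, OF sB _ that(2,3,1)])
    show "B (xmul i (D i f)) g = B f (xmul i (D i g))" by (rule herm_okD(7)[OF B that])
  qed (rule act)
  have diff: "B (Z a T) (Z b T') = 0" if ab: "mon a" "mon b" "a \<noteq> b" and T: "T \<in> Y" "T' \<in> Y" for a b T T'
  proof -
    obtain i where "a i \<noteq> b i" using ab(3) by (auto simp: fun_eq_iff)
    then have i: "i \<in> {1..N}" using mon_outside ab by metis
    have "\<bar>kappa * real_of_int (rcont a T i - rcont b T' i)\<bar> < 1"
      using content_bounds[OF T(1) rk_in[OF i]] content_bounds[OF T(2) rk_in[OF i]]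
      by (intro kappa_diff_small)
    then have ne: "spec a (rcont a T) i \<noteq> spec b (rcont b T') i"
      using spec_eq_imp[of "a i" _ "b i"] \<open>a i \<noteq> b i\<close> by (auto simp: spec_def)
    have "B (U i (Z a T)) (Z b T') = B (Z a T) (U i (Z b T'))" using U i ab T P_Z by blast
    then have "complex_of_real (spec a (rcont a T) i) * B (Z a T) (Z b T') =
       complex_of_real (spec b (rcont b T') i) * B (Z a T) (Z b T')"
      using ab T i by (simp add: U_Z sesq_simps[OF sB] P_Z)
    then show ?thesis using ne by simp
  qed
  \<comment> \<open>For \<open>kappa = 0\<close> the eigenvalues do not separate \<open>T\<close> from \<open>T'\<close>; following the steps works for every \<open>kappa\<close>.\<close>
  have same: "\<forall>T\<in>Y. \<forall>T'\<in>Y. B (Z a T) (Z a T') = (if T = T' then complex_of_real (nu a T) else 0)"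
    if "mon a" for a
    using that
  proof (rule mono_induct)
    show "\<forall>T\<in>Y. \<forall>T'\<in>Y. B (Z (\<lambda>_. 0) T) (Z (\<lambda>_. 0) T') =
        (if T = T' then complex_of_real (nu (\<lambda>_. 0) T) else 0)"
    proof (intro ballI)
      fix T T' assume T: "T \<in> Y" "T' \<in> Y"
      have "B (one_tensor T) (one_tensor T') = complex_of_real (inner0 N tau T T')"
        by (rule herm_okD(5)[OF B T])
      then show "B (Z (\<lambda>_. 0) T) (Z (\<lambda>_. 0) T') =
        (if T = T' then complex_of_real (nu (\<lambda>_. 0) T) else 0)"
        using T by (auto simp: Z_zero nu_zero inner0_def)
    qed
  next
    fix a assume a: "mon a" and IH: "\<forall>T\<in>Y. \<forall>T'\<in>Y. B (Z a T) (Z a T') =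
        (if T = T' then complex_of_real (nu a T) else 0)"
    have "B (Z (shift a) T) (Z (shift a) T') = B (Z a T) (Z a T')" if T: "T \<in> Y" "T' \<in> Y" for T T'
      unfolding Z_shift[OF a T(1)] Z_shift[OF a T(2)] Phi_def
      using xx[of N "act rot (Z a T)" "act rot (Z a T')"] act[OF rot_permutes, of "Z a T" "Z a T'"]
        P_act[OF P_Z[OF a T(1)] rot_permutes] P_act[OF P_Z[OF a T(2)] rot_permutes] P_Z a T N2 by simp
    then show "\<forall>T\<in>Y. \<forall>T'\<in>Y. B (Z (shift a) T) (Z (shift a) T') =
        (if T = T' then complex_of_real (nu (shift a) T) else 0)"
      using IH by (simp add: nu_shift)
  next
    fix a k assume a: "mon a" and k: "1 \<le> k" "k < N" "a k < a (Suc k)"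
      and IH: "\<forall>T\<in>Y. \<forall>T'\<in>Y. B (Z a T) (Z a T') = (if T = T' then complex_of_real (nu a T) else 0)"
    have ma: "mon (a \<circ> adj k)" using a mon_comp[OF adj_permutes[OF k(1,2)]] by blast
    have ne: "a \<noteq> a \<circ> adj k" using k(3) by (metis comp_apply less_irrefl transpose_apply_first)
    show "\<forall>T\<in>Y. \<forall>T'\<in>Y. B (Z (a \<circ> adj k) T) (Z (a \<circ> adj k) T') =
        (if T = T' then complex_of_real (nu (a \<circ> adj k) T) else 0)"
    proof (intro ballI)
      fix T T' assume T: "T \<in> Y" "T' \<in> Y"
      let ?b = "complex_of_real (step_coef a T k)" and ?b' = "complex_of_real (step_coef a T' k)"
      have "B (Z a T) (Z a T') = B (act (adj k) (Z a T)) (act (adj k) (Z a T'))"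
        using act[OF adj_permutes[OF k(1,2)] P_Z[OF a T(1)] P_Z[OF a T(2)]] by simp
      also have "\<dots> = B (Z (a \<circ> adj k) T) (Z (a \<circ> adj k) T') + ?b * ?b' * B (Z a T) (Z a T')"
        unfolding Z_step[OF a T(1) k] Z_step[OF a T(2) k]
        using diff[OF a ma ne T] diff[OF ma a ne[symmetric] T] T a ma
        by (simp add: sesq_simps[OF sB] P_Z P_pscale P_add)
      finally have "B (Z (a \<circ> adj k) T) (Z (a \<circ> adj k) T') = (1 - ?b * ?b') * B (Z a T) (Z a T')"
        by (simp add: algebra_simps)
      then show "B (Z (a \<circ> adj k) T) (Z (a \<circ> adj k) T') =
        (if T = T' then complex_of_real (nu (a \<circ> adj k) T) else 0)"
        using IH T nu_step[OF k, of T] by (cases "T = T'") (simp_all add: power2_eq_square)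
    qed
  qed
  show ?thesis
  proof (cases "fst x = fst y")
    case True
    then show ?thesis using same[of "fst x"] x y by (cases x; cases y) (simp add: zvec_def index_def)
  next
    case False
    then show ?thesis using diff[of "fst x" "fst y"] x y by (auto simp: zvec_def index_def)
  qed
qed

lemma hermT_form: "hermT N tau kappa = form"
  unfolding hermT_def
proof (rule the_equality)
  show "herm_ok N tau kappa form" by (rule herm_ok_form)
next
  fix B assume B: "herm_ok N tau kappa B"
  show "B = form"
  proof (intro ext)
    fix f g show "B f g = form f g"
    proof (cases "P f \<and> P g")
      case True
      then have P: "P f" "P g" by auto
      show ?thesis
      proof (rule sesq_ext[OF herm_ok_sesq[OF B] sesq_form _ P])
        fix x y assume "x \<in> index" "y \<in> index"
        then show "B (zvec x) (zvec y) = form (zvec x) (zvec y)"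
          by (simp only: herm_ok_zvec[OF B] form_zvec)
      qed
    next
      case False
      then have "B f g = 0" by (rule herm_okD(1)[OF B])
      then show ?thesis using False by (auto simp: form_def)
    qed
  qed
qed

lemma pnorm2_zvec: "x \<in> index \<Longrightarrow> pnorm2 N tau kappa (zvec x) = complex_of_real (nux x)"
  by (simp add: pnorm2_def hermT_form form_zvec)

lemma pnorm2_combination:
  assumes X: "finite X" "X \<subseteq> index"
  shows "pnorm2 N tau kappa (\<Sum>x\<in>X. pscale (complex_of_real (c x)) (zvec x)) =
    complex_of_real (\<Sum>x\<in>X. (c x)\<^sup>2 * nux x)"
proof -
  let ?z = "\<lambda>x. pscale (complex_of_real (c x)) (zvec x)"
  have Pz: "P (?z x)" if "x \<in> X" for x using that X P_zvec P_pscale by blast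
  have PS: "P (\<Sum>x\<in>X. ?z x)" by (rule P_sum[OF Pz])
  have "form (\<Sum>x\<in>X. ?z x) (\<Sum>x\<in>X. ?z x) = (\<Sum>x\<in>X. \<Sum>y\<in>X. form (?z x) (?z y))"
    using sesq_sum(1)[OF sesq_form X(1) Pz PS] sesq_sum(2)[OF sesq_form X(1) Pz Pz] by simp
  also have "\<dots> = (\<Sum>x\<in>X. \<Sum>y\<in>X. if x = y then complex_of_real ((c x)\<^sup>2 * nux x) else 0)"
  proof (intro sum.cong refl)
    fix x y assume "x \<in> X" "y \<in> X"
    then have xy: "x \<in> index" "y \<in> index" using X by auto
    note Pxy = P_zvec[OF xy(1)] P_zvec[OF xy(2)]
    have "form (?z x) (?z y) = complex_of_real (c x) * complex_of_real (c y) * form (zvec x) (zvec y)"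
      using sesq_simps(3)[OF sesq_form Pxy(1) P_pscale[OF Pxy(2)], of "complex_of_real (c x)"]
        sesq_simps(4)[OF sesq_form Pxy, of "complex_of_real (c y)"] by simp
    then show "form (?z x) (?z y) = (if x = y then complex_of_real ((c x)\<^sup>2 * nux x) else 0)"
      using form_zvec[OF xy] by (simp add: power2_eq_square)
  qed
  also have "\<dots> = complex_of_real (\<Sum>x\<in>X. (c x)\<^sup>2 * nux x)" using X(1) by simp
  finally show ?thesis by (simp add: pnorm2_def hermT_form)
qed

end

section \<open>Sums over arrangements\<close>

text \<open>The expansion of a rational function of t with simple poles at the Z k and value 1 at
  infinity; the numerators are the residues. The induction adds one pole and evaluates the
  hypothesis both at t and at the new pole.\<close>

lemma partial_fraction_prod:
  fixes Z :: "'a \<Rightarrow> real"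
  assumes "finite A" "inj_on Z A" "\<And>j. j \<in> A \<Longrightarrow> t \<noteq> Z j"
  shows "(\<Prod>j\<in>A. 1 + 1 / (t - Z j)) = 1 + (\<Sum>k\<in>A. (\<Prod>j\<in>A - {k}. 1 + 1 / (Z k - Z j)) / (t - Z k))"
  using assms
proof (induction A arbitrary: t rule: finite_induct)
  case (insert b A)
  let ?w = "\<lambda>k. \<Prod>j\<in>A - {k}. 1 + 1 / (Z k - Z j)"
  let ?s = "Z b"
  have ts: "t \<noteq> ?s" and tz: "\<And>k. k \<in> A \<Longrightarrow> t \<noteq> Z k" using insert by auto
  have sz: "\<And>k. k \<in> A \<Longrightarrow> ?s \<noteq> Z k" using insert by (auto simp: inj_on_def)
  have inj: "inj_on Z A" using insert by (auto simp: inj_on_def)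
  have IHt: "(\<Prod>j\<in>A. 1 + 1 / (t - Z j)) = 1 + (\<Sum>k\<in>A. ?w k / (t - Z k))" by (rule insert.IH[OF inj tz])
  have IHs: "(\<Prod>j\<in>A. 1 + 1 / (?s - Z j)) = 1 + (\<Sum>k\<in>A. ?w k / (?s - Z k))" by (rule insert.IH[OF inj sz])
  \<comment> \<open>Splits a product of two simple poles: one part corrects the residue at Z k, the
    other collects at the new pole.\<close>
  have pf: "1 / (t - ?s) * (?w k / (t - Z k)) =
      1 / (Z k - ?s) * (?w k / (t - Z k)) + ?w k / (?s - Z k) / (t - ?s)" if "k \<in> A" for k
    using ts tz[OF that] sz[OF that] by (simp add: divide_simps) (simp add: algebra_simps)
  have wk: "(\<Prod>j\<in>insert b A - {k}. 1 + 1 / (Z k - Z j)) = (1 + 1 / (Z k - ?s)) * ?w k" if "k \<in> A" for k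
  proof -
    have "insert b A - {k} = insert b (A - {k})" using that insert by auto
    then show ?thesis using insert by simp
  qed
  have "(\<Prod>j\<in>insert b A. 1 + 1 / (t - Z j)) = (1 + 1 / (t - ?s)) * (1 + (\<Sum>k\<in>A. ?w k / (t - Z k)))"
    using insert IHt by simp
  also have "\<dots> = 1 + (\<Sum>k\<in>A. ?w k / (t - Z k)) + 1 / (t - ?s)
      + (\<Sum>k\<in>A. 1 / (t - ?s) * (?w k / (t - Z k)))"
    by (simp only: sum_distrib_left[symmetric]) (simp add: distrib_left distrib_right)
  also have "(\<Sum>k\<in>A. 1 / (t - ?s) * (?w k / (t - Z k))) =
      (\<Sum>k\<in>A. 1 / (Z k - ?s) * (?w k / (t - Z k))) + (\<Sum>k\<in>A. ?w k / (?s - Z k)) / (t - ?s)"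
    unfolding sum_divide_distrib sum.distrib[symmetric] by (intro sum.cong refl pf)
  also have "1 + (\<Sum>k\<in>A. ?w k / (t - Z k)) + 1 / (t - ?s)
      + ((\<Sum>k\<in>A. 1 / (Z k - ?s) * (?w k / (t - Z k))) + (\<Sum>k\<in>A. ?w k / (?s - Z k)) / (t - ?s))
    = 1 + (\<Sum>k\<in>A. (1 + 1 / (Z k - ?s)) * ?w k / (t - Z k)) + (1 + (\<Sum>k\<in>A. ?w k / (?s - Z k))) / (t - ?s)"
    by (simp add: sum.distrib add_divide_distrib distrib_right)
  also have "(1 + (\<Sum>k\<in>A. ?w k / (?s - Z k))) / (t - ?s) = (\<Prod>j\<in>insert b A - {b}. 1 + 1 / (?s - Z j)) / (t - ?s)"
    using insert IHs by simp
  finally show ?case using insert by (simp add: wk)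
qed simp

text \<open>Adding b changes each old term by w_k / (Z b - Z k), and the new term is the partial
  fraction expansion at t = Z b. The corrections cancel, leaving an increase by 1.\<close>

lemma sum_prod_unit_shift:
  fixes Z :: "'a \<Rightarrow> real"
  assumes "finite A" "inj_on Z A"
  shows "(\<Sum>k\<in>A. \<Prod>j\<in>A - {k}. 1 + 1 / (Z k - Z j)) = real (card A)"
  using assms
proof (induction A rule: finite_induct)
  case (insert b A)
  let ?w = "\<lambda>k. \<Prod>j\<in>A - {k}. 1 + 1 / (Z k - Z j)"
  have inj: "inj_on Z A" using insert by (auto simp: inj_on_def)
  have sz: "\<And>k. k \<in> A \<Longrightarrow> Z b \<noteq> Z k" using insert by (auto simp: inj_on_def)
  have "(\<Prod>j\<in>insert b A - {k}. 1 + 1 / (Z k - Z j)) = ?w k - ?w k / (Z b - Z k)" if "k \<in> A" for k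
  proof -
    have "insert b A - {k} = insert b (A - {k})" using that insert by auto
    moreover have "1 / (Z k - Z b) = - (1 / (Z b - Z k))" by (metis minus_diff_eq minus_divide_right)
    ultimately show ?thesis using insert by (simp add: algebra_simps)
  qed
  moreover have "insert b A - {b} = A" using insert by auto
  ultimately have "(\<Sum>k\<in>insert b A. \<Prod>j\<in>insert b A - {k}. 1 + 1 / (Z k - Z j)) =
     (\<Prod>j\<in>A. 1 + 1 / (Z b - Z j)) + ((\<Sum>k\<in>A. ?w k) - (\<Sum>k\<in>A. ?w k / (Z b - Z k)))"
    using insert by (simp add: sum_subtractf)
  also have "\<dots> = 1 + real (card A)"
    using partial_fraction_prod[OF insert.hyps(1) inj sz] insert.IH[OF inj] by simp
  finally show ?case using insert by simp
qed simp

text \<open>Classes cover the degenerate case \<open>kappa = 0\<close>, where only cells with equal entries interact,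
  and the count of arrangements, where only cells of a common row do.\<close>
definition class_factor :: "('a \<Rightarrow> 'c) \<Rightarrow> ('a \<Rightarrow> real) \<Rightarrow> 'a \<Rightarrow> 'a \<Rightarrow> real" where
  "class_factor cls Z u v = (if cls u = cls v then 1 + 1 / (Z u - Z v) else 1)"

text \<open>Factors between different classes are 1, so every class contributes its own
  cardinality.\<close>

lemma sum_prod_class_factor:
  assumes A: "finite A" and inj: "\<And>u v. u \<in> A \<Longrightarrow> v \<in> A \<Longrightarrow> cls u = cls v \<Longrightarrow> Z u = Z v \<Longrightarrow> u = v"
  shows "(\<Sum>k\<in>A. \<Prod>j\<in>A - {k}. class_factor cls Z k j) = real (card A)"
proof -
  have "(\<Sum>k\<in>{k \<in> A. cls k = c}. \<Prod>j\<in>A - {k}. class_factor cls Z k j) = (\<Sum>k\<in>{k \<in> A. cls k = c}. 1)" for c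
  proof -
    let ?B = "{k \<in> A. cls k = c}"
    have "(\<Sum>k\<in>?B. \<Prod>j\<in>A - {k}. class_factor cls Z k j) = (\<Sum>k\<in>?B. \<Prod>j\<in>?B - {k}. 1 + 1 / (Z k - Z j))"
      using A by (intro sum.cong refl prod.mono_neutral_cong_right) (auto simp: class_factor_def)
    also have "\<dots> = real (card ?B)"
      using A inj by (intro sum_prod_unit_shift) (auto simp: inj_on_def)
    finally show ?thesis by simp
  qed
  then have "(\<Sum>c\<in>cls ` A. \<Sum>k\<in>{k \<in> A. cls k = c}. \<Prod>j\<in>A - {k}. class_factor cls Z k j) =
     (\<Sum>c\<in>cls ` A. \<Sum>k\<in>{k \<in> A. cls k = c}. 1)" by simp
  then show ?thesis
    using sum.group[OF A finite_imageI[OF A] order_refl, of "\<lambda>k. \<Prod>j\<in>A - {k}. class_factor cls Z k j" cls]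
      sum.group[OF A finite_imageI[OF A] order_refl, of "\<lambda>k. 1 :: real" cls] by simp
qed

fun pair_prod :: "('a \<Rightarrow> 'a \<Rightarrow> real) \<Rightarrow> 'a list \<Rightarrow> real" where
  "pair_prod g [] = 1"
| "pair_prod g (x # xs) = (\<Prod>y\<in>set xs. g x y) * pair_prod g xs"

text \<open>Recursion on the first letter: the remaining letters sum to the factorial of one less,
  independently of the choice, and the first letter contributes the cardinality. The hypothesis is
  made for all subsets because the set shrinks at each step.\<close>

lemma sum_pair_prod:
  assumes "finite A" "\<And>B. B \<subseteq> A \<Longrightarrow> (\<Sum>k\<in>B. \<Prod>j\<in>B - {k}. g k j) = real (card B)"
  shows "(\<Sum>xs\<in>permutations_of_set A. pair_prod g xs) = fact (card A)"
  using assms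
proof (induction A rule: finite_psubset_induct)
  case (psubset A)
  show ?case
  proof (cases "A = {}")
    case False
    have "(\<Sum>xs\<in>permutations_of_set A. pair_prod g xs) =
       (\<Sum>x\<in>A. \<Sum>xs\<in>(#) x ` permutations_of_set (A - {x}). pair_prod g xs)"
      unfolding permutations_of_set_nonempty[OF False] using psubset.hyps
      by (intro sum.UNION_disjoint) auto
    also have "\<dots> = (\<Sum>x\<in>A. \<Sum>xs\<in>permutations_of_set (A - {x}). (\<Prod>y\<in>A - {x}. g x y) * pair_prod g xs)"
    proof (rule sum.cong[OF refl])
      fix x
      have "(\<Sum>xs\<in>(#) x ` permutations_of_set (A - {x}). pair_prod g xs) =
          (\<Sum>xs\<in>permutations_of_set (A - {x}). pair_prod g (x # xs))"
        by (subst sum.reindex) auto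
      also have "\<dots> = (\<Sum>xs\<in>permutations_of_set (A - {x}). (\<Prod>y\<in>A - {x}. g x y) * pair_prod g xs)"
        by (intro sum.cong refl) (simp add: permutations_of_setD)
      finally show "(\<Sum>xs\<in>(#) x ` permutations_of_set (A - {x}). pair_prod g xs) = \<dots>" .
    qed
    also have "\<dots> = (\<Sum>x\<in>A. (\<Prod>y\<in>A - {x}. g x y) * fact (card A - 1))"
    proof (intro sum.cong refl)
      fix x assume x: "x \<in> A"
      then have "A - {x} \<subset> A" by auto
      from psubset.IH[OF this] psubset.prems x psubset.hyps
      show "(\<Sum>xs\<in>permutations_of_set (A - {x}). (\<Prod>y\<in>A - {x}. g x y) * pair_prod g xs) =
          (\<Prod>y\<in>A - {x}. g x y) * fact (card A - 1)"
        by (subst sum_distrib_left[symmetric]) (auto simp: card_Diff_singleton)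
    qed
    also have "\<dots> = real (card A) * fact (card A - 1)"
      using psubset.prems[OF order_refl] by (simp add: sum_distrib_right[symmetric])
    also have "\<dots> = fact (card A)"
      using False psubset.hyps by (subst (2) fact_reduce) (auto simp: card_gt_0_iff)
    finally show ?thesis .
  qed simp
qed

lemma pair_prod_pairs:
  "distinct xs \<Longrightarrow> pair_prod g xs = (\<Prod>(i, j)\<in>pairs (length xs). g (xs ! (i - 1)) (xs ! (j - 1)))"
proof (induction xs)
  case Nil
  have "pairs 0 = {}" by (auto simp: pairs_def)
  then show ?case by simp
next
  case (Cons x xs)
  let ?n = "length xs"
  let ?h = "\<lambda>(i, j). g ((x # xs) ! (i - 1)) ((x # xs) ! (j - 1))"
  have split: "pairs (Suc ?n) = (\<lambda>j. (1, Suc j)) ` {1..?n} \<union> (\<lambda>(i, j). (Suc i, Suc j)) ` pairs ?n"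
  proof
    show "pairs (Suc ?n) \<subseteq> (\<lambda>j. (1, Suc j)) ` {1..?n} \<union> (\<lambda>(i, j). (Suc i, Suc j)) ` pairs ?n"
    proof
      fix p assume "p \<in> pairs (Suc ?n)"
      then obtain i j where p: "p = (i, j)" "1 \<le> i" "i < j" "j \<le> Suc ?n" by (auto simp: pairs_def)
      show "p \<in> (\<lambda>j. (1, Suc j)) ` {1..?n} \<union> (\<lambda>(i, j). (Suc i, Suc j)) ` pairs ?n"
      proof (cases "i = 1")
        case True
        then show ?thesis using p by (intro UnI1 image_eqI[of _ _ "j - 1"]) auto
      next
        case False
        then show ?thesis using p by (intro UnI2 image_eqI[of _ _ "(i - 1, j - 1)"]) (auto simp: pairs_def)
      qed
    qed
  qed (auto simp: pairs_def)
  have "(\<Prod>p\<in>pairs (Suc ?n). ?h p) = (\<Prod>p\<in>(\<lambda>j. (1, Suc j)) ` {1..?n}. ?h p) *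
      (\<Prod>p\<in>(\<lambda>(i, j). (Suc i, Suc j)) ` pairs ?n. ?h p)"
    unfolding split using finite_pairs by (intro prod.union_disjoint) (auto simp: pairs_def)
  also have "(\<Prod>p\<in>(\<lambda>j. (1, Suc j)) ` {1..?n}. ?h p) = (\<Prod>j\<in>{1..?n}. g x (xs ! (j - 1)))"
    by (subst prod.reindex) (auto simp: inj_on_def nth_Cons split: nat.splits intro!: prod.cong)
  also have "\<dots> = (\<Prod>y\<in>set xs. g x y)"
  proof (rule prod.reindex_bij_betw)
    have "bij_betw ((!) xs) {..<?n} (set xs)" using Cons.prems by (intro bij_betw_nth) auto
    moreover have "bij_betw (\<lambda>j. j - 1) {1..?n} {..<?n}"
      by (rule bij_betw_byWitness[where f' = Suc]) auto
    ultimately show "bij_betw (\<lambda>j. xs ! (j - 1)) {1..?n} (set xs)"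
      using bij_betw_trans[of "\<lambda>j. j - 1" "{1..?n}" "{..<?n}" "(!) xs" "set xs"] by (simp add: comp_def)
  qed
  also have "(\<Prod>p\<in>(\<lambda>(i, j). (Suc i, Suc j)) ` pairs ?n. ?h p) =
      (\<Prod>(i, j)\<in>pairs ?n. g (xs ! (i - 1)) (xs ! (j - 1)))"
  proof -
    have "inj_on (\<lambda>(i, j). (Suc i, Suc j)) (pairs ?n)" by (auto simp: inj_on_def)
    then show ?thesis
      by (subst prod.reindex) (auto simp: pairs_def nth_Cons split: nat.splits intro!: prod.cong)
  qed
  finally show ?case using Cons by simp
qed

text \<open>Rewrites a product over pairs of positions as a product over pairs of cells in an order
  that does not depend on the arrangement, which enters only through the test q u < q v. Products
  for different arrangements thereby become comparable factor by factor.\<close>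

lemma prod_pairs_bij:
  fixes h :: "'a \<Rightarrow> 'a \<Rightarrow> real"
  assumes e: "bij_betw e {1..N} A" and q: "\<And>i. i \<in> {1..N} \<Longrightarrow> q (e i) = i"
    and total: "\<And>u v. u \<in> A \<Longrightarrow> v \<in> A \<Longrightarrow> u \<noteq> v \<Longrightarrow> lt u v \<or> lt v u"
    and asym: "\<And>u v. lt u v \<Longrightarrow> \<not> lt v u"
  shows "(\<Prod>(i, j)\<in>pairs N. h (e i) (e j)) =
    (\<Prod>(u, v)\<in>{(u, v). u \<in> A \<and> v \<in> A \<and> lt u v}. if q u < q v then h u v else h v u)"
proof -
  let ?L = "{(u, v). u \<in> A \<and> v \<in> A \<and> lt u v}"
  let ?f = "\<lambda>(i, j). if lt (e i) (e j) then (e i, e j) else (e j, e i)"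
  let ?g = "\<lambda>(u, v). if q u < q v then (q u, q v) else (q v, q u)"
  let ?H = "\<lambda>(u, v). if q u < q v then h u v else h v u"
  have eA: "\<And>i. i \<in> {1..N} \<Longrightarrow> e i \<in> A" using e by (auto simp: bij_betw_def)
  have qA: "q u \<in> {1..N} \<and> e (q u) = u" if "u \<in> A" for u
  proof -
    have "u \<in> e ` {1..N}" using e that by (simp add: bij_betw_def)
    then obtain i where "i \<in> {1..N}" "u = e i" by blast
    then show ?thesis using q by simp
  qed
  have in_p: "(i, j) \<in> pairs N \<Longrightarrow> i \<in> {1..N} \<and> j \<in> {1..N} \<and> i < j" for i j by (auto simp: pairs_def)
  have bij: "bij_betw ?f (pairs N) ?L"
  proof (rule bij_betw_byWitness[where f' = ?g])
    show "\<forall>p\<in>pairs N. ?g (?f p) = p"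
    proof
      fix p assume "p \<in> pairs N"
      then obtain i j where p: "p = (i, j)" "(i, j) \<in> pairs N" by (cases p) auto
      then have "i \<in> {1..N}" "j \<in> {1..N}" "i < j" using in_p by auto
      then show "?g (?f p) = p" using q p by auto
    qed
    show "\<forall>p\<in>?L. ?f (?g p) = p" using qA asym by auto
    show "?f ` pairs N \<subseteq> ?L"
    proof
      fix p assume "p \<in> ?f ` pairs N"
      then obtain i j where ij: "(i, j) \<in> pairs N" "p = ?f (i, j)" by auto
      then have "i \<in> {1..N}" "j \<in> {1..N}" "i < j" using in_p by auto
      then have "e i \<in> A" "e j \<in> A" "e i \<noteq> e j" using eA q by (metis, metis, metis less_irrefl)
      then show "p \<in> ?L" using total ij by auto
    qed
    show "?g ` ?L \<subseteq> pairs N"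
    proof
      fix p assume "p \<in> ?g ` ?L"
      then obtain u v where uv: "u \<in> A" "v \<in> A" "lt u v" "p = ?g (u, v)" by auto
      then have "u \<noteq> v" using asym by auto
      then have "q u \<noteq> q v" using qA uv by metis
      then show "p \<in> pairs N" using qA[OF uv(1)] qA[OF uv(2)] uv(4) by (auto simp: pairs_def)
    qed
  qed
  have "(\<Prod>p\<in>pairs N. case p of (i, j) \<Rightarrow> h (e i) (e j)) = (\<Prod>p\<in>pairs N. ?H (?f p))"
  proof (rule prod.cong[OF refl])
    fix p assume "p \<in> pairs N"
    then obtain i j where p: "p = (i, j)" "(i, j) \<in> pairs N" by (cases p) auto
    then have "i \<in> {1..N}" "j \<in> {1..N}" "i < j" using in_p by auto
    then show "(case p of (i, j) \<Rightarrow> h (e i) (e j)) = ?H (?f p)" using q p by auto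
  qed
  also have "\<dots> = (\<Prod>p\<in>?L. ?H p)" by (rule prod.reindex_bij_betw[OF bij])
  finally show ?thesis .
qed

lemma card_rank_order:
  assumes A: "finite A"
    and refl: "\<And>u. u \<in> A \<Longrightarrow> le u u"
    and trans: "\<And>u v w. u \<in> A \<Longrightarrow> v \<in> A \<Longrightarrow> w \<in> A \<Longrightarrow> le u v \<Longrightarrow> le v w \<Longrightarrow> le u w"
    and antisym: "\<And>u v. u \<in> A \<Longrightarrow> v \<in> A \<Longrightarrow> le u v \<Longrightarrow> le v u \<Longrightarrow> u = v"
    and total: "\<And>u v. u \<in> A \<Longrightarrow> v \<in> A \<Longrightarrow> le u v \<or> le v u"
  defines "t \<equiv> \<lambda>u. card {w \<in> A. le w u}"
  shows "bij_betw t A {1..card A}" and "\<And>u v. u \<in> A \<Longrightarrow> v \<in> A \<Longrightarrow> t u \<le> t v \<longleftrightarrow> le u v"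
proof -
  show le_iff: "t u \<le> t v \<longleftrightarrow> le u v" if u: "u \<in> A" and v: "v \<in> A" for u v
  proof (cases "le u v")
    case True
    then have "{w \<in> A. le w u} \<subseteq> {w \<in> A. le w v}" using trans u v by blast
    then show ?thesis using True A by (auto simp: t_def intro!: card_mono)
  next
    case False
    then have "le v u" using total u v by blast
    then have "{w \<in> A. le w v} \<subset> {w \<in> A. le w u}" using trans refl u v False by blast
    then have "t v < t u" unfolding t_def using A by (intro psubset_card_mono) auto
    then show ?thesis using False by simp
  qed
  have inj: "inj_on t A" by (rule inj_onI) (metis le_iff antisym order_refl)
  have "t ` A \<subseteq> {1..card A}"
  proof
    fix k assume "k \<in> t ` A"
    then obtain u where u: "u \<in> A" "k = t u" by blast
    have "{w \<in> A. le w u} \<noteq> {}" using refl u by blast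
    then have "0 < t u" unfolding t_def using A by (simp add: card_gt_0_iff)
    moreover have "t u \<le> card A" unfolding t_def using A by (intro card_mono) auto
    ultimately show "k \<in> {1..card A}" using u by simp
  qed
  moreover have "card (t ` A) = card {1..card A}" using inj by (simp add: card_image)
  ultimately have "t ` A = {1..card A}" by (intro card_subset_eq) auto
  then show "bij_betw t A {1..card A}" using inj by (simp add: bij_betw_def)
qed

lemma plus_part_of_antimono:
  assumes "\<And>i j. 1 \<le> i \<Longrightarrow> i \<le> j \<Longrightarrow> j \<le> N \<Longrightarrow> a j \<le> a i" and "k \<in> {1..N}"
  shows "plus_part N a k = a k"
proof -
  have "rank N a = id"
  proof (rule rank_eqI)
    fix i j assume "i \<in> {1..N}" "j \<in> {1..N}"
    then show "id j \<le> id i \<longleftrightarrow> a i < a j \<or> (a j = a i \<and> j \<le> i)"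
      using assms(1)[of i j] assms(1)[of j i] by (cases "j \<le> i") auto
  qed (simp add: permutes_id)
  then show ?thesis using plus_part_eq[OF assms(2), of a] by (simp add: inv_id)
qed

section \<open>The norm of the symmetric Jack polynomial\<close>

lemma nth_bij_perm:
  assumes "xs \<in> permutations_of_set A"
  shows "bij_betw (\<lambda>i. xs ! (i - 1)) {1..card A} A"
proof -
  note d = permutations_of_setD[OF assms]
  have len: "length xs = card A" using d distinct_card by metis
  have "bij_betw ((!) xs) {..<length xs} (set xs)" using d by (intro bij_betw_nth) auto
  moreover have "bij_betw (\<lambda>j. j - 1) {1..length xs} {..<length xs}"
    by (rule bij_betw_byWitness[where f' = Suc]) auto
  ultimately show ?thesis
    using bij_betw_trans[of "\<lambda>j. j - 1" "{1..length xs}" "{..<length xs}" "(!) xs" "set xs"] d len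
    by (simp add: comp_def)
qed

lemma prod_nonzeroI: "(\<And>x. x \<in> A \<Longrightarrow> f x \<noteq> 0) \<Longrightarrow> prod f A \<noteq> (0 :: real)"
  by (cases "finite A") (auto simp: prod_zero_iff)

locale jack_setup = dunkl_small +
  fixes lam :: mono and T0 :: tab
  assumes lam_mon: "mon lam"
    and lam_antimono: "\<And>i j. 1 \<le> i \<Longrightarrow> i \<le> j \<Longrightarrow> j \<le> N \<Longrightarrow> lam j \<le> lam i"
    and T0: "T0 \<in> Y"
    and col_strict: "column_strict tau (fill N tau lam T0)"
begin

definition F :: tab where "F = fill N tau lam T0"

abbreviation "C \<equiv> cells tau"

lemma card_C: "card C = N"
  by (rule card_cells[OF filling_RSYT[OF T0]])

lemma plus_lam: "k \<in> {1..N} \<Longrightarrow> plus_part N lam k = lam k"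
  by (rule plus_part_of_antimono[OF lam_antimono])

lemma F_T0: "c \<in> C \<Longrightarrow> F c = lam (T0 c)"
  using plus_lam filling_in[OF filling_RSYT[OF T0]] by (simp add: F_def fill_def)

lemma F_mono:
  assumes u: "u \<in> C" and v: "v \<in> C" and le: "fst u \<le> fst v" "snd u \<le> snd v"
  shows "F u \<le> F v" "fst u < fst v \<Longrightarrow> F u < F v"
proof -
  have row: "(i, j + m) \<in> C \<Longrightarrow> 1 \<le> j \<Longrightarrow> F (i, j) \<le> F (i, j + m)" for i j m
  proof (induction m)
    case (Suc m)
    have "(i, j + m) \<in> C"
      using cells_pos[OF Suc.prems(1)] Suc.prems by (intro cells_down[OF Suc.prems(1)]) auto
    moreover from this have "F (i, j + m) \<le> F (i, j + m + 1)"
      using col_strict Suc.prems(1) unfolding column_strict_def F_def by auto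
    ultimately show ?case using Suc by auto
  qed simp
  have col: "(i + m, j) \<in> C \<Longrightarrow> 1 \<le> i \<Longrightarrow> F (i, j) + m \<le> F (i + m, j)" for i j m
  proof (induction m)
    case (Suc m)
    have "(i + m, j) \<in> C"
      using cells_pos[OF Suc.prems(1)] Suc.prems by (intro cells_down[OF Suc.prems(1)]) auto
    moreover from this have "F (i + m, j) < F (i + m + 1, j)"
      using col_strict Suc.prems(1) unfolding column_strict_def F_def by auto
    ultimately show ?case using Suc by auto
  qed simp
  obtain i j i' j' where uv: "u = (i, j)" "v = (i', j')" by (cases u, cases v)
  have w: "(i, j') \<in> C" using cells_pos[OF u] cells_pos[OF v] le uv v by (auto intro: cells_down)
  have "F (i, j) \<le> F (i, j')" using row[of i j "j' - j"] w le uv cells_pos[OF u] by auto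
  moreover have "F (i, j') + (i' - i) \<le> F (i', j')" using col[of i "i' - i" j'] v le uv cells_pos[OF u] by auto
  ultimately show "F u \<le> F v" "fst u < fst v \<Longrightarrow> F u < F v" using uv by auto
qed

lemma strip:
  assumes "u \<in> C" "v \<in> C" "F u = F v" "u \<noteq> v"
  shows "(snd u < snd v \<and> fst v \<le> fst u) \<or> (snd v < snd u \<and> fst u \<le> fst v)"
proof -
  have "fst u < fst v \<Longrightarrow> snd v < snd u" using F_mono(2)[OF assms(1,2)] assms(3) by force
  moreover have "fst v < fst u \<Longrightarrow> snd u < snd v" using F_mono(2)[OF assms(2,1)] assms(3) by force
  moreover have "fst u = fst v \<Longrightarrow> snd u \<noteq> snd v" using assms(4) by (auto simp: prod_eq_iff)
  ultimately show ?thesis by linarith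
qed

text \<open>Equal entries form a horizontal strip: going right, the rows weakly ascend. Contents
  thus tell its cells apart, and cells in different rows differ in both coordinates, hence by at
  least 2 in content.\<close>

lemma strip_cont:
  assumes "u \<in> C" "v \<in> C" "F u = F v"
  shows "cont u = cont v \<Longrightarrow> u = v"
    and "cont u < cont v \<Longrightarrow> snd u < snd v \<and> fst v \<le> fst u"
    and "fst v < fst u \<Longrightarrow> cont u \<le> cont v - 2"
proof -
  have s: "(snd u < snd v \<and> fst v \<le> fst u) \<or> (snd v < snd u \<and> fst u \<le> fst v)" if "u \<noteq> v"
    by (rule strip[OF assms that])
  show "u = v" if c: "cont u = cont v"
  proof (rule ccontr)
    assume "u \<noteq> v"
    from s[OF this] show False using c unfolding cont_def by linarith
  qed
  show "snd u < snd v \<and> fst v \<le> fst u" if c: "cont u < cont v"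
  proof -
    have "u \<noteq> v" using c by auto
    from s[OF this] show ?thesis using c unfolding cont_def by linarith
  qed
  show "cont u \<le> cont v - 2" if c: "fst v < fst u"
  proof -
    have "u \<noteq> v" using c by auto
    from s[OF this] show ?thesis using c unfolding cont_def by linarith
  qed
qed

text \<open>The fixed order of cells against which all products are written. Content breaks ties
  because it is injective on equal entries.\<close>

definition lt :: "nat \<times> nat \<Rightarrow> nat \<times> nat \<Rightarrow> bool" where
  "lt u v \<longleftrightarrow> F u < F v \<or> (F u = F v \<and> cont u < cont v)"

definition L :: "((nat \<times> nat) \<times> (nat \<times> nat)) set" where
  "L = {(u, v). u \<in> C \<and> v \<in> C \<and> lt u v}"

lemma finite_L: "finite L"
  by (rule finite_subset[of _ "C \<times> C"]) (auto simp: L_def finite_cells)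

lemma prod_pairs_L:
  assumes "bij_betw e {1..N} C" "\<And>i. i \<in> {1..N} \<Longrightarrow> q (e i) = i"
  shows "(\<Prod>(i, j)\<in>pairs N. h (e i) (e j)) = (\<Prod>(u, v)\<in>L. if q u < q v then h u v else h v u :: real)"
  unfolding L_def using assms
  by (intro prod_pairs_bij) (auto simp: lt_def dest: strip_cont(1))

lemma prod_L_cong:
  assumes "\<And>u v. u \<in> C \<Longrightarrow> v \<in> C \<Longrightarrow> F u < F v \<Longrightarrow> f u v = g u v"
    and "\<And>u v. u \<in> C \<Longrightarrow> v \<in> C \<Longrightarrow> F u = F v \<Longrightarrow> cont u < cont v \<Longrightarrow> snd u < snd v \<Longrightarrow>
      fst v \<le> fst u \<Longrightarrow> f u v = g u v"
  shows "(\<Prod>(u, v)\<in>L. f u v :: real) = (\<Prod>(u, v)\<in>L. g u v)"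
  using assms strip_cont(2) by (intro prod.cong refl) (auto simp: L_def lt_def)

section \<open>Configurations and the factors of C, E and the norm over pairs of cells\<close>

text \<open>Only a filling is required, so that (lambda^-, T_R) can be treated exactly as the
  members of T(lambda, T_S).\<close>

definition config :: "mono \<Rightarrow> tab \<Rightarrow> bool" where
  "config b T \<longleftrightarrow> mon b \<and> filling T \<and> (\<forall>c\<in>C. plus_part N b (T c) = F c)"

text \<open>The cell attached to the variable with index i: its entry is the exponent of that
  variable and its content appears in the eigenvalue of U_i. \<open>slot\<close> is the inverse map,
  so a configuration is an arrangement of the cells.\<close>

definition place :: "mono \<Rightarrow> tab \<Rightarrow> nat \<Rightarrow> nat \<times> nat" where
  "place b T i = pos tau T (rk b i)"

definition slot :: "mono \<Rightarrow> tab \<Rightarrow> nat \<times> nat \<Rightarrow> nat" where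
  "slot b T c = inv (rk b) (T c)"

lemma place_bij: "filling T \<Longrightarrow> bij_betw (place b T) {1..N} C"
  and slot_place: "filling T \<Longrightarrow> i \<in> {1..N} \<Longrightarrow> slot b T (place b T i) = i"
  and place_slot: "filling T \<Longrightarrow> c \<in> C \<Longrightarrow> place b T (slot b T c) = c"
  and slot_in: "filling T \<Longrightarrow> c \<in> C \<Longrightarrow> slot b T c \<in> {1..N}"
proof -
  note r = rank_permutes[of N b]
  show 1: "i \<in> {1..N} \<Longrightarrow> slot b T (place b T i) = i" if "filling T" for i
    using pos_in(2)[OF that rk_in] permutes_inverses(2)[OF r] by (simp add: slot_def place_def)
  show 2: "c \<in> C \<Longrightarrow> place b T (slot b T c) = c" if "filling T" for c
    using pos_eq[OF that] permutes_inverses(1)[OF r] by (simp add: slot_def place_def)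
  show 3: "c \<in> C \<Longrightarrow> slot b T c \<in> {1..N}" if "filling T" for c
    using filling_in[OF that] permutes_in_image[OF permutes_inv[OF r]] unfolding slot_def by blast
  show "bij_betw (place b T) {1..N} C" if "filling T"
    using 1[OF that] 2[OF that] 3[OF that] pos_in(1)[OF that rk_in]
    by (intro bij_betw_byWitness[where f' = "slot b T"]) (auto simp: place_def)
qed

lemma place_F:
  assumes "config b T" "i \<in> {1..N}"
  shows "F (place b T i) = b i"
proof -
  have f: "filling T" using assms by (simp add: config_def)
  have "plus_part N b (T (place b T i)) = F (place b T i)"
    using assms pos_in(1)[OF f rk_in[OF assms(2)]] by (simp add: config_def place_def)
  then show ?thesis using pos_in(2)[OF f rk_in[OF assms(2)]] plus_part_rank[OF assms(2), of b]
    by (simp add: place_def)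
qed

lemma config_slot_F: "config b T \<Longrightarrow> c \<in> C \<Longrightarrow> b (slot b T c) = F c"
  using place_F[of b T "slot b T c"] slot_in[of T c b] place_slot[of T c b] by (auto simp: config_def)

lemma slot_less_iff:
  assumes c: "config b T" and uv: "u \<in> C" "v \<in> C" "F u = F v"
  shows "slot b T u < slot b T v \<longleftrightarrow> T u < T v"
proof -
  have f: "filling T" using c by (simp add: config_def)
  note s = slot_in[OF f uv(1), of b] slot_in[OF f uv(2), of b]
  have rr: "rk b (slot b T x) = T x" for x
    unfolding slot_def by (rule permutes_inverses(1)[OF rank_permutes])
  from rank_le_iff[OF s(2,1), of b] show ?thesis
    using config_slot_F[OF c uv(1)] config_slot_F[OF c uv(2)] uv(3) unfolding rr by auto
qed

lemma config_less:
  assumes c: "config b T" and uv: "u \<in> C" "v \<in> C" "F u < F v"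
  shows "T v < T u"
proof (rule ccontr)
  assume "\<not> T v < T u"
  then have le: "T u \<le> T v" by simp
  have f: "filling T" using c by (simp add: config_def)
  have "plus_part N b (T v) \<le> plus_part N b (T u)"
    by (rule plus_part_antimono[OF filling_in[OF f uv(1)] filling_in[OF f uv(2)] le])
  then show False using c uv by (simp add: config_def)
qed

definition kf :: "real \<Rightarrow> nat \<times> nat \<Rightarrow> nat \<times> nat \<Rightarrow> real" where
  "kf eps u v = (if cont v \<le> cont u - 2 then 1 + eps / real_of_int (cont v - cont u) else 1)"

text \<open>Cells with unequal entries are always numbered with the larger entry first, so their
  factors do not depend on the configuration. For equal entries a factor appears only if the cell of
  smaller content comes first.\<close>

lemma Cfac_config:
  assumes c: "config b T"
  shows "Cfac N tau eps T = (\<Prod>(u, v)\<in>L. if F u < F v then kf eps u v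
    else if slot b T u < slot b T v then kf eps v u else 1)"
proof -
  have f: "filling T" using c by (simp add: config_def)
  have e: "bij_betw (pos tau T) {1..N} C"
    using pos_in[OF f] pos_eq[OF f] filling_in[OF f] by (intro bij_betw_byWitness[where f' = T]) auto
  have "Cfac N tau eps T = (\<Prod>(i, j)\<in>pairs N. kf eps (pos tau T j) (pos tau T i))"
    unfolding Cfac_def prod_pairs_filter kf_def content_eq ..
  also have "\<dots> = (\<Prod>(u, v)\<in>L. if T u < T v then kf eps v u else kf eps u v)"
    using prod_pairs_L[OF e, of T "\<lambda>u v. kf eps v u"] pos_in(2)[OF f] by simp
  also have "\<dots> = (\<Prod>(u, v)\<in>L. if F u < F v then kf eps u v
    else if slot b T u < slot b T v then kf eps v u else 1)"
  proof (rule prod_L_cong)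
    fix u v assume uv: "u \<in> C" "v \<in> C" "F u < F v"
    show "(if T u < T v then kf eps v u else kf eps u v) = (if F u < F v then kf eps u v
      else if slot b T u < slot b T v then kf eps v u else 1)"
      using config_less[OF c uv] uv by simp
  next
    fix u v assume uv: "u \<in> C" "v \<in> C" "F u = F v" "cont u < cont v"
    show "(if T u < T v then kf eps v u else kf eps u v) = (if F u < F v then kf eps u v
      else if slot b T u < slot b T v then kf eps v u else 1)"
      using slot_less_iff[OF c uv(1-3)] uv by (simp add: kf_def)
  qed
  finally show ?thesis .
qed

text \<open>The difference of the eigenvalues attached to two cells, i.e. the denominators occurring
  in E.\<close>

definition gap :: "nat \<times> nat \<Rightarrow> nat \<times> nat \<Rightarrow> real" where
  "gap u v = real (F v) - real (F u) + kappa * real_of_int (cont v - cont u)"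

lemma Efac_config:
  assumes c: "config b T"
  shows "Efac N tau kappa eps b T = (\<Prod>(u, v)\<in>L. if F u < F v \<and> slot b T u < slot b T v
    then 1 + eps * kappa / gap u v else 1)"
proof -
  have f: "filling T" using c by (simp add: config_def)
  let ?h = "\<lambda>u v. if F u < F v then 1 + eps * kappa / gap u v else 1"
  have "Efac N tau kappa eps b T = (\<Prod>(i, j)\<in>pairs N. ?h (place b T i) (place b T j))"
    unfolding Efac_def prod_pairs_filter
    by (intro prod.cong refl) (auto simp: pairs_def place_F[OF c] gap_def content_eq place_def[symmetric])
  also have "\<dots> = (\<Prod>(u, v)\<in>L. if slot b T u < slot b T v then ?h u v else ?h v u)"
    by (rule prod_pairs_L[OF place_bij[OF f] slot_place[OF f]])
  also have "\<dots> = (\<Prod>(u, v)\<in>L. if F u < F v \<and> slot b T u < slot b T v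
    then 1 + eps * kappa / gap u v else 1)"
    by (rule prod_L_cong) auto
  finally show ?thesis .
qed

text \<open>The entries differ by at least 1, which outweighs \<open>kappa\<close> times the
  difference of contents, also after a shift by one. The shifted bounds make the factors 1 +
  \<open>kappa\<close>/gap and 1 - \<open>kappa\<close>/gap nonzero.\<close>

lemma gap_bounds:
  assumes "u \<in> C" "v \<in> C" "F u < F v"
  shows "0 < gap u v" "0 < gap u v + kappa" "0 < gap u v - kappa"
proof -
  note b = kappa_diff_small[OF cont_bounds[OF assms(2)] cont_bounds[OF assms(1)]]
  have F: "1 \<le> real (F v) - real (F u)" using assms(3) by simp
  have e: "gap u v + kappa = real (F v) - real (F u) + kappa * real_of_int (cont v - cont u + 1)"
    "gap u v - kappa = real (F v) - real (F u) + kappa * real_of_int (cont v - cont u - 1)"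
    by (simp_all add: gap_def algebra_simps)
  show "0 < gap u v" using b(1) F unfolding gap_def by linarith
  show "0 < gap u v + kappa" using b(2) F unfolding e by linarith
  show "0 < gap u v - kappa" using b(3) F unfolding e by linarith
qed

lemma Efac_nonzero:
  assumes c: "config b T" and eps: "eps = 1 \<or> eps = - 1"
  shows "Efac N tau kappa eps b T \<noteq> 0"
  unfolding Efac_config[OF c]
proof (rule prod_nonzeroI)
  fix x assume x: "x \<in> L"
  then obtain u v where uv: "x = (u, v)" "u \<in> C" "v \<in> C" by (auto simp: L_def)
  show "(case x of (u, v) \<Rightarrow> if F u < F v \<and> slot b T u < slot b T v
    then 1 + eps * kappa / gap u v else 1) \<noteq> 0"
  proof (cases "F u < F v")
    case True
    have "1 + eps * kappa / gap u v = (gap u v + eps * kappa) / gap u v"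
      using gap_bounds(1)[OF uv(2,3) True] by (simp add: field_simps)
    then show ?thesis using gap_bounds[OF uv(2,3) True] eps uv by auto
  qed (simp add: uv)
qed

lemma Cfac_nonzero:
  assumes eps: "eps = 1 \<or> eps = - 1"
  shows "Cfac N tau eps T \<noteq> 0"
  unfolding Cfac_def prod_pairs_filter
proof (rule prod_nonzeroI)
  fix x
  have "1 + eps / real_of_int d \<noteq> 0" if "d \<le> -2" for d
    using that eps by (auto simp: field_simps)
  moreover have "content tau T i \<le> content tau T j - 2 \<Longrightarrow> content tau T i - content tau T j \<le> -2" for i j
    by simp
  ultimately show "(case x of (i, j) \<Rightarrow> if content tau T i \<le> content tau T j - 2
     then 1 + eps / real_of_int (content tau T i - content tau T j) else 1) \<noteq> 0"
    by (cases x) (auto simp del: of_int_diff)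
qed

lemma inner0_Cfac: "inner0 N tau T T = Cfac N tau 1 T * Cfac N tau (- 1) T"
  unfolding inner0_pairs Cfac_def prod_pairs_filter prod.distrib[symmetric]
  by (intro prod.cong refl) (auto simp: power2_eq_square algebra_simps)

definition ladders :: real where
  "ladders = (\<Prod>(u, v)\<in>L. if F u < F v then ladder (F v - F u) (cont v - cont u) else 1)"

text \<open>If the cell with the smaller entry comes first, its pair has one rung less in the norm,
  and the factors of E_1 and E_(-1) supply exactly that rung; otherwise the ladder is already
  complete. So the product of ladders no longer depends on the configuration.\<close>

lemma nu_config:
  assumes c: "config b T"
  shows "nu b T * (Efac N tau kappa 1 b T * Efac N tau kappa (- 1) b T) =
    Cfac N tau 1 T * Cfac N tau (- 1) T * ladders"
proof -
  have f: "filling T" using c by (simp add: config_def)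
  let ?h = "\<lambda>u v. pair_norm (F u) (cont u) (F v) (cont v)"
  have "(\<Prod>(i, j)\<in>pairs N. pair_norm (b i) (rcont b T i) (b j) (rcont b T j)) =
     (\<Prod>(i, j)\<in>pairs N. ?h (place b T i) (place b T j))"
    by (intro prod.cong refl) (auto simp: pairs_def place_F[OF c] content_eq place_def[symmetric])
  also have "\<dots> = (\<Prod>(u, v)\<in>L. if slot b T u < slot b T v then ?h u v else ?h v u)"
    by (rule prod_pairs_L[OF place_bij[OF f] slot_place[OF f]])
  finally have 1: "(\<Prod>(i, j)\<in>pairs N. pair_norm (b i) (rcont b T i) (b j) (rcont b T j)) = \<dots>" .
  have "(\<Prod>(u, v)\<in>L. if slot b T u < slot b T v then ?h u v else ?h v u) *
     (Efac N tau kappa 1 b T * Efac N tau kappa (- 1) b T) =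
     (\<Prod>(u, v)\<in>L. (if slot b T u < slot b T v then ?h u v else ?h v u) *
       ((if F u < F v \<and> slot b T u < slot b T v then 1 + 1 * kappa / gap u v else 1) *
        (if F u < F v \<and> slot b T u < slot b T v then 1 + - 1 * kappa / gap u v else 1)))"
    unfolding Efac_config[OF c] prod.distrib[symmetric] by (simp add: case_prod_unfold)
  also have "\<dots> = ladders"
    unfolding ladders_def
  proof (rule prod_L_cong)
    fix u v assume uv: "u \<in> C" "v \<in> C" "F u < F v"
    obtain m where m: "F v - F u = Suc m" using uv(3) by (cases "F v - F u") auto
    have g: "gap u v = real (Suc m) + kappa * real_of_int (cont v - cont u)"
      using m uv(3) by (simp add: gap_def of_nat_diff)
    have "?h u v = ladder m (cont v - cont u)" using uv(3) m by (simp add: pair_norm_def)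
    moreover have "?h v u = ladder (Suc m) (cont v - cont u)" using uv(3) m by (simp add: pair_norm_def)
    moreover have "ladder (Suc m) (cont v - cont u) = ladder m (cont v - cont u) *
       ((1 + 1 * kappa / gap u v) * (1 + - 1 * kappa / gap u v))"
      unfolding ladder_Suc g[symmetric] by (simp add: power2_eq_square algebra_simps)
    ultimately show "(if slot b T u < slot b T v then ?h u v else ?h v u) *
       ((if F u < F v \<and> slot b T u < slot b T v then 1 + 1 * kappa / gap u v else 1) *
        (if F u < F v \<and> slot b T u < slot b T v then 1 + - 1 * kappa / gap u v else 1))
      = (if F u < F v then ladder (F v - F u) (cont v - cont u) else 1)"
      using uv(3) m by auto
  next
    fix u v assume "F u = F v"
    then show "(if slot b T u < slot b T v then ?h u v else ?h v u) *
       ((if F u < F v \<and> slot b T u < slot b T v then 1 + 1 * kappa / gap u v else 1) *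
        (if F u < F v \<and> slot b T u < slot b T v then 1 + - 1 * kappa / gap u v else 1))
      = (if F u < F v then ladder (F v - F u) (cont v - cont u) else 1)"
      by (simp add: pair_norm_def ladder_def)
  qed
  finally show ?thesis unfolding nu_def 1 inner0_Cfac by (simp only: mult.assoc)
qed

text \<open>This is 1 + 1/(Z u - Z v) for Z = entry/\<open>kappa\<close> + content, with the
  division by \<open>kappa\<close> cleared so that it remains meaningful at \<open>kappa\<close> =
  0.\<close>

definition arr :: "nat \<times> nat \<Rightarrow> nat \<times> nat \<Rightarrow> real" where
  "arr u v = (if F u = F v then 1 + 1 / real_of_int (cont u - cont v) else 1 + kappa / gap v u)"

definition row_arr :: "nat \<times> nat \<Rightarrow> nat \<times> nat \<Rightarrow> real" where
  "row_arr = class_factor (\<lambda>u. (F u, fst u)) (\<lambda>u. real_of_int (cont u))"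

text \<open>For nonzero \<open>kappa\<close> all cells form one class and Z is injective by the
  bounds on \<open>gap\<close>. For \<open>kappa\<close> = 0 only cells with equal entries interact,
  with Z the content.\<close>

lemma sum_prod_arr:
  assumes B: "B \<subseteq> C"
  shows "(\<Sum>k\<in>B. \<Prod>j\<in>B - {k}. arr k j) = real (card B)"
proof -
  have fin: "finite B" using B finite_cells finite_subset by blast
  show ?thesis
  proof (cases "kappa = 0")
    case True
    have "arr k j = class_factor F (\<lambda>u. real_of_int (cont u)) k j" for k j
      unfolding arr_def class_factor_def using True by simp
    moreover have "(\<Sum>k\<in>B. \<Prod>j\<in>B - {k}. class_factor F (\<lambda>u. real_of_int (cont u)) k j) = real (card B)"
    proof (intro sum_prod_class_factor fin)
      fix u v assume "u \<in> B" "v \<in> B" "F u = F v" "real_of_int (cont u) = real_of_int (cont v)"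
      then show "u = v" using subsetD[OF B, of u] subsetD[OF B, of v] strip_cont(1)[of u v] by simp
    qed
    ultimately show ?thesis by simp
  next
    case False
    define Z where "Z u = real (F u) / kappa + real_of_int (cont u)" for u
    have Zd: "Z u - Z v = gap v u / kappa" for u v
      using False by (simp add: Z_def gap_def field_simps)
    have "arr k j = class_factor (\<lambda>_. ()) Z k j" for k j
      unfolding arr_def class_factor_def Zd using False by (simp add: gap_def)
    moreover have "(\<Sum>k\<in>B. \<Prod>j\<in>B - {k}. class_factor (\<lambda>_. ()) Z k j) = real (card B)"
    proof (intro sum_prod_class_factor fin)
      fix u v assume uv: "u \<in> B" "v \<in> B" and "Z u = Z v"
      then have g: "gap v u = 0" using Zd[of u v] False by simp
      have C: "u \<in> C" "v \<in> C" using uv B by auto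
      have "F u = F v" using gap_bounds(1)[OF C] gap_bounds(1)[OF C(2,1)] g
        by (cases "F u" "F v" rule: linorder_cases) (auto simp: gap_def algebra_simps)
      moreover from this have "cont u = cont v" using g False by (simp add: gap_def)
      ultimately show "u = v" using strip_cont(1)[OF C] by blast
    qed
    ultimately show ?thesis by simp
  qed
qed

lemma sum_prod_row_arr:
  assumes B: "B \<subseteq> C"
  shows "(\<Sum>k\<in>B. \<Prod>j\<in>B - {k}. row_arr k j) = real (card B)"
  unfolding row_arr_def
proof (rule sum_prod_class_factor)
  show "finite B" by (rule finite_subset[OF B finite_cells])
  fix u v assume "u \<in> B" "v \<in> B" "(F u, fst u) = (F v, fst v)" "real_of_int (cont u) = real_of_int (cont v)"
  then show "u = v" using subsetD[OF B, of u] subsetD[OF B, of v] strip_cont(1)[of u v] by simp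
qed

lemma sum_arrangements:
  "(\<Sum>xs\<in>permutations_of_set C. pair_prod arr xs) = fact N"
  "(\<Sum>xs\<in>permutations_of_set C. pair_prod row_arr xs) = fact N"
  using sum_pair_prod[OF finite_cells sum_prod_arr] sum_pair_prod[OF finite_cells sum_prod_row_arr]
  by (simp_all add: card_C)

section \<open>Members of T(lambda, T_S) as words of cells\<close>

definition list_slot :: "(nat \<times> nat) list \<Rightarrow> nat \<times> nat \<Rightarrow> nat" where
  "list_slot xs = inv_into {1..N} (\<lambda>i. xs ! (i - 1))"

definition valid :: "(nat \<times> nat \<Rightarrow> nat) \<Rightarrow> bool" where
  "valid q \<longleftrightarrow> (\<forall>i j. (i, j) \<in> C \<and> (i, Suc j) \<in> C \<and> F (i, j) = F (i, Suc j) \<longrightarrow> q (i, Suc j) < q (i, j))"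

lemma list_slot_props:
  assumes xs: "xs \<in> permutations_of_set C"
  shows "i \<in> {1..N} \<Longrightarrow> list_slot xs (xs ! (i - 1)) = i"
    and "c \<in> C \<Longrightarrow> list_slot xs c \<in> {1..N} \<and> xs ! (list_slot xs c - 1) = c"
proof -
  have b: "bij_betw (\<lambda>i. xs ! (i - 1)) {1..N} C" using nth_bij_perm[OF xs] by (simp add: card_C)
  show "list_slot xs (xs ! (i - 1)) = i" if "i \<in> {1..N}"
    unfolding list_slot_def using inv_into_f_f[OF bij_betw_imp_inj_on[OF b] that] .
  show "list_slot xs c \<in> {1..N} \<and> xs ! (list_slot xs c - 1) = c" if "c \<in> C"
  proof -
    have "c \<in> (\<lambda>i. xs ! (i - 1)) ` {1..N}" using b that by (simp add: bij_betw_def)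
    from inv_into_into[OF this] f_inv_into_f[OF this] show ?thesis unfolding list_slot_def by simp
  qed
qed

lemma pair_prod_L:
  assumes xs: "xs \<in> permutations_of_set C"
  shows "pair_prod h xs = (\<Prod>(u, v)\<in>L. if list_slot xs u < list_slot xs v then h u v else h v u)"
proof -
  note d = permutations_of_setD[OF xs]
  have len: "length xs = N" using d distinct_card card_C by metis
  have b: "bij_betw (\<lambda>i. xs ! (i - 1)) {1..N} C" using nth_bij_perm[OF xs] by (simp add: card_C)
  show ?thesis
    using pair_prod_pairs[OF d(2), of h] prod_pairs_L[OF b list_slot_props(1)[OF xs], of h] len by simp
qed

text \<open>A violation places a cell before its right neighbour with the same entry; the contents
  differ by -1 and the factor is 1 - 1 = 0.\<close>

lemma invalid_pair_prod:
  assumes xs: "xs \<in> permutations_of_set C" and nv: "\<not> valid (list_slot xs)"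
  shows "pair_prod arr xs = 0" "pair_prod row_arr xs = 0"
proof -
  obtain i j where ij: "(i, j) \<in> C" "(i, Suc j) \<in> C" "F (i, j) = F (i, Suc j)"
    "\<not> list_slot xs (i, Suc j) < list_slot xs (i, j)" using nv by (auto simp: valid_def)
  have "list_slot xs (i, Suc j) \<noteq> list_slot xs (i, j)"
    using list_slot_props(2)[OF xs ij(1)] list_slot_props(2)[OF xs ij(2)] by force
  then have s: "list_slot xs (i, j) < list_slot xs (i, Suc j)" using ij(4) by simp
  have inL: "((i, j), (i, Suc j)) \<in> L" using ij by (simp add: L_def lt_def cont_def)
  have "arr (i, j) (i, Suc j) = 0" "row_arr (i, j) (i, Suc j) = 0"
    using ij by (simp_all add: arr_def row_arr_def class_factor_def cont_def)
  then show "pair_prod arr xs = 0" "pair_prod row_arr xs = 0"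
    unfolding pair_prod_L[OF xs] using s inL finite_L by (auto intro!: prod_zero bexI[of _ "((i, j), (i, Suc j))"])
qed

text \<open>Validity speaks of neighbours only; entries weakly increase along a row, so everything
  between two equal entries is equal to them and the inequalities chain.\<close>

lemma valid_row:
  assumes q: "valid q" and u: "(i, j) \<in> C" and v: "(i, j') \<in> C" and lt: "j < j'" and F: "F (i, j) = F (i, j')"
  shows "q (i, j') < q (i, j)"
proof -
  have "(i, Suc (j + m)) \<in> C \<Longrightarrow> F (i, j) = F (i, Suc (j + m)) \<Longrightarrow> q (i, Suc (j + m)) < q (i, j)" for m
  proof (induction m)
    case 0
    then show ?case using q u by (simp add: valid_def)
  next
    case (Suc m)
    have c: "(i, Suc (j + m)) \<in> C"
      using cells_pos[OF Suc.prems(1)] by (intro cells_down[OF Suc.prems(1)]) auto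
    have "F (i, j) \<le> F (i, Suc (j + m))" "F (i, Suc (j + m)) \<le> F (i, Suc (j + Suc m))"
      using F_mono(1)[OF u c] F_mono(1)[OF c Suc.prems(1)] by auto
    then have "F (i, j) = F (i, Suc (j + m))" "F (i, Suc (j + m)) = F (i, Suc (Suc (j + m)))"
      using Suc.prems(2) by auto
    moreover from this have "q (i, Suc (Suc (j + m))) < q (i, Suc (j + m))"
      using q c Suc.prems(1) by (auto simp: valid_def)
    ultimately show ?case using Suc.IH[OF c] by simp
  qed
  from this[of "j' - j - 1"] show ?thesis using lt v F by simp
qed

definition X :: "(mono \<times> tab) set" where
  "X = {(b, T). config b T \<and> T \<in> Y}"

definition word :: "mono \<times> tab \<Rightarrow> (nat \<times> nat) list" where
  "word x = map (place (fst x) (snd x)) [1..<N + 1]"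

lemma word_nth: "i \<in> {1..N} \<Longrightarrow> word x ! (i - 1) = place (fst x) (snd x) i"
  using nth_map_upt[of "i - 1" "N + 1" 1 "place (fst x) (snd x)"] by (auto simp: word_def simp del: upt_Suc)

lemma word_perm:
  assumes "filling (snd x)"
  shows "word x \<in> permutations_of_set C"
proof (rule permutations_of_setI)
  have s: "set [1..<N + 1] = {1..N}" by auto
  note b = place_bij[OF assms, of "fst x"]
  show "set (word x) = C" unfolding word_def set_map s using b by (simp add: bij_betw_def)
  show "distinct (word x)" unfolding word_def distinct_map s using b by (simp add: bij_betw_def)
qed

lemma word_slot:
  assumes f: "filling (snd x)" and c: "c \<in> C"
  shows "list_slot (word x) c = slot (fst x) (snd x) c"
proof -
  note s = slot_in[OF f c, of "fst x"]
  have "word x ! (slot (fst x) (snd x) c - 1) = c" using word_nth[OF s] place_slot[OF f c] by simp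
  then show ?thesis using list_slot_props(1)[OF word_perm[OF f] s] by simp
qed

lemma X_filling: "x \<in> X \<Longrightarrow> filling (snd x)" and X_config: "x \<in> X \<Longrightarrow> config (fst x) (snd x)"
  by (auto simp: X_def config_def)

lemma slot_valid:
  assumes x: "x \<in> X" shows "valid (slot (fst x) (snd x))"
  unfolding valid_def
proof (intro allI impI)
  fix i j assume ij: "(i, j) \<in> C \<and> (i, Suc j) \<in> C \<and> F (i, j) = F (i, Suc j)"
  have "snd x (i, Suc j) < snd x (i, j)" using x ij by (auto simp: X_def RSYT_def)
  then show "slot (fst x) (snd x) (i, Suc j) < slot (fst x) (snd x) (i, j)"
    using slot_less_iff[OF X_config[OF x], of "(i, Suc j)" "(i, j)"] ij by simp
qed

lemma valid_cong: "(\<And>c. c \<in> C \<Longrightarrow> q c = q' c) \<Longrightarrow> valid q \<longleftrightarrow> valid q'"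
  unfolding valid_def by (metis (no_types, lifting))

lemma word_inj: "inj_on word X"
proof (rule inj_onI)
  fix x y assume x: "x \<in> X" and y: "y \<in> X" and eq: "word x = word y"
  have p: "place (fst x) (snd x) i = place (fst y) (snd y) i" if "i \<in> {1..N}" for i
    using word_nth[OF that] eq by metis
  have "fst x i = fst y i" if "i \<in> {1..N}" for i
    using place_F[OF X_config[OF x] that] place_F[OF X_config[OF y] that] p[OF that] by simp
  moreover have "mon (fst x)" "mon (fst y)" using x y by (auto simp: X_def config_def)
  ultimately have b: "fst x = fst y" using mon_outside by (intro ext) metis
  have "snd x c = snd y c" for c
  proof (cases "c \<in> C")
    case True
    have "slot (fst x) (snd x) c = slot (fst y) (snd y) c"
      using word_slot[OF X_filling[OF x] True] word_slot[OF X_filling[OF y] True] eq by simp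
    then have "rk (fst x) (slot (fst x) (snd x) c) = rk (fst y) (slot (fst y) (snd y) c)" using b by simp
    then show ?thesis unfolding slot_def by (simp add: permutes_inverses(1)[OF rank_permutes])
  next
    case False
    then show ?thesis using X_filling[OF x] X_filling[OF y] unfolding filling_def by metis
  qed
  then have "snd x = snd y" by (rule ext)
  with b show "x = y" by (simp add: prod_eq_iff)
qed

text \<open>From a word the exponents are the entries read along it, and the tableau consists of the
  ranks of the positions. Column-strictness gives the decrease down columns, while validity is what
  decides ties along rows.\<close>

lemma word_image: "word ` X = {xs \<in> permutations_of_set C. valid (list_slot xs)}"
proof
  show "word ` X \<subseteq> {xs \<in> permutations_of_set C. valid (list_slot xs)}"
  proof
    fix xs assume "xs \<in> word ` X"
    then obtain x where x: "x \<in> X" "xs = word x" by blast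
    show "xs \<in> {xs \<in> permutations_of_set C. valid (list_slot xs)}"
      using word_perm[OF X_filling[OF x(1)]] slot_valid[OF x(1)]
        valid_cong[OF word_slot[OF X_filling[OF x(1)]]] x(2) by auto
  qed
  show "{xs \<in> permutations_of_set C. valid (list_slot xs)} \<subseteq> word ` X"
  proof
    fix xs assume "xs \<in> {xs \<in> permutations_of_set C. valid (list_slot xs)}"
    then have xs: "xs \<in> permutations_of_set C" and val: "valid (list_slot xs)" by auto
    note ls = list_slot_props[OF xs]
    have bij: "bij_betw (\<lambda>i. xs ! (i - 1)) {1..N} C" using nth_bij_perm[OF xs] by (simp add: card_C)
    define b where "b i = (if i \<in> {1..N} then F (xs ! (i - 1)) else 0)" for i
    \<comment> \<open>Equal entries are ranked by position in the word, so a cell read earlier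
      receives the smaller number.\<close>
    define T where "T c = (if c \<in> C then rk b (list_slot xs c) else 0)" for c
    have mb: "mon b" by (auto simp: mon_def b_def split: if_splits)
    have bF: "b (list_slot xs c) = F c" if "c \<in> C" for c using ls(2)[OF that] by (simp add: b_def)
    have lb: "bij_betw (list_slot xs) C {1..N}"
      using ls bij by (intro bij_betw_byWitness[where f' = "\<lambda>i. xs ! (i - 1)"]) (auto simp: bij_betw_def)
    have "bij_betw (rk b \<circ> list_slot xs) C {1..N}"
      by (rule bij_betw_trans[OF lb permutes_imp_bij[OF rank_permutes]])
    then have "bij_betw T C {1..N}" by (rule bij_betw_cong[THEN iffD1, rotated]) (simp add: T_def)
    then have fT: "filling T" by (auto simp: filling_def T_def)
    have Tle: "T c' < T c" if "c \<in> C" "c' \<in> C" "F c < F c' \<or> (F c = F c' \<and> list_slot xs c' < list_slot xs c)" for c c'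
      using rank_le_iff[of "list_slot xs c" N "list_slot xs c'" b] ls(2)[OF that(1)] ls(2)[OF that(2)]
        bF[OF that(1)] bF[OF that(2)] that by (auto simp: T_def)
    have TY: "T \<in> Y"
      unfolding RSYT_def
    proof (intro CollectI conjI allI impI)
      fix i j assume a: "(i, j) \<in> C \<and> (i, j + 1) \<in> C"
      have "F (i, j) \<le> F (i, j + 1)" using a by (intro F_mono(1)) auto
      then show "T (i, j + 1) < T (i, j)" using a val by (intro Tle) (auto simp: valid_def le_less)
    next
      fix i j assume a: "(i, j) \<in> C \<and> (i + 1, j) \<in> C"
      then have "F (i, j) < F (i + 1, j)" by (intro F_mono(2)) auto
      then show "T (i + 1, j) < T (i, j)" using a by (intro Tle) auto
    next
      show "bij_betw T C {1..N}" by fact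
    qed (simp add: T_def)
    have "plus_part N b (T c) = F c" if "c \<in> C" for c
      using plus_part_rank[of "list_slot xs c" N b] ls(2)[OF that] bF[OF that] that by (simp add: T_def)
    then have x: "(b, T) \<in> X" using mb fT TY by (simp add: X_def config_def)
    have "place b T i = xs ! (i - 1)" if i: "i \<in> {1..N}" for i
    proof -
      have "xs ! (i - 1) \<in> C" using bij i by (auto simp: bij_betw_def)
      moreover from this have "T (xs ! (i - 1)) = rk b i" using ls(1)[OF i] by (simp add: T_def)
      ultimately show ?thesis unfolding place_def using pos_eq[OF fT] by metis
    qed
    then have w: "word (b, T) ! k = xs ! k" if "k < N" for k
      using word_nth[of "Suc k" "(b, T)"] that by simp
    have "length xs = N" using permutations_of_setD[OF xs] distinct_card card_C by metis
    moreover have "length (word (b, T)) = N" by (simp add: word_def del: upt_Suc)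
    ultimately have "word (b, T) = xs" using w by (intro nth_equalityI) auto
    then show "xs \<in> word ` X" using x by blast
  qed
qed

lemma finite_X: "finite X"
proof (rule finite_imageD[OF _ word_inj])
  show "finite (word ` X)" unfolding word_image using finite_cells by simp
qed

lemma sum_X:
  assumes "\<And>xs. xs \<in> permutations_of_set C \<Longrightarrow> \<not> valid (list_slot xs) \<Longrightarrow> pair_prod h xs = 0"
  shows "(\<Sum>x\<in>X. \<Prod>(u, v)\<in>L. if slot (fst x) (snd x) u < slot (fst x) (snd x) v then h u v else h v u) =
    (\<Sum>xs\<in>permutations_of_set C. pair_prod h xs)"
proof -
  have "(\<Sum>xs\<in>permutations_of_set C. pair_prod h xs) = (\<Sum>xs\<in>word ` X. pair_prod h xs)"
    unfolding word_image using assms finite_cells by (intro sum.mono_neutral_right) auto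
  also have "\<dots> = (\<Sum>x\<in>X. pair_prod h (word x))" by (simp add: sum.reindex[OF word_inj])
  also have "\<dots> = (\<Sum>x\<in>X. \<Prod>(u, v)\<in>L. if slot (fst x) (snd x) u < slot (fst x) (snd x) v then h u v else h v u)"
  proof (intro sum.cong refl)
    fix x assume x: "x \<in> X"
    show "pair_prod h (word x) =
      (\<Prod>(u, v)\<in>L. if slot (fst x) (snd x) u < slot (fst x) (snd x) v then h u v else h v u)"
      unfolding pair_prod_L[OF word_perm[OF X_filling[OF x]]]
      by (intro prod.cong refl) (auto simp: L_def word_slot[OF X_filling[OF x]])
  qed
  finally show ?thesis by simp
qed

text \<open>Every valid word has the same row product: within a row the order of equal entries is
  forced, and all other factors are 1. The sum over all words is N!, so this constant measures the
  cardinality.\<close>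

lemma card_X: "fact N = real (card X) * (\<Prod>(u, v)\<in>L. row_arr v u)"
proof -
  have "fact N = (\<Sum>x\<in>X. \<Prod>(u, v)\<in>L. if slot (fst x) (snd x) u < slot (fst x) (snd x) v
     then row_arr u v else row_arr v u)"
    using sum_X[OF invalid_pair_prod(2)] sum_arrangements(2) by simp
  also have "\<dots> = (\<Sum>x\<in>X. \<Prod>(u, v)\<in>L. row_arr v u)"
  proof (intro sum.cong refl)
    fix x assume x: "x \<in> X"
    show "(\<Prod>(u, v)\<in>L. if slot (fst x) (snd x) u < slot (fst x) (snd x) v then row_arr u v else row_arr v u)
      = (\<Prod>(u, v)\<in>L. row_arr v u)"
    proof (rule prod_L_cong)
      fix u v assume "F u < F v"
      then show "(if slot (fst x) (snd x) u < slot (fst x) (snd x) v then row_arr u v else row_arr v u) = row_arr v u"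
        by (simp add: row_arr_def class_factor_def)
    next
      fix u v assume uv: "u \<in> C" "v \<in> C" "F u = F v" "snd u < snd v"
      show "(if slot (fst x) (snd x) u < slot (fst x) (snd x) v then row_arr u v else row_arr v u) = row_arr v u"
      proof (cases "fst u = fst v")
        case True
        then have "slot (fst x) (snd x) v < slot (fst x) (snd x) u"
          using valid_row[OF slot_valid[OF x], of "fst u" "snd u" "snd v"] uv by (cases u; cases v) auto
        then show ?thesis by simp
      next
        case False
        then show ?thesis by (simp add: row_arr_def class_factor_def)
      qed
    qed
  qed
  finally show ?thesis by simp
qed

lemma arr_pos:
  assumes uv: "u \<in> C" "v \<in> C" "lt u v"
  shows "arr v u \<noteq> 0"
proof (cases "F u < F v")
  case True
  have "arr v u = (gap u v + kappa) / gap u v"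
    using gap_bounds(1)[OF uv(1,2) True] True by (simp add: arr_def field_simps)
  then show ?thesis using gap_bounds[OF uv(1,2) True] by simp
next
  case False
  then have "F u = F v" "cont u < cont v" using uv by (auto simp: lt_def)
  then have "0 < real_of_int (cont v - cont u)" "arr v u = 1 + 1 / real_of_int (cont v - cont u)"
    by (auto simp: arr_def)
  then show ?thesis by (metis add_pos_pos less_irrefl zero_less_divide_1_iff zero_less_one)
qed

lemma kf_minus_nonzero: "kf (- 1) u v \<noteq> 0"
  by (auto simp: kf_def field_simps)

text \<open>Relative to the order in which v precedes u, reversing a pair multiplies the left side
  by arr u v / arr v u: for unequal entries through E_(-1) / E_1, for equal entries through C_1 /
  C_(-1). The first product on the right is the normalisation, common to all members.\<close>

lemma ratio_X:
  assumes x: "x \<in> X"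
  shows "Cfac N tau 1 (snd x) / Cfac N tau (- 1) (snd x) *
      (Efac N tau kappa (- 1) (fst x) (snd x) / Efac N tau kappa 1 (fst x) (snd x)) =
    (\<Prod>(u, v)\<in>L. (if F u < F v then kf 1 u v / kf (- 1) u v else 1) / arr v u) *
    (\<Prod>(u, v)\<in>L. if slot (fst x) (snd x) u < slot (fst x) (snd x) v then arr u v else arr v u)"
proof -
  note c = X_config[OF x]
  let ?q = "slot (fst x) (snd x)"
  let ?cf = "\<lambda>eps u v. if F u < F v then kf eps u v else if ?q u < ?q v then kf eps v u else 1"
  let ?ef = "\<lambda>eps u v. if F u < F v \<and> ?q u < ?q v then 1 + eps * kappa / gap u v else 1"
  have "Cfac N tau 1 (snd x) / Cfac N tau (- 1) (snd x) *
      (Efac N tau kappa (- 1) (fst x) (snd x) / Efac N tau kappa 1 (fst x) (snd x)) =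
     (\<Prod>(u, v)\<in>L. ?cf 1 u v / ?cf (- 1) u v * (?ef (- 1) u v / ?ef 1 u v))"
    unfolding Cfac_config[OF c] Efac_config[OF c] prod_dividef[symmetric] prod.distrib[symmetric]
    by (simp add: case_prod_unfold)
  also have "\<dots> = (\<Prod>(u, v)\<in>L. (if F u < F v then kf 1 u v / kf (- 1) u v else 1) / arr v u *
     (if ?q u < ?q v then arr u v else arr v u))"
  proof (rule prod_L_cong)
    fix u v assume uv: "u \<in> C" "v \<in> C" "F u < F v"
    note g = gap_bounds[OF uv]
    have "gap v u = - gap u v" by (simp add: gap_def algebra_simps)
    then have a: "arr u v = 1 + - 1 * kappa / gap u v" "arr v u = 1 + 1 * kappa / gap u v"
      using uv(3) by (auto simp: arr_def)
    have "arr v u \<noteq> 0" using arr_pos[OF uv(1,2)] uv(3) by (simp add: lt_def)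
    then show "?cf 1 u v / ?cf (- 1) u v * (?ef (- 1) u v / ?ef 1 u v) =
      (if F u < F v then kf 1 u v / kf (- 1) u v else 1) / arr v u * (if ?q u < ?q v then arr u v else arr v u)"
      using uv(3) unfolding a by simp
  next
    fix u v assume uv: "u \<in> C" "v \<in> C" "F u = F v" "cont u < cont v" "snd u < snd v" "fst v \<le> fst u"
    have ne: "arr v u \<noteq> 0" using arr_pos[OF uv(1,2)] uv(3,4) by (simp add: lt_def)
    have a: "arr u v = 1 + 1 / real_of_int (cont u - cont v)" "arr v u = 1 + - 1 / real_of_int (cont u - cont v)"
      using uv(3) by (simp_all add: arr_def) (metis minus_diff_eq minus_divide_right)
    show "?cf 1 u v / ?cf (- 1) u v * (?ef (- 1) u v / ?ef 1 u v) =
      (if F u < F v then kf 1 u v / kf (- 1) u v else 1) / arr v u * (if ?q u < ?q v then arr u v else arr v u)"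
    proof (cases "?q u < ?q v")
      case True
      \<comment> \<open>Cells of one row are read from right to left, so only pairs in different
        rows can occur in this order; their contents then differ by at least 2, which is the
        condition under which C has a factor.\<close>
      have "fst v \<noteq> fst u"
      proof
        assume "fst v = fst u"
        then have "?q v < ?q u"
          using valid_row[OF slot_valid[OF x], of "fst u" "snd u" "snd v"] uv by (cases u; cases v) auto
        then show False using True by simp
      qed
      then have "cont u \<le> cont v - 2" using strip_cont(3)[OF uv(1-3)] uv(6) by simp
      then have "kf eps v u = 1 + eps / real_of_int (cont u - cont v)" for eps by (simp add: kf_def)
      then show ?thesis using True uv(3) a by simp
    next
      case False
      then show ?thesis using uv(3) ne by simp
    qed
  qed
  also have "\<dots> = (\<Prod>(u, v)\<in>L. (if F u < F v then kf 1 u v / kf (- 1) u v else 1) / arr v u) *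
    (\<Prod>(u, v)\<in>L. if ?q u < ?q v then arr u v else arr v u)"
    unfolding prod.distrib[symmetric] by (simp add: case_prod_unfold)
  finally show ?thesis .
qed

text \<open>Reading the entries of \<open>F\<close> in the order of t gives a nonincreasing
  rearrangement of \<open>lam\<close>. Since \<open>lam\<close> is itself nonincreasing, the two
  sequences agree.\<close>

lemma sorted_filling:
  assumes t: "filling t" and dec: "\<And>u v. u \<in> C \<Longrightarrow> v \<in> C \<Longrightarrow> F u < F v \<Longrightarrow> t v < t u" and c: "c \<in> C"
  shows "lam (t c) = F c"
proof -
  define a where "a k = (if k \<in> {1..N} then F (pos tau t k) else 0)" for k
  have f0: "filling T0" using T0 by (rule filling_RSYT)
  define w where "w k = (if k \<in> {1..N} then t (pos tau T0 k) else k)" for k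
  have bt: "bij_betw t C {1..N}" using t by (simp add: filling_def)
  have "bij_betw (pos tau T0) {1..N} C"
    using pos_in[OF f0] pos_eq[OF f0] filling_in[OF f0] by (intro bij_betw_byWitness[where f' = T0]) auto
  from bij_betw_trans[OF this bt] have "bij_betw (t \<circ> pos tau T0) {1..N} {1..N}" .
  then have "bij_betw w {1..N} {1..N}" by (rule bij_betw_cong[THEN iffD1, rotated]) (simp add: w_def)
  then have w: "w permutes {1..N}" by (rule bij_imp_permutes) (auto simp: w_def)
  have am: "a j \<le> a i" if "1 \<le> i" "i \<le> j" "j \<le> N" for i j
  proof (rule ccontr)
    assume "\<not> a j \<le> a i"
    then have "F (pos tau t i) < F (pos tau t j)" using that by (simp add: a_def)
    from dec[OF _ _ this] show False using pos_in[OF t] that by force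
  qed
  have "lam k = (a \<circ> w) k" for k
  proof (cases "k \<in> {1..N}")
    case True
    have p: "pos tau T0 k \<in> C" "T0 (pos tau T0 k) = k" using pos_in[OF f0 True] by auto
    have "a (w k) = F (pos tau T0 k)"
      using True filling_in[OF t p(1)] pos_eq[OF t p(1)] by (simp add: a_def w_def)
    then show ?thesis using F_T0[OF p(1)] p(2) by simp
  next
    case False
    then have "w k = k" by (auto simp: w_def)
    then show ?thesis using False mon_outside[OF lam_mon False] by (auto simp: a_def)
  qed
  then have "lam = a \<circ> w" by (rule ext)
  then have "plus_part N lam = plus_part N a" using plus_part_comp[OF w, of a] by simp
  moreover note tc = filling_in[OF t c]
  ultimately have "lam (t c) = a (t c)" using plus_lam[OF tc] plus_part_of_antimono[OF am tc] by simp
  then show ?thesis using tc pos_eq[OF t c] by (simp add: a_def)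
qed

section \<open>The extreme tableaux T_S and T_R and the final evaluation\<close>

definition le_S :: "nat \<times> nat \<Rightarrow> nat \<times> nat \<Rightarrow> bool" where
  "le_S w u \<longleftrightarrow> F u < F w \<or> (F w = F u \<and> (fst u < fst w \<or> (fst w = fst u \<and> snd u \<le> snd w)))"

definition le_R :: "nat \<times> nat \<Rightarrow> nat \<times> nat \<Rightarrow> bool" where
  "le_R w u \<longleftrightarrow> F u < F w \<or> (F w = F u \<and> (snd u < snd w \<or> (snd w = snd u \<and> fst u \<le> fst w)))"

lemma TS_eq: "TS tau F c = (if c \<in> C then card {w \<in> C. le_S w c} else 0)"
proof (cases c)
  case (Pair i j)
  have "{(k, l). (k, l) \<in> C \<and> F (i, j) < F (k, l)} \<union>
     {(k, l). (k, l) \<in> C \<and> F (k, l) = F (i, j) \<and> (i < k \<or> k = i \<and> j \<le> l)} = {w \<in> C. le_S w (i, j)}"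
    by (auto simp: le_S_def)
  moreover have "card ({(k, l). (k, l) \<in> C \<and> F (i, j) < F (k, l)} \<union>
     {(k, l). (k, l) \<in> C \<and> F (k, l) = F (i, j) \<and> (i < k \<or> k = i \<and> j \<le> l)}) =
    card {(k, l). (k, l) \<in> C \<and> F (i, j) < F (k, l)} +
    card {(k, l). (k, l) \<in> C \<and> F (k, l) = F (i, j) \<and> (i < k \<or> k = i \<and> j \<le> l)}"
    by (rule card_Un_disjoint) (auto intro: finite_subset[OF _ finite_cells])
  ultimately show ?thesis using Pair by (simp add: TS_def)
qed

lemma TR_eq: "TR tau F c = (if c \<in> C then card {w \<in> C. le_R w c} else 0)"
proof (cases c)
  case (Pair i j)
  have "{(k, l). (k, l) \<in> C \<and> F (i, j) < F (k, l)} \<union>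
     {(k, l). (k, l) \<in> C \<and> F (k, l) = F (i, j) \<and> (j < l \<or> l = j \<and> i \<le> k)} = {w \<in> C. le_R w (i, j)}"
    by (auto simp: le_R_def)
  moreover have "card ({(k, l). (k, l) \<in> C \<and> F (i, j) < F (k, l)} \<union>
     {(k, l). (k, l) \<in> C \<and> F (k, l) = F (i, j) \<and> (j < l \<or> l = j \<and> i \<le> k)}) =
    card {(k, l). (k, l) \<in> C \<and> F (i, j) < F (k, l)} +
    card {(k, l). (k, l) \<in> C \<and> F (k, l) = F (i, j) \<and> (j < l \<or> l = j \<and> i \<le> k)}"
    by (rule card_Un_disjoint) (auto intro: finite_subset[OF _ finite_cells])
  ultimately show ?thesis using Pair by (simp add: TR_def)
qed

lemma filling_TS: "filling (TS tau F)"
  and TS_le_iff: "u \<in> C \<Longrightarrow> v \<in> C \<Longrightarrow> TS tau F u \<le> TS tau F v \<longleftrightarrow> le_S u v"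
proof -
  have o: "bij_betw (\<lambda>u. card {w \<in> C. le_S w u}) C {1..card C}"
    "\<And>u v. u \<in> C \<Longrightarrow> v \<in> C \<Longrightarrow> card {w \<in> C. le_S w u} \<le> card {w \<in> C. le_S w v} \<longleftrightarrow> le_S u v"
    by (rule card_rank_order[OF finite_cells, of le_S]; auto simp: le_S_def prod_eq_iff)+
  from o(1) have "bij_betw (TS tau F) C {1..N}"
    unfolding card_C by (rule bij_betw_cong[THEN iffD1, rotated]) (simp add: TS_eq)
  then show "filling (TS tau F)" by (simp add: filling_def TS_eq)
  show "u \<in> C \<Longrightarrow> v \<in> C \<Longrightarrow> TS tau F u \<le> TS tau F v \<longleftrightarrow> le_S u v" using o(2) by (simp add: TS_eq)
qed

lemma filling_TR: "filling (TR tau F)"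
  and TR_le_iff: "u \<in> C \<Longrightarrow> v \<in> C \<Longrightarrow> TR tau F u \<le> TR tau F v \<longleftrightarrow> le_R u v"
proof -
  have o: "bij_betw (\<lambda>u. card {w \<in> C. le_R w u}) C {1..card C}"
    "\<And>u v. u \<in> C \<Longrightarrow> v \<in> C \<Longrightarrow> card {w \<in> C. le_R w u} \<le> card {w \<in> C. le_R w v} \<longleftrightarrow> le_R u v"
    by (rule card_rank_order[OF finite_cells, of le_R]; auto simp: le_R_def prod_eq_iff)+
  from o(1) have "bij_betw (TR tau F) C {1..N}"
    unfolding card_C by (rule bij_betw_cong[THEN iffD1, rotated]) (simp add: TR_eq)
  then show "filling (TR tau F)" by (simp add: filling_def TR_eq)
  show "u \<in> C \<Longrightarrow> v \<in> C \<Longrightarrow> TR tau F u \<le> TR tau F v \<longleftrightarrow> le_R u v" using o(2) by (simp add: TR_eq)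
qed

lemma TS_less_iff: "u \<in> C \<Longrightarrow> v \<in> C \<Longrightarrow> TS tau F u < TS tau F v \<longleftrightarrow> \<not> le_S v u"
  using TS_le_iff[of v u] by auto

lemma TR_less_iff: "u \<in> C \<Longrightarrow> v \<in> C \<Longrightarrow> TR tau F u < TR tau F v \<longleftrightarrow> \<not> le_R v u"
  using TR_le_iff[of v u] by auto

lemma TS_RSYT: "TS tau F \<in> Y"
  unfolding RSYT_def
proof (intro CollectI conjI allI impI)
  fix i j assume a: "(i, j) \<in> C \<and> (i, j + 1) \<in> C"
  have "F (i, j) \<le> F (i, j + 1)" using a by (intro F_mono(1)) auto
  then show "TS tau F (i, j + 1) < TS tau F (i, j)" using a TS_less_iff by (auto simp: le_S_def)
next
  fix i j assume a: "(i, j) \<in> C \<and> (i + 1, j) \<in> C"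
  then have "F (i, j) < F (i + 1, j)" by (intro F_mono(2)) auto
  then show "TS tau F (i + 1, j) < TS tau F (i, j)" using a TS_less_iff by (auto simp: le_S_def)
qed (use filling_TS in \<open>auto simp: filling_def\<close>)

lemma config_TS: "config lam (TS tau F)"
proof -
  have "lam (TS tau F c) = F c" if "c \<in> C" for c
    using filling_TS TS_less_iff that by (intro sorted_filling) (auto simp: le_S_def)
  then show ?thesis using lam_mon filling_TS plus_lam filling_in[OF filling_TS] by (simp add: config_def)
qed

definition rev_perm :: "nat \<Rightarrow> nat" where
  "rev_perm i = (if i \<in> {1..N} then N + 1 - i else i)"

lemma rev_perm_permutes: "rev_perm permutes {1..N}"
  by (rule bij_imp_permutes, rule bij_betw_byWitness[where f' = rev_perm]) (auto simp: rev_perm_def)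

lemma minus_lam: "minus_part N lam = lam \<circ> rev_perm"
proof
  fix i
  show "minus_part N lam i = (lam \<circ> rev_perm) i"
  proof (cases "i \<in> {1..N}")
    case True
    let ?s = "sort (map lam [1..<N + 1])"
    have len: "length ?s = N" by (simp del: upt_Suc)
    have "?s ! (i - 1) = rev ?s ! (N + 1 - i - 1)" using True len by (simp add: rev_nth del: upt_Suc)
    also have "\<dots> = plus_part N lam (N + 1 - i)" using True unfolding plus_part_def by (auto simp del: upt_Suc)
    also have "\<dots> = lam (N + 1 - i)" using True by (intro plus_lam) auto
    finally show ?thesis using True by (simp add: minus_part_def rev_perm_def del: upt_Suc)
  next
    case False
    then show ?thesis using mon_outside[OF lam_mon False] by (auto simp: minus_part_def rev_perm_def)
  qed
qed

lemma config_TR: "config (minus_part N lam) (TR tau F)"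
proof -
  have "lam (TR tau F c) = F c" if "c \<in> C" for c
    using filling_TR TR_less_iff that by (intro sorted_filling) (auto simp: le_R_def)
  moreover have "mon (minus_part N lam)" unfolding minus_lam using mon_comp[OF rev_perm_permutes] lam_mon by blast
  moreover have "plus_part N (minus_part N lam) = plus_part N lam"
    unfolding minus_lam by (rule plus_part_comp[OF rev_perm_permutes])
  ultimately show ?thesis using filling_TR plus_lam filling_in[OF filling_TR] by (simp add: config_def)
qed

lemma Efac_lam: "Efac N tau kappa eps lam T = 1"
proof -
  have "\<not> lam i < lam j" if "1 \<le> i" "i < j" "j \<le> N" for i j
    using lam_antimono[of i j] that by simp
  then have "{(i, j). 1 \<le> i \<and> i < j \<and> j \<le> N \<and> lam i < lam j} = {}" by blast
  then show ?thesis unfolding Efac_def by (simp only: prod.empty)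
qed

text \<open>T_R numbers equal entries from the rightmost column on, so the cell of larger content
  comes first and no pair of equal entries contributes.\<close>

lemma Cfac_TR: "Cfac N tau 1 (TR tau F) = (\<Prod>(u, v)\<in>L. if F u < F v then kf 1 u v else 1)"
  unfolding Cfac_config[OF config_TR]
proof (rule prod_L_cong)
  fix u v assume uv: "u \<in> C" "v \<in> C" "F u = F v" "snd u < snd v"
  have "TR tau F v < TR tau F u" using TR_less_iff uv by (auto simp: le_R_def)
  then have "\<not> slot (minus_part N lam) (TR tau F) u < slot (minus_part N lam) (TR tau F) v"
    using slot_less_iff[OF config_TR uv(1-3)] by simp
  then show "(if F u < F v then kf 1 u v
      else if slot (minus_part N lam) (TR tau F) u < slot (minus_part N lam) (TR tau F) v then kf 1 v u else 1) =
    (if F u < F v then kf 1 u v else 1)" using uv(3) by simp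
qed simp

text \<open>T_S numbers equal entries from the lowest row on, so every pair in different rows comes
  with the smaller content first and contributes, while pairs within a row do not.\<close>

lemma Cfac_TS: "Cfac N tau (- 1) (TS tau F) =
  (\<Prod>(u, v)\<in>L. if F u < F v then kf (- 1) u v else if fst u = fst v then 1 else arr v u)"
  unfolding Cfac_config[OF config_TS]
proof (rule prod_L_cong)
  fix u v assume uv: "u \<in> C" "v \<in> C" "F u = F v" "cont u < cont v" "snd u < snd v" "fst v \<le> fst u"
  have s: "slot lam (TS tau F) u < slot lam (TS tau F) v \<longleftrightarrow> fst u \<noteq> fst v"
    unfolding slot_less_iff[OF config_TS uv(1-3)] TS_less_iff[OF uv(1,2)] using uv by (auto simp: le_S_def)
  have "kf (- 1) v u = arr v u" if "fst u \<noteq> fst v"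
  proof -
    have "cont u \<le> cont v - 2" using strip_cont(3)[OF uv(1-3)] uv(6) that by simp
    then have "kf (- 1) v u = 1 + - 1 / real_of_int (cont u - cont v)" by (simp add: kf_def)
    also have "\<dots> = arr v u" using uv(3) by (simp add: arr_def) (metis minus_diff_eq minus_divide_right)
    finally show ?thesis .
  qed
  then show "(if F u < F v then kf (- 1) u v
      else if slot lam (TS tau F) u < slot lam (TS tau F) v then kf (- 1) v u else 1) =
    (if F u < F v then kf (- 1) u v else if fst u = fst v then 1 else arr v u)"
    using uv(3) s by simp
qed simp

text \<open>In the nondecreasing rearrangement every cell with a smaller entry stands before those
  with larger entries, so E_1 collects the factor of each pair of unequal entries.\<close>

lemma Efac_TR: "Efac N tau kappa 1 (minus_part N lam) (TR tau F) =
  (\<Prod>(u, v)\<in>L. if F u < F v then arr v u else 1)"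
  unfolding Efac_config[OF config_TR]
proof (rule prod_L_cong)
  let ?m = "minus_part N lam" and ?q = "slot (minus_part N lam) (TR tau F)"
  fix u v assume uv: "u \<in> C" "v \<in> C" "F u < F v"
  have in_N: "?q u \<in> {1..N}" "?q v \<in> {1..N}" using slot_in[OF filling_TR] uv by auto
  have "?m (?q u) < ?m (?q v)"
    using config_slot_F[OF config_TR uv(1)] config_slot_F[OF config_TR uv(2)] uv(3) by simp
  then have l: "lam (N + 1 - ?q u) < lam (N + 1 - ?q v)" using in_N by (simp add: minus_lam rev_perm_def)
  have "?q u < ?q v"
  proof (rule ccontr)
    assume "\<not> ?q u < ?q v"
    then have "lam (N + 1 - ?q v) \<le> lam (N + 1 - ?q u)" using in_N by (intro lam_antimono) auto
    then show False using l by simp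
  qed
  then show "(if F u < F v \<and> ?q u < ?q v then 1 + 1 * kappa / gap u v else 1) =
    (if F u < F v then arr v u else 1)" using uv(3) by (simp add: arr_def)
qed simp

text \<open>Both evaluations equal to N! are combined. The normalising factors arr v u cancel
  against the row product for pairs in one row and against C_(-1)(T_S) for other pairs of equal
  entries; unequal entries leave C_1(T_R) / E_1(lambda^-, T_R).\<close>

lemma weighted_sum_X:
  "Cfac N tau (- 1) (TS tau F) * (\<Sum>x\<in>X. Cfac N tau 1 (snd x) / Cfac N tau (- 1) (snd x) *
      (Efac N tau kappa (- 1) (fst x) (snd x) / Efac N tau kappa 1 (fst x) (snd x))) =
    real (card X) * (Cfac N tau 1 (TR tau F) / Efac N tau kappa 1 (minus_part N lam) (TR tau F))"
proof -
  let ?K = "\<Prod>(u, v)\<in>L. (if F u < F v then kf 1 u v / kf (- 1) u v else 1) / arr v u"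
  have "(\<Sum>x\<in>X. Cfac N tau 1 (snd x) / Cfac N tau (- 1) (snd x) *
      (Efac N tau kappa (- 1) (fst x) (snd x) / Efac N tau kappa 1 (fst x) (snd x))) =
     (\<Sum>x\<in>X. ?K * (\<Prod>(u, v)\<in>L. if slot (fst x) (snd x) u < slot (fst x) (snd x) v
        then arr u v else arr v u))"
    by (intro sum.cong refl ratio_X)
  also have "\<dots> = ?K * fact N"
    unfolding sum_distrib_left[symmetric] using sum_X[OF invalid_pair_prod(1)] sum_arrangements(1) by simp
  finally have "(\<Sum>x\<in>X. Cfac N tau 1 (snd x) / Cfac N tau (- 1) (snd x) *
      (Efac N tau kappa (- 1) (fst x) (snd x) / Efac N tau kappa 1 (fst x) (snd x))) = ?K * fact N" .
  then have "Cfac N tau (- 1) (TS tau F) * (\<Sum>x\<in>X. Cfac N tau 1 (snd x) / Cfac N tau (- 1) (snd x) *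
      (Efac N tau kappa (- 1) (fst x) (snd x) / Efac N tau kappa 1 (fst x) (snd x))) =
     real (card X) * (Cfac N tau (- 1) (TS tau F) * ?K * (\<Prod>(u, v)\<in>L. row_arr v u))"
    unfolding card_X by simp
  also have "Cfac N tau (- 1) (TS tau F) * ?K * (\<Prod>(u, v)\<in>L. row_arr v u) =
     (\<Prod>(u, v)\<in>L. (if F u < F v then kf (- 1) u v else if fst u = fst v then 1 else arr v u) *
        ((if F u < F v then kf 1 u v / kf (- 1) u v else 1) / arr v u) * row_arr v u)"
    unfolding Cfac_TS prod.distrib[symmetric] by (simp add: case_prod_unfold)
  also have "\<dots> = (\<Prod>(u, v)\<in>L. (if F u < F v then kf 1 u v else 1) / (if F u < F v then arr v u else 1))"
  proof (rule prod_L_cong)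
    fix u v assume uv: "u \<in> C" "v \<in> C" "F u < F v"
    then have "row_arr v u = 1" by (simp add: row_arr_def class_factor_def)
    then show "(if F u < F v then kf (- 1) u v else if fst u = fst v then 1 else arr v u) *
        ((if F u < F v then kf 1 u v / kf (- 1) u v else 1) / arr v u) * row_arr v u =
      (if F u < F v then kf 1 u v else 1) / (if F u < F v then arr v u else 1)"
      using uv kf_minus_nonzero[of u v] by simp
  next
    fix u v assume uv: "u \<in> C" "v \<in> C" "F u = F v" "cont u < cont v"
    then have "arr v u \<noteq> 0" by (intro arr_pos) (auto simp: lt_def)
    moreover have "row_arr v u = (if fst u = fst v then arr v u else 1)"
      using uv(3) by (simp add: row_arr_def class_factor_def arr_def)
    ultimately show "(if F u < F v then kf (- 1) u v else if fst u = fst v then 1 else arr v u) *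
        ((if F u < F v then kf 1 u v / kf (- 1) u v else 1) / arr v u) * row_arr v u =
      (if F u < F v then kf 1 u v else 1) / (if F u < F v then arr v u else 1)"
      using uv(3) by simp
  qed
  also have "\<dots> = Cfac N tau 1 (TR tau F) / Efac N tau kappa 1 (minus_part N lam) (TR tau F)"
    unfolding Cfac_TR Efac_TR prod_dividef[symmetric] by (simp add: case_prod_unfold)
  finally show ?thesis .
qed

lemma fill_iff: "filling T \<Longrightarrow> fill N tau b T = F \<longleftrightarrow> (\<forall>c\<in>C. plus_part N b (T c) = F c)"
  by (auto simp: fill_def F_def fun_eq_iff)

lemma tabset_eq: "tabset N tau lam (TS tau F) = X"
proof -
  have "fill N tau lam (TS tau F) = F" using fill_iff[OF filling_TS, of lam] config_TS by (simp add: config_def)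
  then show ?thesis
    unfolding tabset_def X_def config_def mon_def using fill_iff filling_RSYT by auto
qed

lemma Jpoly_eq: "Jpoly N tau kappa lam (TS tau F) =
  (\<Sum>x\<in>X. pscale (complex_of_real (Cfac N tau (- 1) (TS tau F) / Cfac N tau (- 1) (snd x) *
     Efac N tau kappa (- 1) (fst x) (snd x))) (zvec x))"
  unfolding Jpoly_def tabset_eq
  by (simp add: fun_eq_iff sum_fun_apply pscale_def zvec_def case_prod_unfold)

theorem norm_Jpoly:
  "pnorm2 N tau kappa (Jpoly N tau kappa lam (TS tau F)) =
     of_nat (card (tabset N tau lam (TS tau F)))
       * complex_of_real (Cfac N tau 1 (TR tau F)
           / (Cfac N tau 1 (TS tau F) * Efac N tau kappa 1 (minus_part N lam) (TR tau F)))
       * pnorm2 N tau kappa (Z lam (TS tau F))"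
proof -
  let ?S = "TS tau F" and ?R = "TR tau F"
  let ?CS = "Cfac N tau (- 1) ?S" and ?CS1 = "Cfac N tau 1 ?S" and ?E = "Efac N tau kappa 1 (minus_part N lam) ?R"
  let ?W = "\<lambda>x. Cfac N tau 1 (snd x) / Cfac N tau (- 1) (snd x) *
      (Efac N tau kappa (- 1) (fst x) (snd x) / Efac N tau kappa 1 (fst x) (snd x))"
  have Xi: "X \<subseteq> index" by (auto simp: X_def index_def config_def)
  \<comment> \<open>The squared coefficient carries C_(-1) and E_(-1) twice; inserting
    \<open>nu_config\<close> removes one copy of each and brings in C_1 and 1 / E_1.\<close>
  have term_eq: "(?CS / Cfac N tau (- 1) (snd x) * Efac N tau kappa (- 1) (fst x) (snd x))\<^sup>2 * nux x =
      ?CS\<^sup>2 * ladders * ?W x" if x: "x \<in> X" for x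
  proof -
    define a where "a = Cfac N tau (- 1) (snd x)"
    define b where "b = Efac N tau kappa (- 1) (fst x) (snd x)"
    define c where "c = Efac N tau kappa 1 (fst x) (snd x)"
    define d where "d = Cfac N tau 1 (snd x)"
    have nz: "a \<noteq> 0" "b \<noteq> 0" "c \<noteq> 0"
      using Cfac_nonzero Efac_nonzero[OF X_config[OF x]] by (auto simp: a_def b_def c_def)
    have "nux x * (c * b) = d * a * ladders"
      using nu_config[OF X_config[OF x]] by (simp add: a_def b_def c_def d_def)
    then have n: "nux x = d * a * ladders / (c * b)" using nz by (simp add: field_simps)
    show ?thesis unfolding n a_def[symmetric] b_def[symmetric] c_def[symmetric] d_def[symmetric]
      using nz by (simp add: field_simps power2_eq_square)
  qed
  have "pnorm2 N tau kappa (Jpoly N tau kappa lam ?S) = complex_of_real (\<Sum>x\<in>X. ?CS\<^sup>2 * ladders * ?W x)"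
    unfolding Jpoly_eq pnorm2_combination[OF finite_X Xi] by (simp only: term_eq cong: sum.cong)
  also have "(\<Sum>x\<in>X. ?CS\<^sup>2 * ladders * ?W x) = ?CS * ladders * (?CS * (\<Sum>x\<in>X. ?W x))"
    by (simp only: sum_distrib_left[symmetric] power2_eq_square ac_simps)
  also have "\<dots> = real (card X) * (Cfac N tau 1 ?R / (?CS1 * ?E)) * (?CS1 * ?CS * ladders)"
    unfolding weighted_sum_X using Cfac_nonzero[of 1 ?S] by simp
  \<comment> \<open>The constant \<open>ladders\<close> disappears here: for (lambda, T_S) both
    factors E are 1 because \<open>lam\<close> is nonincreasing, and \<open>nu_config\<close>
    expresses the norm by C and \<open>ladders\<close> alone.\<close>
  also have "?CS1 * ?CS * ladders = nu lam ?S" using nu_config[OF config_TS] by (simp add: Efac_lam)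
  finally show ?thesis
    using pnorm2_zvec[of "(lam, ?S)"] lam_mon TS_RSYT by (simp add: tabset_eq zvec_def index_def)
qed

end

theorem theorem2:
  fixes N :: nat and tau :: "nat list" and kappa :: real and lam :: "nat \<Rightarrow> nat" and T :: tab
  assumes "is_partition N tau"
    and "tau \<noteq> [N]" and "tau \<noteq> replicate N 1"
    and "- 1 / real (tau ! 0 + length tau - 1) < kappa"
    and "kappa < 1 / real (tau ! 0 + length tau - 1)"
    and "\<forall>i. lam i \<noteq> 0 \<longrightarrow> i \<in> {1..N}"
    and "\<forall>i j. 1 \<le> i \<and> i \<le> j \<and> j \<le> N \<longrightarrow> lam j \<le> lam i"
    and "T \<in> RSYT N tau"
    and "column_strict tau (fill N tau lam T)"
  shows "pnorm2 N tau kappa (Jpoly N tau kappa lam (TS tau (fill N tau lam T)))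
     = of_nat (card (tabset N tau lam (TS tau (fill N tau lam T))))
       * complex_of_real (Cfac N tau 1 (TR tau (fill N tau lam T))
           / (Cfac N tau 1 (TS tau (fill N tau lam T))
              * Efac N tau kappa 1 (minus_part N lam) (TR tau (fill N tau lam T))))
       * pnorm2 N tau kappa (zeta N tau kappa lam (TS tau (fill N tau lam T)))"
proof -
  \<comment> \<open>The empty diagram is the column of length 0 and the single cell is a row, so the
    two excluded shapes rule out N = 0 and N = 1.\<close>
  have N: "2 \<le> N"
  proof (rule ccontr)
    assume "\<not> 2 \<le> N"
    then consider "N = 0" | "N = 1" by linarith
    then show False
    proof cases
      case 1
      then have "tau = []" using assms(1) by (cases tau) (auto simp: is_partition_def)
      then show False using assms(3) 1 by simp
    next
      case 2
      then obtain x xs where t: "tau = x # xs" using assms(1) by (cases tau) (auto simp: is_partition_def)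
      then have x: "0 < x" "x + sum_list xs = 1" "\<forall>y\<in>set xs. 0 < y" using assms(1) 2 by (auto simp: is_partition_def)
      then have "xs = []" by (cases xs) auto
      then show False using assms(2) 2 t x by simp
    qed
  qed
  have small: "\<bar>kappa\<bar> * real (tau ! 0 + length tau - 1) < 1"
  proof (cases "real (tau ! 0 + length tau - 1) = 0")
    case False
    then have h: "0 < real (tau ! 0 + length tau - 1)" by simp
    have "\<bar>kappa\<bar> < 1 / real (tau ! 0 + length tau - 1)" using assms(4,5) by (simp add: abs_less_iff)
    then show ?thesis using h by (simp add: pos_less_divide_eq del: of_nat_diff)
  qed simp
  interpret yd: young_diagram N tau by unfold_locales fact
  interpret ym: young_module N tau by unfold_locales (rule N)
  interpret dk: dunkl_operators N tau kappa by unfold_locales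
  interpret ds: dunkl_small N tau kappa by unfold_locales (rule small)
  interpret js: jack_setup N tau kappa lam T
    by unfold_locales (use assms in \<open>auto simp: ym.mon_def\<close>)
  show ?thesis using js.norm_Jpoly unfolding js.F_def .
qed

end
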